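(* Let $\mathbb{K}$ be a commutative ring with unit. Let $1\prec 2\in h^1(\Pi_2(2))$ denote the class of the chain $[\,\hat 0<w_{12}\,]$ in $\Pi_2(\{1,2\})$, where $\hat 0$ is the one-block non-crossing $2$-partition and $w_{12}$ is the non-crossing $2$-partition with two blocks whose bijection sends $\{1\}$ to $\{1\}$ and $\{2\}$ to $\{2\}$. Then the following equality holds in $h^2(\Pi_2(3))$: $$(1\prec 2)\prec 3+1\prec (2\prec 3) + (1\prec 3)\prec 2 + 1\prec (3\prec2)=0.$$ In particular, the morphism of graded operads $a^*:\Lambda^{-1}\mathrm{Lie}\to h^\bullet(\Pi_2)$ factors through $\Lambda^{-1}\mathrm{PreLie}$.
   Context: All finite sets are non-empty. A partition of $\{1,\dots,n\}$ is non-crossing if for any $i<j<k<l$, if $i,k$ are in the same block and $j,l$ are in the same block, then the four elements are in the same block. A non-crossing $2$-partition of a finite set $S$ is a triple $(\pi,\rho,f)$ where $\pi$ is a partition of $S$, $\rho$ is a non-crossing partition of $\{1,\dots,|S|\}$, and $f:\pi\to\rho$ is a bijection between the sets of blocks with $|f(T)|=|T|$ for all $T\in\pi$. $\Pi_2(S)$ is the poset of those, with $(\pi,\rho,f)\le(\pi',\rho',f')$ iff $\pi\le\pi'$, $\rho\le\rho'$ (where $\alpha\le\beta$ means that $\alpha$ is obtained by merging blocks of $\beta$), and for all $T\in\pi$, $T'\in\pi'$, $T'\subset T\Rightarrow f'(T')\subset f(T)$. Write $\Pi_2(n)=\Pi_2(\{1,\dots,n\})$. For a finite poset $P$, $c^k(P)$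 is the free $\mathbb{K}$-module on symbols $[x_0<\cdots<x_k]$ for chains with $x_0$ minimal and $x_k$ maximal in $P$, with $d[x_0<\cdots<x_k]=\sum_{i=1}^k(-1)^i\sum_{x_{i-1}<y<x_i}[\cdots<x_{i-1}<y<x_i<\cdots]$, and $h^\bullet(P)$ is its cohomology. For a poset morphism $f$, $f^*[y_0<\cdots<y_n]=\sum_{f(x_i)=y_i}[x_0<\cdots<x_n]$. Operad structure on $h^\bullet(\Pi_2):S\mapsto h^\bullet(\Pi_2(S))$. It is determined by the following partial compositions. For disjoint finite sets $A$, $B$, let $\pi$ be the partition of $A\sqcup B$ with blocks $B$ and the singletons $\{a\}$, $a\in A$; identify its set of blocks with $A\sqcup\{*\}$. For each $x=(\pi,\rho,f)\in\Pi_2(A\sqcup B)$ with first component $\pi$ let $\varphi_x:(\Pi_2)_{\le x}(A\sqcup B)\to\Pi_2(A\sqcup\{*\})$ send $(\alpha,\mu,g)$ to the triple consisting of the partition of $A\sqcup\{*\}$ induced by $\alpha$, the non-crossing partition of $\{1,\dots,|\rho|\}$ induced by $\mu$ on the set of blocks of $\rho$ ordered by their minimal elements, and the bijection induced by $g$; let $\psi_x:(\Pi_2)_{\ge x}(A\sqcup B)\to\Pi_2(B)$ send $(\beta,\mu,g)$ to the restrictions of $\beta$ to $B$, of $\mu$ to $f(B)\simeq\{1,\dots,|B|\}$ (increasing bijection), and of $g$. Then $\circ_*:h^\bullet(\Pi_2(A\sqcup\{*\}))\otimes h^\bullet(\Pi_2(B))\to h^\bullet(\Pi_2(A\sqcup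 B))$ is $\sum_x\mu_x\circ(\varphi_x^*\otimes\psi_x^* )$ where $\mu_x([x_0<\cdots<x_m=x]\otimes[x=x_m<\cdots<x_{m+n}])=[x_0<\cdots<x_{m+n}]$. For distinct labels $i,j$, $i\prec j\in h^1(\Pi_2(\{i,j\}))$ is the image of $1\prec2$ under the relabeling $1\mapsto i$, $2\mapsto j$; and $(i\prec j)\prec k=( *\prec k)\circ_*(i\prec j)$, $i\prec(j\prec k)=(i\prec* )\circ_*(j\prec k)$. The operadic desuspension is $(\Lambda^{-1}\mathcal{P})(n)=s^{n-1}\mathrm{sgn}_n\otimes\mathcal{P}(n)$ with $(sV)^\bullet=V^{\bullet-1}$, i.e. the arity-wise tensor product with the endomorphism operad of $\mathbb{K}$ placed in cohomological degree $-1$. $\mathrm{Lie}$ and $\mathrm{PreLie}$ are the operads encoding Lie and pre-Lie algebras, with the usual morphism $\mathrm{Lie}\to\mathrm{PreLie}$ given by antisymmetrization of the pre-Lie product. The morphism $a^*:\Lambda^{-1}\mathrm{Lie}\to h^\bullet(\Pi_2)$ is the morphism of operads sending the Lie bracket to $1\prec2+2\prec1$ (it is the pullback along $a:\Pi_2\to\Pi$, $(\pi,\rho,f)\mapsto\pi$, where $h^\bullet(\Pi)\simeq\Lambda^{-1}\mathrm{Lie}$ for the partition posets $\Pi$). *)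

theory Defs
  imports
    "HOL-Library.FuncSet"
    "HOL-Library.Disjoint_Sets"
    "HOL-Library.Function_Algebras"
    "HOL-Library.Set_Algebras"
    "HOL-Combinatorics.Permutations"
begin

text \<open>
  The sort \<open>{comm_ring, comm_monoid_mult}\<close> is that of commutative rings with unit; unlike
  \<open>comm_ring_1\<close> it does not exclude the zero ring.  The free module on a finite set of symbols is
  represented by the functions to the ring that vanish outside that set.
\<close>

section \<open>Linear algebra\<close>

definition scale_fun :: "'k \<Rightarrow> ('b \<Rightarrow> 'k) \<Rightarrow> 'b \<Rightarrow> 'k::{comm_ring, comm_monoid_mult}" where
  "scale_fun c u = (\<lambda>b. c * u b)"

definition basis :: "'b \<Rightarrow> 'b \<Rightarrow> 'k::{comm_ring, comm_monoid_mult}" where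
  "basis b = (\<lambda>c. if c = b then 1 else 0)"

definition lin_ext ::
  "'b set \<Rightarrow> ('b \<Rightarrow> 'c \<Rightarrow> 'k) \<Rightarrow> ('b \<Rightarrow> 'k) \<Rightarrow> 'c \<Rightarrow> 'k::{comm_ring, comm_monoid_mult}" where
  "lin_ext X F u = (\<Sum>b\<in>X. scale_fun (u b) (F b))"

text \<open>
  Elements of a quotient by a submodule \<open>I\<close> are the cosets \<open>u +o I\<close>.  The next two operations are
  the maps induced on cosets by a linear map \<open>f\<close>, respectively a (bi)additive map, into a module
  in which \<open>I\<close> is factored out.
\<close>

definition coset_map ::
  "('c \<Rightarrow> 'k) set \<Rightarrow> (('b \<Rightarrow> 'k) \<Rightarrow> 'c \<Rightarrow> 'k) \<Rightarrow> ('b \<Rightarrow> 'k) set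
    \<Rightarrow> ('c \<Rightarrow> 'k::{comm_ring, comm_monoid_mult}) set" where
  "coset_map I f X = (\<Union>u\<in>X. f u +o I)"

definition coset_map2 ::
  "('d \<Rightarrow> 'k) set \<Rightarrow> (('b \<Rightarrow> 'k) \<Rightarrow> ('c \<Rightarrow> 'k) \<Rightarrow> 'd \<Rightarrow> 'k) \<Rightarrow> ('b \<Rightarrow> 'k) set \<Rightarrow> ('c \<Rightarrow> 'k) set
    \<Rightarrow> ('d \<Rightarrow> 'k::{comm_ring, comm_monoid_mult}) set" where
  "coset_map2 I f X Y = (\<Union>u\<in>X. \<Union>v\<in>Y. f u v +o I)"


section \<open>Cohomology of finite posets\<close>

definition strict :: "('p \<Rightarrow> 'p \<Rightarrow> bool) \<Rightarrow> 'p \<Rightarrow> 'p \<Rightarrow> bool" where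
  "strict le x y \<longleftrightarrow> le x y \<and> x \<noteq> y"

text \<open>The chains \<open>x\<^sub>0 < \<dots> < x\<^sub>k\<close> with \<open>x\<^sub>0\<close> minimal and \<open>x\<^sub>k\<close> maximal, as lists of length \<open>k + 1\<close>.\<close>

definition full_chains :: "'p set \<Rightarrow> ('p \<Rightarrow> 'p \<Rightarrow> bool) \<Rightarrow> 'p list set" where
  "full_chains P le =
     {xs. xs \<noteq> [] \<and> set xs \<subseteq> P \<and> sorted_wrt (strict le) xs \<and>
          (\<nexists>y. y \<in> P \<and> strict le y (hd xs)) \<and> (\<nexists>y. y \<in> P \<and> strict le (last xs) y)}"

definition cochains ::
  "'p set \<Rightarrow> ('p \<Rightarrow> 'p \<Rightarrow> bool) \<Rightarrow> int \<Rightarrow> ('p list \<Rightarrow> 'k::{comm_ring, comm_monoid_mult}) set" where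
  "cochains P le k =
     {u. \<forall>xs. u xs \<noteq> 0 \<longrightarrow> xs \<in> full_chains P le \<and> int (length xs) = k + 1}"

definition codiff ::
  "'p set \<Rightarrow> ('p \<Rightarrow> 'p \<Rightarrow> bool) \<Rightarrow> ('p list \<Rightarrow> 'k) \<Rightarrow> 'p list \<Rightarrow> 'k::{comm_ring, comm_monoid_mult}" where
  "codiff P le =
     lin_ext (full_chains P le)
       (\<lambda>xs. \<Sum>i\<in>{1..<length xs}. scale_fun ((-1) ^ i)
          (\<Sum>y\<in>{y\<in>P. strict le (xs ! (i - 1)) y \<and> strict le y (xs ! i)}.
             basis (take i xs @ y # drop i xs)))"

definition cocycles ::
  "'p set \<Rightarrow> ('p \<Rightarrow> 'p \<Rightarrow> bool) \<Rightarrow> int \<Rightarrow> ('p list \<Rightarrow> 'k::{comm_ring, comm_monoid_mult}) set" where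
  "cocycles P le k = {u \<in> cochains P le k. codiff P le u = 0}"

definition coboundaries ::
  "'p set \<Rightarrow> ('p \<Rightarrow> 'p \<Rightarrow> bool) \<Rightarrow> int \<Rightarrow> ('p list \<Rightarrow> 'k::{comm_ring, comm_monoid_mult}) set" where
  "coboundaries P le k = codiff P le ` cochains P le (k - 1)"

definition cohomology ::
  "'p set \<Rightarrow> ('p \<Rightarrow> 'p \<Rightarrow> bool) \<Rightarrow> int \<Rightarrow> ('p list \<Rightarrow> 'k::{comm_ring, comm_monoid_mult}) set set" where
  "cohomology P le k = (\<lambda>u. u +o coboundaries P le k) ` cocycles P le k"

text \<open>The map \<open>f\<^sup>*\<close> from the cochains of \<open>Q\<close> to those of \<open>P\<close>, for a map \<open>f\<close> from \<open>P\<close> to \<open>Q\<close>.\<close>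

definition pullback ::
  "'p set \<Rightarrow> ('p \<Rightarrow> 'p \<Rightarrow> bool) \<Rightarrow> 'q set \<Rightarrow> ('q \<Rightarrow> 'q \<Rightarrow> bool) \<Rightarrow> ('p \<Rightarrow> 'q)
    \<Rightarrow> ('q list \<Rightarrow> 'k) \<Rightarrow> 'p list \<Rightarrow> 'k::{comm_ring, comm_monoid_mult}" where
  "pullback P leP Q leQ f =
     lin_ext (full_chains Q leQ) (\<lambda>ys. \<Sum>xs\<in>{xs\<in>full_chains P leP. map f xs = ys}. basis xs)"

text \<open>
  Concatenation (the map \<open>\<mu>\<^sub>x\<close>) of a cochain of the elements below \<open>x\<close> with one of the elements
  above \<open>x\<close>; the common element \<open>x\<close> is kept once.
\<close>

definition concat_at ::
  "'p set \<Rightarrow> ('p \<Rightarrow> 'p \<Rightarrow> bool) \<Rightarrow> 'p \<Rightarrow> ('p list \<Rightarrow> 'k) \<Rightarrow> ('p list \<Rightarrow> 'k)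
    \<Rightarrow> 'p list \<Rightarrow> 'k::{comm_ring, comm_monoid_mult}" where
  "concat_at P le x u v =
     (\<Sum>us\<in>full_chains {y\<in>P. le y x} le. \<Sum>vs\<in>full_chains {y\<in>P. le x y} le.
        scale_fun (u us * v vs) (basis (us @ tl vs)))"


section \<open>Non-crossing 2-partitions\<close>

definition noncrossing :: "nat \<Rightarrow> nat set set \<Rightarrow> bool" where
  "noncrossing n \<rho> \<longleftrightarrow>
     partition_on {1..n} \<rho> \<and>
     (\<forall>i j k l. i < j \<and> j < k \<and> k < l \<longrightarrow>
        (\<exists>X\<in>\<rho>. {i, k} \<subseteq> X) \<longrightarrow> (\<exists>Y\<in>\<rho>. {j, l} \<subseteq> Y) \<longrightarrow> (\<exists>Z\<in>\<rho>. {i, j, k, l} \<subseteq> Z))"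

text \<open>
  The bijection between the blocks is a total function, made canonical by being \<open>undefined\<close>
  outside the set of blocks.
\<close>

type_synonym 'a ncp2 = "'a set set \<times> nat set set \<times> ('a set \<Rightarrow> nat set)"

definition NCP2 :: "'a set \<Rightarrow> 'a ncp2 set" where
  "NCP2 S = {(\<pi>, \<rho>, f). partition_on S \<pi> \<and> noncrossing (card S) \<rho> \<and>
     f \<in> extensional \<pi> \<and> bij_betw f \<pi> \<rho> \<and> (\<forall>T\<in>\<pi>. card (f T) = card T)}"

text \<open>\<open>refines S Q P\<close> says that \<open>Q\<close> is finer than \<open>P\<close>; the coarser partition is the smaller one.\<close>

fun ncp2_le :: "'a set \<Rightarrow> 'a ncp2 \<Rightarrow> 'a ncp2 \<Rightarrow> bool" where
  "ncp2_le S (\<pi>, \<rho>, f) (\<pi>', \<rho>', f') \<longleftrightarrow>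
     refines S \<pi>' \<pi> \<and> refines {1..card S} \<rho>' \<rho> \<and>
     (\<forall>T\<in>\<pi>. \<forall>T'\<in>\<pi>'. T' \<subseteq> T \<longrightarrow> f' T' \<subseteq> f T)"

fun ncp2_relabel :: "('a \<Rightarrow> 'b) \<Rightarrow> 'a set \<Rightarrow> 'a ncp2 \<Rightarrow> 'b ncp2" where
  "ncp2_relabel \<tau> S (\<pi>, \<rho>, f) =
     ((`) \<tau> ` \<pi>, \<rho>, restrict (\<lambda>U. f {a\<in>S. \<tau> a \<in> U}) ((`) \<tau> ` \<pi>))"

text \<open>
  \<open>block_index \<rho> M\<close> is the set of the numbers of the blocks of \<open>\<rho>\<close> contained in \<open>M\<close>, the blocks of
  \<open>\<rho>\<close> being numbered from 1 in the order of their minimal elements.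
\<close>

definition block_index :: "nat set set \<Rightarrow> nat set \<Rightarrow> nat set" where
  "block_index \<rho> M = (\<lambda>R. card {R'\<in>\<rho>. Min R' \<le> Min R}) ` {R\<in>\<rho>. R \<subseteq> M}"

text \<open>
  The maps \<open>\<phi>\<^sub>x\<close> and \<open>\<psi>\<^sub>x\<close>.  In \<open>proj_below\<close>, the label \<open>s\<close> plays the role of \<open>*\<close>, i.e. of the block \<open>B\<close>.
\<close>

fun proj_below :: "'a set \<Rightarrow> 'a \<Rightarrow> 'a set \<Rightarrow> 'a ncp2 \<Rightarrow> 'a ncp2 \<Rightarrow> 'a ncp2" where
  "proj_below A s B (\<pi>, \<rho>, f) (\<alpha>, \<mu>, g) =
     (let q = (\<lambda>a. if a \<in> B then s else a); \<alpha>' = (`) q ` \<alpha>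
      in (\<alpha>', block_index \<rho> ` \<mu>, restrict (\<lambda>U. block_index \<rho> (g {a\<in>A \<union> B. q a \<in> U})) \<alpha>'))"

fun proj_above :: "'a set \<Rightarrow> 'a ncp2 \<Rightarrow> 'a ncp2 \<Rightarrow> 'a ncp2" where
  "proj_above B (\<pi>, \<rho>, f) (\<beta>, \<mu>, g) =
     (let r = (\<lambda>j. card {i\<in>f B. i \<le> j}); \<beta>' = {T\<in>\<beta>. T \<subseteq> B}
      in (\<beta>', (`) r ` {M\<in>\<mu>. M \<subseteq> f B}, restrict (\<lambda>T. r ` g T) \<beta>'))"

definition relabel_cochain ::
  "('a \<Rightarrow> 'b) \<Rightarrow> 'a set \<Rightarrow> ('a ncp2 list \<Rightarrow> 'k) \<Rightarrow> 'b ncp2 list \<Rightarrow> 'k::{comm_ring, comm_monoid_mult}" where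
  "relabel_cochain \<tau> S =
     lin_ext (full_chains (NCP2 S) (ncp2_le S)) (\<lambda>xs. basis (map (ncp2_relabel \<tau> S) xs))"

definition circ_cochain ::
  "'a set \<Rightarrow> 'a \<Rightarrow> 'a set \<Rightarrow> ('a ncp2 list \<Rightarrow> 'k) \<Rightarrow> ('a ncp2 list \<Rightarrow> 'k)
    \<Rightarrow> 'a ncp2 list \<Rightarrow> 'k::{comm_ring, comm_monoid_mult}" where
  "circ_cochain A s B u v =
     (let S = A \<union> B; P = NCP2 S; le = ncp2_le S; S' = insert s A in
      \<Sum>x\<in>{x\<in>P. fst x = insert B ((\<lambda>a. {a}) ` A)}.
        concat_at P le x
          (pullback {y\<in>P. le y x} le (NCP2 S') (ncp2_le S') (proj_below A s B x) u)
          (pullback {y\<in>P. le x y} le (NCP2 B) (ncp2_le B) (proj_above B x) v))"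


section \<open>The cohomology of the non-crossing 2-partition posets\<close>

abbreviation hB :: "'a set \<Rightarrow> int \<Rightarrow> ('a ncp2 list \<Rightarrow> 'k::{comm_ring, comm_monoid_mult}) set" where
  "hB S k \<equiv> coboundaries (NCP2 S) (ncp2_le S) k"

definition h_add where
  "h_add S k = coset_map2 (hB S k) (+)"

definition h_zero :: "'a set \<Rightarrow> int \<Rightarrow> ('a ncp2 list \<Rightarrow> 'k::{comm_ring, comm_monoid_mult}) set" where
  "h_zero S k = 0 +o hB S k"

text \<open>\<open>h_relabel \<tau> S k\<close> acts on degree \<open>k\<close> over \<open>S\<close>.\<close>

definition h_relabel where
  "h_relabel \<tau> S k = coset_map (hB (\<tau> ` S) k) (relabel_cochain \<tau> S)"

text \<open>
  \<open>h_circ A s B k l\<close> is the partial composition at \<open>s\<close> of classes of degree \<open>k\<close> over \<open>insert s A\<close>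
  with classes of degree \<open>l\<close> over \<open>B\<close>, for disjoint \<open>A\<close>, \<open>B\<close> not containing \<open>s\<close>.
\<close>

definition h_circ where
  "h_circ A s B k l = coset_map2 (hB (A \<union> B) (k + l)) (circ_cochain A s B)"

definition ncp2_bot :: "'a set \<Rightarrow> 'a ncp2" where
  "ncp2_bot S = ({S}, {{1..card S}}, restrict (\<lambda>_. {1..card S}) {S})"

definition w12 :: "nat ncp2" where
  "w12 = ({{1}, {2}}, {{1}, {2}}, restrict (\<lambda>T. T) {{1}, {2}})"

definition prec12 :: "(nat ncp2 list \<Rightarrow> 'k::{comm_ring, comm_monoid_mult}) set" where
  "prec12 = basis [ncp2_bot {1, 2}, w12] +o hB {1, 2} 1"

definition prec :: "nat \<Rightarrow> nat \<Rightarrow> (nat ncp2 list \<Rightarrow> 'k::{comm_ring, comm_monoid_mult}) set" where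
  "prec i j = h_relabel (\<lambda>a. if a = 1 then i else j) {1, 2} 1 prec12"

text \<open>
  \<open>(i \<prec> j) \<prec> k\<close> and \<open>i \<prec> (j \<prec> k)\<close>, with \<open>0\<close> as the label \<open>*\<close>; to be used for positive labels.
\<close>

definition prec_left where
  "prec_left i j k = h_circ {k} 0 {i, j} 1 1 (prec 0 k) (prec i j)"

definition prec_right where
  "prec_right i j k = h_circ {i} 0 {j, k} 1 1 (prec i 0) (prec j k)"


section \<open>Graded operads and their morphisms\<close>

text \<open>
  The structure of a graded operad in terms of homogeneous components (indexed by arity, at least
  1, and cohomological degree), left actions of the permutations of \<open>{1..n}\<close>, and partial
  compositions.  In \<open>pcomp P m k n l i x y\<close>, the element \<open>y\<close> of arity \<open>n\<close> and degree \<open>l\<close> is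
  inserted at the \<open>i\<close>-th input of the element \<open>x\<close> of arity \<open>m\<close> and degree \<open>k\<close>.
\<close>

record ('k, 'm) graded_operad =
  component :: "nat \<Rightarrow> int \<Rightarrow> 'm set"
  op_add :: "nat \<Rightarrow> int \<Rightarrow> 'm \<Rightarrow> 'm \<Rightarrow> 'm"
  op_scale :: "nat \<Rightarrow> int \<Rightarrow> 'k \<Rightarrow> 'm \<Rightarrow> 'm"
  op_act :: "nat \<Rightarrow> int \<Rightarrow> (nat \<Rightarrow> nat) \<Rightarrow> 'm \<Rightarrow> 'm"
  pcomp :: "nat \<Rightarrow> int \<Rightarrow> nat \<Rightarrow> int \<Rightarrow> nat \<Rightarrow> 'm \<Rightarrow> 'm \<Rightarrow> 'm"
  op_unit :: 'm

definition operad_morphism ::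
  "('k, 'm) graded_operad \<Rightarrow> ('k, 'n) graded_operad \<Rightarrow> (nat \<Rightarrow> int \<Rightarrow> 'm \<Rightarrow> 'n) \<Rightarrow> bool" where
  "operad_morphism P Q \<phi> \<longleftrightarrow>
     (\<forall>n\<ge>1. \<forall>k. \<phi> n k ` component P n k \<subseteq> component Q n k \<and>
        (\<forall>x\<in>component P n k. \<forall>y\<in>component P n k.
           \<phi> n k (op_add P n k x y) = op_add Q n k (\<phi> n k x) (\<phi> n k y)) \<and>
        (\<forall>c. \<forall>x\<in>component P n k. \<phi> n k (op_scale P n k c x) = op_scale Q n k c (\<phi> n k x)) \<and>
        (\<forall>\<sigma>. \<sigma> permutes {1..n} \<longrightarrow>
           (\<forall>x\<in>component P n k. \<phi> n k (op_act P n k \<sigma> x) = op_act Q n k \<sigma> (\<phi> n k x)))) \<and>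
     (\<forall>m\<ge>1. \<forall>n\<ge>1. \<forall>k l. \<forall>i\<in>{1..m}. \<forall>x\<in>component P m k. \<forall>y\<in>component P n l.
        \<phi> (m + n - 1) (k + l) (pcomp P m k n l i x y) = pcomp Q m k n l i (\<phi> m k x) (\<phi> n l y)) \<and>
     \<phi> 1 0 (op_unit P) = op_unit Q"

text \<open>
  Operadic desuspension: arity-wise tensor product with the endomorphism operad of the ground ring
  placed in degree -1.  With \<open>e\<^sub>n\<close> (of degree \<open>n - 1\<close>) the generator of the latter in arity \<open>n\<close>, one has
  \<open>e\<^sub>m \<circ>\<^sub>i e\<^sub>n = (-1)^((i - 1)(n - 1)) e\<^sub>m\<^sub>+\<^sub>n\<^sub>-\<^sub>1\<close>, and
  \<open>(e\<^sub>m \<otimes> x) \<circ>\<^sub>i (e\<^sub>n \<otimes> y) = (-1)^(deg x * (n - 1)) (e\<^sub>m \<circ>\<^sub>i e\<^sub>n) \<otimes> (x \<circ>\<^sub>i y)\<close>.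
  The element \<open>e\<^sub>n \<otimes> x\<close> is represented by \<open>x\<close>.
\<close>

definition desuspension ::
  "('k::{comm_ring, comm_monoid_mult}, 'm) graded_operad \<Rightarrow> ('k, 'm) graded_operad" where
  "desuspension P =
     \<lparr> component = (\<lambda>n k. component P n (k - (int n - 1))),
       op_add = (\<lambda>n k. op_add P n (k - (int n - 1))),
       op_scale = (\<lambda>n k. op_scale P n (k - (int n - 1))),
       op_act = (\<lambda>n k \<sigma> x.
         op_scale P n (k - (int n - 1)) (if evenperm \<sigma> then 1 else -1)
           (op_act P n (k - (int n - 1)) \<sigma> x)),
       pcomp = (\<lambda>m k n l i x y.
         let k' = k - (int m - 1); l' = l - (int n - 1) in
         op_scale P (m + n - 1) (k' + l')
           (if even (k' * (int n - 1) + (int i - 1) * (int n - 1)) then 1 else -1)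
           (pcomp P m k' n l' i x y)),
       op_unit = op_unit P \<rparr>"

definition desuspension_map ::
  "(nat \<Rightarrow> int \<Rightarrow> 'm \<Rightarrow> 'n) \<Rightarrow> nat \<Rightarrow> int \<Rightarrow> 'm \<Rightarrow> 'n" where
  "desuspension_map \<phi> = (\<lambda>n k. \<phi> n (k - (int n - 1)))"

text \<open>
  The operad of the cohomology of the non-crossing 2-partition posets.  The \<open>i\<close>-th partial
  composition of arities \<open>m\<close> and \<open>n\<close> is the composition at \<open>*\<close> (the label \<open>0\<close>) with
  \<open>B = {i..i + n - 1}\<close> and \<open>A = {1..m + n - 1} - B\<close>, via the identifications \<open>{1..m} \<simeq> A \<squnion> {*}\<close> and
  \<open>{1..n} \<simeq> B\<close> which are increasing when \<open>*\<close> is put in the place of \<open>B\<close>.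
\<close>

definition hNCP2 ::
  "('k::{comm_ring, comm_monoid_mult}, (nat ncp2 list \<Rightarrow> 'k) set) graded_operad" where
  "hNCP2 =
     \<lparr> component = (\<lambda>n k. cohomology (NCP2 {1..n}) (ncp2_le {1..n}) k),
       op_add = (\<lambda>n. h_add {1..n}),
       op_scale = (\<lambda>n k c. coset_map (hB {1..n} k) (scale_fun c)),
       op_act = (\<lambda>n k \<sigma>. h_relabel \<sigma> {1..n} k),
       pcomp = (\<lambda>m k n l i X Y.
         let B = {i..i + n - 1}; A = {1..m + n - 1} - B in
         h_circ A 0 B k l
           (h_relabel (\<lambda>j. if j < i then j else if j = i then 0 else j + n - 1) {1..m} k X)
           (h_relabel (\<lambda>j. j + i - 1) {1..n} l Y)),
       op_unit = basis [ncp2_bot {1}] +o hB {1} 0 \<rparr>"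


section \<open>The operads encoding Lie and pre-Lie algebras\<close>

text \<open>
  The free operad on one binary operation without symmetry has in arity \<open>n\<close> the basis of binary
  trees with leaves labelled bijectively by \<open>{1..n}\<close>; it is concentrated in degree 0.
\<close>

datatype 'a bitree = Leaf 'a | Node "'a bitree" "'a bitree"

fun leaves :: "'a bitree \<Rightarrow> 'a list" where
  "leaves (Leaf a) = [a]"
| "leaves (Node t s) = leaves t @ leaves s"

fun graft :: "('a \<Rightarrow> 'b bitree) \<Rightarrow> 'a bitree \<Rightarrow> 'b bitree" where
  "graft g (Leaf a) = g a"
| "graft g (Node t s) = Node (graft g t) (graft g s)"

definition trees :: "nat \<Rightarrow> nat bitree set" where
  "trees n = {t. distinct (leaves t) \<and> set (leaves t) = {1..n}}"

type_synonym 'k mag = "nat bitree \<Rightarrow> 'k"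

definition Mag :: "nat \<Rightarrow> 'k::{comm_ring, comm_monoid_mult} mag set" where
  "Mag n = {u. \<forall>t. u t \<noteq> 0 \<longrightarrow> t \<in> trees n}"

definition mag_act ::
  "nat \<Rightarrow> (nat \<Rightarrow> nat) \<Rightarrow> 'k mag \<Rightarrow> 'k::{comm_ring, comm_monoid_mult} mag" where
  "mag_act n \<sigma> = lin_ext (trees n) (\<lambda>t. basis (map_bitree \<sigma> t))"

definition tree_comp :: "nat \<Rightarrow> nat \<Rightarrow> nat bitree \<Rightarrow> nat bitree \<Rightarrow> nat bitree" where
  "tree_comp n i t s =
     graft (\<lambda>j. if j < i then Leaf j else if j = i then map_bitree (\<lambda>p. p + i - 1) s
                else Leaf (j + n - 1)) t"

definition mag_comp ::
  "nat \<Rightarrow> nat \<Rightarrow> nat \<Rightarrow> 'k mag \<Rightarrow> 'k mag \<Rightarrow> 'k::{comm_ring, comm_monoid_mult} mag" where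
  "mag_comp m n i u v =
     lin_ext (trees m) (\<lambda>t. lin_ext (trees n) (\<lambda>s. basis (tree_comp n i t s)) v) u"

text \<open>The operadic ideal generated by the relators \<open>R\<close> (pairs of an arity and an element of it).\<close>

inductive operad_ideal ::
  "(nat \<times> 'k mag) set \<Rightarrow> nat \<Rightarrow> 'k::{comm_ring, comm_monoid_mult} mag \<Rightarrow> bool"
  for R where
  gen: "(n, u) \<in> R \<Longrightarrow> operad_ideal R n u"
| zero: "operad_ideal R n 0"
| add: "operad_ideal R n u \<Longrightarrow> operad_ideal R n v \<Longrightarrow> operad_ideal R n (u + v)"
| scale: "operad_ideal R n u \<Longrightarrow> operad_ideal R n (scale_fun c u)"
| act: "operad_ideal R n u \<Longrightarrow> \<sigma> permutes {1..n} \<Longrightarrow> operad_ideal R n (mag_act n \<sigma> u)"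
| comp_left: "operad_ideal R m u \<Longrightarrow> v \<in> Mag n \<Longrightarrow> n \<ge> 1 \<Longrightarrow> i \<in> {1..m} \<Longrightarrow>
    operad_ideal R (m + n - 1) (mag_comp m n i u v)"
| comp_right: "u \<in> Mag m \<Longrightarrow> operad_ideal R n v \<Longrightarrow> n \<ge> 1 \<Longrightarrow> i \<in> {1..m} \<Longrightarrow>
    operad_ideal R (m + n - 1) (mag_comp m n i u v)"

definition deg0 :: "'m::zero set \<Rightarrow> int \<Rightarrow> 'm set" where
  "deg0 M k = (if k = 0 then M else {0})"

definition presented_ideal ::
  "(nat \<times> 'k mag) set \<Rightarrow> nat \<Rightarrow> int \<Rightarrow> 'k::{comm_ring, comm_monoid_mult} mag set" where
  "presented_ideal R n k = deg0 {u. operad_ideal R n u} k"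

definition presented_operad ::
  "(nat \<times> 'k mag) set \<Rightarrow> ('k::{comm_ring, comm_monoid_mult}, 'k mag set) graded_operad" where
  "presented_operad R =
     (let I = presented_ideal R in
      \<lparr> component = (\<lambda>n k. (\<lambda>u. u +o I n k) ` deg0 (Mag n) k),
        op_add = (\<lambda>n k. coset_map2 (I n k) (+)),
        op_scale = (\<lambda>n k c. coset_map (I n k) (scale_fun c)),
        op_act = (\<lambda>n k \<sigma>. coset_map (I n k) (mag_act n \<sigma>)),
        pcomp = (\<lambda>m k n l i. coset_map2 (I (m + n - 1) (k + l)) (mag_comp m n i)),
        op_unit = basis (Leaf 1) +o I 1 0 \<rparr>)"

text \<open>\<open>tr_left i j k\<close> is the tree \<open>(i j) k\<close> and \<open>tr_right i j k\<close> is the tree \<open>i (j k)\<close>.\<close>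

definition tr_left :: "nat \<Rightarrow> nat \<Rightarrow> nat \<Rightarrow> 'k::{comm_ring, comm_monoid_mult} mag" where
  "tr_left i j k = basis (Node (Node (Leaf i) (Leaf j)) (Leaf k))"

definition tr_right :: "nat \<Rightarrow> nat \<Rightarrow> nat \<Rightarrow> 'k::{comm_ring, comm_monoid_mult} mag" where
  "tr_right i j k = basis (Node (Leaf i) (Node (Leaf j) (Leaf k)))"

definition lie_relators :: "(nat \<times> 'k::{comm_ring, comm_monoid_mult} mag) set" where
  "lie_relators =
     {(2, basis (Node (Leaf 1) (Leaf 2)) + basis (Node (Leaf 2) (Leaf 1))),
      (3, tr_left 1 2 3 + tr_left 2 3 1 + tr_left 3 1 2)}"

text \<open>Right pre-Lie algebras: the associator is symmetric in its last two arguments.\<close>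

definition prelie_relators :: "(nat \<times> 'k::{comm_ring, comm_monoid_mult} mag) set" where
  "prelie_relators =
     {(3, (tr_left 1 2 3 - tr_right 1 2 3) - (tr_left 1 3 2 - tr_right 1 3 2))}"

definition Lie :: "('k::{comm_ring, comm_monoid_mult}, 'k mag set) graded_operad" where
  "Lie = presented_operad lie_relators"

definition PreLie :: "('k::{comm_ring, comm_monoid_mult}, 'k mag set) graded_operad" where
  "PreLie = presented_operad prelie_relators"

definition lie_bracket :: "'k::{comm_ring, comm_monoid_mult} mag set" where
  "lie_bracket = basis (Node (Leaf 1) (Leaf 2)) +o presented_ideal lie_relators 2 0"

text \<open>
  Antisymmetrization: \<open>antisym t\<close> expands every bracket \<open>[x, y]\<close> of the tree \<open>t\<close> as \<open>x y - y x\<close>.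
\<close>

definition tree_mult ::
  "'k mag \<Rightarrow> 'k mag \<Rightarrow> 'k::{comm_ring, comm_monoid_mult} mag" where
  "tree_mult u v = (\<lambda>t. case t of Leaf _ \<Rightarrow> 0 | Node t1 t2 \<Rightarrow> u t1 * v t2)"

fun antisym :: "nat bitree \<Rightarrow> 'k::{comm_ring, comm_monoid_mult} mag" where
  "antisym (Leaf a) = basis (Leaf a)"
| "antisym (Node t s) =
     tree_mult (antisym t) (antisym s) - tree_mult (antisym s) (antisym t)"

definition lie_to_prelie ::
  "nat \<Rightarrow> int \<Rightarrow> 'k::{comm_ring, comm_monoid_mult} mag set \<Rightarrow> 'k mag set" where
  "lie_to_prelie n k = coset_map (presented_ideal prelie_relators n k) (lin_ext (trees n) antisym)"

text \<open>
  The defining property of the morphism from the desuspension of \<open>Lie\<close> induced by forgetting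
  the non-crossing partition.
\<close>

definition is_a_star ::
  "(nat \<Rightarrow> int \<Rightarrow> 'k::{comm_ring, comm_monoid_mult} mag set \<Rightarrow> (nat ncp2 list \<Rightarrow> 'k) set) \<Rightarrow> bool" where
  "is_a_star a \<longleftrightarrow>
     operad_morphism (desuspension Lie) hNCP2 a \<and>
     a 2 1 lie_bracket = h_add {1, 2} 1 (prec 1 2) (prec 2 1)"

end

theory Submission
  imports Defs
begin

text \<open>
  In degree \<open>card S - 1\<close>, where the desuspension of an operad concentrated in degree 0 lives, the
  cochains of \<open>NCP2 S\<close> are supported on maximal chains and are all cocycles.  On a maximal chain of
  \<open>NCP2 {1, 2, 3}\<close> the sum of the four composites takes a value that depends only on the maximal
  element, so it is the coboundary of a sum of chains of length one.

  Interpreting a binary tree as the iterated composite of \<open>1 \<prec> 2\<close>, with the sign of the word of its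
  leaves and a sign for the order in which the compositions are carried out, defines a morphism on the
  desuspension of the free operad, since the sequential axiom holds for cochains and the parallel one
  up to coboundaries.  It maps the pre-Lie relator to the above sum and hence factors through
  \<open>PreLie\<close>.  After antisymmetrization the Jacobi relator becomes a sum of three permuted pre-Lie
  relators, which gives a morphism from the desuspension of \<open>Lie\<close>; there is only one with the given value
  on the bracket, because the bracket generates.
\<close>

section \<open>Cochains of finite posets\<close>

text \<open>The parallel axiom fails for cochains for the following reason. Above an element with
  two distinguished blocks, an element is determined by its two restrictions, so a chain there is a
  path in a product. One composite sees the paths that finish the first coordinate before the second
  one starts, the other composite sees the opposite order. Exchanging two neighbouring steps in
  different coordinates costs a sign and the coboundary of the paths that take both steps at once;
  in top degree every step moves one coordinate only, so no other terms appear. In the relation, the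
  middle element of a maximal chain is a partition of the labels 1, 2, 3 into two blocks and selects
  one left product or both right products. A left product asks that label 1 come first within a
  block that comes first. Both right products ask that label 1 come first and differ in the order of
  2 and 3, which is summed away. The pre-Lie relator carries exactly the signs of its four trees, so
  all four composites enter with a plus.\<close>

lemma sum_fun_apply: "(sum f A) x = (\<Sum>a\<in>A. f a x)"
  by (induction A rule: infinite_finite_induct) auto

lemma scale_fun_apply [simp]: "scale_fun c u b = c * u b"
  by (simp add: scale_fun_def)

lemma basis_apply: "basis b c = (if c = b then 1 else 0)"
  by (simp add: basis_def)

lemma lin_ext_apply: "lin_ext X F u c = (\<Sum>b\<in>X. u b * F b c)"
  by (simp add: lin_ext_def sum_fun_apply)

lemma lin_ext_add: "lin_ext X F (u + v) = lin_ext X F u + lin_ext X F v"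
  by (rule ext) (simp add: lin_ext_apply distrib_right sum.distrib)

lemma lin_ext_scale: "lin_ext X F (scale_fun c u) = scale_fun c (lin_ext X F u)"
  by (rule ext) (simp add: lin_ext_apply sum_distrib_left mult.assoc)

lemma lin_ext_zero: "lin_ext X F 0 = 0"
  by (rule ext) (simp add: lin_ext_apply)

lemma lin_ext_basis: "finite X \<Longrightarrow> b \<in> X \<Longrightarrow> lin_ext X F (basis b) = F b"
proof (rule ext)
  fix c assume "finite X" "b \<in> X"
  have "lin_ext X F (basis b) c = (\<Sum>a\<in>X. if a = b then F a c else 0)"
    unfolding lin_ext_apply by (rule sum.cong) (auto simp: basis_apply)
  then show "lin_ext X F (basis b) c = F b c"
    using \<open>finite X\<close> \<open>b \<in> X\<close> by (simp add: sum.delta)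
qed

lemma in_set_take_nth:
  assumes "x \<in> set (take n xs)" obtains j where "j < n" "j < length xs" "x = xs ! j"
proof -
  obtain j where "j < length (take n xs)" "x = take n xs ! j" using assms by (metis in_set_conv_nth)
  then show ?thesis using that[of j] by simp
qed

lemma in_set_drop_nth:
  assumes "x \<in> set (drop n xs)" obtains j where "n \<le> j" "j < length xs" "x = xs ! j"
proof -
  obtain j where "j < length (drop n xs)" "x = drop n xs ! j" using assms by (metis in_set_conv_nth)
  then show ?thesis using that[of "n + j"] by simp
qed

section \<open>Deletion of an entry of a chain\<close>

definition del :: "nat \<Rightarrow> 'a list \<Rightarrow> 'a list" where
  "del i zs = take i zs @ drop (Suc i) zs"

lemma length_del: "i < length zs \<Longrightarrow> length (del i zs) = length zs - 1"
  by (simp add: del_def)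

lemma nth_del: "i < length zs \<Longrightarrow> del i zs ! j = (if j < i then zs ! j else zs ! Suc j)"
  by (auto simp: del_def nth_append)

lemma map_del: "map f (del i zs) = del i (map f zs)"
  by (simp add: del_def take_map drop_map)

lemma take_del_le: "i \<le> k \<Longrightarrow> take k (del i zs) = del i (take (Suc k) zs)"
  by (cases "i < length zs") (auto simp: del_def min_def take_drop)

lemma take_del_ge: "k \<le> i \<Longrightarrow> take k (del i zs) = take k zs"
  by (auto simp: del_def min_def)

lemma drop_del_le: "i \<le> k \<Longrightarrow> i < length zs \<Longrightarrow> drop k (del i zs) = drop (Suc k) zs"
  by (auto simp: del_def min_def)

lemma drop_del_ge: "k \<le> i \<Longrightarrow> drop k (del i zs) = del (i - k) (drop k zs)"
  by (cases "i < length zs") (auto simp: del_def drop_take)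

lemma hd_del: "1 \<le> i \<Longrightarrow> zs \<noteq> [] \<Longrightarrow> hd (del i zs) = hd zs"
  by (cases zs; cases i) (auto simp: del_def)

lemma last_del: "Suc i < length zs \<Longrightarrow> last (del i zs) = last zs"
  by (simp add: del_def last_append)

lemma sorted_wrt_del: "sorted_wrt r zs \<Longrightarrow> sorted_wrt r (del i zs)"
proof -
  assume s: "sorted_wrt r zs"
  have "sorted_wrt r (take i zs @ drop i zs)" using s by simp
  moreover have "set (drop (Suc i) zs) \<subseteq> set (drop i zs)" by (rule set_drop_subset_set_drop) simp
  moreover have "sorted_wrt r (drop (Suc i) zs)" using s by (rule sorted_wrt_drop)
  ultimately show ?thesis unfolding del_def sorted_wrt_append by blast
qed

lemma set_del_subset: "set (del i zs) \<subseteq> set zs"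
  by (auto simp: del_def dest: in_set_takeD in_set_dropD)

section \<open>Full chains, codifferential and concatenation in a finite poset\<close>

locale finite_poset =
  fixes P :: "'p set" and le :: "'p \<Rightarrow> 'p \<Rightarrow> bool"
  assumes fin: "finite P"
    and le_refl: "x \<in> P \<Longrightarrow> le x x"
    and le_trans: "x \<in> P \<Longrightarrow> y \<in> P \<Longrightarrow> z \<in> P \<Longrightarrow> le x y \<Longrightarrow> le y z \<Longrightarrow> le x z"
    and le_antisym: "x \<in> P \<Longrightarrow> y \<in> P \<Longrightarrow> le x y \<Longrightarrow> le y x \<Longrightarrow> x = y"
begin

lemma strict_trans:
  "x \<in> P \<Longrightarrow> y \<in> P \<Longrightarrow> z \<in> P \<Longrightarrow> strict le x y \<Longrightarrow> strict le y z \<Longrightarrow> strict le x z"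
  unfolding strict_def using le_trans le_antisym by blast

lemma strict_sorted_distinct: "sorted_wrt (strict le) xs \<Longrightarrow> distinct xs"
  by (induction xs) (auto simp: strict_def)

lemma finite_full_chains: "finite (full_chains P le)"
proof (rule finite_subset)
  show "full_chains P le \<subseteq> {xs. set xs \<subseteq> P \<and> length xs \<le> card P}"
  proof
    fix xs assume "xs \<in> full_chains P le"
    then have s: "set xs \<subseteq> P" "distinct xs"
      by (auto simp: full_chains_def intro: strict_sorted_distinct)
    have "length xs = card (set xs)" using s by (simp add: distinct_card)
    also have "\<dots> \<le> card P" using s fin by (intro card_mono)
    finally show "xs \<in> {xs. set xs \<subseteq> P \<and> length xs \<le> card P}" using s by simp
  qed
  show "finite {xs. set xs \<subseteq> P \<and> length xs \<le> card P}"
    using fin by (rule finite_lists_length_le)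
qed

lemma full_chains_del:
  assumes "zs \<in> full_chains P le" "1 \<le> i" "Suc i < length zs"
  shows "del i zs \<in> full_chains P le"
proof -
  have "del i zs \<noteq> []" using assms(2,3) by (auto simp: del_def)
  moreover have "zs \<noteq> []" using assms(3) by auto
  ultimately show ?thesis
    using assms set_del_subset[of i zs] sorted_wrt_del[of "strict le" zs i] hd_del[of i zs] last_del[of i zs]
    unfolding full_chains_def by auto
qed

lemma full_chains_insert:
  assumes "del i zs \<in> full_chains P le" "sorted_wrt (strict le) zs" "set zs \<subseteq> P"
    "1 \<le> i" "Suc i < length zs"
  shows "zs \<in> full_chains P le"
proof -
  have "zs \<noteq> []" using assms(5) by auto
  then show ?thesis
    using assms hd_del[of i zs] last_del[of i zs]
    unfolding full_chains_def by auto
qed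

lemma sorted_insert:
  assumes "sorted_wrt (strict le) xs" "set xs \<subseteq> P" "y \<in> P" "1 \<le> i" "i < length xs"
    "strict le (xs ! (i - 1)) y" "strict le y (xs ! i)"
  shows "sorted_wrt (strict le) (take i xs @ y # drop i xs)"
proof -
  have s: "sorted_wrt (strict le) (take i xs @ drop i xs)" using assms(1) by simp
  have 1: "strict le x y" if x: "x \<in> set (take i xs)" for x
  proof -
    obtain j where j: "j < i" "x = xs ! j" using x by (rule in_set_take_nth)
    show ?thesis
    proof (cases "j = i - 1")
      case False
      then have "strict le x (xs ! (i-1))" using j assms(1,5) by (auto intro: sorted_wrt_nth_less)
      then show ?thesis using assms(2,3,5,6) j strict_trans
        by (metis less_imp_diff_less nth_mem order.strict_trans subsetD)
    qed (use assms(6) j in auto)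
  qed
  have 2: "strict le y x" if x: "x \<in> set (drop i xs)" for x
  proof -
    obtain j where j: "i \<le> j" "j < length xs" "x = xs ! j" using x by (rule in_set_drop_nth)
    show ?thesis
    proof (cases "j = i")
      case False
      then have "strict le (xs ! i) x" using j assms(1,5) by (auto intro: sorted_wrt_nth_less)
      then show ?thesis using assms(2,3,5,7) j strict_trans
        by (meson nth_mem subsetD)
    qed (use assms(7) j in auto)
  qed
  show ?thesis using s 1 2 unfolding sorted_wrt_append by auto
qed

text \<open>Inserting an element at index \<open>i\<close> is undone by deleting index
  \<open>i\<close>, so the coefficient at \<open>zs\<close> collects the chains that arise from
  \<open>zs\<close> by one deletion. Only interior indices occur, because the differential inserts
  strictly between two entries.\<close>

lemma codiff_apply:
  fixes u :: "'p list \<Rightarrow> 'k::{comm_ring, comm_monoid_mult}"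
  assumes u: "\<And>xs. u xs \<noteq> 0 \<Longrightarrow> xs \<in> full_chains P le"
  shows "codiff P le u zs =
    (if zs \<in> full_chains P le then \<Sum>i\<in>{1..<length zs - 1}. (-1) ^ i * u (del i zs) else 0)"
proof -
  let ?F = "full_chains P le"
  let ?Z = "zs \<in> ?F"
  have inner: "(\<Sum>i\<in>{1..<length xs}. scale_fun ((-1) ^ i)
          (\<Sum>y\<in>{y\<in>P. strict le (xs ! (i - 1)) y \<and> strict le y (xs ! i)}.
             basis (take i xs @ y # drop i xs))) zs
      = (\<Sum>i\<in>{1..<length zs - 1}. if ?Z \<and> xs = del i zs then (-1 :: 'k) ^ i else 0)" (is "?L = ?R")
    if xs: "xs \<in> ?F" for xs
  proof -
    \<comment> \<open>Recording the length allows the range of \<open>i\<close>, given at first by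
      \<open>xs\<close>, to be replaced by one that depends on \<open>zs\<close> alone.\<close>
    have step: "(\<Sum>y\<in>{y\<in>P. strict le (xs ! (i - 1)) y \<and> strict le y (xs ! i)}.
             if zs = take i xs @ y # drop i xs then 1 else 0)
        = (if ?Z \<and> xs = del i zs \<and> length zs = Suc (length xs) then (1::'k) else 0)" (is "?l = ?r") if i: "i \<in> {1..<length xs}" for i
    proof -
      have fY: "finite {y\<in>P. strict le (xs ! (i - 1)) y \<and> strict le y (xs ! i)}" using fin by simp
      show ?thesis
      proof (cases "\<exists>y\<in>P. strict le (xs ! (i - 1)) y \<and> strict le y (xs ! i) \<and> zs = take i xs @ y # drop i xs")
        case True
        then obtain y where y: "y\<in>P" "strict le (xs ! (i - 1)) y" "strict le y (xs ! i)" and zs: "zs = take i xs @ y # drop i xs"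
          by blast
        have dl: "xs = del i zs" using i by (simp add: zs del_def)
        have len: "length zs = Suc (length xs)" using i by (simp add: zs)
        have "sorted_wrt (strict le) zs" unfolding zs
          using xs i y by (intro sorted_insert) (auto simp: full_chains_def)
        moreover have "set zs \<subseteq> P" using xs y by (auto simp: zs full_chains_def dest: in_set_takeD in_set_dropD)
        moreover have "del i zs \<in> ?F" using xs dl by metis
        moreover have "1 \<le> i" "Suc i < length zs" using i len by auto
        ultimately have "?Z" using full_chains_insert[of i zs] by blast
        moreover have "?l = (\<Sum>y'\<in>{y\<in>P. strict le (xs ! (i - 1)) y \<and> strict le y (xs ! i)}. if y' = y then 1 else 0)"
          by (rule sum.cong) (auto simp: zs)
        moreover have "(\<Sum>y'\<in>{y\<in>P. strict le (xs ! (i - 1)) y \<and> strict le y (xs ! i)}. if y' = y then 1 else 0) = (1::'k)"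
          using fY y by (simp add: sum.delta)
        ultimately show ?thesis using dl len by metis
      next
        case False
        then have "?l = 0" by (intro sum.neutral) auto
        moreover have "\<not> (?Z \<and> xs = del i zs \<and> length zs = Suc (length xs))"
        proof
          \<comment> \<open>Such a \<open>zs\<close> provides the inserted element itself, namely
            \<open>zs ! i\<close>, contrary to the case assumption.\<close>
          assume a: "?Z \<and> xs = del i zs \<and> length zs = Suc (length xs)"
          have so: "sorted_wrt (strict le) zs" "set zs \<subseteq> P" using a by (auto simp: full_chains_def)
          have li: "i < length zs" using a i by simp
          have "take i (del i zs) = take i zs" "drop i (del i zs) = drop (Suc i) zs" using li by (simp_all add: del_def)
          then have "zs = take i (del i zs) @ (zs ! i) # drop i (del i zs)"
            using id_take_nth_drop[OF li] by simp
          then have "zs = take i xs @ (zs ! i) # drop i xs" using a by metis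
          moreover have "zs ! i \<in> P" using so li by auto
          moreover have "(del i zs) ! (i - 1) = zs ! (i - 1)" using li i nth_del[of i zs "i-1"] by auto
          then have "xs ! (i - 1) = zs ! (i - 1)" using a by metis
          moreover have "(del i zs) ! i = zs ! Suc i" using li nth_del[of i zs i] by auto
          then have "xs ! i = zs ! Suc i" using a by metis
          moreover have "Suc i < length zs" using a i by auto
          then have "strict le (zs ! (i-1)) (zs ! i)" "strict le (zs ! i) (zs ! Suc i)"
            using i sorted_wrt_nth_less[OF so(1), of "i-1" i] sorted_wrt_nth_less[OF so(1), of i "Suc i"] by auto
          ultimately show False using False by metis
        qed
        ultimately show ?thesis by (simp only: if_False)
      qed
    qed
    have "?L = (\<Sum>i\<in>{1..<length xs}. (-1)^i * (if ?Z \<and> xs = del i zs \<and> length zs = Suc (length xs) then 1 else 0))"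
      unfolding sum_fun_apply scale_fun_apply basis_apply
      using step by (intro sum.cong) auto
    also have "\<dots> = (\<Sum>i\<in>{1..<length xs}. if ?Z \<and> xs = del i zs \<and> length zs = Suc (length xs) then (-1)^i else 0)"
      by (intro sum.cong) auto
    also have "\<dots> = ?R"
    proof (cases "length zs = Suc (length xs)")
      case False
      have "xs \<noteq> del i zs" if "i \<in> {1..<length zs - 1}" for i
        using that False length_del[of i zs] by auto
      then show ?thesis using False by (auto intro!: sum.neutral[symmetric])
    qed simp
    finally show ?thesis .
  qed
  have "codiff P le u zs = (\<Sum>xs\<in>?F. u xs * (\<Sum>i\<in>{1..<length zs - 1}. if ?Z \<and> xs = del i zs then (-1 :: 'k) ^ i else 0))"
    unfolding codiff_def lin_ext_apply by (intro sum.cong refl arg_cong2[of _ _ _ _ times] inner)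
  also have "\<dots> = (\<Sum>i\<in>{1..<length zs - 1}. \<Sum>xs\<in>?F. if xs = del i zs then (if ?Z then (-1) ^ i * u xs else 0) else 0)"
    unfolding sum_distrib_left
    by (subst sum.swap, intro sum.cong refl) (auto simp: mult.commute)
  also have "\<dots> = (\<Sum>i\<in>{1..<length zs - 1}. if ?Z then (-1) ^ i * u (del i zs) else 0)"
  proof (intro sum.cong refl)
    fix i assume "i \<in> {1..<length zs - 1}"
    show "(\<Sum>xs\<in>?F. if xs = del i zs then (if ?Z then (-1) ^ i * u xs else 0) else 0)
        = (if ?Z then (-1) ^ i * u (del i zs) else 0)"
      using u[of "del i zs"] by (cases "u (del i zs) = 0") (auto simp: sum.delta[OF finite_full_chains])
  qed
  finally show ?thesis by auto
qed

lemma cochainsD: "u \<in> cochains P le k \<Longrightarrow> u xs \<noteq> 0 \<Longrightarrow> xs \<in> full_chains P le \<and> int (length xs) = k + 1"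
  by (auto simp: cochains_def)

lemma codiff_cochains: 
  assumes "u \<in> cochains P le k" shows "codiff P le u \<in> cochains P le (k + 1)"
proof -
  have "zs \<in> full_chains P le \<and> int (length zs) = k + 1 + 1" if "codiff P le u zs \<noteq> 0" for zs
  proof -
    have eq: "codiff P le u zs = (if zs \<in> full_chains P le then \<Sum>i\<in>{1..<length zs - 1}. (-1) ^ i * u (del i zs) else 0)"
      using assms by (intro codiff_apply) (auto simp: cochains_def)
    then have z: "zs \<in> full_chains P le" "(\<Sum>i\<in>{1..<length zs - 1}. (-1) ^ i * u (del i zs)) \<noteq> 0" using that by (auto split: if_splits)
    then obtain i where i: "i\<in>{1..<length zs - 1}" "u (del i zs) \<noteq> 0"
      by (metis (no_types, lifting) mult_zero_right sum.neutral)
    then show ?thesis using cochainsD[OF assms, of "del i zs"] z length_del[of i zs] by auto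
  qed
  then show ?thesis by (auto simp: cochains_def)
qed

text \<open>The end points of a chain survive the deletions, which therefore preserve fullness.\<close>

lemma codiff_apply_sorted:
  fixes u :: "'p list \<Rightarrow> 'k::{comm_ring, comm_monoid_mult}"
  assumes u: "\<And>xs. u xs \<noteq> 0 \<Longrightarrow> xs \<in> full_chains P le"
    and "sorted_wrt (strict le) zs" "set zs \<subseteq> P"
  shows "(\<Sum>i\<in>{1..<length zs - 1}. (-1) ^ i * u (del i zs)) = codiff P le u zs"
proof (cases "zs \<in> full_chains P le")
  case False
  have "u (del i zs) = 0" if "i \<in> {1..<length zs - 1}" for i
    using u[of "del i zs"] full_chains_insert[of i zs] assms(2,3) False that by fastforce
  then have "(\<Sum>i\<in>{1..<length zs - 1}. (-1) ^ i * u (del i zs)) = 0" by (intro sum.neutral) auto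
  then show ?thesis using False codiff_apply[of u zs, OF u] by simp
qed (use codiff_apply[of u zs, OF u] in simp)

text \<open>The entry at which the chain is cut is the top of the lower interval, hence maximal
  there; minimality of the other end is inherited from the whole poset. The next lemma is the
  dual.\<close>

lemma full_chain_takeI:
  assumes "zs \<in> full_chains P le" "k < length zs"
  shows "take (Suc k) zs \<in> full_chains {y\<in>P. le y (zs ! k)} le"
proof -
  have z: "zs \<noteq> []" "set zs \<subseteq> P" "sorted_wrt (strict le) zs" "\<And>y. y \<in> P \<Longrightarrow> \<not> strict le y (hd zs)"
    using assms by (auto simp: full_chains_def)
  have t: "take (Suc k) zs \<noteq> []" using z by simp
  have "hd (take (Suc k) zs) = hd zs" by (simp add: hd_conv_nth z(1) t)
  moreover have "last (take (Suc k) zs) = zs ! k" using assms(2) by (simp add: last_conv_nth take_Suc_conv_app_nth)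
  moreover have "le x (zs ! k)" if x: "x \<in> set (take (Suc k) zs)" for x
  proof -
    obtain j where "j < Suc k" "x = zs ! j" using x by (rule in_set_take_nth)
    moreover have "zs ! k \<in> P" using z(2) assms(2) by (simp add: subset_eq)
    ultimately show ?thesis using assms(2) le_refl[of "zs ! k"] sorted_wrt_nth_less[OF z(3), of j k]
      by (cases "j = k") (auto simp: strict_def)
  qed
  moreover have "\<not> strict le (zs ! k) y" if "y \<in> P" "le y (zs ! k)" for y
    using that z(2) assms(2) le_antisym[of y "zs ! k"] nth_mem[of k zs] unfolding strict_def by blast
  moreover have "sorted_wrt (strict le) (take (Suc k) zs)" using z(3) by (rule sorted_wrt_take)
  ultimately show ?thesis using z t by (auto simp: full_chains_def dest: in_set_takeD)
qed

lemma full_chain_dropI: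
  assumes "zs \<in> full_chains P le" "k < length zs"
  shows "drop k zs \<in> full_chains {y\<in>P. le (zs ! k) y} le"
proof -
  have z: "zs \<noteq> []" "set zs \<subseteq> P" "sorted_wrt (strict le) zs" "\<And>y. y \<in> P \<Longrightarrow> \<not> strict le (last zs) y"
    using assms by (auto simp: full_chains_def)
  have t: "drop k zs \<noteq> []" using assms by simp
  have "last (drop k zs) = last zs" using assms(2) by simp
  moreover have "hd (drop k zs) = zs ! k" using assms(2) by (simp add: hd_drop_conv_nth)
  moreover have "le (zs ! k) x" if x: "x \<in> set (drop k zs)" for x
  proof -
    obtain j where "k \<le> j" "j < length zs" "x = zs ! j" using x by (rule in_set_drop_nth)
    moreover have "zs ! k \<in> P" using z(2) assms(2) by (simp add: subset_eq)
    ultimately show ?thesis using assms(2) le_refl[of "zs ! k"] sorted_wrt_nth_less[OF z(3), of k j]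
      by (cases "j = k") (auto simp: strict_def)
  qed
  moreover have "\<not> strict le y (zs ! k)" if "y \<in> P" "le (zs ! k) y" for y
    using that z(2) assms(2) le_antisym[of y "zs ! k"] nth_mem[of k zs] unfolding strict_def by blast
  moreover have "sorted_wrt (strict le) (drop k zs)" using z(3) by (rule sorted_wrt_drop)
  ultimately show ?thesis using z t by (auto simp: full_chains_def dest: in_set_dropD)
qed

lemma full_chain_below_last:
  assumes "us \<in> full_chains {y\<in>P. le y x} le" "x \<in> P" shows "last us = x"
proof -
  have us: "us \<noteq> []" "set us \<subseteq> {y\<in>P. le y x}" "\<not> strict le (last us) x"
    using assms le_refl[of x] by (auto simp: full_chains_def)
  then have "last us \<in> P" "le (last us) x" using last_in_set[OF us(1)] by blast+
  with us
  show ?thesis by (auto simp: strict_def)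
qed

lemma full_chain_above_hd:
  assumes "vs \<in> full_chains {y\<in>P. le x y} le" "x \<in> P" shows "hd vs = x"
proof -
  have vs: "vs \<noteq> []" "set vs \<subseteq> {y\<in>P. le x y}" "\<not> strict le x (hd vs)"
    using assms le_refl[of x] by (auto simp: full_chains_def)
  then have "hd vs \<in> P" "le x (hd vs)" using hd_in_set[OF vs(1)] by blast+
  with vs
  show ?thesis by (auto simp: strict_def)
qed

text \<open>An element of the whole poset beyond an outer end is comparable to \<open>x\<close> by
  transitivity, so it lies in the interval, where extremality of that end is known.\<close>

lemma full_chain_append:
  assumes "us \<in> full_chains {y\<in>P. le y x} le" "vs \<in> full_chains {y\<in>P. le x y} le" "x \<in> P"
  shows "us @ tl vs \<in> full_chains P le"
proof -
  have l: "last us = x" "hd vs = x" using assms full_chain_below_last full_chain_above_hd by auto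
  have ne: "us \<noteq> []" "vs \<noteq> []" using assms by (auto simp: full_chains_def)
  have su: "set us \<subseteq> {y\<in>P. le y x}" "set vs \<subseteq> {y\<in>P. le x y}" "sorted_wrt (strict le) us" "sorted_wrt (strict le) vs"
    using assms by (auto simp: full_chains_def)
  obtain vs' where vs: "vs = x # vs'" using l ne by (cases vs) auto
  have "strict le a b" if "a \<in> set us" "b \<in> set vs'" for a b
  proof -
    have "strict le x b" using su(4) vs that by auto
    moreover have "le a x" "a \<in> P" "b \<in> P" using su that vs by auto
    ultimately show ?thesis using assms(3) le_trans le_antisym unfolding strict_def by metis
  qed
  then have so: "sorted_wrt (strict le) (us @ tl vs)" using su vs by (auto simp: sorted_wrt_append)
  have "hd (us @ tl vs) = hd us" using ne by simp
  moreover have "last (us @ tl vs) = last vs" using ne l vs by (cases vs') auto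
  moreover have "\<not> strict le y (hd us)" if "y \<in> P" for y
  proof
    assume s: "strict le y (hd us)"
    have h: "hd us \<in> P" "le (hd us) x" using su(1) ne by (auto dest: hd_in_set)
    then have "le y x" using s that assms(3) le_trans unfolding strict_def by metis
    then show False using s that assms(1) by (auto simp: full_chains_def)
  qed
  moreover have "\<not> strict le (last vs) y" if "y \<in> P" for y
  proof
    assume s: "strict le (last vs) y"
    have h: "last vs \<in> P" "le x (last vs)" using su(2) ne by (auto dest: last_in_set)
    then have "le x y" using s that assms(3) le_trans unfolding strict_def by metis
    then show False using s that assms(2) by (auto simp: full_chains_def)
  qed
  ultimately show ?thesis using so ne su vs by (auto simp: full_chains_def)
qed

lemma finite_poset_subset:
  assumes "Q \<subseteq> P" shows "finite_poset Q le"
proof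
  show "finite Q" using assms fin by (rule finite_subset)
  show "le x x" if "x \<in> Q" for x using that assms by (intro le_refl) blast
  show "le x z" if "x \<in> Q" "y \<in> Q" "z \<in> Q" "le x y" "le y z" for x y z
    by (rule le_trans[of x y z]) (use that assms in blast)+
  show "x = y" if "x \<in> Q" "y \<in> Q" "le x y" "le y x" for x y
    by (rule le_antisym[of x y]) (use that assms in blast)+
qed

text \<open>Since \<open>u\<close> lives on lists of one length, the place where \<open>zs\<close>
  would have to be cut is forced, and the double sum has at most one nonzero term.\<close>

lemma concat_at_apply:
  fixes u v :: "'p list \<Rightarrow> 'k::{comm_ring, comm_monoid_mult}"
  assumes x: "x \<in> P" and u: "\<And>us. us \<in> full_chains {y\<in>P. le y x} le \<Longrightarrow> u us \<noteq> 0 \<Longrightarrow> length us = Suc k"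
  shows "concat_at P le x u v zs =
    (if zs \<in> full_chains P le \<and> k < length zs \<and> zs ! k = x then u (take (Suc k) zs) * v (drop k zs) else 0)"
proof -
  let ?U = "full_chains {y\<in>P. le y x} le" and ?V = "full_chains {y\<in>P. le x y} le"
  let ?C = "zs \<in> full_chains P le \<and> k < length zs \<and> zs ! k = x"
  interpret below: finite_poset "{y\<in>P. le y x}" le by (rule finite_poset_subset) auto
  interpret above: finite_poset "{y\<in>P. le x y}" le by (rule finite_poset_subset) auto
  have fU: "finite ?U" by (rule below.finite_full_chains)
  have fV: "finite ?V" by (rule above.finite_full_chains)
  have "concat_at P le x u v zs = (\<Sum>us\<in>?U. \<Sum>vs\<in>?V. u us * v vs * (if zs = us @ tl vs then 1 else 0))"
    by (simp add: concat_at_def sum_fun_apply basis_apply)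
  also have "\<dots> = (\<Sum>us\<in>?U. \<Sum>vs\<in>?V. if us = take (Suc k) zs then (if vs = drop k zs then (if ?C then u us * v vs else 0) else 0) else 0)"
  proof (intro sum.cong refl)
    fix us vs assume us: "us \<in> ?U" and vs: "vs \<in> ?V"
    have ne: "us \<noteq> []" "vs \<noteq> []" using us vs by (auto simp: full_chains_def)
    have l: "last us = x" "hd vs = x" using us vs x full_chain_below_last full_chain_above_hd by auto
    show "u us * v vs * (if zs = us @ tl vs then 1 else 0) = (if us = take (Suc k) zs then (if vs = drop k zs then (if ?C then u us * v vs else 0) else 0) else 0)"
    proof (cases "u us = 0")
      case False
      then have len: "length us = Suc k" using u us by auto
      have "zs = us @ tl vs \<longleftrightarrow> us = take (Suc k) zs \<and> vs = drop k zs \<and> ?C"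
      proof
        assume z: "zs = us @ tl vs"
        have "zs \<in> full_chains P le" unfolding z using us vs x by (rule full_chain_append)
        moreover have k: "zs ! k = x" using l len ne by (simp add: z nth_append last_conv_nth)
        moreover obtain us' where us': "us = us' @ [x]" "length us' = k"
          using len l ne by (metis append_butlast_last_id diff_Suc_1 length_butlast)
        obtain vs' where "vs = x # vs'" using l ne by (cases vs) auto
        then have "drop k zs = vs" using us' by (simp add: z)
        moreover have "take (Suc k) zs = us" using len by (simp add: z)
        moreover have "k < length zs" using len by (simp add: z)
        ultimately show "us = take (Suc k) zs \<and> vs = drop k zs \<and> ?C" by blast
      next
        assume a: "us = take (Suc k) zs \<and> vs = drop k zs \<and> ?C"
        then have "tl vs = drop (Suc k) zs" by (simp add: drop_Suc tl_drop)
        then show "zs = us @ tl vs" using a by simp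
      qed
      then show ?thesis by auto
    qed auto
  qed
  also have "\<dots> = (\<Sum>us\<in>?U. if us = take (Suc k) zs then (\<Sum>vs\<in>?V. (if vs = drop k zs then (if ?C then u us * v vs else 0) else 0)) else 0)"
    by (intro sum.cong refl) (auto intro!: sum.neutral)
  also have "\<dots> = (if ?C then u (take (Suc k) zs) * v (drop k zs) else 0)"
  proof (cases ?C)
    case True
    then have "take (Suc k) zs \<in> ?U" "drop k zs \<in> ?V" using full_chain_takeI full_chain_dropI by auto
    then show ?thesis using True by (simp add: sum.delta[OF fU] sum.delta[OF fV])
  qed (auto simp: sum.neutral)
  finally show ?thesis .
qed

end

lemma pullback_apply:
  fixes u :: "'q list \<Rightarrow> 'k::{comm_ring, comm_monoid_mult}"
  assumes P: "finite_poset P leP" and Q: "finite_poset Q leQ"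
   and u: "\<And>ys. u ys \<noteq> 0 \<Longrightarrow> ys \<in> full_chains Q leQ"
  shows "pullback P leP Q leQ f u xs = (if xs \<in> full_chains P leP then u (map f xs) else 0)"
proof -
  interpret P: finite_poset P leP by fact
  interpret Q: finite_poset Q leQ by fact
  have "pullback P leP Q leQ f u xs = (\<Sum>ys\<in>full_chains Q leQ. u ys * (\<Sum>xs'\<in>{xs\<in>full_chains P leP. map f xs = ys}. if xs = xs' then 1 else 0))"
    by (simp add: pullback_def lin_ext_apply sum_fun_apply basis_apply)
  also have "\<dots> = (\<Sum>ys\<in>full_chains Q leQ. if ys = map f xs then (if xs \<in> full_chains P leP then u ys else 0) else 0)"
    using P.finite_full_chains by (intro sum.cong refl) (auto simp: sum.delta')
  also have "\<dots> = (if xs \<in> full_chains P leP then u (map f xs) else 0)"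
    using u[of "map f xs"] by (auto simp: sum.delta[OF Q.finite_full_chains])
  finally show ?thesis .
qed

text \<open>The sign \<open>(-1) ^ n\<close>, restricted to a parity to avoid the class of rings with \<open>0 \<noteq> 1\<close>.\<close>

lemma minus_one_power: "(-1 :: 'k::{comm_ring, comm_monoid_mult}) ^ n = (if even n then 1 else -1)"
  by (induction n) (auto simp: minus_mult_left[symmetric])

section \<open>Submodules and maps on cosets\<close>

lemma mem_coset: "u \<in> v +o I \<longleftrightarrow> (u - v :: 'b \<Rightarrow> 'k::comm_ring) \<in> I"
  by (simp add: set_minus_plus)

locale submodule =
  fixes I :: "('b \<Rightarrow> 'k::{comm_ring, comm_monoid_mult}) set"
  assumes zero_mem: "0 \<in> I" and add_mem: "u \<in> I \<Longrightarrow> v \<in> I \<Longrightarrow> u + v \<in> I"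
    and scale_mem: "u \<in> I \<Longrightarrow> scale_fun c u \<in> I"
begin

lemma neg_mem: assumes "u \<in> I" shows "- u \<in> I"
proof -
  have "- u = scale_fun (-1) u" by (rule ext) (simp add: minus_mult_left[symmetric])
  then show ?thesis using scale_mem[OF assms] by simp
qed

lemma diff_mem: "u \<in> I \<Longrightarrow> v \<in> I \<Longrightarrow> u - v \<in> I"
  using add_mem[of u "-v"] neg_mem[of v] by simp

lemma sum_mem: "(\<And>x. x \<in> A \<Longrightarrow> f x \<in> I) \<Longrightarrow> sum f A \<in> I"
  by (induction A rule: infinite_finite_induct) (auto simp: zero_mem add_mem)

lemma self_mem: "u \<in> u +o I" using zero_mem by (simp add: mem_coset)

lemma coset_eq_iff: "u +o I = v +o I \<longleftrightarrow> u - v \<in> I"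
proof
  assume "u +o I = v +o I"
  then have "u \<in> v +o I" using self_mem[of u] by simp
  then show "u - v \<in> I" by (simp add: mem_coset)
next
  assume a: "u - v \<in> I"
  show "u +o I = v +o I"
  proof (rule set_eqI)
    fix w
    have "w - u \<in> I \<longleftrightarrow> w - v \<in> I"
      using add_mem[of "w - u" "u - v"] diff_mem[of "w - v" "u - v"] a by auto
    then show "w \<in> u +o I \<longleftrightarrow> w \<in> v +o I" by (simp add: mem_coset)
  qed
qed

lemma coset_map_coset:
  assumes "submodule J" "\<And>w. w - u \<in> J \<Longrightarrow> f w - f u \<in> I"
  shows "coset_map I f (u +o J) = f u +o I"
proof -
  interpret J: submodule J by fact
  have "f w +o I = f u +o I" if "w \<in> u +o J" for w
    using that assms(2)[of w] by (simp add: coset_eq_iff mem_coset)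
  then show ?thesis unfolding coset_map_def using J.self_mem[of u] by blast
qed

text \<open>Invariance is asked at the given \<open>u\<close> and \<open>v\<close> only, because the
  composition of cochains respects coboundaries only when its arguments are cocycles.\<close>

lemma coset_map2_coset:
  assumes "submodule J" "submodule K"
   "\<And>w z. w - u \<in> J \<Longrightarrow> z - v \<in> K \<Longrightarrow> f w z - f u v \<in> I"
  shows "coset_map2 I f (u +o J) (v +o K) = f u v +o I"
proof -
  interpret J: submodule J by fact
  interpret K: submodule K by fact
  have "f w z +o I = f u v +o I" if "w \<in> u +o J" "z \<in> v +o K" for w z
    using that assms(3)[of w z] by (simp add: coset_eq_iff mem_coset)
  then show ?thesis unfolding coset_map2_def using J.self_mem[of u] K.self_mem[of v] by blast
qed

end

lemma submodule_cochains: "submodule (cochains P le k)"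
  by unfold_locales (auto simp: cochains_def, metis add.right_neutral, metis add.right_neutral, metis mult_zero_right, metis mult_zero_right)

lemma codiff_add: "codiff P le (u + v) = codiff P le u + codiff P le v"
  by (simp add: codiff_def lin_ext_add)

lemma codiff_scale: "codiff P le (scale_fun c u) = scale_fun c (codiff P le u)"
  by (simp add: codiff_def lin_ext_scale)

lemma codiff_zero: "codiff P le 0 = 0"
  by (simp add: codiff_def lin_ext_zero)

lemma submodule_coboundaries: "submodule (coboundaries P le k)"
proof
  interpret c: submodule "cochains P le (k-1)" by (rule submodule_cochains)
  show "0 \<in> coboundaries P le k" unfolding coboundaries_def
    using codiff_zero[of P le] c.zero_mem by (metis image_eqI)
  show "u + v \<in> coboundaries P le k" if "u \<in> coboundaries P le k" "v \<in> coboundaries P le k" for u v :: "'a list \<Rightarrow> 'b"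
    using that unfolding coboundaries_def by (auto simp: codiff_add[symmetric] intro: c.add_mem)
  show "scale_fun a u \<in> coboundaries P le k" if "u \<in> coboundaries P le k" for u :: "'a list \<Rightarrow> 'b" and a
    using that unfolding coboundaries_def by (auto simp: codiff_scale[symmetric] intro: c.scale_mem)
qed

section \<open>Partitions\<close>

text \<open>This is \<open>refines\<close>, arguments exchanged, without the partition hypotheses,
  so that it passes to direct images under any map.\<close>

definition crs :: "'b set set \<Rightarrow> 'b set set \<Rightarrow> bool" where
  "crs X Y \<longleftrightarrow> (\<forall>Z'\<in>Y. \<exists>Z\<in>X. Z' \<subseteq> Z)"

lemma crs_refl: "crs X X" by (auto simp: crs_def)

lemma crs_trans: "crs X Y \<Longrightarrow> crs Y Z \<Longrightarrow> crs X Z"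
  unfolding crs_def by (meson subset_trans)

lemma crs_image: "crs X Y \<Longrightarrow> crs ((`) h ` X) ((`) h ` Y)"
  unfolding crs_def by (metis (no_types, lifting) image_iff image_mono)

lemma partition_eq: "partition_on A P \<Longrightarrow> X \<in> P \<Longrightarrow> Y \<in> P \<Longrightarrow> a \<in> X \<Longrightarrow> a \<in> Y \<Longrightarrow> X = Y"
  by (metis partition_onD2 disjointD disjoint_iff)

lemma partition_ne: "partition_on A P \<Longrightarrow> X \<in> P \<Longrightarrow> X \<noteq> {}"
  using partition_onD3 by blast

lemma partition_sub: "partition_on A P \<Longrightarrow> X \<in> P \<Longrightarrow> X \<subseteq> A"
  by (metis Union_upper partition_onD1)

lemma partition_ex: "partition_on A P \<Longrightarrow> a \<in> A \<Longrightarrow> \<exists>X\<in>P. a \<in> X"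
  by (metis Union_iff partition_onD1)

lemma crs_antisym:
  assumes "partition_on A X" "partition_on A Y" "crs X Y" "crs Y X" shows "X = Y"
proof (rule refines_asym)
  show "refines A X Y" "refines A Y X" using assms by (auto simp: refines_def crs_def)
qed

lemma crs_block:
  assumes "partition_on A X" "partition_on A Y" "crs X Y" "Z \<in> X" "Z' \<in> Y" "a \<in> Z" "a \<in> Z'"
  shows "Z' \<subseteq> Z"
proof -
  obtain W where "W \<in> X" "Z' \<subseteq> W" using assms by (auto simp: crs_def)
  then show ?thesis using partition_eq[OF assms(1) _ assms(4), of W a] assms by blast
qed

lemma crs_union:
  assumes "partition_on A X" "partition_on A Y" "crs X Y" "Z \<in> X"
  shows "\<Union>{Z'\<in>Y. Z' \<subseteq> Z} = Z"
proof
  show "Z \<subseteq> \<Union>{Z'\<in>Y. Z' \<subseteq> Z}"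
  proof
    fix a assume a: "a \<in> Z"
    then have "a \<in> A" using partition_sub[OF assms(1,4)] by blast
    then obtain Z' where "Z' \<in> Y" "a \<in> Z'" using partition_ex[OF assms(2)] by blast
    then show "a \<in> \<Union>{Z'\<in>Y. Z' \<subseteq> Z}" using crs_block[OF assms] a by blast
  qed
qed auto

text \<open>Sending a block of \<open>Y\<close> to the block of \<open>X\<close> that contains it is
  onto. If the cardinalities agree it is also injective, so every block of \<open>X\<close> contains
  just one block of \<open>Y\<close> and equals it.\<close>

lemma crs_card:
  assumes "finite A" "partition_on A X" "partition_on A Y" "crs X Y"
  shows "card X \<le> card Y" and "card X = card Y \<Longrightarrow> X = Y"
proof -
  have fin: "finite X" "finite Y" using assms finite_elements by auto
  define g where "g Z' = (SOME Z. Z \<in> X \<and> Z' \<subseteq> Z)" for Z'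
  have g: "g Z' \<in> X \<and> Z' \<subseteq> g Z'" if "Z' \<in> Y" for Z'
    unfolding g_def by (rule someI_ex) (use assms(4) that in \<open>auto simp: crs_def\<close>)
  have im: "g ` Y = X"
  proof
    show "g ` Y \<subseteq> X" using g by blast
    show "X \<subseteq> g ` Y"
    proof
      fix Z assume Z: "Z \<in> X"
      then obtain a where a: "a \<in> Z" "a \<in> A"
        using partition_ne[OF assms(2)] partition_sub[OF assms(2)] by blast
      then obtain Z' where Z': "Z' \<in> Y" "a \<in> Z'" using partition_ex[OF assms(3)] by blast
      then have "g Z' = Z" using g[of Z'] partition_eq[OF assms(2) _ Z, of "g Z'" a] a by blast
      then show "Z \<in> g ` Y" using Z' by blast
    qed
  qed
  show "card X \<le> card Y" using card_image_le[OF fin(2), of g] im by simp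
  assume "card X = card Y"
  then have inj: "inj_on g Y" using im fin by (intro eq_card_imp_inj_on) auto
  have "crs Y X" unfolding crs_def
  proof
    fix Z assume Z: "Z \<in> X"
    then obtain Z' where Z': "Z' \<in> Y" "Z = g Z'" using im by blast
    have "W = Z'" if W: "W \<in> Y" "W \<subseteq> Z" for W
    proof -
      obtain a where a: "a \<in> W" using W partition_ne[OF assms(3)] by blast
      have "g W = Z" using g[OF W(1)] partition_eq[OF assms(2) _ Z, of "g W" a] a W by blast
      then show ?thesis using inj_onD[OF inj, of W Z'] Z' W by blast
    qed
    then have "Z \<subseteq> Z'" using crs_union[OF assms(2-4) Z] by blast
    then show "\<exists>Z'\<in>Y. Z \<subseteq> Z'" using Z' by blast
  qed
  then show "X = Y" using crs_antisym[OF assms(2-4)] by blast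
qed

abbreviation singles :: "'a set \<Rightarrow> 'a set set" where
  "singles A \<equiv> (\<lambda>a. {a}) ` A"

lemma card_singles: "card (singles A) = card A"
  by (simp add: card_image)

lemma crs_singles: assumes "partition_on A X" shows "crs X (singles A)"
  using partition_ex[OF assms] unfolding crs_def by blast

lemma partition_card_le:
  assumes "finite A" "partition_on A X"
  shows "card X \<le> card A" and "card X = card A \<Longrightarrow> X = singles A"
  using crs_card[OF assms partition_on_singletons crs_singles[OF assms(2)]]
  by (auto simp: card_singles)


text \<open>The condition under which the images of the blocks form a partition again and each block
  is recovered as a preimage. Injective maps satisfy it, and so do maps that collapse the blocks of
  a finer partition.\<close>

definition sat :: "'b set set \<Rightarrow> ('b \<Rightarrow> 'c) \<Rightarrow> bool" where
  "sat P h \<longleftrightarrow> (\<forall>Z\<in>P. \<forall>z\<in>Z. \<forall>z'\<in>\<Union>P. h z' = h z \<longrightarrow> z' \<in> Z)"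

lemma sat_inj: "partition_on A P \<Longrightarrow> inj_on h A \<Longrightarrow> sat P h"
  unfolding sat_def by (metis Union_iff inj_onD partition_onD1)

lemma sat_vimage: "partition_on A P \<Longrightarrow> sat P h \<Longrightarrow> Z \<in> P \<Longrightarrow> {z\<in>A. h z \<in> h ` Z} = Z"
proof -
  assume a: "partition_on A P" "sat P h" "Z \<in> P"
  have "Z \<subseteq> A" "A = \<Union>P" using a partition_sub partition_onD1 by metis+
  then show ?thesis using a(2,3) unfolding sat_def by blast
qed

text \<open>Through this lemma a map that collapses the blocks of one element can be applied to
  everything below that element.\<close>

lemma sat_crs:
  assumes "partition_on A X" "partition_on A Y" "crs X Y" "sat Y h" shows "sat X h"
  unfolding sat_def
proof (intro ballI impI)
  fix Z z z' assume a: "Z \<in> X" "z \<in> Z" "z' \<in> \<Union>X" "h z' = h z"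
  have U: "\<Union>X = A" "\<Union>Y = A" using assms(1,2) partition_onD1 by metis+
  obtain Z' where Z': "Z' \<in> Y" "z \<in> Z'" using a U by blast
  then have "z' \<in> Z'" using assms(4) a U unfolding sat_def by blast
  then show "z' \<in> Z" using crs_block[OF assms(1-3) a(1) Z'(1) a(2) Z'(2)] by blast
qed

lemma sat_inj_image: "partition_on A P \<Longrightarrow> sat P h \<Longrightarrow> inj_on ((`) h) P"
  by (rule inj_on_inverseI[where g = "\<lambda>W. {z\<in>A. h z \<in> W}"]) (rule sat_vimage)

lemma sat_image_eq:
  assumes "partition_on A P" "partition_on A Q" "sat P h" "sat Q h" "(`) h ` P = (`) h ` Q"
  shows "P = Q"
proof -
  have r: "(\<lambda>W. {z\<in>A. h z \<in> W}) ` (`) h ` P = P" if "partition_on A P" "sat P h" for P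
    unfolding image_image using sat_vimage[OF that] by (simp cong: image_cong_simp)
  have "P = (\<lambda>W. {z\<in>A. h z \<in> W}) ` (`) h ` P" by (rule r[OF assms(1,3), symmetric])
  also have "\<dots> = Q" unfolding assms(5) by (rule r[OF assms(2,4)])
  finally show ?thesis .
qed

lemma partition_image:
  assumes "partition_on A P" "sat P h" shows "partition_on (h ` A) ((`) h ` P)"
proof (rule partition_onI)
  show "\<Union>((`) h ` P) = h ` A" using partition_onD1[OF assms(1)] by (metis image_Union)
  show "{} \<notin> (`) h ` P" using partition_ne[OF assms(1)] by blast
  have "p \<inter> p' = {}" if pp: "p \<in> (`) h ` P" "p' \<in> (`) h ` P" "p \<noteq> p'" for p p'
  proof (rule ccontr)
    assume "p \<inter> p' \<noteq> {}"
    then obtain Z Z' z z' where z: "Z \<in> P" "Z' \<in> P" "p = h ` Z" "p' = h ` Z'" "z \<in> Z" "z' \<in> Z'" "h z' = h z"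
      using pp by (smt (verit) disjoint_iff image_iff)
    then have "z' \<in> Z" using assms(2) unfolding sat_def by blast
    then show False using partition_eq[OF assms(1), of Z Z' z'] z pp by blast
  qed
  then show "disjnt p p'" if "p \<in> (`) h ` P" "p' \<in> (`) h ` P" "p \<noteq> p'" for p p'
    using that unfolding disjnt_def .
qed

text \<open>On the union of \<open>P\<close>, such a map is the quotient map by the partition, up to
  the names given to the blocks.\<close>

definition qm :: "'b set set \<Rightarrow> ('b \<Rightarrow> 'c) \<Rightarrow> bool" where
  "qm P h \<longleftrightarrow> (\<forall>Z\<in>P. \<forall>z\<in>Z. \<forall>z'\<in>\<Union>P. h z' = h z \<longleftrightarrow> z' \<in> Z)"

lemma qm_sat: "qm P h \<Longrightarrow> sat P h" by (auto simp: qm_def sat_def)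

text \<open>The map takes one value per block and different values on different blocks. This
  computes the sizes of collapsed blocks.\<close>

lemma qm_card_image:
  assumes "partition_on A P" "qm P h" "\<Union>{Z\<in>P. Z \<subseteq> M} = M"
  shows "card (h ` M) = card {Z\<in>P. Z \<subseteq> M}"
proof -
  define g where "g Z = h (SOME z. z \<in> Z)" for Z
  have s: "(SOME z. z \<in> Z) \<in> Z" if "Z \<in> P" for Z
    using partition_ne[OF assms(1) that] by (metis ex_in_conv someI_ex)
  have g: "g Z = h z" if "Z \<in> P" "z \<in> Z" for Z z
    unfolding g_def using assms(2) s[OF that(1)] that unfolding qm_def by blast
  have "inj_on g {Z\<in>P. Z \<subseteq> M}"
  proof (rule inj_onI)
    fix Z Z' assume a: "Z \<in> {Z\<in>P. Z \<subseteq> M}" "Z' \<in> {Z\<in>P. Z \<subseteq> M}" "g Z = g Z'"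
    obtain z z' where z: "z \<in> Z" "z' \<in> Z'" using a partition_ne[OF assms(1)] by blast
    then have "h z' = h z" using a g by auto
    then have "z' \<in> Z" using assms(2) a z unfolding qm_def by blast
    then show "Z = Z'" using partition_eq[OF assms(1), of Z Z' z'] a z by blast
  qed
  moreover have "g ` {Z\<in>P. Z \<subseteq> M} = h ` M"
  proof
    show "g ` {Z\<in>P. Z \<subseteq> M} \<subseteq> h ` M" unfolding g_def using s by blast
    show "h ` M \<subseteq> g ` {Z\<in>P. Z \<subseteq> M}"
    proof
      fix w assume "w \<in> h ` M"
      then obtain z where z: "z \<in> M" "w = h z" by blast
      then obtain Z where "Z \<in> P" "Z \<subseteq> M" "z \<in> Z" using assms(3) by blast
      then show "w \<in> g ` {Z\<in>P. Z \<subseteq> M}" using g z by (metis (mono_tags, lifting) image_eqI mem_Collect_eq)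
    qed
  qed
  ultimately show ?thesis by (metis card_image)
qed


section \<open>Ranks in finite sets and the numbering of blocks by their minima\<close>

definition rk :: "nat set \<Rightarrow> nat \<Rightarrow> nat" where
  "rk M a = card {m\<in>M. m \<le> a}"

lemma rk_less: assumes "finite M" "b \<in> M" "a < b" shows "rk M a < rk M b"
  unfolding rk_def
proof (rule psubset_card_mono)
  have "b \<in> {m\<in>M. m \<le> b}" "b \<notin> {m\<in>M. m \<le> a}" "{m\<in>M. m \<le> a} \<subseteq> {m\<in>M. m \<le> b}" using assms by auto
  then show "{m\<in>M. m \<le> a} \<subset> {m\<in>M. m \<le> b}" by blast
qed (use assms in auto)

lemma rk_mono: "finite M \<Longrightarrow> a \<le> b \<Longrightarrow> rk M a \<le> rk M b"
  unfolding rk_def by (rule card_mono) auto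

lemma rk_less_iff: "finite M \<Longrightarrow> a \<in> M \<Longrightarrow> b \<in> M \<Longrightarrow> rk M a < rk M b \<longleftrightarrow> a < b"
  using rk_less[of M b a] rk_mono[of M b a] by (meson linorder_not_le)

lemma rk_le_iff: "finite M \<Longrightarrow> a \<in> M \<Longrightarrow> b \<in> M \<Longrightarrow> rk M a \<le> rk M b \<longleftrightarrow> a \<le> b"
  using rk_less_iff[of M b a] by (metis linorder_not_le)

lemma rk_inj: "finite M \<Longrightarrow> inj_on (rk M) M"
  by (rule inj_onI) (metis rk_le_iff order_antisym order_refl)

lemma rk_image_set: assumes "finite M" shows "rk M ` M = {1..card M}"
proof (rule card_subset_eq)
  show "rk M ` M \<subseteq> {1..card M}"
  proof
    fix w assume "w \<in> rk M ` M"
    then obtain a where a: "a \<in> M" "w = rk M a" by blast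
    have "card {m\<in>M. m \<le> a} \<le> card M" using assms by (intro card_mono) auto
    moreover have "0 < card {m\<in>M. m \<le> a}" using assms a by (subst card_gt_0_iff) auto
    ultimately show "w \<in> {1..card M}" using a by (simp add: rk_def)
  qed
  show "card (rk M ` M) = card {1..card M}" using rk_inj[OF assms] by (simp add: card_image)
qed auto

lemma rk_image:
  assumes "finite M" "a \<in> M" "\<And>x y. x \<in> M \<Longrightarrow> y \<in> M \<Longrightarrow> g x \<le> (g y :: nat) \<longleftrightarrow> x \<le> y"
  shows "rk (g ` M) (g a) = rk M a"
proof -
  have "{m \<in> g ` M. m \<le> g a} = g ` {m\<in>M. m \<le> a}" using assms(2,3) by auto
  moreover have "inj_on g {m\<in>M. m \<le> a}"
    by (rule inj_onI) (metis (no_types, lifting) assms(3) mem_Collect_eq order_antisym order_refl)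
  ultimately show ?thesis by (simp add: rk_def card_image)
qed

lemma rk_interval: "i \<in> {1..n} \<Longrightarrow> rk {1..n} i = i"
proof -
  assume "i \<in> {1..n}"
  then have "{m\<in>{1..n}. m \<le> i} = {1..i}" by auto
  then show ?thesis by (simp add: rk_def)
qed

definition blk :: "nat set set \<Rightarrow> nat \<Rightarrow> nat set" where
  "blk \<rho> i = \<Union>{R\<in>\<rho>. i \<in> R}"

text \<open>The number of the block of \<open>i\<close> when the blocks are ordered by their minimal elements.\<close>

definition pos :: "nat set set \<Rightarrow> nat \<Rightarrow> nat" where
  "pos \<rho> i = rk (Min ` \<rho>) (Min (blk \<rho> i))"

lemma blk_eq: "partition_on N \<rho> \<Longrightarrow> R \<in> \<rho> \<Longrightarrow> i \<in> R \<Longrightarrow> blk \<rho> i = R"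
proof -
  assume a: "partition_on N \<rho>" "R \<in> \<rho>" "i \<in> R"
  then have "{R\<in>\<rho>. i \<in> R} = {R}" using partition_eq[OF a(1) _ a(2) _ a(3)] by blast
  then show ?thesis unfolding blk_def by simp
qed

lemma pos_eq: "partition_on N \<rho> \<Longrightarrow> R \<in> \<rho> \<Longrightarrow> i \<in> R \<Longrightarrow> pos \<rho> i = rk (Min ` \<rho>) (Min R)"
  unfolding pos_def using blk_eq by metis

context
  fixes N :: "nat set" and \<rho> assumes fN: "finite N" and part: "partition_on N \<rho>"
begin

lemma fin_blocks: "finite \<rho>" "R \<in> \<rho> \<Longrightarrow> finite R"
  using fN part finite_elements partition_sub finite_subset by metis+

lemma Min_block: "R \<in> \<rho> \<Longrightarrow> Min R \<in> R"
  by (metis fin_blocks(2) partition_ne[OF part] Min_in)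

lemma Min_inj: "inj_on Min \<rho>"
  by (rule inj_onI) (metis Min_block part partition_eq)

lemma rk_Min_le: "R \<in> \<rho> \<Longrightarrow> R' \<in> \<rho> \<Longrightarrow> rk (Min ` \<rho>) (Min R) \<le> rk (Min ` \<rho>) (Min R') \<longleftrightarrow> Min R \<le> Min R'"
  using fin_blocks by (intro rk_le_iff) auto

lemma card_le_Min: "card {R'\<in>\<rho>. Min R' \<le> a} = rk (Min ` \<rho>) a"
proof -
  have "{m \<in> Min ` \<rho>. m \<le> a} = Min ` {R'\<in>\<rho>. Min R' \<le> a}" by auto
  moreover have "inj_on Min {R'\<in>\<rho>. Min R' \<le> a}" using Min_inj by (rule inj_on_subset) auto
  ultimately show ?thesis by (simp add: rk_def card_image)
qed

lemma pos_qm: "qm \<rho> (pos \<rho>)"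
  unfolding qm_def
proof (intro ballI)
  fix R i j assume a: "R \<in> \<rho>" "i \<in> R" "j \<in> \<Union>\<rho>"
  then obtain R' where R': "R' \<in> \<rho>" "j \<in> R'" by blast
  have "pos \<rho> j = pos \<rho> i \<longleftrightarrow> Min R' = Min R"
    unfolding pos_eq[OF part a(1,2)] pos_eq[OF part R']
    using rk_Min_le[OF a(1) R'(1)] rk_Min_le[OF R'(1) a(1)] by (metis order_antisym order_refl)
  also have "\<dots> \<longleftrightarrow> R' = R" using inj_on_eq_iff[OF Min_inj R'(1) a(1)] .
  also have "\<dots> \<longleftrightarrow> j \<in> R" using R' partition_eq[OF part R'(1) a(1) R'(2)] by blast
  finally show "pos \<rho> j = pos \<rho> i \<longleftrightarrow> j \<in> R" .
qed

lemma pos_image_blocks: 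
  assumes "\<Union>{R\<in>\<rho>. R \<subseteq> M} = M"
  shows "pos \<rho> ` M = rk (Min ` \<rho>) ` Min ` {R\<in>\<rho>. R \<subseteq> M}"
proof
  show "pos \<rho> ` M \<subseteq> rk (Min ` \<rho>) ` Min ` {R\<in>\<rho>. R \<subseteq> M}"
  proof
    fix w assume "w \<in> pos \<rho> ` M"
    then obtain i where i: "i \<in> M" "w = pos \<rho> i" by blast
    then obtain R where R: "R \<in> \<rho>" "R \<subseteq> M" "i \<in> R" using assms by blast
    then show "w \<in> rk (Min ` \<rho>) ` Min ` {R\<in>\<rho>. R \<subseteq> M}" using pos_eq[OF part R(1,3)] i by blast
  qed
  show "rk (Min ` \<rho>) ` Min ` {R\<in>\<rho>. R \<subseteq> M} \<subseteq> pos \<rho> ` M"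
  proof
    fix w assume "w \<in> rk (Min ` \<rho>) ` Min ` {R\<in>\<rho>. R \<subseteq> M}"
    then obtain R where R: "R \<in> \<rho>" "R \<subseteq> M" "w = rk (Min ` \<rho>) (Min R)" by blast
    have "Min R \<in> M" using R(2) Min_block[OF R(1)] by blast
    moreover have "w = pos \<rho> (Min R)" using pos_eq[OF part R(1) Min_block[OF R(1)]] R(3) by simp
    ultimately show "w \<in> pos \<rho> ` M" by blast
  qed
qed

lemma pos_image: "pos \<rho> ` N = {1..card \<rho>}"
proof -
  have "{R\<in>\<rho>. R \<subseteq> N} = \<rho>" using partition_sub[OF part] by blast
  then have "pos \<rho> ` N = rk (Min ` \<rho>) ` Min ` \<rho>"
    using pos_image_blocks[of N] partition_onD1[OF part] by simp
  also have "\<dots> = {1..card (Min ` \<rho>)}" using fin_blocks by (intro rk_image_set) auto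
  finally show ?thesis using Min_inj by (simp add: card_image)
qed

text \<open>Turns the numbering of a union of blocks, given by a set of block numbers, into a direct
  image under a map on positions.\<close>

lemma block_index_pos: 
  assumes "\<Union>{R\<in>\<rho>. R \<subseteq> M} = M"
  shows "block_index \<rho> M = pos \<rho> ` M"
  unfolding block_index_def card_le_Min pos_image_blocks[OF assms] image_image by simp

lemma pos_le: "i \<in> N \<Longrightarrow> j \<in> N \<Longrightarrow> pos \<rho> i \<le> pos \<rho> j \<longleftrightarrow> Min (blk \<rho> i) \<le> Min (blk \<rho> j)"
proof -
  assume ij: "i \<in> N" "j \<in> N"
  obtain R R' where R: "R \<in> \<rho>" "i \<in> R" "R' \<in> \<rho>" "j \<in> R'" using partition_ex[OF part] ij by blast
  show ?thesis
    unfolding pos_eq[OF part R(1,2)] pos_eq[OF part R(3,4)] blk_eq[OF part R(1,2)] blk_eq[OF part R(3,4)]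
    by (rule rk_Min_le[OF R(1,3)])
qed

lemma pos_less: "i \<in> N \<Longrightarrow> j \<in> N \<Longrightarrow> pos \<rho> i < pos \<rho> j \<longleftrightarrow> Min (blk \<rho> i) < Min (blk \<rho> j)"
  using pos_le[of j i] by (auto simp: not_le[symmetric])

text \<open>The minimum of a union of blocks is the least of their minima, and the numbering
  increases with the minima.\<close>

lemma Min_pos_image:
  assumes "R \<subseteq> N" "R \<noteq> {}" "\<Union>{R'\<in>\<rho>. R' \<subseteq> R} = R"
  shows "Min (pos \<rho> ` R) = rk (Min ` \<rho>) (Min R)"
proof -
  have fR: "finite R" using assms fN finite_subset by blast
  have "Min R \<in> R" using assms fR by simp
  then obtain R0 where R0: "R0 \<in> \<rho>" "R0 \<subseteq> R" "Min R \<in> R0" using assms(3) by blast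
  have "Min R0 \<in> R" using R0 Min_block by blast
  then have "Min R \<le> Min R0" using fR by simp
  moreover have "Min R0 \<le> Min R" using R0 fin_blocks(2) by simp
  ultimately have m0: "Min R0 = Min R" by simp
  show ?thesis
  proof (rule Min_eqI)
    show "finite (pos \<rho> ` R)" using fR by simp
    show "rk (Min ` \<rho>) (Min R) \<in> pos \<rho> ` R" using pos_eq[OF part R0(1,3)] m0 R0 by force
    fix w assume "w \<in> pos \<rho> ` R"
    then obtain i where i: "i \<in> R" "w = pos \<rho> i" by blast
    then obtain R' where R': "R' \<in> \<rho>" "R' \<subseteq> R" "i \<in> R'" using assms(3) by blast
    have "Min R \<le> Min R'" using R' Min_block fR by (meson Min_le subsetD)
    then show "rk (Min ` \<rho>) (Min R) \<le> w"
      using i pos_eq[OF part R'(1,3)] rk_Min_le[OF R0(1) R'(1)] m0 by simp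
  qed
qed

text \<open>Numbering the fine blocks first and the coarse blocks of these numbers afterwards gives
  the direct numbering of the coarse blocks: both orders are those of the minima, and the first
  numbering preserves the order of minima.\<close>

lemma pos_pos:
  assumes part': "partition_on N \<rho>'" and crs: "crs \<rho>' \<rho>" and i: "i \<in> N"
  shows "pos ((`) (pos \<rho>) ` \<rho>') (pos \<rho> i) = pos \<rho>' i"
proof -
  have sat: "sat \<rho>' (pos \<rho>)" using sat_crs[OF part' part crs qm_sat[OF pos_qm]] .
  have pim: "partition_on (pos \<rho> ` N) ((`) (pos \<rho>) ` \<rho>')" using part' sat by (rule partition_image)
  have un: "\<Union>{R'\<in>\<rho>. R' \<subseteq> R} = R" if "R \<in> \<rho>'" for R using crs_union[OF part' part crs that] .
  have Mi: "Min (pos \<rho> ` R) = rk (Min ` \<rho>) (Min R)" if "R \<in> \<rho>'" for R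
    using that un partition_sub[OF part'] partition_ne[OF part'] by (intro Min_pos_image) auto
  have fin': "finite \<rho>'" using fN part' finite_elements by blast
  \<comment> \<open>The minimum of a coarse block is also the minimum of the fine block that
    contains it, and on such numbers the rank is strictly increasing.\<close>
  have MM: "Min R \<in> Min ` \<rho>" if R: "R \<in> \<rho>'" for R
  proof -
    have fR: "finite R" "R \<noteq> {}" using partition_sub[OF part' R] partition_ne[OF part' R] fN finite_subset by auto
    then have "Min R \<in> R" by simp
    then obtain R0 where R0: "R0 \<in> \<rho>" "R0 \<subseteq> R" "Min R \<in> R0" using un[OF R] by blast
    have "Min R \<le> Min R0" using fR R0 Min_block by (meson Min_le subsetD)
    moreover have "Min R0 \<le> Min R" using R0 fin_blocks(2) by simp
    ultimately show ?thesis using R0 by (metis image_eqI order_antisym)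
  qed
  obtain R where R: "R \<in> \<rho>'" "i \<in> R" using partition_ex[OF part' i] by blast
  have "pos ((`) (pos \<rho>) ` \<rho>') (pos \<rho> i) = rk (Min ` (`) (pos \<rho>) ` \<rho>') (Min (pos \<rho> ` R))"
    using R by (intro pos_eq[OF pim]) auto
  also have "Min ` (`) (pos \<rho>) ` \<rho>' = rk (Min ` \<rho>) ` Min ` \<rho>'"
    unfolding image_image using Mi by (intro image_cong) auto
  also have "rk \<dots> (Min (pos \<rho> ` R)) = rk (Min ` \<rho>') (Min R)"
    unfolding Mi[OF R(1)]
  proof (rule rk_image)
    fix x y assume "x \<in> Min ` \<rho>'" "y \<in> Min ` \<rho>'"
    then have "x \<in> Min ` \<rho>" "y \<in> Min ` \<rho>" using MM by blast+
    then show "(rk (Min ` \<rho>) x \<le> rk (Min ` \<rho>) y) = (x \<le> y)" using fin_blocks by (intro rk_le_iff) auto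
  qed (use fin' R in auto)
  also have "\<dots> = pos \<rho>' i" using pos_eq[OF part' R] by simp
  finally show ?thesis .
qed

text \<open>Ranks among the numbers of the blocks inside \<open>F\<close> are ranks among their
  minima; whatever lies outside \<open>F\<close> drops out. The lemma \<open>pos_rk\<close> reaches
  the same expression by restricting first.\<close>

lemma rk_pos_image:
  assumes F: "F \<subseteq> N" "\<Union>{R\<in>\<rho>. R \<subseteq> F} = F" and j: "j \<in> F"
  shows "rk (pos \<rho> ` F) (pos \<rho> j) = rk (Min ` {R\<in>\<rho>. R \<subseteq> F}) (Min (blk \<rho> j))"
proof -
  obtain R where R: "R \<in> \<rho>" "R \<subseteq> F" "j \<in> R" using F j by blast
  have "rk (pos \<rho> ` F) (pos \<rho> j) = rk (rk (Min ` \<rho>) ` Min ` {R\<in>\<rho>. R \<subseteq> F}) (rk (Min ` \<rho>) (Min R))"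
    using pos_image_blocks[OF F(2)] pos_eq[OF part R(1,3)] by simp
  also have "\<dots> = rk (Min ` {R\<in>\<rho>. R \<subseteq> F}) (Min R)"
    using fin_blocks R by (intro rk_image) (auto simp: rk_le_iff)
  finally show ?thesis using blk_eq[OF part R(1,3)] by simp
qed

end

section \<open>Projections of non-crossing 2-partitions\<close>

definition noncr :: "nat set set \<Rightarrow> bool" where
  "noncr \<rho> \<longleftrightarrow> (\<forall>X\<in>\<rho>. \<forall>Y\<in>\<rho>. \<forall>i\<in>X. \<forall>j\<in>Y. \<forall>k\<in>X. \<forall>l\<in>Y. i < j \<longrightarrow> j < k \<longrightarrow> k < l \<longrightarrow> X = Y)"

lemma noncrossing_iff: "noncrossing n \<rho> \<longleftrightarrow> partition_on {1..n} \<rho> \<and> noncr \<rho>"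
proof (cases "partition_on {1..n} \<rho>")
  case part: True
  have "(\<forall>i j k l. i < j \<and> j < k \<and> k < l \<longrightarrow> (\<exists>X\<in>\<rho>. {i, k} \<subseteq> X) \<longrightarrow> (\<exists>Y\<in>\<rho>. {j, l} \<subseteq> Y) \<longrightarrow>
        (\<exists>Z\<in>\<rho>. {i, j, k, l} \<subseteq> Z)) \<longleftrightarrow> noncr \<rho>" (is "?L \<longleftrightarrow> _")
  proof
    assume L: ?L
    show "noncr \<rho>" unfolding noncr_def
    proof (intro ballI impI)
      fix X Y i j k l assume a: "X \<in> \<rho>" "Y \<in> \<rho>" "i \<in> X" "j \<in> Y" "k \<in> X" "l \<in> Y" "i < j" "j < k" "k < l"
      have "\<exists>X\<in>\<rho>. {i, k} \<subseteq> X" "\<exists>Y\<in>\<rho>. {j, l} \<subseteq> Y" using a by auto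
      then obtain Z where Z: "Z \<in> \<rho>" "{i,j,k,l} \<subseteq> Z" using L[rule_format, of i j k l] a(7-9) by blast
      then show "X = Y" using partition_eq[OF part a(1) Z(1) a(3)] partition_eq[OF part a(2) Z(1) a(4)] by simp
    qed
  next
    assume n: "noncr \<rho>"
    show ?L
    proof (intro allI impI)
      fix i j k l assume a: "i < j \<and> j < k \<and> k < l" "\<exists>X\<in>\<rho>. {i, k} \<subseteq> X" "\<exists>Y\<in>\<rho>. {j, l} \<subseteq> Y"
      obtain X where X: "X \<in> \<rho>" "i \<in> X" "k \<in> X" using a(2) by auto
      obtain Y where Y: "Y \<in> \<rho>" "j \<in> Y" "l \<in> Y" using a(3) by auto
      have "X = Y" using n X Y a(1) unfolding noncr_def by blast
      then have "{i,j,k,l} \<subseteq> X" using X Y by simp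
      then show "\<exists>Z\<in>\<rho>. {i, j, k, l} \<subseteq> Z" using X(1) by blast
    qed
  qed
  then show ?thesis using part by (simp add: noncrossing_def)
qed (simp add: noncrossing_def)

text \<open>The elements of \<open>NCP2 S\<close>, but with an arbitrary set \<open>N\<close> of positions in place of \<open>{1..card S}\<close>.\<close>

definition NC :: "'a set \<Rightarrow> nat set \<Rightarrow> 'a ncp2 set" where
  "NC S N = {(\<pi>, \<rho>, f). partition_on S \<pi> \<and> partition_on N \<rho> \<and> noncr \<rho> \<and>
     f \<in> extensional \<pi> \<and> bij_betw f \<pi> \<rho> \<and> (\<forall>T\<in>\<pi>. card (f T) = card T)}"

abbreviation "posns x \<equiv> fst (snd x)"
abbreviation "asg x \<equiv> snd (snd x)"

lemma NCP2_NC: "NCP2 S = NC S {1..card S}"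
  by (simp add: NCP2_def NC_def noncrossing_iff)

lemma NC_D:
  assumes "x \<in> NC S N"
  shows "partition_on S (fst x)" "partition_on N (posns x)" "noncr (posns x)" "asg x \<in> extensional (fst x)"
    "bij_betw (asg x) (fst x) (posns x)" "T \<in> fst x \<Longrightarrow> card (asg x T) = card T"
  using assms by (auto simp: NC_def)

lemma NC_I:
  assumes "partition_on S (fst x)" "partition_on N (posns x)" "noncr (posns x)" "asg x \<in> extensional (fst x)"
    "bij_betw (asg x) (fst x) (posns x)" "\<And>T. T \<in> fst x \<Longrightarrow> card (asg x T) = card T"
  shows "x \<in> NC S N"
  using assms by (cases x) (auto simp: NC_def)

lemma asg_image: "x \<in> NC S N \<Longrightarrow> asg x ` fst x = posns x"
  using NC_D(5) by (metis bij_betw_imp_surj_on)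

lemma asg_in: "x \<in> NC S N \<Longrightarrow> T \<in> fst x \<Longrightarrow> asg x T \<in> posns x"
  using asg_image by blast

lemma asg_sub: "x \<in> NC S N \<Longrightarrow> T \<in> fst x \<Longrightarrow> asg x T \<subseteq> N"
  using asg_in NC_D(2) partition_sub by metis

text \<open>Encoding an element by one partition of the disjoint union of labels and positions turns all
  projections and relabellings into direct images.\<close>

definition J :: "'a ncp2 \<Rightarrow> ('a + nat) set set" where
  "J x = (\<lambda>T. T <+> asg x T) ` fst x"

lemma Plus_sub_iff: "A <+> B \<subseteq> C <+> D \<longleftrightarrow> A \<subseteq> C \<and> B \<subseteq> D"
  unfolding Plus_def by blast

lemma Plus_eq_iff: "A <+> B = C <+> D \<longleftrightarrow> A = C \<and> B = D"
  by (metis Plus_sub_iff subset_antisym order_refl)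

lemma J_partition:
  assumes x: "x \<in> NC S N" shows "partition_on (S <+> N) (J x)"
proof (rule partition_onI)
  note D = NC_D[OF x]
  have "\<Union>(J x) = \<Union>(fst x) <+> \<Union>(asg x ` fst x)" unfolding J_def Plus_def by blast
  then show "\<Union>(J x) = S <+> N"
    unfolding asg_image[OF x] using partition_onD1[OF D(1)] partition_onD1[OF D(2)] by simp
  show "{} \<notin> J x" unfolding J_def using partition_ne[OF D(1)] by blast
  fix p q assume pq: "p \<in> J x" "q \<in> J x" "p \<noteq> q"
  then obtain T T' where T: "T \<in> fst x" "T' \<in> fst x" "p = T <+> asg x T" "q = T' <+> asg x T'" "T \<noteq> T'"
    unfolding J_def by blast
  then have "asg x T \<noteq> asg x T'" using D(5) unfolding bij_betw_def by (meson inj_onD)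
  then have "asg x T \<inter> asg x T' = {}" using partition_eq[OF D(2) asg_in[OF x T(1)] asg_in[OF x T(2)]] by blast
  moreover have "T \<inter> T' = {}" using partition_eq[OF D(1) T(1,2)] T(5) by blast
  ultimately show "disjnt p q" unfolding T disjnt_def Plus_def by blast
qed

lemma asg_ne:
  assumes "x \<in> NC S N" "T \<in> fst x" shows "asg x T \<noteq> {}"
  using partition_ne[OF NC_D(2)[OF assms(1)] asg_in[OF assms]] .

lemma card_J: "x \<in> NC S N \<Longrightarrow> card (J x) = card (fst x)"
  unfolding J_def by (rule card_image) (simp add: inj_on_def Plus_eq_iff)

text \<open>Faithful thanks to the convention that \<open>asg\<close> is \<open>undefined\<close>
  off the blocks.\<close>

lemma J_inj:
  assumes x: "x \<in> NC S N" and y: "y \<in> NC S N" and J: "J x = J y" shows "x = y"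
proof -
  have 1: "T \<in> fst y \<and> asg y T = asg x T" if "T \<in> fst x" "J x = J y" for x y :: "'a ncp2" and T
  proof -
    have "T <+> asg x T \<in> J y" using that unfolding J_def by blast
    then obtain T' where "T' \<in> fst y" "T <+> asg x T = T' <+> asg y T'" unfolding J_def by blast
    then show ?thesis unfolding Plus_eq_iff by metis
  qed
  have f: "fst x = fst y" using 1[OF _ J] 1[OF _ J[symmetric]] by blast
  have a: "asg x = asg y"
  proof (rule extensionalityI)
    show "asg x \<in> extensional (fst x)" "asg y \<in> extensional (fst x)" using NC_D(4)[OF x] NC_D(4)[OF y] f by auto
    show "asg x T = asg y T" if "T \<in> fst x" for T using 1[OF that J] by simp
  qed
  have "posns x = posns y" using asg_image[OF x] asg_image[OF y] f a by simp
  then show ?thesis using f a by (metis prod_eqI)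
qed

lemma J_block: "T \<in> fst x \<Longrightarrow> T <+> asg x T \<in> J x" unfolding J_def by blast

lemma J_cases: assumes "Z \<in> J x" obtains T where "T \<in> fst x" "Z = T <+> asg x T"
  using assms unfolding J_def by blast

text \<open>A block of \<open>J y\<close> lies in a block of \<open>J x\<close> with its labels and
  its positions at once. Either half determines the block of \<open>x\<close>, by disjointness and
  by injectivity of \<open>asg x\<close>, so containment of one half forces containment of the
  other.\<close>

lemma crs_J_D:
  assumes x: "x \<in> NC S N" and y: "y \<in> NC S N" and c: "crs (J x) (J y)"
  shows "crs (fst x) (fst y)" "crs (posns x) (posns y)"
   "T \<in> fst x \<Longrightarrow> T' \<in> fst y \<Longrightarrow> T' \<subseteq> T \<Longrightarrow> asg y T' \<subseteq> asg x T"
   "T \<in> fst x \<Longrightarrow> T' \<in> fst y \<Longrightarrow> asg y T' \<subseteq> asg x T \<Longrightarrow> T' \<subseteq> T"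
proof -
  have ex: "\<exists>T\<in>fst x. T' \<subseteq> T \<and> asg y T' \<subseteq> asg x T" if T': "T' \<in> fst y" for T'
  proof -
    obtain Z where "Z \<in> J x" "T' <+> asg y T' \<subseteq> Z" using c J_block[OF T'] unfolding crs_def by blast
    then obtain T where "T \<in> fst x" "T' <+> asg y T' \<subseteq> T <+> asg x T" unfolding J_def by blast
    then show ?thesis unfolding Plus_sub_iff by blast
  qed
  show "crs (fst x) (fst y)" unfolding crs_def using ex by blast
  show "crs (posns x) (posns y)" unfolding crs_def
  proof
    fix R' assume "R' \<in> posns y"
    then obtain T' where T': "T' \<in> fst y" "R' = asg y T'" unfolding asg_image[OF y, symmetric] by blast
    then obtain T where "T \<in> fst x" "R' \<subseteq> asg x T" using ex by blast
    then show "\<exists>R\<in>posns x. R' \<subseteq> R" using asg_in[OF x] by blast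
  qed
  show "asg y T' \<subseteq> asg x T" if a: "T \<in> fst x" "T' \<in> fst y" "T' \<subseteq> T"
  proof -
    obtain T0 where T0: "T0 \<in> fst x" "T' \<subseteq> T0" "asg y T' \<subseteq> asg x T0" using ex[OF a(2)] by blast
    obtain t where "t \<in> T'" using partition_ne[OF NC_D(1)[OF y] a(2)] by blast
    then have "T0 = T" using partition_eq[OF NC_D(1)[OF x] T0(1) a(1), of t] T0 a by blast
    then show ?thesis using T0 by simp
  qed
  show "T' \<subseteq> T" if a: "T \<in> fst x" "T' \<in> fst y" "asg y T' \<subseteq> asg x T"
  proof -
    obtain T0 where T0: "T0 \<in> fst x" "T' \<subseteq> T0" "asg y T' \<subseteq> asg x T0" using ex[OF a(2)] by blast
    obtain t where "t \<in> asg y T'" using asg_ne[OF y a(2)] by blast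
    then have "asg x T0 = asg x T"
      using partition_eq[OF NC_D(2)[OF x] asg_in[OF x T0(1)] asg_in[OF x a(1)], of t] T0 a by blast
    then have "T0 = T" using NC_D(5)[OF x] T0(1) a(1) unfolding bij_betw_def by (meson inj_onD)
    then show ?thesis using T0 by simp
  qed
qed

text \<open>The compatibility of the bijections in the order says that the label half and the
  position half of a block stay inside one and the same larger block.\<close>

lemma ncp2_le_iff:
  assumes x: "x \<in> NCP2 S" and y: "y \<in> NCP2 S"
  shows "ncp2_le S x y \<longleftrightarrow> crs (J x) (J y)"
proof -
  have x': "x \<in> NC S {1..card S}" and y': "y \<in> NC S {1..card S}" using x y by (auto simp: NCP2_NC)
  obtain \<pi> \<rho> f where xx: "x = (\<pi>, \<rho>, f)" by (cases x)
  obtain \<pi>' \<rho>' f' where yy: "y = (\<pi>', \<rho>', f')" by (cases y)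
  show ?thesis
  proof
    assume le: "ncp2_le S x y"
    show "crs (J x) (J y)" unfolding crs_def
    proof
      fix Z' assume "Z' \<in> J y"
      then obtain T' where T': "T' \<in> \<pi>'" "Z' = T' <+> f' T'" unfolding yy by (auto simp: J_def)
      obtain T where T: "T \<in> \<pi>" "T' \<subseteq> T" using le T' unfolding xx yy by (auto simp: refines_def)
      then have "f' T' \<subseteq> f T" using le T' unfolding xx yy by auto
      then show "\<exists>Z\<in>J x. Z' \<subseteq> Z" using T T' unfolding xx by (auto simp: J_def Plus_sub_iff)
    qed
  next
    assume c: "crs (J x) (J y)"
    note D = crs_J_D[OF x' y' c]
    show "ncp2_le S x y"
      using D NC_D(1,2)[OF x'] NC_D(1,2)[OF y'] unfolding xx yy by (auto simp: refines_def crs_def)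
  qed
qed

text \<open>Finiteness and the order axioms are pulled back along the injection \<open>J\<close>
  from refinement of partitions.\<close>

lemma finite_poset_NCP2:
  assumes "finite S" shows "finite_poset (NCP2 S) (ncp2_le S)"
proof
  have "J ` NCP2 S \<subseteq> Pow (Pow (S <+> {1..card S}))"
  proof
    fix W assume "W \<in> J ` NCP2 S"
    then obtain x where "x \<in> NC S {1..card S}" "W = J x" by (auto simp: NCP2_NC)
    then show "W \<in> Pow (Pow (S <+> {1..card S}))" using partition_sub[OF J_partition] by blast
  qed
  moreover have "finite (Pow (Pow (S <+> {1..card S})))" using assms by simp
  ultimately have "finite (J ` NCP2 S)" by (rule finite_subset)
  moreover have "inj_on J (NCP2 S)" by (rule inj_onI) (simp add: NCP2_NC J_inj)
  ultimately show "finite (NCP2 S)" by (rule finite_imageD)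
  show "ncp2_le S x x" if "x \<in> NCP2 S" for x using that by (simp add: ncp2_le_iff crs_refl)
  show "ncp2_le S x z" if "x \<in> NCP2 S" "y \<in> NCP2 S" "z \<in> NCP2 S" "ncp2_le S x y" "ncp2_le S y z" for x y z
    using that crs_trans[of "J x" "J y" "J z"] by (simp add: ncp2_le_iff)
  show "x = y" if "x \<in> NCP2 S" "y \<in> NCP2 S" "ncp2_le S x y" "ncp2_le S y x" for x y
  proof -
    have xy: "x \<in> NC S {1..card S}" "y \<in> NC S {1..card S}" using that by (auto simp: NCP2_NC)
    have "J x = J y" using that(3,4) crs_antisym[OF J_partition[OF xy(1)] J_partition[OF xy(2)]]
      by (simp add: ncp2_le_iff[OF that(1,2)] ncp2_le_iff[OF that(2,1)])
    then show ?thesis by (rule J_inj[OF xy])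
  qed
qed

text \<open>The number of blocks serves as rank: refinement does not lower it, and joint partitions
  comparable with equally many blocks coincide.\<close>

lemma strict_card:
  assumes "finite S" "x \<in> NCP2 S" "y \<in> NCP2 S" "strict (ncp2_le S) x y"
  shows "card (fst x) < card (fst y)"
proof -
  have x: "x \<in> NC S {1..card S}" and y: "y \<in> NC S {1..card S}" using assms by (auto simp: NCP2_NC)
  have c: "crs (J x) (J y)" "x \<noteq> y" using assms by (auto simp: strict_def ncp2_le_iff)
  have f: "finite (S <+> {1..card S})" using assms by simp
  note k = crs_card[OF f J_partition[OF x] J_partition[OF y] c(1)]
  show ?thesis using k c(2) J_inj[OF x y] card_J[OF x] card_J[OF y] by linarith
qed

lemma le_card:
  assumes "finite S" "x \<in> NCP2 S" "y \<in> NCP2 S" "ncp2_le S x y"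
  shows "card (fst x) \<le> card (fst y)"
  using strict_card[OF assms(1-3)] assms(4) by (cases "x = y") (auto simp: strict_def)

lemma card_fst_bounds:
  assumes "finite S" "S \<noteq> {}" "x \<in> NCP2 S"
  shows "1 \<le> card (fst x)" "card (fst x) \<le> card S" "card (fst x) = card S \<Longrightarrow> fst x = singles S"
proof -
  have p: "partition_on S (fst x)" using assms by (auto simp: NCP2_NC dest: NC_D(1))
  have "fst x \<noteq> {}" using partition_onD1[OF p] assms(2) by auto
  then show "1 \<le> card (fst x)" using finite_elements[OF assms(1) p] by (simp add: Suc_le_eq card_gt_0_iff)
  show "card (fst x) \<le> card S" "card (fst x) = card S \<Longrightarrow> fst x = singles S"
    using partition_card_le[OF assms(1) p] by auto
qed

text \<open>The common form of relabelling and of both projections: \<open>h\<close> acts on labels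
  and \<open>k\<close> on positions. The bijection is read off through preimages, which returns the
  original block when \<open>h\<close> is saturated for the blocks.\<close>

definition imx :: "('a \<Rightarrow> 'b) \<Rightarrow> (nat \<Rightarrow> nat) \<Rightarrow> 'a set \<Rightarrow> 'a ncp2 \<Rightarrow> 'b ncp2" where
  "imx h k S x = ((`) h ` fst x, (`) k ` posns x, restrict (\<lambda>U. k ` asg x {a\<in>S. h a \<in> U}) ((`) h ` fst x))"

lemma asg_imx:
  assumes "x \<in> NC S N" "sat (fst x) h" "T \<in> fst x"
  shows "asg (imx h k S x) (h ` T) = k ` asg x T"
  using assms(3) sat_vimage[OF NC_D(1)[OF assms(1)] assms(2,3)] by (simp add: imx_def)

lemma J_imx:
  assumes "x \<in> NC S N" "sat (fst x) h"
  shows "J (imx h k S x) = (`) (map_sum h k) ` J x"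
proof -
  have "h ` T <+> asg (imx h k S x) (h ` T) = map_sum h k ` (T <+> asg x T)" if "T \<in> fst x" for T
    unfolding asg_imx[OF assms that] Plus_def by (auto simp: image_Un image_image)
  then show ?thesis unfolding J_def imx_def by (simp add: image_image)
qed

lemma imx_NC:
  assumes x: "x \<in> NC S N" and h: "sat (fst x) h" and k: "sat (posns x) k"
   and card: "\<And>T. T \<in> fst x \<Longrightarrow> card (h ` T) = card (k ` asg x T)" and nc: "noncr ((`) k ` posns x)"
  shows "imx h k S x \<in> NC (h ` S) (k ` N)"
proof (rule NC_I)
  note D = NC_D[OF x]
  have f: "fst (imx h k S x) = (`) h ` fst x" "posns (imx h k S x) = (`) k ` posns x" by (simp_all add: imx_def)
  show "partition_on (h ` S) (fst (imx h k S x))" unfolding f by (rule partition_image[OF D(1) h])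
  show "partition_on (k ` N) (posns (imx h k S x))" unfolding f by (rule partition_image[OF D(2) k])
  show "noncr (posns (imx h k S x))" unfolding f by (rule nc)
  show "asg (imx h k S x) \<in> extensional (fst (imx h k S x))" by (simp add: imx_def)
  show "card (asg (imx h k S x) U) = card U" if "U \<in> fst (imx h k S x)" for U
    using that card asg_imx[OF x h] unfolding f by auto
  \<comment> \<open>Precomposed with the bijection that takes blocks to their images, the new
    assignment is \<open>asg x\<close> followed by taking images under \<open>k\<close>.\<close>
  have "bij_betw ((\<lambda>U. asg (imx h k S x) U) \<circ> (`) h) (fst x) ((`) k ` posns x) \<longleftrightarrow> bij_betw ((`) k \<circ> asg x) (fst x) ((`) k ` posns x)"
    by (rule bij_betw_cong) (simp add: asg_imx[OF x h])
  moreover have "bij_betw ((`) k \<circ> asg x) (fst x) ((`) k ` posns x)"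
    using D(5) sat_inj_image[OF D(2) k] by (intro bij_betw_trans) (auto simp: bij_betw_def)
  moreover have "bij_betw ((`) h) (fst x) ((`) h ` fst x)" using sat_inj_image[OF D(1) h] by (simp add: bij_betw_def)
  ultimately show "bij_betw (asg (imx h k S x)) (fst (imx h k S x)) (posns (imx h k S x))"
    unfolding f by (subst bij_betw_comp_iff[of "(`) h" "fst x"]) auto
qed

lemma sat_J:
  assumes x: "x \<in> NC S N" and h: "sat (fst x) h" and k: "sat (posns x) k"
  shows "sat (J x) (map_sum h k)"
  unfolding sat_def
proof (intro ballI impI)
  fix Z z z' assume a: "Z \<in> J x" "z \<in> Z" "z' \<in> \<Union>(J x)" "map_sum h k z' = map_sum h k z"
  obtain T where T: "T \<in> fst x" "Z = T <+> asg x T" using a(1) by (rule J_cases)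
  obtain T' where T': "T' \<in> fst x" "z' \<in> T' <+> asg x T'" using a(3) unfolding J_def by blast
  show "z' \<in> Z"
  proof (cases z)
    case (Inl b)
    then obtain b' where b': "z' = Inl b'" "h b' = h b" using a(4) by (cases z') auto
    then have "b' \<in> T" using h T T' a(2) Inl unfolding sat_def by blast
    then show ?thesis using T b' by blast
  next
    case (Inr b)
    then obtain b' where b': "z' = Inr b'" "k b' = k b" using a(4) by (cases z') auto
    then have "b' \<in> asg x T" using k asg_in[OF x T(1)] asg_in[OF x T'(1)] T' a(2) Inr T unfolding sat_def by blast
    then show ?thesis using T b' by blast
  qed
qed

text \<open>The restriction with its positions left inside \<open>F\<close>; the upper projection is
  this followed by the renumbering \<open>rk F\<close>.\<close>

definition restr :: "'a set \<Rightarrow> nat set \<Rightarrow> 'a ncp2 \<Rightarrow> 'a ncp2" where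
  "restr B F z = ({T\<in>fst z. T \<subseteq> B}, {M\<in>posns z. M \<subseteq> F}, restrict (asg z) {T\<in>fst z. T \<subseteq> B})"

lemma partition_restrict_block:
  assumes "partition_on A X" "partition_on A Y" "crs X Y" "Z \<in> X"
  shows "partition_on Z {Z'\<in>Y. Z' \<subseteq> Z}"
proof -
  have "refines A Y X" using assms by (auto simp: refines_def crs_def)
  then show ?thesis using assms(4) by (rule refines_obtains_subset)
qed

text \<open>Labels and positions can be restricted together because a block of \<open>z\<close> lies
  in \<open>B\<close> exactly when its positions lie in \<open>asg x B\<close>.\<close>

lemma
  assumes x: "x \<in> NC S N" and z: "z \<in> NC S N" and c: "crs (J x) (J z)" and B: "B \<in> fst x"
  shows restr_NC: "restr B (asg x B) z \<in> NC B (asg x B)"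
    and J_restr: "J (restr B (asg x B) z) = {Z\<in>J z. Z \<subseteq> B <+> asg x B}"
proof -
  note c' = crs_J_D[OF x z c]
  have iff: "asg z T \<subseteq> asg x B \<longleftrightarrow> T \<subseteq> B" if "T \<in> fst z" for T using c'(3,4)[OF B that] by blast
  have "asg z ` {T\<in>fst z. T \<subseteq> B} = {M\<in>posns z. M \<subseteq> asg x B}"
    unfolding asg_image[OF z, symmetric] using iff by blast
  moreover have "inj_on (asg z) {T\<in>fst z. T \<subseteq> B}"
    using NC_D(5)[OF z] by (auto simp: bij_betw_def intro: inj_on_subset)
  ultimately have b: "bij_betw (asg z) {T\<in>fst z. T \<subseteq> B} {M\<in>posns z. M \<subseteq> asg x B}" by (simp add: bij_betw_def)
  show "restr B (asg x B) z \<in> NC B (asg x B)"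
  proof (rule NC_I)
    show "partition_on B (fst (restr B (asg x B) z))" unfolding restr_def fst_conv
      by (rule partition_restrict_block[OF NC_D(1)[OF x] NC_D(1)[OF z] c'(1) B])
    show "partition_on (asg x B) (posns (restr B (asg x B) z))" unfolding restr_def fst_conv snd_conv
      by (rule partition_restrict_block[OF NC_D(2)[OF x] NC_D(2)[OF z] c'(2) asg_in[OF x B]])
    show "noncr (posns (restr B (asg x B) z))" using NC_D(3)[OF z] unfolding restr_def noncr_def by auto
    show "bij_betw (asg (restr B (asg x B) z)) (fst (restr B (asg x B) z)) (posns (restr B (asg x B) z))"
      unfolding restr_def fst_conv snd_conv using b by (subst bij_betw_restrict_eq)
  qed (use NC_D(6)[OF z] in \<open>auto simp: restr_def\<close>)
  show "J (restr B (asg x B) z) = {Z\<in>J z. Z \<subseteq> B <+> asg x B}"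
    unfolding J_def restr_def using iff by (auto simp: Plus_sub_iff)
qed

lemma bot_NCP2: assumes "finite S" "S \<noteq> {}" shows "ncp2_bot S \<in> NCP2 S"
proof -
  have "{1..card S} \<noteq> {}" using assms by (simp add: card_gt_0_iff Suc_le_eq)
  then show ?thesis
    unfolding NCP2_NC NC_def ncp2_bot_def noncr_def using assms
    by (auto simp: partition_on_space bij_betw_def)
qed

lemma J_bot: "J (ncp2_bot S) = {S <+> {1..card S}}"
  by (simp add: J_def ncp2_bot_def)

lemma bot_le: 
  assumes "finite S" "S \<noteq> {}" "x \<in> NCP2 S" shows "ncp2_le S (ncp2_bot S) x"
proof -
  have "crs (J (ncp2_bot S)) (J x)" unfolding crs_def J_bot
    using partition_sub[OF J_partition[of x S "{1..card S}"]] assms(3) by (auto simp: NCP2_NC)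
  then show ?thesis using ncp2_le_iff[OF bot_NCP2[OF assms(1,2)] assms(3)] by blast
qed

lemma fst_bot: "fst (ncp2_bot S) = {S}" by (simp add: ncp2_bot_def)

lemma card_fst_1_bot:
  assumes "finite S" "S \<noteq> {}" "x \<in> NCP2 S" "card (fst x) = 1" shows "x = ncp2_bot S"
proof (rule ccontr)
  assume "x \<noteq> ncp2_bot S"
  then have "strict (ncp2_le S) (ncp2_bot S) x" using bot_le[OF assms(1-3)] by (auto simp: strict_def)
  then have "card (fst (ncp2_bot S)) < card (fst x)" using strict_card[OF assms(1) bot_NCP2[OF assms(1,2)] assms(3)] by blast
  then show False using assms(4) by (simp add: fst_bot)
qed

lemma NCP2_singleton: "x \<in> NCP2 {b} \<Longrightarrow> x = ncp2_bot {b}"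
proof -
  assume x: "x \<in> NCP2 {b}"
  have "1 \<le> card (fst x)" "card (fst x) \<le> card {b}"
    by (rule card_fst_bounds(1,2)[OF _ _ x]; simp)+
  then show ?thesis using card_fst_1_bot[OF _ _ x] by simp
qed

lemma full_chain_hd:
  assumes "finite S" "S \<noteq> {}" "zs \<in> full_chains (NCP2 S) (ncp2_le S)" shows "hd zs = ncp2_bot S"
proof -
  have z: "zs \<noteq> []" "set zs \<subseteq> NCP2 S" "\<nexists>y. y \<in> NCP2 S \<and> strict (ncp2_le S) y (hd zs)"
    using assms(3) by (auto simp: full_chains_def)
  have h: "hd zs \<in> NCP2 S" using z(2) hd_in_set[OF z(1)] by blast
  have "\<not> strict (ncp2_le S) (ncp2_bot S) (hd zs)" using z(3) bot_NCP2[OF assms(1,2)] by blast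
  then show ?thesis using bot_le[OF assms(1,2) h] by (auto simp: strict_def)
qed

lemma noncr_D:
  assumes "noncr \<rho>" "X \<in> \<rho>" "Y \<in> \<rho>" "i \<in> X" "j \<in> Y" "k \<in> X" "l \<in> Y" "i < j" "j < k" "k < l"
  shows "X = Y"
  using assms(1)[unfolded noncr_def, rule_format, OF assms(2-10)] .

lemma le_D:
  assumes "x \<in> NCP2 S" "y \<in> NCP2 S" "ncp2_le S x y"
  shows "x \<in> NC S {1..card S}" "y \<in> NC S {1..card S}" "crs (J x) (J y)"
  using assms ncp2_le_iff[OF assms(1,2)] by (auto simp: NCP2_NC)

lemma NCP2_D: "x \<in> NCP2 S \<Longrightarrow> x \<in> NC S {1..card S}"
  by (simp add: NCP2_NC)

lemma NCP2_J_inj: "x \<in> NCP2 S \<Longrightarrow> y \<in> NCP2 S \<Longrightarrow> J x = J y \<Longrightarrow> x = y"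
  using J_inj unfolding NCP2_NC by blast

lemma J_sub: "x \<in> NCP2 S \<Longrightarrow> Z \<in> J x \<Longrightarrow> Z \<subseteq> S <+> {1..card S}"
  using partition_sub[OF J_partition] unfolding NCP2_NC by metis

lemma NCP2_fst_sub: "x \<in> NCP2 S \<Longrightarrow> T \<in> fst x \<Longrightarrow> T \<subseteq> S"
  using partition_sub[OF NC_D(1)] unfolding NCP2_NC by metis

lemma map_sum_image_cong:
  assumes "\<And>a. Inl a \<in> Z \<Longrightarrow> h a = h' a" "\<And>i. Inr i \<in> Z \<Longrightarrow> k i = k' i"
  shows "map_sum h k ` Z = map_sum h' k' ` Z"
proof (rule image_cong)
  show "map_sum h k z = map_sum h' k' z" if "z \<in> Z" for z
    using that assms by (cases z) auto
qed simp

lemma image_image_cong: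
  "(\<And>Z. Z \<in> X \<Longrightarrow> map_sum h k ` Z = map_sum h' k' ` Z) \<Longrightarrow> (`) (map_sum h k) ` X = (`) (map_sum h' k') ` X"
  by (rule image_cong) auto

lemma map_sum_map_sum: "(`) (map_sum h k) ` (`) (map_sum h' k') ` X = (`) (map_sum (\<lambda>a. h (h' a)) (\<lambda>i. k (k' i))) ` X"
  by (simp add: image_image sum.map_comp o_def)

lemma filter_image_sub:
  assumes "\<And>Z. Z \<in> X \<Longrightarrow> H ` Z \<subseteq> H ` V \<Longrightarrow> Z \<subseteq> V"
  shows "{W \<in> (`) H ` X. W \<subseteq> H ` V} = (`) H ` {Z\<in>X. Z \<subseteq> V}"
  using assms by blast

lemma image_Collect_mem: "U \<subseteq> h ` X \<Longrightarrow> h ` {a\<in>X. h a \<in> U} = U"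
  by blast

lemma map_sum_Plus: "map_sum h k ` (A <+> B) = h ` A <+> k ` B"
  unfolding Plus_def by (auto simp: image_Un image_image)

abbreviation colq :: "'a set \<Rightarrow> 'a \<Rightarrow> 'a \<Rightarrow> 'a" where
  "colq B s \<equiv> \<lambda>a. if a \<in> B then s else a"

section \<open>Projection of a lower interval\<close>

locale below =
  fixes A :: "'a set" and s :: 'a and B :: "'a set" and y :: "'a ncp2"
  assumes finA: "finite A" and finB: "finite B" and disj: "A \<inter> B = {}" and Bne: "B \<noteq> {}" and s: "s \<notin> A"
    and y: "y \<in> NCP2 (A \<union> B)" and fst_y: "fst y = insert B (singles A)"
begin

abbreviation "n \<equiv> card (A \<union> B)"
abbreviation "le \<equiv> ncp2_le (A \<union> B)"
abbreviation "\<phi> \<equiv> proj_below A s B y"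
abbreviation "\<rho> \<equiv> posns y"

lemma yNC: "y \<in> NC (A \<union> B) {1..n}" using y by (rule NCP2_D)

lemmas partS = NC_D(1)[OF yNC] and partN = NC_D(2)[OF yNC]

lemma q_qm: "qm (fst y) (colq B s)"
  unfolding qm_def fst_y using disj s by auto

lemma q_image: "colq B s ` (A \<union> B) = insert s A"
  using disj Bne by force

lemma card_posns: "card \<rho> = card (insert s A)"
proof -
  have "card \<rho> = card (fst y)" using bij_betw_same_card[OF NC_D(5)[OF yNC]] by simp
  moreover have "B \<notin> singles A" using disj Bne by auto
  ultimately show ?thesis using finA s by (simp add: fst_y card_singles)
qed

context
  fixes x assumes x: "x \<in> NCP2 (A \<union> B)" and le: "le x y"
begin

lemma xNC: "x \<in> NC (A \<union> B) {1..n}" using x by (rule NCP2_D)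
lemmas crsJ = le_D(3)[OF x y le]
lemmas crsD = crs_J_D[OF xNC yNC crsJ]

lemma satS: "sat (fst x) (colq B s)"
  by (rule sat_crs[OF NC_D(1)[OF xNC] partS crsD(1) qm_sat[OF q_qm]])

lemma satN: "sat (posns x) (pos \<rho>)"
  by (rule sat_crs[OF NC_D(2)[OF xNC] partN crsD(2) qm_sat[OF pos_qm[OF _ partN]]]) simp

lemma unS: "T \<in> fst x \<Longrightarrow> \<Union>{Z\<in>fst y. Z \<subseteq> T} = T"
  by (rule crs_union[OF NC_D(1)[OF xNC] partS crsD(1)])

lemma unN: "R \<in> posns x \<Longrightarrow> \<Union>{R'\<in>\<rho>. R' \<subseteq> R} = R"
  by (rule crs_union[OF NC_D(2)[OF xNC] partN crsD(2)])

lemma proj_below_imx: "\<phi> x = imx (colq B s) (pos \<rho>) (A \<union> B) x"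
proof -
  obtain \<pi>y \<rho>y fy where yy: "y = (\<pi>y, \<rho>y, fy)" by (cases y)
  obtain \<pi>x \<rho>x fx where xx: "x = (\<pi>x, \<rho>x, fx)" by (cases x)
  have bi: "block_index \<rho>y R = pos \<rho>y ` R" if "R \<in> \<rho>x" for R
    using block_index_pos[OF _ partN unN, of R] that by (simp add: xx yy)
  have 1: "block_index \<rho>y ` \<rho>x = (`) (pos \<rho>y) ` \<rho>x" by (rule image_cong) (simp_all add: bi)
  have 2: "restrict (\<lambda>U. block_index \<rho>y (fx {a\<in>A \<union> B. colq B s a \<in> U})) ((`) (colq B s) ` \<pi>x)
     = restrict (\<lambda>U. pos \<rho>y ` fx {a\<in>A \<union> B. colq B s a \<in> U}) ((`) (colq B s) ` \<pi>x)"
  proof (rule restrict_ext)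
    fix U assume "U \<in> (`) (colq B s) ` \<pi>x"
    then obtain T where T: "T \<in> fst x" "U = colq B s ` T" unfolding xx by auto
    have e: "{a\<in>A \<union> B. colq B s a \<in> U} = T" unfolding T(2) by (rule sat_vimage[OF NC_D(1)[OF xNC] satS T(1)])
    show "block_index \<rho>y (fx {a\<in>A \<union> B. colq B s a \<in> U}) = pos \<rho>y ` fx {a\<in>A \<union> B. colq B s a \<in> U}"
      unfolding e using bi[of "fx T"] asg_in[OF xNC T(1)] by (simp add: xx)
  qed
  show ?thesis unfolding xx yy imx_def proj_below.simps Let_def using 1 2 by simp
qed

lemma J_below: "J (\<phi> x) = (`) (map_sum (colq B s) (pos \<rho>)) ` J x"
  unfolding proj_below_imx by (rule J_imx[OF xNC satS])

lemma fst_below: "fst (\<phi> x) = (`) (colq B s) ` fst x" and posns_below: "posns (\<phi> x) = (`) (pos \<rho>) ` posns x"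
  unfolding proj_below_imx imx_def by simp_all

lemma asg_below: "T \<in> fst x \<Longrightarrow> asg (\<phi> x) (colq B s ` T) = pos \<rho> ` asg x T"
  unfolding proj_below_imx by (rule asg_imx[OF xNC satS])

lemma blk_sub: "R \<in> posns x \<Longrightarrow> i \<in> R \<Longrightarrow> blk \<rho> i \<subseteq> R"
proof -
  assume R: "R \<in> posns x" "i \<in> R"
  have "i \<in> {1..n}" using partition_sub[OF NC_D(2)[OF xNC] R(1)] R(2) by blast
  then obtain R' where R': "R' \<in> \<rho>" "i \<in> R'" using partition_ex[OF partN] by blast
  show ?thesis unfolding blk_eq[OF partN R']
    by (rule crs_block[OF NC_D(2)[OF xNC] partN crsD(2) R(1) R'(1) R(2) R'(2)])
qed

lemma Min_blk_in: "R \<in> posns x \<Longrightarrow> i \<in> R \<Longrightarrow> Min (blk \<rho> i) \<in> R"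
proof -
  assume R: "R \<in> posns x" "i \<in> R"
  have "i \<in> {1..n}" using partition_sub[OF NC_D(2)[OF xNC] R(1)] R(2) by blast
  then obtain R' where R': "R' \<in> \<rho>" "i \<in> R'" using partition_ex[OF partN] by blast
  have "Min (blk \<rho> i) \<in> blk \<rho> i" unfolding blk_eq[OF partN R'] by (rule Min_block[OF _ partN R'(1)]) simp
  then show ?thesis using blk_sub[OF R] by blast
qed

text \<open>The number of a fine block grows with its minimum, and this minimum lies in the same
  block of \<open>x\<close>. A crossing among the numbers therefore lifts to a crossing among these
  minima.\<close>

lemma noncr_below: "noncr ((`) (pos \<rho>) ` posns x)"
  unfolding noncr_def
proof (intro ballI impI)
  fix X Y i j k l assume a: "X \<in> (`) (pos \<rho>) ` posns x" "Y \<in> (`) (pos \<rho>) ` posns x" "i \<in> X" "j \<in> Y" "k \<in> X" "l \<in> Y"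
    "i < j" "j < k" "k < l"
  obtain R R' where R: "R \<in> posns x" "R' \<in> posns x" "X = pos \<rho> ` R" "Y = pos \<rho> ` R'" using a by blast
  obtain i' k' where i: "i' \<in> R" "k' \<in> R" "i = pos \<rho> i'" "k = pos \<rho> k'" using a R by blast
  obtain j' l' where j: "j' \<in> R'" "l' \<in> R'" "j = pos \<rho> j'" "l = pos \<rho> l'" using a R by blast
  have N: "i' \<in> {1..n}" "k' \<in> {1..n}" "j' \<in> {1..n}" "l' \<in> {1..n}"
    using i j partition_sub[OF NC_D(2)[OF xNC] R(1)] partition_sub[OF NC_D(2)[OF xNC] R(2)] by blast+
  have lt: "Min (blk \<rho> i') < Min (blk \<rho> j')" "Min (blk \<rho> j') < Min (blk \<rho> k')" "Min (blk \<rho> k') < Min (blk \<rho> l')"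
    using a(7-9) pos_less[OF _ partN] N i j by auto
  have "R = R'"
    by (rule noncr_D[OF NC_D(3)[OF xNC] R(1,2) Min_blk_in[OF R(1) i(1)] Min_blk_in[OF R(2) j(1)]
      Min_blk_in[OF R(1) i(2)] Min_blk_in[OF R(2) j(2)] lt])
  then show "X = Y" unfolding R(3,4) by (rule arg_cong)
qed

lemma below_NCP2: "\<phi> x \<in> NCP2 (insert s A)"
proof -
  have "\<phi> x \<in> NC (colq B s ` (A \<union> B)) (pos \<rho> ` {1..n})"
    unfolding proj_below_imx
  proof (rule imx_NC[OF xNC satS satN _ noncr_below])
    fix T assume T: "T \<in> fst x"
    have "card (colq B s ` T) = card {Z\<in>fst y. Z \<subseteq> T}" by (rule qm_card_image[OF partS q_qm unS[OF T]])
    also have "\<dots> = card {R\<in>\<rho>. R \<subseteq> asg x T}"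
    proof (rule bij_betw_same_card[of "asg y"])
      have "inj_on (asg y) {Z\<in>fst y. Z \<subseteq> T}" using NC_D(5)[OF yNC] unfolding bij_betw_def by (auto intro: inj_on_subset)
      moreover have "asg y ` {Z\<in>fst y. Z \<subseteq> T} = {R\<in>\<rho>. R \<subseteq> asg x T}"
      proof
        show "asg y ` {Z\<in>fst y. Z \<subseteq> T} \<subseteq> {R\<in>\<rho>. R \<subseteq> asg x T}"
          using crsD(3)[OF T] asg_in[OF yNC] by blast
        show "{R\<in>\<rho>. R \<subseteq> asg x T} \<subseteq> asg y ` {Z\<in>fst y. Z \<subseteq> T}"
        proof
          fix R assume R: "R \<in> {R\<in>\<rho>. R \<subseteq> asg x T}"
          then obtain Z where "Z \<in> fst y" "R = asg y Z" unfolding asg_image[OF yNC, symmetric] by blast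
          then show "R \<in> asg y ` {Z\<in>fst y. Z \<subseteq> T}" using crsD(4)[OF T] R by blast
        qed
      qed
      ultimately show "bij_betw (asg y) {Z\<in>fst y. Z \<subseteq> T} {R\<in>\<rho>. R \<subseteq> asg x T}" by (simp add: bij_betw_def)
    qed
    also have "\<dots> = card (pos \<rho> ` asg x T)"
      by (rule qm_card_image[OF partN pos_qm[OF _ partN] unN[OF asg_in[OF xNC T]], symmetric]) simp
    finally show "card (colq B s ` T) = card (pos \<rho> ` asg x T)" .
  qed
  moreover have "pos \<rho> ` {1..n} = {1..card (insert s A)}"
    unfolding pos_image[OF finite_atLeastAtMost partN] card_posns ..
  ultimately show ?thesis by (simp only: q_image NCP2_NC)
qed

text \<open>Preimages of blocks undo the collapse, so a prescribed label partition of the projection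
  translates into one of \<open>x\<close>. This matches the summation conditions on both sides of
  the associativity axioms.\<close>

lemma fst_below_eq:
  assumes "\<And>U. U \<in> Q \<Longrightarrow> U \<subseteq> insert s A"
  shows "fst (\<phi> x) = Q \<longleftrightarrow> fst x = (\<lambda>U. {a\<in>A \<union> B. colq B s a \<in> U}) ` Q"
proof
  assume "fst (\<phi> x) = Q"
  then have Q: "Q = (`) (colq B s) ` fst x" unfolding fst_below by (rule sym)
  have "(\<lambda>U. {a\<in>A \<union> B. colq B s a \<in> U}) ` Q = (\<lambda>T. {a\<in>A \<union> B. colq B s a \<in> colq B s ` T}) ` fst x"
    unfolding Q image_image ..
  also have "\<dots> = (\<lambda>T. T) ` fst x"
    by (rule image_cong[OF refl]) (rule sat_vimage[OF NC_D(1)[OF xNC] satS])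
  also have "\<dots> = fst x" by (rule image_ident)
  finally show "fst x = (\<lambda>U. {a\<in>A \<union> B. colq B s a \<in> U}) ` Q" ..
next
  assume f: "fst x = (\<lambda>U. {a\<in>A \<union> B. colq B s a \<in> U}) ` Q"
  have "colq B s ` {a\<in>A \<union> B. colq B s a \<in> U} = U" if "U \<in> Q" for U
    by (rule image_Collect_mem) (use assms[OF that] in \<open>simp only: q_image\<close>)
  then have "(\<lambda>U. colq B s ` {a\<in>A \<union> B. colq B s a \<in> U}) ` Q = (\<lambda>U. U) ` Q" by (rule image_cong[OF refl])
  then show "fst (\<phi> x) = Q" unfolding fst_below f image_image by (simp only: image_ident)
qed

end

lemma le_y_refl: "le y y"
  using ncp2_le_iff[OF y y] crs_refl by blast

lemma below_mono:
  assumes "x \<in> NCP2 (A \<union> B)" "le x y" "x' \<in> NCP2 (A \<union> B)" "le x' y" "le x x'"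
  shows "ncp2_le (insert s A) (\<phi> x) (\<phi> x')"
  unfolding ncp2_le_iff[OF below_NCP2[OF assms(1,2)] below_NCP2[OF assms(3,4)]] J_below[OF assms(1,2)] J_below[OF assms(3,4)]
  by (rule crs_image[OF le_D(3)[OF assms(1,3,5)]])

text \<open>The collapse is saturated for every element below \<open>y\<close>, and saturated images
  determine the partition. Hence strict chains project to strict chains.\<close>

lemma below_inj:
  assumes "x \<in> NCP2 (A \<union> B)" "le x y" "x' \<in> NCP2 (A \<union> B)" "le x' y" "\<phi> x = \<phi> x'"
  shows "x = x'"
proof (rule NCP2_J_inj[OF assms(1,3)])
  show "J x = J x'"
  proof (rule sat_image_eq)
    show "partition_on ((A \<union> B) <+> {1..n}) (J x)" "partition_on ((A \<union> B) <+> {1..n}) (J x')"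
      by (rule J_partition[OF NCP2_D[OF assms(1)]], rule J_partition[OF NCP2_D[OF assms(3)]])
    show "sat (J x) (map_sum (colq B s) (pos \<rho>))" using xNC[OF assms(1,2)] satS[OF assms(1,2)] satN[OF assms(1,2)] by (rule sat_J)
    show "sat (J x') (map_sum (colq B s) (pos \<rho>))" using xNC[OF assms(3,4)] satS[OF assms(3,4)] satN[OF assms(3,4)] by (rule sat_J)
    show "(`) (map_sum (colq B s) (pos \<rho>)) ` J x = (`) (map_sum (colq B s) (pos \<rho>)) ` J x'"
      using J_below[OF assms(1,2)] J_below[OF assms(3,4)] assms(5) by simp
  qed
qed

lemma below_strict:
  assumes "x \<in> NCP2 (A \<union> B)" "le x y" "x' \<in> NCP2 (A \<union> B)" "le x' y" "strict le x x'"
  shows "strict (ncp2_le (insert s A)) (\<phi> x) (\<phi> x')"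
  using below_mono[OF assms(1-4)] below_inj[OF assms(1-4)] assms(5) unfolding strict_def by blast

end

section \<open>Projection of an upper interval\<close>

locale above =
  fixes S B :: "'a set" and x :: "'a ncp2"
  assumes finS: "finite S" and x: "x \<in> NCP2 S" and B: "B \<in> fst x"
begin

abbreviation "F \<equiv> asg x B"
abbreviation "le \<equiv> ncp2_le S"
abbreviation "\<psi> \<equiv> proj_above B x"

lemma xNC: "x \<in> NC S {1..card S}" using x by (rule NCP2_D)

lemma finF: "finite F" using asg_sub[OF xNC B] finite_subset by blast

lemma finB: "finite B" using NCP2_fst_sub[OF x B] finS finite_subset by blast

lemma Bne: "B \<noteq> {}" using partition_ne[OF NC_D(1)[OF xNC] B] .

lemma cardF: "card F = card B" by (rule NC_D(6)[OF xNC B])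

context
  fixes z assumes z: "z \<in> NCP2 S" and le: "le x z"
begin

lemma zNC: "z \<in> NC S {1..card S}" using z by (rule NCP2_D)
lemmas crsJ = le_D(3)[OF x z le]
lemmas crsD = crs_J_D[OF xNC zNC crsJ]
lemmas rNC = restr_NC[OF xNC zNC crsJ B] and Jr = J_restr[OF xNC zNC crsJ B]

lemma proj_above_imx: "\<psi> z = imx id (rk F) B (restr B F z)"
proof -
  obtain \<pi>z \<rho>z fz where zz: "z = (\<pi>z, \<rho>z, fz)" by (cases z)
  obtain \<pi>x \<rho>x fx where xx: "x = (\<pi>x, \<rho>x, fx)" by (cases x)
  have r: "(\<lambda>j. card {i \<in> fx B. i \<le> j}) = rk (fx B)" by (rule ext) (simp add: rk_def)
  have "restrict (\<lambda>T. rk (fx B) ` fz T) {T\<in>\<pi>z. T \<subseteq> B}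
    = restrict (\<lambda>U. rk (fx B) ` restrict fz {T\<in>\<pi>z. T \<subseteq> B} {a\<in>B. a \<in> U}) {T\<in>\<pi>z. T \<subseteq> B}"
  proof (rule restrict_ext)
    fix T assume T: "T \<in> {T\<in>\<pi>z. T \<subseteq> B}"
    then have "{a\<in>B. a \<in> T} = T" by blast
    then show "rk (fx B) ` fz T = rk (fx B) ` restrict fz {T\<in>\<pi>z. T \<subseteq> B} {a\<in>B. a \<in> T}" using T by simp
  qed
  then show ?thesis unfolding xx zz proj_above.simps Let_def r imx_def restr_def by simp
qed

lemma J_above: "J (\<psi> z) = (`) (map_sum id (rk F)) ` {Z\<in>J z. Z \<subseteq> B <+> F}"
  unfolding proj_above_imx Jr[symmetric] by (rule J_imx[OF rNC sat_inj[OF NC_D(1)[OF rNC]]]) simp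

lemma fst_above: "fst (\<psi> z) = {T\<in>fst z. T \<subseteq> B}"
  unfolding proj_above_imx imx_def restr_def by simp

lemma posns_above: "posns (\<psi> z) = (`) (rk F) ` {R\<in>posns z. R \<subseteq> F}"
  unfolding proj_above_imx imx_def restr_def by simp

lemma asg_above: assumes "T \<in> fst z" "T \<subseteq> B" shows "asg (\<psi> z) T = rk F ` asg z T"
proof -
  have "T \<in> fst (restr B F z)" "asg (restr B F z) T = asg z T" using assms by (simp_all add: restr_def)
  then show ?thesis unfolding proj_above_imx
    using asg_imx[OF rNC sat_inj[OF NC_D(1)[OF rNC], of id], of T "rk F"] by simp
qed

lemma satF: "sat (posns (restr B F z)) (rk F)"
  by (rule sat_inj[OF NC_D(2)[OF rNC] rk_inj[OF finF]])

lemma above_NCP2: "\<psi> z \<in> NCP2 B"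
proof -
  have "\<psi> z \<in> NC (id ` B) (rk F ` F)"
    unfolding proj_above_imx
  proof (rule imx_NC[OF rNC _ satF])
    show "sat (fst (restr B F z)) id" by (rule sat_inj[OF NC_D(1)[OF rNC]]) simp
    show "card (id ` T) = card (rk F ` asg (restr B F z) T)" if T: "T \<in> fst (restr B F z)" for T
    proof -
      have "inj_on (rk F) (asg (restr B F z) T)" using rk_inj[OF finF] asg_sub[OF rNC T] by (rule inj_on_subset)
      then show ?thesis using NC_D(6)[OF rNC T] by (simp add: card_image)
    qed
    show "noncr ((`) (rk F) ` posns (restr B F z))" unfolding noncr_def
    proof (intro ballI impI)
      fix X Y i j k l assume a: "X \<in> (`) (rk F) ` posns (restr B F z)" "Y \<in> (`) (rk F) ` posns (restr B F z)"
        "i \<in> X" "j \<in> Y" "k \<in> X" "l \<in> Y" "i < j" "j < k" "k < l"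
      obtain R R' where R: "R \<in> posns (restr B F z)" "R' \<in> posns (restr B F z)" "X = rk F ` R" "Y = rk F ` R'" using a by blast
      obtain i' k' where i: "i' \<in> R" "k' \<in> R" "i = rk F i'" "k = rk F k'" using a R by blast
      obtain j' l' where j: "j' \<in> R'" "l' \<in> R'" "j = rk F j'" "l = rk F l'" using a R by blast
      have "R \<subseteq> F" "R' \<subseteq> F" using partition_sub[OF NC_D(2)[OF rNC]] R by blast+
      then have N: "i' \<in> F" "k' \<in> F" "j' \<in> F" "l' \<in> F" using i j by blast+
      have lt: "i' < j'" "j' < k'" "k' < l'" using a(7-9) rk_less_iff[OF finF] N i j by auto
      have "R = R'" by (rule noncr_D[OF NC_D(3)[OF rNC] R(1,2) i(1) j(1) i(2) j(2) lt])
      then show "X = Y" unfolding R(3,4) by (rule arg_cong)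
    qed
  qed
  then show ?thesis using rk_image_set[OF finF] cardF by (simp add: NCP2_NC)
qed

end

lemma above_mono:
  assumes "z \<in> NCP2 S" "le x z" "z' \<in> NCP2 S" "le x z'" "le z z'"
  shows "ncp2_le B (\<psi> z) (\<psi> z')"
proof -
  have "crs {Z\<in>J z. Z \<subseteq> B <+> F} {Z\<in>J z'. Z \<subseteq> B <+> F}" unfolding crs_def
  proof
    fix Z' assume Z': "Z' \<in> {Z\<in>J z'. Z \<subseteq> B <+> F}"
    then obtain Z where Z: "Z \<in> J z" "Z' \<subseteq> Z" using le_D(3)[OF assms(1,3,5)] unfolding crs_def by blast
    obtain c where c: "c \<in> Z'" using partition_ne[OF J_partition[OF NCP2_D[OF assms(3)]]] Z' by blast
    have "Z \<subseteq> B <+> F"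
      by (rule crs_block[OF J_partition[OF xNC] J_partition[OF NCP2_D[OF assms(1)]] crsJ[OF assms(1,2)] J_block[OF B] Z(1), of c])
        (use c Z Z' in blast)+
    then show "\<exists>Z\<in>{Z\<in>J z. Z \<subseteq> B <+> F}. Z' \<subseteq> Z" using Z by blast
  qed
  then show ?thesis
    unfolding ncp2_le_iff[OF above_NCP2[OF assms(1,2)] above_NCP2[OF assms(3,4)]] J_above[OF assms(1,2)] J_above[OF assms(3,4)]
    by (rule crs_image)
qed

text \<open>The projection sees only what lies inside \<open>B\<close> and its positions, but loses
  nothing there because \<open>rk F\<close> is injective on \<open>F\<close>.\<close>

lemma above_inj_part:
  assumes "z \<in> NCP2 S" "le x z" "z' \<in> NCP2 S" "le x z'" "\<psi> z = \<psi> z'"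
  shows "{Z\<in>J z. Z \<subseteq> B <+> F} = {Z\<in>J z'. Z \<subseteq> B <+> F}"
proof -
  have inj: "inj_on (map_sum id (rk F)) (B <+> F)"
  proof (rule inj_onI)
    fix c d assume a: "c \<in> B <+> F" "d \<in> B <+> F" "map_sum id (rk F) c = map_sum id (rk F) d"
    then show "c = d" using inj_onD[OF rk_inj[OF finF]] by (cases c; cases d) auto
  qed
  have r: "partition_on (B <+> F) {Z\<in>J z. Z \<subseteq> B <+> F}" if "z \<in> NCP2 S" "le x z" for z
    using J_partition[OF rNC[OF that]] unfolding Jr[OF that] .
  show ?thesis
  proof (rule sat_image_eq[OF r[OF assms(1,2)] r[OF assms(3,4)]])
    show "sat {Z\<in>J z. Z \<subseteq> B <+> F} (map_sum id (rk F))" by (rule sat_inj[OF r[OF assms(1,2)] inj])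
    show "sat {Z\<in>J z'. Z \<subseteq> B <+> F} (map_sum id (rk F))" by (rule sat_inj[OF r[OF assms(3,4)] inj])
    show "(`) (map_sum id (rk F)) ` {Z\<in>J z. Z \<subseteq> B <+> F} = (`) (map_sum id (rk F)) ` {Z\<in>J z'. Z \<subseteq> B <+> F}"
      using J_above[OF assms(1,2)] J_above[OF assms(3,4)] assms(5) by simp
  qed
qed

end

text \<open>Each block of \<open>z\<close> lies under one block of \<open>x\<close>, so the
  restrictions to all blocks of \<open>x\<close> determine \<open>z\<close>: the upper interval
  embeds into a product.\<close>

lemma above_joint_inj:
  assumes S: "finite S" and x: "x \<in> NCP2 S" and z: "z \<in> NCP2 S" "ncp2_le S x z" and z': "z' \<in> NCP2 S" "ncp2_le S x z'"
    and eq: "\<And>B. B \<in> fst x \<Longrightarrow> proj_above B x z = proj_above B x z'"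
  shows "z = z'"
proof (rule NCP2_J_inj[OF z(1) z'(1)])
  have J: "J z = (\<Union>B\<in>fst x. {Z\<in>J z. Z \<subseteq> B <+> asg x B})" if z: "z \<in> NCP2 S" "ncp2_le S x z" for z
  proof
    show "J z \<subseteq> (\<Union>B\<in>fst x. {Z\<in>J z. Z \<subseteq> B <+> asg x B})"
    proof
      fix Z assume Z: "Z \<in> J z"
      then obtain Z0 where Z0: "Z0 \<in> J x" "Z \<subseteq> Z0" using le_D(3)[OF x z] unfolding crs_def by blast
      obtain T where "T \<in> fst x" "Z0 = T <+> asg x T" using Z0(1) by (rule J_cases)
      then show "Z \<in> (\<Union>B\<in>fst x. {Z\<in>J z. Z \<subseteq> B <+> asg x B})" using Z Z0(2) by blast
    qed
  qed blast
  have "{Z\<in>J z. Z \<subseteq> B <+> asg x B} = {Z\<in>J z'. Z \<subseteq> B <+> asg x B}" if B: "B \<in> fst x" for B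
  proof -
    interpret above S B x using S x B by unfold_locales
    show ?thesis by (rule above_inj_part[OF z z' eq[OF B]])
  qed
  then show "J z = J z'" by (subst J[OF z], subst J[OF z']) (rule SUP_cong, auto)
qed

section \<open>Relabelling of non-crossing 2-partitions\<close>

lemma relabel_imx: "ncp2_relabel \<tau> S x = imx \<tau> id S x"
  by (cases x) (simp add: imx_def image_id[unfolded id_def])

context
  fixes \<tau> :: "'a \<Rightarrow> 'b" and S and x
  assumes inj: "inj_on \<tau> S" and x: "x \<in> NCP2 S"
begin

lemma relabel_sat: "sat (fst x) \<tau>" by (rule sat_inj[OF NC_D(1)[OF NCP2_D[OF x]] inj])

lemma relabel_NCP2: "ncp2_relabel \<tau> S x \<in> NCP2 (\<tau> ` S)"
proof -
  note xNC = NCP2_D[OF x]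
  have "imx \<tau> id S x \<in> NC (\<tau> ` S) (id ` {1..card S})"
  proof (rule imx_NC[OF xNC relabel_sat])
    show "sat (posns x) id" by (rule sat_inj[OF NC_D(2)[OF xNC]]) simp
    show "noncr ((`) id ` posns x)" using NC_D(3)[OF xNC] by simp
    show "card (\<tau> ` T) = card (id ` asg x T)" if T: "T \<in> fst x" for T
      using NC_D(6)[OF xNC T] card_image[OF inj_on_subset[OF inj NCP2_fst_sub[OF x T]]] by simp
  qed
  then show ?thesis using card_image[OF inj] by (simp add: relabel_imx NCP2_NC)
qed

lemma J_relabel: "J (ncp2_relabel \<tau> S x) = (`) (map_sum \<tau> id) ` J x"
  unfolding relabel_imx by (rule J_imx[OF NCP2_D[OF x] relabel_sat])

lemma fst_relabel: "fst (ncp2_relabel \<tau> S x) = (`) \<tau> ` fst x" and posns_relabel: "posns (ncp2_relabel \<tau> S x) = posns x"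
  unfolding relabel_imx imx_def by simp_all

lemma asg_relabel: "T \<in> fst x \<Longrightarrow> asg (ncp2_relabel \<tau> S x) (\<tau> ` T) = asg x T"
  unfolding relabel_imx using asg_imx[OF NCP2_D[OF x] relabel_sat, of T id] by simp

end

lemma relabel_mono:
  assumes "inj_on \<tau> S" "x \<in> NCP2 S" "y \<in> NCP2 S" "ncp2_le S x y"
  shows "ncp2_le (\<tau> ` S) (ncp2_relabel \<tau> S x) (ncp2_relabel \<tau> S y)"
  unfolding ncp2_le_iff[OF relabel_NCP2[OF assms(1,2)] relabel_NCP2[OF assms(1,3)]] J_relabel[OF assms(1,2)] J_relabel[OF assms(1,3)]
  by (rule crs_image[OF le_D(3)[OF assms(2-4)]])

lemma relabel_comp:
  assumes "inj_on \<tau> S" "inj_on \<sigma> (\<tau> ` S)" "x \<in> NCP2 S"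
  shows "ncp2_relabel \<sigma> (\<tau> ` S) (ncp2_relabel \<tau> S x) = ncp2_relabel (\<sigma> \<circ> \<tau>) S x"
proof (rule NCP2_J_inj)
  have c: "inj_on (\<sigma> \<circ> \<tau>) S" using assms(1,2) by (rule comp_inj_on)
  note r = relabel_NCP2[OF assms(1,3)]
  show "ncp2_relabel \<sigma> (\<tau> ` S) (ncp2_relabel \<tau> S x) \<in> NCP2 (\<sigma> ` \<tau> ` S)" by (rule relabel_NCP2[OF assms(2) r])
  show "ncp2_relabel (\<sigma> \<circ> \<tau>) S x \<in> NCP2 (\<sigma> ` \<tau> ` S)" using relabel_NCP2[OF c assms(3)] by (simp add: image_comp)
  show "J (ncp2_relabel \<sigma> (\<tau> ` S) (ncp2_relabel \<tau> S x)) = J (ncp2_relabel (\<sigma> \<circ> \<tau>) S x)"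
    unfolding J_relabel[OF assms(2) r] J_relabel[OF assms(1,3)] J_relabel[OF c assms(3)] map_sum_map_sum by (simp add: o_def id_def)
qed

lemma relabel_cong:
  assumes "\<And>a. a \<in> S \<Longrightarrow> \<tau> a = \<sigma> a" "inj_on \<tau> S" "x \<in> NCP2 S"
  shows "ncp2_relabel \<tau> S x = ncp2_relabel \<sigma> S x"
proof (rule NCP2_J_inj)
  have i: "inj_on \<sigma> S" using assms(1,2) by (simp add: inj_on_def)
  have im: "\<tau> ` S = \<sigma> ` S" using assms(1) by simp
  show "ncp2_relabel \<tau> S x \<in> NCP2 (\<tau> ` S)" by (rule relabel_NCP2[OF assms(2,3)])
  show "ncp2_relabel \<sigma> S x \<in> NCP2 (\<tau> ` S)" unfolding im by (rule relabel_NCP2[OF i assms(3)])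
  show "J (ncp2_relabel \<tau> S x) = J (ncp2_relabel \<sigma> S x)"
    unfolding J_relabel[OF assms(2,3)] J_relabel[OF i assms(3)]
  proof (intro image_image_cong map_sum_image_cong refl)
    show "\<tau> a = \<sigma> a" if "Z \<in> J x" "Inl a \<in> Z" for Z a
      using J_sub[OF assms(3) that(1)] that(2) assms(1) by blast
  qed
qed

lemma relabel_id: "x \<in> NCP2 S \<Longrightarrow> (\<And>a. a \<in> S \<Longrightarrow> \<tau> a = a) \<Longrightarrow> ncp2_relabel \<tau> S x = x"
proof -
  assume x: "x \<in> NCP2 S" and t: "\<And>a. a \<in> S \<Longrightarrow> \<tau> a = a"
  have i: "inj_on \<tau> S" using t by (simp add: inj_on_def)
  have im: "\<tau> ` S = S" using t by simp
  show ?thesis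
  proof (rule NCP2_J_inj[OF _ x])
    show "ncp2_relabel \<tau> S x \<in> NCP2 S" using relabel_NCP2[OF i x] unfolding im .
    have "map_sum \<tau> id ` Z = map_sum id id ` Z" if "Z \<in> J x" for Z
      using J_sub[OF x that] t by (intro map_sum_image_cong) auto
    then show "J (ncp2_relabel \<tau> S x) = J x" unfolding J_relabel[OF i x] by (simp add: map_sum.id cong: image_cong_simp)
  qed
qed

lemma relabel_strict:
  assumes "inj_on \<tau> S" "x \<in> NCP2 S" "y \<in> NCP2 S" "strict (ncp2_le S) x y"
  shows "strict (ncp2_le (\<tau> ` S)) (ncp2_relabel \<tau> S x) (ncp2_relabel \<tau> S y)"
proof -
  have i: "inj_on (inv_into S \<tau>) (\<tau> ` S)" by (rule inj_on_inv_into) simp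
  have "ncp2_relabel (inv_into S \<tau>) (\<tau> ` S) (ncp2_relabel \<tau> S x) = x" if "x \<in> NCP2 S" for x
    unfolding relabel_comp[OF assms(1) i that] using assms(1) by (intro relabel_id[OF that]) simp
  then have "ncp2_relabel \<tau> S x \<noteq> ncp2_relabel \<tau> S y" using assms(2-4) unfolding strict_def by metis
  then show ?thesis using relabel_mono[OF assms(1-3)] assms(4) unfolding strict_def by blast
qed

section \<open>Composites of projections\<close>

lemma NCP2_le_trans:
  "finite S \<Longrightarrow> x \<in> NCP2 S \<Longrightarrow> y \<in> NCP2 S \<Longrightarrow> z \<in> NCP2 S \<Longrightarrow> ncp2_le S x y \<Longrightarrow> ncp2_le S y z \<Longrightarrow> ncp2_le S x z"
  by (rule finite_poset.le_trans[OF finite_poset_NCP2])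

text \<open>Collapsing along \<open>y\<close> and then along the image of \<open>x\<close> is one
  collapse; on positions this is \<open>pos_pos\<close>.\<close>

lemma J_below_below:
  assumes b: "below A0 t D y" and x: "x \<in> NCP2 (A0 \<union> D)" "ncp2_le (A0 \<union> D) x y"
    and z: "z \<in> NCP2 (A0 \<union> D)" "ncp2_le (A0 \<union> D) z x"
    and b': "below A1 s B1 (proj_below A0 t D y x)" and un: "A1 \<union> B1 = insert t A0"
  shows "J (proj_below A1 s B1 (proj_below A0 t D y x) (proj_below A0 t D y z))
    = (`) (map_sum (\<lambda>a. colq B1 s (colq D t a)) (pos (posns x))) ` J z"
proof -
  interpret Y: below A0 t D y by fact
  interpret X: below A1 s B1 "proj_below A0 t D y x" by fact
  have fin: "finite (A0 \<union> D)" using Y.finA Y.finB by simp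
  have zy: "ncp2_le (A0 \<union> D) z y" by (rule NCP2_le_trans[OF fin z(1) x(1) Y.y z(2) x(2)])
  have z': "proj_below A0 t D y z \<in> NCP2 (A1 \<union> B1)" unfolding un by (rule Y.below_NCP2[OF z(1) zy])
  have zx': "ncp2_le (A1 \<union> B1) (proj_below A0 t D y z) (proj_below A0 t D y x)"
    unfolding un by (rule Y.below_mono[OF z(1) zy x z(2)])
  show ?thesis
    unfolding X.J_below[OF z' zx'] Y.J_below[OF z(1) zy] map_sum_map_sum
  proof (intro image_image_cong map_sum_image_cong refl)
    fix Z i assume "Z \<in> J z" "Inr i \<in> Z"
    then have "i \<in> {1..card (A0 \<union> D)}" using J_sub[OF z(1)] by blast
    then show "pos (posns (proj_below A0 t D y x)) (pos (posns y) i) = pos (posns x) i"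
      unfolding Y.posns_below[OF x]
      by (rule pos_pos[OF finite_atLeastAtMost Y.partN NC_D(2)[OF NCP2_D[OF x(1)]] Y.crsD(2)[OF x]])
  qed
qed

text \<open>The composite is expressed by the minima of the blocks of \<open>y\<close> inside
  \<open>asg x B\<close>, a form that does not show in which order collapse and restriction were
  made.\<close>

lemma J_above_below:
  assumes b: "below A0 t D y" and x: "x \<in> NCP2 (A0 \<union> D)"
    and z: "z \<in> NCP2 (A0 \<union> D)" "ncp2_le (A0 \<union> D) x z" "ncp2_le (A0 \<union> D) z y" and B: "B \<in> fst x"
  shows "proj_above (colq D t ` B) (proj_below A0 t D y x) (proj_below A0 t D y z) \<in> NCP2 (colq D t ` B)" (is ?mem)
   and "J (proj_above (colq D t ` B) (proj_below A0 t D y x) (proj_below A0 t D y z))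
    = (`) (map_sum (colq D t) (\<lambda>j. rk (Min ` {R\<in>posns y. R \<subseteq> asg x B}) (Min (blk (posns y) j)))) `
       {Z\<in>J z. Z \<subseteq> B <+> asg x B}" (is ?J)
proof -
  interpret Y: below A0 t D y by fact
  have fin: "finite (A0 \<union> D)" using Y.finA Y.finB by simp
  have xy: "ncp2_le (A0 \<union> D) x y" by (rule NCP2_le_trans[OF fin x z(1) Y.y z(2,3)])
  have x': "proj_below A0 t D y x \<in> NCP2 (insert t A0)" by (rule Y.below_NCP2[OF x xy])
  have B': "colq D t ` B \<in> fst (proj_below A0 t D y x)" unfolding Y.fst_below[OF x xy] using B by blast
  interpret X: above "insert t A0" "colq D t ` B" "proj_below A0 t D y x"
    using Y.finA x' B' by unfold_locales simp_all
  have z': "proj_below A0 t D y z \<in> NCP2 (insert t A0)" by (rule Y.below_NCP2[OF z(1,3)])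
  have xz': "ncp2_le (insert t A0) (proj_below A0 t D y x) (proj_below A0 t D y z)"
    by (rule Y.below_mono[OF x xy z(1,3,2)])
  show ?mem by (rule X.above_NCP2[OF z' xz'])
  let ?H = "map_sum (colq D t) (pos (posns y))"
  have F': "X.F = pos (posns y) ` asg x B" by (rule Y.asg_below[OF x xy B])
  have V: "colq D t ` B <+> X.F = ?H ` (B <+> asg x B)" unfolding F' map_sum_Plus ..
  have sat: "sat (J x) ?H" by (rule sat_J[OF NCP2_D[OF x] Y.satS[OF x xy] Y.satN[OF x xy]])
  have filt: "{W \<in> (`) ?H ` J z. W \<subseteq> ?H ` (B <+> asg x B)} = (`) ?H ` {Z\<in>J z. Z \<subseteq> B <+> asg x B}"
  proof (rule filter_image_sub)
    fix Z assume Z: "Z \<in> J z" "?H ` Z \<subseteq> ?H ` (B <+> asg x B)"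
    show "Z \<subseteq> B <+> asg x B"
    proof
      fix w assume w: "w \<in> Z"
      obtain v where v: "v \<in> B <+> asg x B" "?H w = ?H v" using Z(2) w by blast
      have "w \<in> \<Union>(J x)" using J_sub[OF z(1) Z(1)] w partition_onD1[OF J_partition[OF NCP2_D[OF x]]] by blast
      then show "w \<in> B <+> asg x B" using sat[unfolded sat_def, rule_format, OF J_block[OF B] v(1) _ v(2)] by blast
    qed
  qed
  show ?J
    unfolding X.J_above[OF z' xz'] V Y.J_below[OF z(1,3)] filt map_sum_map_sum
  proof (intro image_image_cong map_sum_image_cong)
    fix Z i assume "Z \<in> {Z\<in>J z. Z \<subseteq> B <+> asg x B}" "Inr i \<in> Z"
    then have i: "i \<in> asg x B" by blast
    show "rk X.F (pos (posns y) i) = rk (Min ` {R\<in>posns y. R \<subseteq> asg x B}) (Min (blk (posns y) i))"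
      unfolding F'
      by (rule rk_pos_image[OF finite_atLeastAtMost Y.partN asg_sub[OF NCP2_D[OF x] B] Y.unN[OF x xy asg_in[OF NCP2_D[OF x] B]] i])
  qed simp
qed

text \<open>The counterpart of \<open>rk_pos_image\<close> with the two operations exchanged:
  \<open>rk F\<close> is increasing on \<open>F\<close>, so it preserves the minima of blocks and
  their order.\<close>

lemma pos_rk:
  assumes fF: "finite F" and part: "partition_on N \<rho>" and pF: "partition_on F {R\<in>\<rho>. R \<subseteq> F}" and j: "j \<in> F"
  shows "pos ((`) (rk F) ` {R\<in>\<rho>. R \<subseteq> F}) (rk F j) = rk (Min ` {R\<in>\<rho>. R \<subseteq> F}) (Min (blk \<rho> j))"
proof -
  let ?r = "{R\<in>\<rho>. R \<subseteq> F}"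
  obtain R where R: "R \<in> ?r" "j \<in> R" using partition_ex[OF pF j] by blast
  have pim: "partition_on (rk F ` F) ((`) (rk F) ` ?r)" by (rule partition_image[OF pF sat_inj[OF pF rk_inj[OF fF]]])
  have fr: "finite ?r" by (rule finite_elements[OF fF pF])
  have MF: "Min R \<in> F" if "R \<in> ?r" for R using Min_block[OF fF pF that] that by blast
  have Mi: "Min (rk F ` R) = rk F (Min R)" if R: "R \<in> ?r" for R
  proof (rule Min_eqI)
    have fR: "finite R" by (rule fin_blocks(2)[OF fF pF R])
    then show "finite (rk F ` R)" by simp
    show "rk F (Min R) \<in> rk F ` R" using Min_block[OF fF pF R] by blast
    show "rk F (Min R) \<le> w" if "w \<in> rk F ` R" for w
      using that rk_mono[OF fF] Min_le[OF fR] by blast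
  qed
  have "pos ((`) (rk F) ` ?r) (rk F j) = rk (Min ` (`) (rk F) ` ?r) (Min (rk F ` R))"
    by (rule pos_eq[OF pim]) (use R in blast)+
  also have "Min ` (`) (rk F) ` ?r = rk F ` Min ` ?r"
    unfolding image_image using Mi by (rule image_cong[OF refl])
  also have "rk \<dots> (Min (rk F ` R)) = rk (Min ` ?r) (Min R)"
    unfolding Mi[OF R(1)]
  proof (rule rk_image)
    show "rk F a \<le> rk F b \<longleftrightarrow> a \<le> b" if "a \<in> Min ` ?r" "b \<in> Min ` ?r" for a b
      by (rule rk_le_iff[OF fF]) (use that MF in blast)+
    show "finite (Min ` ?r)" using fr by simp
    show "Min R \<in> Min ` ?r" using R(1) by blast
  qed
  also have "Min R = Min (blk \<rho> j)" using blk_eq[OF part _ R(2)] R(1) by simp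
  finally show ?thesis .
qed

text \<open>The rank in \<open>X.F\<close> is increasing there, so ranking the images of a subset
  gives the same result as ranking the subset itself.\<close>

lemma above_above:
  assumes S: "finite S" and x: "x \<in> NCP2 S" and y: "y \<in> NCP2 S" and z: "z \<in> NCP2 S"
    and le: "ncp2_le S x y" "ncp2_le S y z" and B: "B \<in> fst x" and D: "D \<in> fst y" "D \<subseteq> B"
  shows "proj_above D (proj_above B x y) (proj_above B x z) = proj_above D y z"
proof -
  interpret X: above S B x using S x B by unfold_locales
  interpret Y: above S D y using S y D by unfold_locales
  have xz: "ncp2_le S x z" by (rule NCP2_le_trans[OF S x y z le])
  have D': "D \<in> fst (proj_above B x y)" unfolding X.fst_above[OF y le(1)] using D by blast
  interpret XY: above B D "proj_above B x y" using X.finB X.above_NCP2[OF y le(1)] D' by unfold_locales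
  note z' = X.above_NCP2[OF z xz] and le' = X.above_mono[OF y le(1) z xz le(2)]
  have F': "XY.F = rk X.F ` Y.F" by (rule X.asg_above[OF y le(1) D])
  have GF: "Y.F \<subseteq> X.F" by (rule X.crsD(3)[OF y le(1) B D])
  show ?thesis
  proof (rule NCP2_J_inj[OF XY.above_NCP2[OF z' le'] Y.above_NCP2[OF z le(2)]])
    let ?H = "map_sum id (rk X.F) :: 'a + nat \<Rightarrow> _"
    have V: "D <+> XY.F = ?H ` (D <+> Y.F)" unfolding F' map_sum_Plus by simp
    have filt: "{W \<in> (`) ?H ` {Z\<in>J z. Z \<subseteq> B <+> X.F}. W \<subseteq> ?H ` (D <+> Y.F)}
        = (`) ?H ` {Z \<in> {Z\<in>J z. Z \<subseteq> B <+> X.F}. Z \<subseteq> D <+> Y.F}"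
    proof (rule filter_image_sub)
      fix Z assume Z: "Z \<in> {Z\<in>J z. Z \<subseteq> B <+> X.F}" "?H ` Z \<subseteq> ?H ` (D <+> Y.F)"
      show "Z \<subseteq> D <+> Y.F"
      proof
        fix w assume w: "w \<in> Z"
        obtain v where v: "v \<in> D <+> Y.F" "?H w = ?H v" using Z(2) w by blast
        show "w \<in> D <+> Y.F"
        proof (cases w)
          case (Inl a)
          then show ?thesis using v by (cases v) auto
        next
          case (Inr i)
          then obtain i' where i': "v = Inr i'" "rk X.F i = rk X.F i'" using v(2) by (cases v) auto
          have "i \<in> X.F" "i' \<in> X.F" using Z(1) w Inr i'(1) v(1) GF by blast+
          then have "i = i'" using inj_onD[OF rk_inj[OF X.finF] i'(2)] by blast
          then show ?thesis using v(1) i'(1) Inr by simp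
        qed
      qed
    qed
    have "{Z \<in> {Z\<in>J z. Z \<subseteq> B <+> X.F}. Z \<subseteq> D <+> Y.F} = {Z\<in>J z. Z \<subseteq> D <+> Y.F}"
      using D(2) GF Plus_sub_iff[of D Y.F B X.F] by blast
    then show "J (proj_above D (proj_above B x y) (proj_above B x z)) = J (proj_above D y z)"
      unfolding XY.J_above[OF z' le'] V X.J_above[OF z xz] filt Y.J_above[OF z le(2)] map_sum_map_sum
    proof (simp only:, intro image_image_cong map_sum_image_cong)
      fix Z i assume "Z \<in> {Z\<in>J z. Z \<subseteq> D <+> Y.F}" "Inr i \<in> Z"
      then have i: "i \<in> Y.F" by blast
      have fY: "finite Y.F" by (rule Y.finF)
      show "rk XY.F (rk X.F i) = rk Y.F i" unfolding F'
        by (rule rk_image[OF fY i]) (rule rk_le_iff[OF X.finF]; use GF in blast)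
    qed simp
  qed
qed

section \<open>Nested insertions\<close>

locale seq_setup =
  fixes A B D :: "'a set" and s t :: 'a and x y :: "'a ncp2"
  assumes fin: "finite A" "finite B" "finite D" and disj: "A \<inter> (B \<union> D) = {}" "B \<inter> D = {}"
    and Dne: "D \<noteq> {}" and s: "s \<notin> A" and t: "t \<notin> A" "t \<notin> B"
    and x: "x \<in> NCP2 (A \<union> B \<union> D)" and y: "y \<in> NCP2 (A \<union> B \<union> D)" and xy: "ncp2_le (A \<union> B \<union> D) x y"
    and fst_y: "fst y = insert D (singles (A \<union> B))"
begin

sublocale Y: below "A \<union> B" t D y
  using fin disj Dne t y fst_y by unfold_locales auto

lemma fst_x_iff: "fst (Y.\<phi> x) = insert (insert t B) (singles A) \<longleftrightarrow> fst x = insert (B \<union> D) (singles A)"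
proof -
  have 1: "{a \<in> A \<union> B \<union> D. colq D t a \<in> insert t B} = B \<union> D" using disj t by auto
  have 2: "{a' \<in> A \<union> B \<union> D. colq D t a' \<in> {a}} = {a}" if "a \<in> A" for a using that disj t by auto
  have "(\<lambda>U. {a\<in>A \<union> B \<union> D. colq D t a \<in> U}) ` singles A = singles A"
    unfolding image_image using 2 by (rule image_cong[OF refl])
  then have "(\<lambda>U. {a\<in>A \<union> B \<union> D. colq D t a \<in> U}) ` insert (insert t B) (singles A) = insert (B \<union> D) (singles A)"
    unfolding image_insert 1 by simp
  moreover have "U \<subseteq> insert t (A \<union> B)" if "U \<in> insert (insert t B) (singles A)" for U using that by auto
  ultimately show ?thesis using Y.fst_below_eq[OF x xy, of "insert (insert t B) (singles A)"] by simp
qed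

context
  assumes fst_x: "fst x = insert (B \<union> D) (singles A)"
begin

lemma x'_below: "below A s (insert t B) (Y.\<phi> x)"
proof
  have "insert t (A \<union> B) = A \<union> insert t B" by simp
  then show "Y.\<phi> x \<in> NCP2 (A \<union> insert t B)" using Y.below_NCP2[OF x xy] by simp
  show "fst (Y.\<phi> x) = insert (insert t B) (singles A)" using fst_x_iff fst_x by blast
qed (use fin disj s t in auto)

lemma x_below: "below A s (B \<union> D) x"
proof
  show "x \<in> NCP2 (A \<union> (B \<union> D))" using x by (simp add: Un_assoc)
qed (use fin disj s Dne fst_x in auto)

text \<open>The lower piece of a chain: \<open>D\<close> is collapsed to \<open>t\<close> and then
  \<open>insert t B\<close> to \<open>s\<close>, which is the collapse of
  \<open>B \<union> D\<close> to \<open>s\<close>.\<close>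

lemma seq_u:
  assumes z: "z \<in> NCP2 (A \<union> B \<union> D)" "ncp2_le (A \<union> B \<union> D) z x"
  shows "proj_below A s (insert t B) (Y.\<phi> x) (Y.\<phi> z) = proj_below A s (B \<union> D) x z"
proof -
  interpret X: below A s "B \<union> D" x by (rule x_below)
  interpret X': below A s "insert t B" "Y.\<phi> x" by (rule x'_below)
  have z1: "z \<in> NCP2 (A \<union> (B \<union> D))" "ncp2_le (A \<union> (B \<union> D)) z x" using z by (simp_all add: Un_assoc)
  have finS: "finite (A \<union> B \<union> D)" using fin by simp
  have zy: "ncp2_le (A \<union> B \<union> D) z y" by (rule NCP2_le_trans[OF finS z(1) x y z(2) xy])
  have un: "A \<union> insert t B = insert t (A \<union> B)" by simp
  have z': "Y.\<phi> z \<in> NCP2 (A \<union> insert t B)" unfolding un by (rule Y.below_NCP2[OF z(1) zy])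
  have le': "ncp2_le (A \<union> insert t B) (Y.\<phi> z) (Y.\<phi> x)" unfolding un by (rule Y.below_mono[OF z(1) zy x xy z(2)])
  show ?thesis
  proof (rule NCP2_J_inj[OF X'.below_NCP2[OF z' le'] X.below_NCP2[OF z1]])
    show "J (proj_below A s (insert t B) (Y.\<phi> x) (Y.\<phi> z)) = J (proj_below A s (B \<union> D) x z)"
      unfolding J_below_below[OF Y.below_axioms x xy z x'_below un] X.J_below[OF z1]
    proof (intro image_image_cong map_sum_image_cong refl)
      fix Z a assume "Z \<in> J z" "Inl a \<in> Z"
      then have "a \<in> A \<union> B \<union> D" using J_sub[OF z(1)] by blast
      then show "colq (insert t B) s (colq D t a) = colq (B \<union> D) s a" using t disj by auto
    qed
  qed
qed

lemma x_above: "above (A \<union> B \<union> D) (B \<union> D) x"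
  using fin x fst_x by unfold_locales auto

lemma fst_y_above: "fst (proj_above (B \<union> D) x y) = insert D (singles B)"
proof -
  interpret X: above "A \<union> B \<union> D" "B \<union> D" x by (rule x_above)
  show ?thesis unfolding X.fst_above[OF y xy] fst_y using disj Dne by auto
qed

lemma y'_below: "below B t D (proj_above (B \<union> D) x y)"
proof
  interpret X: above "A \<union> B \<union> D" "B \<union> D" x by (rule x_above)
  show "proj_above (B \<union> D) x y \<in> NCP2 (B \<union> D)" by (rule X.above_NCP2[OF y xy])
qed (use fin disj t Dne fst_y_above in auto)

text \<open>The middle piece of a chain, between \<open>x\<close> and \<open>y\<close>: collapsing
  \<open>D\<close> commutes with restricting to \<open>B \<union> D\<close>. Both positions maps
  number the blocks of \<open>y\<close> inside \<open>X.F\<close> by their minima.\<close>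

lemma seq_v:
  assumes z: "z \<in> NCP2 (A \<union> B \<union> D)" "ncp2_le (A \<union> B \<union> D) x z" "ncp2_le (A \<union> B \<union> D) z y"
  shows "proj_above (insert t B) (Y.\<phi> x) (Y.\<phi> z) = proj_below B t D (proj_above (B \<union> D) x y) (proj_above (B \<union> D) x z)"
proof -
  interpret X: above "A \<union> B \<union> D" "B \<union> D" x by (rule x_above)
  interpret Y': below B t D "X.\<psi> y" by (rule y'_below)
  have q: "colq D t ` (B \<union> D) = insert t B" using disj Dne by force
  note L = J_above_below[OF Y.below_axioms x z X.B, unfolded q]
  note z' = X.above_NCP2[OF z(1,2)] and le' = X.above_mono[OF z(1,2) y xy z(3)]
  show ?thesis
  proof (rule NCP2_J_inj[OF L(1) Y'.below_NCP2[OF z' le']])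
    show "J (proj_above (insert t B) (Y.\<phi> x) (Y.\<phi> z)) = J (Y'.\<phi> (X.\<psi> z))"
      unfolding L(2) Y'.J_below[OF z' le'] X.J_above[OF z(1,2)] map_sum_map_sum X.posns_above[OF y xy]
    proof (intro image_image_cong map_sum_image_cong)
      fix Z i assume "Z \<in> {Z\<in>J z. Z \<subseteq> (B \<union> D) <+> X.F}" "Inr i \<in> Z"
      then have i: "i \<in> X.F" by blast
      show "rk (Min ` {R\<in>posns y. R \<subseteq> X.F}) (Min (blk (posns y) i)) = pos ((`) (rk X.F) ` {R\<in>posns y. R \<subseteq> X.F}) (rk X.F i)"
      proof (rule pos_rk[OF X.finF Y.partN _ i, symmetric])
        show "partition_on X.F {R\<in>posns y. R \<subseteq> X.F}"
          by (rule partition_restrict_block[OF NC_D(2)[OF X.xNC] Y.partN X.crsD(2)[OF y xy] asg_in[OF X.xNC X.B]])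
      qed
    qed simp
  qed
qed

end

end

text \<open>On \<open>A\<close> the element \<open>x\<close> consists of singletons already, so
  anything above it does too, and the type of \<open>y\<close> is decided inside
  \<open>B \<union> D\<close>.\<close>

lemma fst_above_iff:
  assumes fin: "finite A" "finite B" "finite D" and disj: "A \<inter> (B \<union> D) = {}" "B \<inter> D = {}" and Dne: "D \<noteq> {}"
    and x: "x \<in> NCP2 (A \<union> B \<union> D)" and y: "y \<in> NCP2 (A \<union> B \<union> D)" and xy: "ncp2_le (A \<union> B \<union> D) x y"
    and fst_x: "fst x = insert (B \<union> D) (singles A)"
  shows "fst (proj_above (B \<union> D) x y) = insert D (singles B) \<longleftrightarrow> fst y = insert D (singles (A \<union> B))"
proof -
  interpret X: above "A \<union> B \<union> D" "B \<union> D" x using fin x fst_x by unfold_locales auto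
  have f: "fst (X.\<psi> y) = {T\<in>fst y. T \<subseteq> B \<union> D}" by (rule X.fst_above[OF y xy])
  have py: "partition_on (A \<union> B \<union> D) (fst y)" by (rule NC_D(1)[OF NCP2_D[OF y]])
  have sub: "\<exists>T'\<in>fst x. T \<subseteq> T'" if "T \<in> fst y" for T
    using X.crsD(1)[OF y xy] that unfolding crs_def by blast
  have A: "T = {a}" if T: "T \<in> fst y" "T \<subseteq> {a}" for T a using T(2) partition_ne[OF py T(1)] by blast
  have Ain: "{a} \<in> fst y" if a: "a \<in> A" for a
  proof -
    obtain T where T: "T \<in> fst y" "a \<in> T" using partition_ex[OF py, of a] a by blast
    obtain T' where T': "T' \<in> fst x" "T \<subseteq> T'" using sub[OF T(1)] by blast
    have "T' \<noteq> B \<union> D" using T' T(2) a disj by blast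
    then obtain a' where "T' = {a'}" using T'(1) fst_x by auto
    then have "T = {a}" using A[OF T(1), of a'] T' T(2) by auto
    then show ?thesis using T by simp
  qed
  have e1: "fst y = {T\<in>fst y. T \<subseteq> B \<union> D} \<union> singles A"
  proof
    show "fst y \<subseteq> {T\<in>fst y. T \<subseteq> B \<union> D} \<union> singles A"
    proof
      fix T assume T: "T \<in> fst y"
      obtain T' where "T' \<in> fst x" "T \<subseteq> T'" using sub[OF T] by blast
      then show "T \<in> {T\<in>fst y. T \<subseteq> B \<union> D} \<union> singles A" using A[OF T] T unfolding fst_x by blast
    qed
    show "{T\<in>fst y. T \<subseteq> B \<union> D} \<union> singles A \<subseteq> fst y" using Ain by blast
  qed
  have e2: "{T \<in> insert D (singles (A \<union> B)). T \<subseteq> B \<union> D} = insert D (singles B)" using disj Dne by auto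
  show ?thesis unfolding f
  proof
    assume "{T\<in>fst y. T \<subseteq> B \<union> D} = insert D (singles B)"
    then have "fst y = insert D (singles B) \<union> singles A" using e1 by (simp only:)
    moreover have "insert D (singles B) \<union> singles A = insert D (singles (A \<union> B))" by auto
    ultimately show "fst y = insert D (singles (A \<union> B))" by (simp only:)
  next
    assume y: "fst y = insert D (singles (A \<union> B))"
    show "{T\<in>fst y. T \<subseteq> B \<union> D} = insert D (singles B)" unfolding y by (rule e2)
  qed
qed

lemma relabel_below:
  assumes "below A s B y" and x: "x \<in> NCP2 (A \<union> B)" "ncp2_le (A \<union> B) x y"
    and inj: "inj_on \<tau> (A \<union> B)" and inj': "inj_on \<tau>' (insert s A)" and eq: "\<And>a. a \<in> A \<Longrightarrow> \<tau>' a = \<tau> a"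
  shows "proj_below (\<tau> ` A) (\<tau>' s) (\<tau> ` B) (ncp2_relabel \<tau> (A \<union> B) y) (ncp2_relabel \<tau> (A \<union> B) x)
    = ncp2_relabel \<tau>' (insert s A) (proj_below A s B y x)" (is "?L = ?R")
    and "below (\<tau> ` A) (\<tau>' s) (\<tau> ` B) (ncp2_relabel \<tau> (A \<union> B) y)" (is ?b)
proof -
  interpret Y: below A s B y by fact
  have dj: "\<tau> ` A \<inter> \<tau> ` B = {}" using inj Y.disj by (simp add: inj_on_image_Int[symmetric])
  show ?b
  proof
    show "ncp2_relabel \<tau> (A \<union> B) y \<in> NCP2 (\<tau> ` A \<union> \<tau> ` B)"
      using relabel_NCP2[OF inj Y.y] by (simp add: image_Un)
    show "fst (ncp2_relabel \<tau> (A \<union> B) y) = insert (\<tau> ` B) (singles (\<tau> ` A))"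
      unfolding fst_relabel[OF inj Y.y] Y.fst_y by (simp add: image_image)
    show "\<tau>' s \<notin> \<tau> ` A"
    proof
      assume "\<tau>' s \<in> \<tau> ` A"
      then obtain a where "a \<in> A" "\<tau>' s = \<tau>' a" using eq by auto
      then show False using inj_onD[OF inj', of s a] Y.s by auto
    qed
  qed (use Y.finA Y.finB Y.Bne dj in auto)
  interpret Y': below "\<tau> ` A" "\<tau>' s" "\<tau> ` B" "ncp2_relabel \<tau> (A \<union> B) y" by fact
  have x': "ncp2_relabel \<tau> (A \<union> B) x \<in> NCP2 (\<tau> ` A \<union> \<tau> ` B)"
    using relabel_NCP2[OF inj x(1)] by (simp add: image_Un)
  have le': "ncp2_le (\<tau> ` A \<union> \<tau> ` B) (ncp2_relabel \<tau> (A \<union> B) x) (ncp2_relabel \<tau> (A \<union> B) y)"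
    using relabel_mono[OF inj x(1) Y.y x(2)] by (simp add: image_Un)
  have ins: "insert (\<tau>' s) (\<tau> ` A) = \<tau>' ` insert s A" using eq by simp
  note px = Y.below_NCP2[OF x]
  show "?L = ?R"
  proof (rule NCP2_J_inj)
    show "?L \<in> NCP2 (\<tau>' ` insert s A)" unfolding ins[symmetric] by (rule Y'.below_NCP2[OF x' le'])
    show "?R \<in> NCP2 (\<tau>' ` insert s A)" by (rule relabel_NCP2[OF inj' px])
    show "J ?L = J ?R"
      unfolding Y'.J_below[OF x' le'] J_relabel[OF inj x(1)] J_relabel[OF inj' px] Y.J_below[OF x] map_sum_map_sum
        posns_relabel[OF inj Y.y]
    proof (intro image_image_cong map_sum_image_cong)
      fix Z a assume "Z \<in> J x" "Inl a \<in> Z"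
      then have a: "a \<in> A \<union> B" using J_sub[OF x(1)] by blast
      have "\<tau> a \<in> \<tau> ` B \<longleftrightarrow> a \<in> B" using inj a by (meson Un_upper2 inj_on_image_mem_iff)
      then show "colq (\<tau> ` B) (\<tau>' s) (\<tau> a) = \<tau>' (colq B s a)" using eq a by auto
    qed simp
  qed
qed

lemma relabel_above:
  assumes "above S B x" and z: "z \<in> NCP2 S" "ncp2_le S x z" and inj: "inj_on \<tau> S"
  shows "proj_above (\<tau> ` B) (ncp2_relabel \<tau> S x) (ncp2_relabel \<tau> S z) = ncp2_relabel \<tau> B (proj_above B x z)" (is "?L = ?R")
    and "above (\<tau> ` S) (\<tau> ` B) (ncp2_relabel \<tau> S x)" (is ?b)
proof -
  interpret X: above S B x by fact
  show ?b
    using X.finS relabel_NCP2[OF inj X.x] X.B by unfold_locales (auto simp: fst_relabel[OF inj X.x])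
  interpret X': above "\<tau> ` S" "\<tau> ` B" "ncp2_relabel \<tau> S x" by fact
  note z' = relabel_NCP2[OF inj z(1)] and le' = relabel_mono[OF inj X.x z]
  have BS: "B \<subseteq> S" by (rule NCP2_fst_sub[OF X.x X.B])
  have injB: "inj_on \<tau> B" using inj BS by (rule inj_on_subset)
  have F: "X'.F = X.F" by (rule asg_relabel[OF inj X.x X.B])
  let ?H = "map_sum \<tau> id :: 'a + nat \<Rightarrow> _"
  have V: "\<tau> ` B <+> X.F = ?H ` (B <+> X.F)" unfolding map_sum_Plus by simp
  have filt: "{W \<in> (`) ?H ` J z. W \<subseteq> ?H ` (B <+> X.F)} = (`) ?H ` {Z\<in>J z. Z \<subseteq> B <+> X.F}"
  proof (rule filter_image_sub)
    fix Z assume Z: "Z \<in> J z" "?H ` Z \<subseteq> ?H ` (B <+> X.F)"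
    show "Z \<subseteq> B <+> X.F"
    proof
      fix w assume w: "w \<in> Z"
      obtain v where v: "v \<in> B <+> X.F" "?H w = ?H v" using Z(2) w by blast
      show "w \<in> B <+> X.F"
      proof (cases w)
        case (Inl a)
        then obtain a' where a': "v = Inl a'" "\<tau> a = \<tau> a'" using v(2) by (cases v) auto
        have "a \<in> S" using J_sub[OF z(1) Z(1)] w Inl by blast
        moreover have "a' \<in> B" using v a' by blast
        ultimately have "a = a'" using inj_onD[OF inj a'(2)] BS by blast
        then show ?thesis using v a' Inl by simp
      next
        case (Inr i)
        then show ?thesis using v by (cases v) auto
      qed
    qed
  qed
  note pz = X.above_NCP2[OF z]
  show "?L = ?R"
  proof (rule NCP2_J_inj[OF X'.above_NCP2[OF z' le'] relabel_NCP2[OF injB pz]])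
    show "J ?L = J ?R"
      unfolding X'.J_above[OF z' le'] F V J_relabel[OF inj z(1)] filt J_relabel[OF injB pz] X.J_above[OF z] map_sum_map_sum
      by simp
  qed
qed

lemma pos_singles: "i \<in> {1..n} \<Longrightarrow> pos (singles {1..n}) i = i"
proof -
  assume i: "i \<in> {1..n}"
  have "pos (singles {1..n}) i = rk (Min ` singles {1..n}) (Min {i})"
    by (rule pos_eq[OF partition_on_singletons]) (use i in auto)
  also have "Min ` singles {1..n} = {1..n}" by (simp add: image_image)
  finally show ?thesis using rk_interval[OF i] by simp
qed

text \<open>When \<open>B\<close> is a single label, \<open>y\<close> has singleton blocks of
  positions, whose numbering is the identity; only the label changes its name.\<close>

lemma below_unit:
  assumes "below A s {b} y" and x: "x \<in> NCP2 (A \<union> {b})" "ncp2_le (A \<union> {b}) x y"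
  shows "proj_below A s {b} y x = ncp2_relabel (colq {b} s) (A \<union> {b}) x"
proof -
  interpret Y: below A s "{b}" y by fact
  have inj: "inj_on (colq {b} s) (A \<union> {b})" using Y.s Y.disj by (auto simp: inj_on_def)
  have "card Y.\<rho> = card {1..Y.n}" using Y.card_posns Y.s Y.disj Y.finA by simp
  then have \<rho>: "Y.\<rho> = singles {1..Y.n}" by (rule partition_card_le(2)[OF finite_atLeastAtMost Y.partN])
  show ?thesis
  proof (rule NCP2_J_inj[OF Y.below_NCP2[OF x]])
    show "ncp2_relabel (colq {b} s) (A \<union> {b}) x \<in> NCP2 (insert s A)"
      using relabel_NCP2[OF inj x(1)] unfolding Y.q_image .
    show "J (Y.\<phi> x) = J (ncp2_relabel (colq {b} s) (A \<union> {b}) x)"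
      unfolding Y.J_below[OF x] J_relabel[OF inj x(1)]
    proof (intro image_image_cong map_sum_image_cong refl)
      fix Z i assume "Z \<in> J x" "Inr i \<in> Z"
      then have "i \<in> {1..Y.n}" using J_sub[OF x(1)] by blast
      then show "pos Y.\<rho> i = id i" unfolding \<rho> using pos_singles[of i] by simp
    qed
  qed
qed

lemma above_bot:
  assumes S: "finite S" "S \<noteq> {}" and z: "z \<in> NCP2 S"
  shows "proj_above S (ncp2_bot S) z = z"
proof -
  interpret X: above S S "ncp2_bot S" using S bot_NCP2[OF S] by unfold_locales (auto simp: fst_bot)
  note le = bot_le[OF S z]
  have F: "X.F = {1..card S}" by (simp add: ncp2_bot_def)
  show ?thesis
  proof (rule NCP2_J_inj[OF X.above_NCP2[OF z le] z])
    have "{Z\<in>J z. Z \<subseteq> S <+> X.F} = J z" unfolding F using J_sub[OF z] by blast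
    then have "J (X.\<psi> z) = (`) (map_sum id (rk X.F)) ` J z" unfolding X.J_above[OF z le] by simp
    also have "\<dots> = (`) (map_sum id id) ` J z"
    proof (intro image_image_cong map_sum_image_cong)
      fix Z i assume "Z \<in> J z" "Inr i \<in> Z"
      then have "i \<in> {1..card S}" using J_sub[OF z] by blast
      then show "rk X.F i = id i" unfolding F using rk_interval[of i] by simp
    qed simp
    also have "\<dots> = J z" by (simp add: map_sum.id)
    finally show "J (X.\<psi> z) = J z" .
  qed
qed


section \<open>Insertions at two disjoint blocks\<close>

locale par_setup =
  fixes S A B D :: "'a set" and x :: "'a ncp2"
  assumes fin: "finite S" and S: "S = A \<union> B \<union> D" and disj: "A \<inter> B = {}" "A \<inter> D = {}" "B \<inter> D = {}"
    and Bne: "B \<noteq> {}" and Dne: "D \<noteq> {}" and x: "x \<in> NCP2 S"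
    and fst_x: "fst x = insert B (insert D (singles A))"
begin

sublocale B: above S B x
  using fin x fst_x by unfold_locales auto

sublocale D: above S D x
  using fin x fst_x by unfold_locales auto

lemma fst_decomp:
  assumes z: "z \<in> NCP2 S" "ncp2_le S x z"
  shows "fst z = singles A \<union> fst (B.\<psi> z) \<union> fst (D.\<psi> z)"
proof -
  have p: "partition_on S (fst z)" by (rule NC_D(1)[OF NCP2_D[OF z(1)]])
  have sub: "\<exists>T'\<in>fst x. T \<subseteq> T'" if "T \<in> fst z" for T
    using B.crsD(1)[OF z] that unfolding crs_def by blast
  have A: "T = {a}" if T: "T \<in> fst z" "T \<subseteq> {a}" for T a using T(2) partition_ne[OF p T(1)] by blast
  have Ain: "{a} \<in> fst z" if a: "a \<in> A" for a
  proof -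
    obtain T where T: "T \<in> fst z" "a \<in> T" using partition_ex[OF p, of a] a S by blast
    obtain T' where T': "T' \<in> fst x" "T \<subseteq> T'" using sub[OF T(1)] by blast
    have "T' \<noteq> B" "T' \<noteq> D" using T' T(2) a disj by blast+
    then obtain a' where "T' = {a'}" using T'(1) fst_x by auto
    then have "T = {a}" using A[OF T(1), of a'] T' T(2) by auto
    then show ?thesis using T by simp
  qed
  show ?thesis unfolding B.fst_above[OF z] D.fst_above[OF z]
  proof
    show "fst z \<subseteq> singles A \<union> {T\<in>fst z. T \<subseteq> B} \<union> {T\<in>fst z. T \<subseteq> D}"
    proof
      fix T assume T: "T \<in> fst z"
      obtain T' where "T' \<in> fst x" "T \<subseteq> T'" using sub[OF T] by blast
      then show "T \<in> singles A \<union> {T\<in>fst z. T \<subseteq> B} \<union> {T\<in>fst z. T \<subseteq> D}" using A[OF T] T unfolding fst_x by blast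
    qed
    show "singles A \<union> {T\<in>fst z. T \<subseteq> B} \<union> {T\<in>fst z. T \<subseteq> D} \<subseteq> fst z" using Ain by blast
  qed
qed

text \<open>By this additivity a step that adds one block can move only one of the two
  coordinates.\<close>

lemma card_decomp:
  assumes z: "z \<in> NCP2 S" "ncp2_le S x z"
  shows "card (fst z) = card A + card (fst (B.\<psi> z)) + card (fst (D.\<psi> z))"
proof -
  have p: "partition_on S (fst z)" by (rule NC_D(1)[OF NCP2_D[OF z(1)]])
  have ne: "{} \<notin> fst z" by (rule partition_onD3[OF p])
  have f: "finite (fst z)" by (rule finite_elements[OF fin p])
  have fA: "finite A" using fin S by simp
  have fB: "fst (B.\<psi> z) = {T\<in>fst z. T \<subseteq> B}" "fst (D.\<psi> z) = {T\<in>fst z. T \<subseteq> D}"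
    by (rule B.fst_above[OF z], rule D.fst_above[OF z])
  have d1: "singles A \<inter> fst (B.\<psi> z) = {}" unfolding fB using disj by blast
  have d2: "(singles A \<union> fst (B.\<psi> z)) \<inter> fst (D.\<psi> z) = {}"
  proof (rule ccontr)
    assume "(singles A \<union> fst (B.\<psi> z)) \<inter> fst (D.\<psi> z) \<noteq> {}"
    then obtain T where T: "T \<in> singles A \<union> fst (B.\<psi> z)" "T \<in> fst z" "T \<subseteq> D" unfolding fB by blast
    then have "T \<noteq> {}" using ne by blast
    then obtain d where d: "d \<in> T" by blast
    then show False using T disj unfolding fB by blast
  qed
  have "card (fst z) = card (singles A \<union> fst (B.\<psi> z)) + card (fst (D.\<psi> z))"
    by (subst fst_decomp[OF z], rule card_Un_disjoint[OF _ _ d2]) (use f fA in \<open>simp_all add: fB\<close>)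
  also have "card (singles A \<union> fst (B.\<psi> z)) = card A + card (fst (B.\<psi> z))"
    by (subst card_Un_disjoint[OF _ _ d1]) (use f fA in \<open>simp_all add: fB card_singles\<close>)
  finally show ?thesis .
qed

lemma joint_inj:
  assumes z: "z \<in> NCP2 S" "ncp2_le S x z" and z': "z' \<in> NCP2 S" "ncp2_le S x z'"
    and eq: "B.\<psi> z = B.\<psi> z'" "D.\<psi> z = D.\<psi> z'"
  shows "z = z'"
proof (rule above_joint_inj[OF fin x z z'])
  fix T assume T: "T \<in> fst x"
  show "proj_above T x z = proj_above T x z'"
  proof (cases "T \<in> singles A")
    case True
    then obtain a where a: "T = {a}" by blast
    interpret T: above S T x using fin x T by unfold_locales
    show ?thesis
      using NCP2_singleton[OF T.above_NCP2[OF z, unfolded a]] NCP2_singleton[OF T.above_NCP2[OF z', unfolded a]] a by simp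
  next
    case False
    then have "T = B \<or> T = D" using T unfolding fst_x by blast
    then show ?thesis using eq by blast
  qed
qed

text \<open>In the coordinates of the product, the elements of this type are those with the first
  coordinate at its finest partition and the second one still at the bottom.\<close>

lemma fst_type_iff:
  assumes y: "y \<in> NCP2 S" "ncp2_le S x y"
  shows "fst y = insert D (singles (A \<union> B)) \<longleftrightarrow> fst (B.\<psi> y) = singles B \<and> fst (D.\<psi> y) = {D}"
proof
  assume f: "fst y = insert D (singles (A \<union> B))"
  show "fst (B.\<psi> y) = singles B \<and> fst (D.\<psi> y) = {D}"
    unfolding B.fst_above[OF y] D.fst_above[OF y] f using disj Dne by auto
next
  assume "fst (B.\<psi> y) = singles B \<and> fst (D.\<psi> y) = {D}"
  then have "fst y = singles A \<union> singles B \<union> {D}" using fst_decomp[OF y] by (simp only:)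
  then show "fst y = insert D (singles (A \<union> B))" by auto
qed

context
  fixes y t
  assumes y: "y \<in> NCP2 S" and xy: "ncp2_le S x y" and fst_y: "fst y = insert D (singles (A \<union> B))"
    and t: "t \<notin> A" "t \<notin> B"
begin

lemma y_below: "below (A \<union> B) t D y"
  using fin y fst_y S t disj Dne by unfold_locales auto

lemma par_below: "s \<notin> A \<Longrightarrow> s \<noteq> t \<Longrightarrow> below (insert t A) s B (proj_below (A \<union> B) t D y x)"
proof -
  assume s: "s \<notin> A" "s \<noteq> t"
  interpret Y: below "A \<union> B" t D y by (rule y_below)
  have x': "x \<in> NCP2 (A \<union> B \<union> D)" "ncp2_le (A \<union> B \<union> D) x y" using x xy S by simp_all
  show ?thesis
  proof
    show "finite (insert t A)" "finite B" using fin S by simp_all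
    show "Y.\<phi> x \<in> NCP2 (insert t A \<union> B)" using Y.below_NCP2[OF x'] by simp
    have 1: "colq D t ` B = B" "colq D t ` D = {t}" "(`) (colq D t) ` singles A = singles A"
      using disj Dne by (force simp: image_image)+
    show "fst (Y.\<phi> x) = insert B (singles (insert t A))"
      unfolding Y.fst_below[OF x'] fst_x image_insert 1 by (simp add: insert_commute)
  qed (use disj t s Bne in auto)
qed

text \<open>The element \<open>y\<close> has disappeared from the right-hand side, and the two
  insertions play symmetric parts there; this lets both orders of composition be compared.\<close>

lemma par_u_J:
  assumes s: "s \<notin> A" "s \<noteq> t" and z: "z \<in> NCP2 S" "ncp2_le S z x"
  shows "J (proj_below (insert t A) s B (proj_below (A \<union> B) t D y x) (proj_below (A \<union> B) t D y z))
    = (`) (map_sum (\<lambda>a. if a \<in> B then s else if a \<in> D then t else a) (pos (posns x))) ` J z"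
   and "proj_below (insert t A) s B (proj_below (A \<union> B) t D y x) (proj_below (A \<union> B) t D y z) \<in> NCP2 (insert s (insert t A))"
proof -
  interpret Y: below "A \<union> B" t D y by (rule y_below)
  have x': "x \<in> NCP2 (A \<union> B \<union> D)" "ncp2_le (A \<union> B \<union> D) x y" using x xy S by simp_all
  have z': "z \<in> NCP2 (A \<union> B \<union> D)" "ncp2_le (A \<union> B \<union> D) z x" using z S by simp_all
  interpret X: below "insert t A" s B "Y.\<phi> x" by (rule par_below[OF s])
  have zy: "ncp2_le (A \<union> B \<union> D) z y" using NCP2_le_trans[OF fin z(1) x y z(2) xy] S by simp
  have un: "insert t A \<union> B = insert t (A \<union> B)" by simp
  show "J (X.\<phi> (Y.\<phi> z)) = (`) (map_sum (\<lambda>a. if a \<in> B then s else if a \<in> D then t else a) (pos (posns x))) ` J z"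
    unfolding J_below_below[OF y_below x' z' par_below[OF s] un]
    by (intro image_image_cong map_sum_image_cong) (use disj t in auto)
  have z2: "Y.\<phi> z \<in> NCP2 (insert t A \<union> B)" unfolding un by (rule Y.below_NCP2[OF z'(1) zy])
  have le2: "ncp2_le (insert t A \<union> B) (Y.\<phi> z) (Y.\<phi> x)" unfolding un by (rule Y.below_mono[OF z'(1) zy x' z'(2)])
  show "X.\<phi> (Y.\<phi> z) \<in> NCP2 (insert s (insert t A))" by (rule X.below_NCP2[OF z2 le2])
qed

text \<open>The blocks of \<open>y\<close> with positions in \<open>B.F\<close> are singletons, so
  the collapse along \<open>y\<close> merely renames those positions in increasing order.\<close>

lemma par_v:
  assumes z: "z \<in> NCP2 S" "ncp2_le S x z" "ncp2_le S z y"
  shows "proj_above B (proj_below (A \<union> B) t D y x) (proj_below (A \<union> B) t D y z) = B.\<psi> z"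
proof -
  interpret Y: below "A \<union> B" t D y by (rule y_below)
  have x': "x \<in> NCP2 (A \<union> B \<union> D)" using x S by simp
  have z': "z \<in> NCP2 (A \<union> B \<union> D)" "ncp2_le (A \<union> B \<union> D) x z" "ncp2_le (A \<union> B \<union> D) z y" using z S by simp_all
  have q: "colq D t ` B = B" using disj by force
  note L = J_above_below[OF y_below x' z' B.B, unfolded q]
  have pF: "partition_on B.F {R\<in>posns y. R \<subseteq> B.F}"
    by (rule partition_restrict_block[OF NC_D(2)[OF B.xNC] NC_D(2)[OF NCP2_D[OF y]] B.crsD(2)[OF y xy] asg_in[OF B.xNC B.B]])
  have R1: "R = {j}" if R: "R \<in> posns y" "R \<subseteq> B.F" "j \<in> R" for R j
  proof -
    obtain T where T: "T \<in> fst y" "R = asg y T" using R(1) unfolding asg_image[OF NCP2_D[OF y], symmetric] by blast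
    have "T \<subseteq> B" using B.crsD(4)[OF y xy B.B T(1)] T(2) R(2) by blast
    moreover have "T \<noteq> D" using \<open>T \<subseteq> B\<close> disj Dne by blast
    ultimately obtain b where "T = {b}" using T(1) unfolding fst_y by blast
    then have "card R = 1" using NC_D(6)[OF NCP2_D[OF y] T(1)] T(2) by simp
    then show ?thesis using R(3) by (auto simp: card_1_singleton_iff)
  qed
  have sing: "{R\<in>posns y. R \<subseteq> B.F} = singles B.F"
  proof
    show "{R\<in>posns y. R \<subseteq> B.F} \<subseteq> singles B.F"
    proof
      fix R assume R: "R \<in> {R\<in>posns y. R \<subseteq> B.F}"
      obtain j where "j \<in> R" using partition_ne[OF pF R] by blast
      then show "R \<in> singles B.F" using R1[of R j] R by blast
    qed
    show "singles B.F \<subseteq> {R\<in>posns y. R \<subseteq> B.F}"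
    proof
      fix R assume "R \<in> singles B.F"
      then obtain j where j: "j \<in> B.F" "R = {j}" by blast
      obtain R' where R': "R' \<in> {R\<in>posns y. R \<subseteq> B.F}" "j \<in> R'" using partition_ex[OF pF j(1)] by blast
      then have "R' = R" using R1[of R' j] j by blast
      then show "R \<in> {R\<in>posns y. R \<subseteq> B.F}" using R' by simp
    qed
  qed
  have k: "rk (Min ` {R\<in>posns y. R \<subseteq> B.F}) (Min (blk (posns y) j)) = rk B.F j" if j: "j \<in> B.F" for j
  proof -
    have "{j} \<in> posns y" using sing j by blast
    then have "blk (posns y) j = {j}" by (rule blk_eq[OF NC_D(2)[OF NCP2_D[OF y]]]) simp
    then show ?thesis unfolding sing by (simp add: image_image)
  qed
  show ?thesis
  proof (rule NCP2_J_inj[OF L(1) B.above_NCP2[OF z(1,2)]])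
    show "J (proj_above B (Y.\<phi> x) (Y.\<phi> z)) = J (B.\<psi> z)"
      unfolding L(2) B.J_above[OF z(1,2)]
    proof (intro image_image_cong map_sum_image_cong)
      fix Z a assume "Z \<in> {Z\<in>J z. Z \<subseteq> B <+> B.F}" "Inl a \<in> Z"
      then have "a \<in> B" by blast
      then show "colq D t a = id a" using disj by auto
    next
      fix Z i assume "Z \<in> {Z\<in>J z. Z \<subseteq> B <+> B.F}" "Inr i \<in> Z"
      then have "i \<in> B.F" by blast
      then show "rk (Min ` {R\<in>posns y. R \<subseteq> B.F}) (Min (blk (posns y) i)) = rk B.F i" by (rule k)
    qed
  qed
qed

text \<open>The block \<open>D\<close> belongs to \<open>x\<close> and to \<open>y\<close>; its
  positions for \<open>y\<close> are contained in those for \<open>x\<close> and equally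
  many.\<close>

lemma par_w:
  assumes z: "z \<in> NCP2 S" "ncp2_le S y z"
  shows "proj_above D y z = D.\<psi> z"
proof -
  interpret Y: above S D y using fin y fst_y by unfold_locales auto
  have "Y.F \<subseteq> D.F" by (rule D.crsD(3)[OF y xy D.B Y.B]) simp
  then have "Y.F = D.F" using card_subset_eq[OF D.finF] Y.cardF D.cardF by simp
  then show ?thesis by (cases x; cases y; cases z) simp
qed

end

end

lemma par_fst_iff:
  assumes b: "below (A \<union> B) t D y" and disj: "A \<inter> B = {}" and x: "x \<in> NCP2 (A \<union> B \<union> D)" "ncp2_le (A \<union> B \<union> D) x y"
  shows "fst (proj_below (A \<union> B) t D y x) = insert B (singles (insert t A)) \<longleftrightarrow> fst x = insert B (insert D (singles A))"
proof -
  interpret Y: below "A \<union> B" t D y by fact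
  have t: "t \<notin> A" "t \<notin> B" "A \<inter> D = {}" "B \<inter> D = {}" using Y.s Y.disj by auto
  have 1: "{a \<in> A \<union> B \<union> D. colq D t a \<in> B} = B" "{a \<in> A \<union> B \<union> D. colq D t a \<in> {t}} = D" using disj t by auto
  have 2: "{a' \<in> A \<union> B \<union> D. colq D t a' \<in> {a}} = {a}" if "a \<in> A" for a using that disj t by auto
  have "(\<lambda>U. {a\<in>A \<union> B \<union> D. colq D t a \<in> U}) ` singles A = singles A"
    unfolding image_image using 2 by (rule image_cong[OF refl])
  then have "(\<lambda>U. {a\<in>A \<union> B \<union> D. colq D t a \<in> U}) ` insert B (singles (insert t A)) = insert B (insert D (singles A))"
    unfolding image_insert 1 by simp
  moreover have "U \<subseteq> insert t (A \<union> B)" if "U \<in> insert B (singles (insert t A))" for U using that by auto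
  ultimately show ?thesis using Y.fst_below_eq[OF x, of "insert B (singles (insert t A))"] by simp
qed

section \<open>Partial compositions of cochains\<close>

lemma del_del: "i \<le> j \<Longrightarrow> Suc j < length zs \<Longrightarrow> del j (del i zs) = del i (del (Suc j) zs)"
  by (rule nth_equalityI) (auto simp: length_del nth_del)

lemma cochains_support: "u \<in> cochains P le k \<Longrightarrow> u xs \<noteq> 0 \<Longrightarrow> xs \<in> full_chains P le \<and> int (length xs) = k + 1"
  by (auto simp: cochains_def)

context finite_poset
begin

text \<open>Two deletions can be made in either order, with one index shifted by 1, so the terms
  cancel in pairs.\<close>

lemma codiff_codiff:
  fixes u :: "'p list \<Rightarrow> 'k::{comm_ring, comm_monoid_mult}"
  assumes u: "u \<in> cochains P le k"
  shows "codiff P le (codiff P le u) = 0"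
proof (rule ext)
  fix zs
  let ?f = "\<lambda>i j. (-1 :: 'k) ^ (i + j) * u (del j (del i zs))"
  have uF: "\<And>xs. u xs \<noteq> 0 \<Longrightarrow> xs \<in> full_chains P le" using cochains_support[OF u] by blast
  have duF: "\<And>xs. codiff P le u xs \<noteq> 0 \<Longrightarrow> xs \<in> full_chains P le"
    using cochains_support[OF codiff_cochains[OF u]] by blast
  show "codiff P le (codiff P le u) zs = 0 zs"
  proof (cases "zs \<in> full_chains P le")
    case False
    then show ?thesis using codiff_apply[of "codiff P le u", OF duF] by simp
  next
    case True
    define N where "N = length zs - 2"
    have "codiff P le (codiff P le u) zs = (\<Sum>i\<in>{1..<length zs - 1}. (-1)^i * codiff P le u (del i zs))"
      using codiff_apply[of "codiff P le u", OF duF] True by simp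
    also have "\<dots> = (\<Sum>i\<in>{1..<Suc N}. \<Sum>j\<in>{1..<N}. ?f i j)"
    proof (rule sum.cong)
      show "{1..<length zs - 1} = {1..<Suc N}" by (auto simp: N_def)
      fix i assume "i \<in> {1..<Suc N}"
      then have i: "1 \<le> i" "Suc i < length zs" by (auto simp: N_def)
      have "length (del i zs) - 1 = N" using i by (simp add: length_del N_def)
      then have "codiff P le u (del i zs) = (\<Sum>j\<in>{1..<N}. (-1)^j * u (del j (del i zs)))"
        using codiff_apply[of u "del i zs", OF uF] full_chains_del[OF True i] by simp
      then show "(-1)^i * codiff P le u (del i zs) = (\<Sum>j\<in>{1..<N}. ?f i j)"
        by (simp add: sum_distrib_left power_add mult.assoc)
    qed
    also have "\<dots> = (\<Sum>(i,j)\<in>{1..<Suc N} \<times> {1..<N}. ?f i j)" by (simp add: sum.cartesian_product)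
    also have "{1..<Suc N} \<times> {1..<N} = {(i,j). 1 \<le> j \<and> j < i \<and> i \<le> N} \<union> {(i,j). 1 \<le> i \<and> i \<le> j \<and> j < N}"
      by auto
    also have "(\<Sum>(i,j)\<in>\<dots>. ?f i j) = (\<Sum>(i,j)\<in>{(i,j). 1 \<le> j \<and> j < i \<and> i \<le> N}. ?f i j) + (\<Sum>(i,j)\<in>{(i,j). 1 \<le> i \<and> i \<le> j \<and> j < N}. ?f i j)"
    proof (rule sum.union_disjoint)
      have "finite ({..N} \<times> {..N})" by simp
      then show "finite {(i,j). 1 \<le> j \<and> j < i \<and> i \<le> N}" by (rule rev_finite_subset) auto
      have "finite ({..N} \<times> {..N})" by simp
      then show "finite {(i,j). 1 \<le> i \<and> i \<le> j \<and> j < N}" by (rule rev_finite_subset) auto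
    qed auto
    \<comment> \<open>The pair \<open>(i, j)\<close> with \<open>j < i\<close> is matched with
      \<open>(j, i - 1)\<close>, as in \<open>del_del\<close>; the sum of the exponents changes by
      one.\<close>
    also have "(\<Sum>(i,j)\<in>{(i,j). 1 \<le> j \<and> j < i \<and> i \<le> N}. ?f i j) = (\<Sum>(i,j)\<in>{(i,j). 1 \<le> i \<and> i \<le> j \<and> j < N}. - ?f i j)"
    proof (rule sum.reindex_bij_witness[where i = "\<lambda>(i,j). (Suc j, i)" and j = "\<lambda>(i,j). (j, i - 1)"])
      fix a assume "a \<in> {(i,j). 1 \<le> j \<and> j < i \<and> i \<le> N}"
      then obtain i j where a: "a = (i,j)" "1 \<le> j" "j < i" "i \<le> N" by auto
      then obtain i' where i': "i = Suc i'" by (cases i) auto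
      have "del i' (del j zs) = del j (del (Suc i') zs)" using a i' by (intro del_del) (auto simp: N_def)
      then show "(case (case a of (i, j) \<Rightarrow> (j, i - 1)) of (i, j) \<Rightarrow> - ?f i j) = (case a of (i, j) \<Rightarrow> ?f i j)"
        unfolding a i' by (simp add: minus_mult_left[symmetric] add.commute)
    qed auto
    finally show ?thesis by (simp add: sum_negf case_prod_unfold)
  qed
qed

lemma coboundary_cocycle:
  "u \<in> coboundaries P le k \<Longrightarrow> u \<in> cocycles P le k"
proof -
  assume "u \<in> coboundaries P le k"
  then obtain w where w: "w \<in> cochains P le (k - 1)" "u = codiff P le w" by (auto simp: coboundaries_def)
  show ?thesis using codiff_cochains[OF w(1)] codiff_codiff[OF w(1)] w(2) by (simp add: cocycles_def)
qed

lemma chain_le: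
  assumes "sorted_wrt (strict le) zs" "set zs \<subseteq> P" "i \<le> j" "j < length zs"
  shows "le (zs ! i) (zs ! j)"
proof (cases "i = j")
  case True
  then show ?thesis using assms le_refl nth_mem by blast
next
  case False
  then show ?thesis using sorted_wrt_nth_less[OF assms(1)] assms(3,4) by (auto simp: strict_def)
qed

end

abbreviation FC :: "'a set \<Rightarrow> 'a ncp2 list set" where
  "FC S \<equiv> full_chains (NCP2 S) (ncp2_le S)"

abbreviation CC :: "'a set \<Rightarrow> int \<Rightarrow> ('a ncp2 list \<Rightarrow> 'k::{comm_ring, comm_monoid_mult}) set" where
  "CC S k \<equiv> cochains (NCP2 S) (ncp2_le S) k"

abbreviation dC :: "'a set \<Rightarrow> ('a ncp2 list \<Rightarrow> 'k) \<Rightarrow> 'a ncp2 list \<Rightarrow> 'k::{comm_ring, comm_monoid_mult}" where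
  "dC S \<equiv> codiff (NCP2 S) (ncp2_le S)"

text \<open>Fullness is left out because the projections of the parts of a chain are readily seen to
  be strict chains, while their fullness would be a further claim.\<close>

definition chain :: "'a set \<Rightarrow> 'a ncp2 list \<Rightarrow> bool" where
  "chain S zs \<longleftrightarrow> sorted_wrt (strict (ncp2_le S)) zs \<and> set zs \<subseteq> NCP2 S"

lemma FC_chain: "zs \<in> FC S \<Longrightarrow> chain S zs"
  by (auto simp: full_chains_def chain_def)

lemma FC_hd_min: "zs \<in> FC S \<Longrightarrow> y \<in> NCP2 S \<Longrightarrow> \<not> strict (ncp2_le S) y (hd zs)"
  unfolding full_chains_def by blast

lemma FC_last_max: "zs \<in> FC S \<Longrightarrow> y \<in> NCP2 S \<Longrightarrow> \<not> strict (ncp2_le S) (last zs) y"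
  unfolding full_chains_def by blast

lemma FC_I: "chain S zs \<Longrightarrow> zs \<noteq> [] \<Longrightarrow> (\<And>y. y \<in> NCP2 S \<Longrightarrow> \<not> strict (ncp2_le S) y (hd zs)) \<Longrightarrow>
  (\<And>y. y \<in> NCP2 S \<Longrightarrow> \<not> strict (ncp2_le S) (last zs) y) \<Longrightarrow> zs \<in> FC S"
  unfolding full_chains_def chain_def by blast

lemma chain_mem: "chain S zs \<Longrightarrow> i < length zs \<Longrightarrow> zs ! i \<in> NCP2 S"
  by (auto simp: chain_def)

lemma chain_nth_le: "finite S \<Longrightarrow> chain S zs \<Longrightarrow> i \<le> j \<Longrightarrow> j < length zs \<Longrightarrow> ncp2_le S (zs ! i) (zs ! j)"
  unfolding chain_def using finite_poset.chain_le[OF finite_poset_NCP2] by blast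

lemma chain_take: "chain S zs \<Longrightarrow> chain S (take n zs)"
  unfolding chain_def by (auto dest: in_set_takeD intro: sorted_wrt_take)

lemma chain_drop: "chain S zs \<Longrightarrow> chain S (drop n zs)"
  unfolding chain_def by (auto dest: in_set_dropD intro: sorted_wrt_drop)

lemma chain_take_le:
  assumes "finite S" "chain S zs" "k < length zs" "z \<in> set (take (Suc k) zs)"
  shows "z \<in> NCP2 S" "ncp2_le S z (zs ! k)"
proof -
  obtain j where j: "j < Suc k" "j < length zs" "z = zs ! j" using assms(4) by (rule in_set_take_nth)
  show "z \<in> NCP2 S" using chain_mem[OF assms(2) j(2)] j by simp
  show "ncp2_le S z (zs ! k)" using chain_nth_le[OF assms(1,2) _ assms(3), of j] j by simp
qed

lemma chain_drop_ge:
  assumes "finite S" "chain S zs" "z \<in> set (drop k zs)"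
  shows "z \<in> NCP2 S" "ncp2_le S (zs ! k) z"
proof -
  obtain j where j: "k \<le> j" "j < length zs" "z = zs ! j" using assms(3) by (rule in_set_drop_nth)
  show "z \<in> NCP2 S" using chain_mem[OF assms(2) j(2)] j by simp
  show "ncp2_le S (zs ! k) z" using chain_nth_le[OF assms(1,2) j(1,2)] j by simp
qed

lemma chain_map:
  assumes "chain S zs" "\<And>z. z \<in> set zs \<Longrightarrow> f z \<in> NCP2 S'"
    "\<And>z z'. z \<in> set zs \<Longrightarrow> z' \<in> set zs \<Longrightarrow> strict (ncp2_le S) z z' \<Longrightarrow> strict (ncp2_le S') (f z) (f z')"
  shows "chain S' (map f zs)"
  using assms unfolding chain_def sorted_wrt_map
  by (auto intro: sorted_wrt_mono_rel[of zs "strict (ncp2_le S)"])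

lemma chain_dC:
  assumes "finite S" "u \<in> CC S k" "chain S zs"
  shows "(\<Sum>i\<in>{1..<length zs - 1}. (-1) ^ i * u (del i zs)) = dC S u zs"
proof -
  interpret finite_poset "NCP2 S" "ncp2_le S" by (rule finite_poset_NCP2[OF assms(1)])
  show ?thesis using assms(3) cochains_support[OF assms(2)] unfolding chain_def by (intro codiff_apply_sorted) auto
qed

section \<open>Evaluation of compositions and the Leibniz rule\<close>

locale comp_sets =
  fixes A B :: "'a set" and s :: 'a
  assumes finA: "finite A" and finB: "finite B" and disj: "A \<inter> B = {}" and Bne: "B \<noteq> {}" and s: "s \<notin> A"
begin

abbreviation "tp \<equiv> insert B (singles A)"

lemma finS: "finite (A \<union> B)" using finA finB by simp

lemma below_x: "x \<in> NCP2 (A \<union> B) \<Longrightarrow> fst x = tp \<Longrightarrow> below A s B x"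
  using finA finB disj Bne s by unfold_locales

lemma above_x: "x \<in> NCP2 (A \<union> B) \<Longrightarrow> fst x = tp \<Longrightarrow> above (A \<union> B) B x"
  using finS by unfold_locales auto

text \<open>All blocks of \<open>x\<close> other than \<open>B\<close> are singletons, over which
  nothing can change; hence the projection to \<open>B\<close> alone is injective here.\<close>

lemma above_strict:
  assumes x: "x \<in> NCP2 (A \<union> B)" "fst x = tp"
    and z: "z \<in> NCP2 (A \<union> B)" "ncp2_le (A \<union> B) x z" and z': "z' \<in> NCP2 (A \<union> B)" "ncp2_le (A \<union> B) x z'"
    and lt: "strict (ncp2_le (A \<union> B)) z z'"
  shows "strict (ncp2_le B) (proj_above B x z) (proj_above B x z')"
proof -
  interpret X: above "A \<union> B" B x by (rule above_x[OF x])
  have "X.\<psi> z \<noteq> X.\<psi> z'"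
  proof
    assume eq: "X.\<psi> z = X.\<psi> z'"
    have "z = z'"
    proof (rule above_joint_inj[OF finS x(1) z z'])
      fix T assume T: "T \<in> fst x"
      show "proj_above T x z = proj_above T x z'"
      proof (cases "T = B")
        case False
        then obtain a where a: "T = {a}" using T x(2) by blast
        interpret T: above "A \<union> B" T x using finS x(1) T by unfold_locales
        show ?thesis
          using NCP2_singleton[OF T.above_NCP2[OF z, unfolded a]] NCP2_singleton[OF T.above_NCP2[OF z', unfolded a]] a by simp
      qed (use eq in simp)
    qed
    then show False using lt by (simp add: strict_def)
  qed
  then show ?thesis using X.above_mono[OF z z'] lt by (simp add: strict_def)
qed

lemma chain_below:
  assumes zs: "chain (A \<union> B) zs" "k < length zs" "fst (zs ! k) = tp"
  shows "chain (insert s A) (map (proj_below A s B (zs ! k)) (take (Suc k) zs))"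
proof -
  interpret X: below A s B "zs ! k" by (rule below_x[OF chain_mem[OF zs(1,2)] zs(3)])
  note le = chain_take_le[OF finS zs(1,2)]
  show ?thesis
  proof (rule chain_map[OF chain_take[OF zs(1)]])
    show "X.\<phi> z \<in> NCP2 (insert s A)" if z: "z \<in> set (take (Suc k) zs)" for z
      by (rule X.below_NCP2[OF le[OF z]])
    show "strict (ncp2_le (insert s A)) (X.\<phi> z) (X.\<phi> z')"
      if z: "z \<in> set (take (Suc k) zs)" "z' \<in> set (take (Suc k) zs)" "strict (ncp2_le (A \<union> B)) z z'" for z z'
      by (rule X.below_strict[OF le[OF z(1)] le[OF z(2)] z(3)])
  qed
qed

lemma chain_above:
  assumes zs: "chain (A \<union> B) zs" "k < length zs" "fst (zs ! k) = tp"
  shows "chain B (map (proj_above B (zs ! k)) (drop k zs))"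
proof -
  interpret X: above "A \<union> B" B "zs ! k" by (rule above_x[OF chain_mem[OF zs(1,2)] zs(3)])
  note le = chain_drop_ge[OF finS zs(1)]
  show ?thesis
  proof (rule chain_map[OF chain_drop[OF zs(1)]])
    show "X.\<psi> z \<in> NCP2 B" if z: "z \<in> set (drop k zs)" for z
      by (rule X.above_NCP2[OF le[OF z]])
    show "strict (ncp2_le B) (X.\<psi> z) (X.\<psi> z')"
      if z: "z \<in> set (drop k zs)" "z' \<in> set (drop k zs)" "strict (ncp2_le (A \<union> B)) z z'" for z z'
      by (rule above_strict[OF X.x zs(3) le[OF z(1)] le[OF z(2)] z(3)])
  qed
qed

text \<open>The degree of \<open>u\<close> fixes the index \<open>k\<close> at which a chain is cut,
  so only \<open>zs ! k\<close> contributes to the sum over \<open>x\<close>.\<close>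

lemma circ_apply:
  fixes u v :: "'a ncp2 list \<Rightarrow> 'k::{comm_ring, comm_monoid_mult}"
  assumes u: "u \<in> CC (insert s A) (int k)" and v: "v \<in> CC B l"
  shows "circ_cochain A s B u v zs = (if zs \<in> FC (A \<union> B) \<and> k < length zs \<and> fst (zs ! k) = tp
    then u (map (proj_below A s B (zs ! k)) (take (Suc k) zs)) * v (map (proj_above B (zs ! k)) (drop k zs)) else 0)"
proof -
  let ?P = "NCP2 (A \<union> B)" and ?le = "ncp2_le (A \<union> B)"
  let ?X = "{x\<in>?P. fst x = tp}"
  interpret P: finite_poset ?P ?le by (rule finite_poset_NCP2[OF finS])
  have Q: "finite_poset (NCP2 (insert s A)) (ncp2_le (insert s A))" using finA by (intro finite_poset_NCP2) simp
  have R: "finite_poset (NCP2 B) (ncp2_le B)" using finB by (intro finite_poset_NCP2)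
  have fX: "finite ?X" using P.fin by simp
  define pu where "pu x = pullback {y\<in>?P. ?le y x} ?le (NCP2 (insert s A)) (ncp2_le (insert s A)) (proj_below A s B x) u" for x
  define pv where "pv x = pullback {y\<in>?P. ?le x y} ?le (NCP2 B) (ncp2_le B) (proj_above B x) v" for x
  have pu: "pu x us = (if us \<in> full_chains {y\<in>?P. ?le y x} ?le then u (map (proj_below A s B x) us) else 0)" for x us
    unfolding pu_def using cochains_support[OF u] by (intro pullback_apply[OF P.finite_poset_subset Q]) auto
  have pv: "pv x vs = (if vs \<in> full_chains {y\<in>?P. ?le x y} ?le then v (map (proj_above B x) vs) else 0)" for x vs
    unfolding pv_def using cochains_support[OF v] by (intro pullback_apply[OF P.finite_poset_subset R]) auto
  have "circ_cochain A s B u v zs = (\<Sum>x\<in>?X. concat_at ?P ?le x (pu x) (pv x) zs)"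
    unfolding circ_cochain_def Let_def sum_fun_apply pu_def pv_def ..
  also have "\<dots> = (\<Sum>x\<in>?X. if zs ! k = x then (if zs \<in> FC (A \<union> B) \<and> k < length zs
       then pu (zs ! k) (take (Suc k) zs) * pv (zs ! k) (drop k zs) else 0) else 0)"
  proof (rule sum.cong[OF refl])
    fix x assume x: "x \<in> ?X"
    have len: "length us = Suc k" if "pu x us \<noteq> 0" for us
    proof -
      have "u (map (proj_below A s B x) us) \<noteq> 0" using that unfolding pu by (auto split: if_splits)
      then show ?thesis using cochains_support[OF u] by fastforce
    qed
    show "concat_at ?P ?le x (pu x) (pv x) zs = (if zs ! k = x then (if zs \<in> FC (A \<union> B) \<and> k < length zs
       then pu (zs ! k) (take (Suc k) zs) * pv (zs ! k) (drop k zs) else 0) else 0)"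
      using P.concat_at_apply[of x "pu x" k "pv x" zs] x len by auto
  qed
  also have "\<dots> = (if zs ! k \<in> ?X then (if zs \<in> FC (A \<union> B) \<and> k < length zs
       then pu (zs ! k) (take (Suc k) zs) * pv (zs ! k) (drop k zs) else 0) else 0)"
    by (rule sum.delta'[OF fX])
  also have "\<dots> = (if zs \<in> FC (A \<union> B) \<and> k < length zs \<and> fst (zs ! k) = tp
    then u (map (proj_below A s B (zs ! k)) (take (Suc k) zs)) * v (map (proj_above B (zs ! k)) (drop k zs)) else 0)"
    using pu[of "zs ! k" "take (Suc k) zs"] pv[of "zs ! k" "drop k zs"]
      P.full_chain_takeI[of zs k] P.full_chain_dropI[of zs k] chain_mem[OF FC_chain, of zs "A \<union> B" k] by auto
  finally show ?thesis .
qed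

text \<open>Fullness of the two parts is automatic, because strictly monotone maps reflect it.\<close>

lemma circ_apply_chain:
  fixes u v :: "'a ncp2 list \<Rightarrow> 'k::{comm_ring, comm_monoid_mult}"
  assumes u: "u \<in> CC (insert s A) (int k)" and v: "v \<in> CC B l" and zs: "chain (A \<union> B) zs"
  shows "circ_cochain A s B u v zs = (if k < length zs \<and> fst (zs ! k) = tp
    then u (map (proj_below A s B (zs ! k)) (take (Suc k) zs)) * v (map (proj_above B (zs ! k)) (drop k zs)) else 0)"
proof (cases "k < length zs \<and> fst (zs ! k) = tp \<and> zs \<notin> FC (A \<union> B)")
  case True
  let ?x = "zs ! k"
  have x: "?x \<in> NCP2 (A \<union> B)" "fst ?x = tp" using chain_mem[OF zs] True by auto
  interpret X: below A s B ?x by (rule below_x[OF x])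
  have "u (map (proj_below A s B ?x) (take (Suc k) zs)) * v (map (proj_above B ?x) (drop k zs)) = 0"
  proof (rule ccontr)
    assume nz: "\<not> ?thesis"
    then have "u (map (proj_below A s B ?x) (take (Suc k) zs)) \<noteq> 0" "v (map (proj_above B ?x) (drop k zs)) \<noteq> 0" by auto
    then have F: "map (proj_below A s B ?x) (take (Suc k) zs) \<in> FC (insert s A)" "map (proj_above B ?x) (drop k zs) \<in> FC B"
      using cochains_support[OF u] cochains_support[OF v] by blast+
    have ne: "zs \<noteq> []" using True by auto
    have hd: "hd zs = zs ! 0" using ne by (simp add: hd_conv_nth)
    have la: "last zs = zs ! (length zs - 1)" using ne by (simp add: last_conv_nth)
    have h0: "ncp2_le (A \<union> B) (hd zs) ?x" "hd zs \<in> NCP2 (A \<union> B)" unfolding hd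
      using chain_nth_le[OF finS zs, of 0 k] chain_mem[OF zs, of 0] True ne by simp_all
    have l0: "ncp2_le (A \<union> B) ?x (last zs)" "last zs \<in> NCP2 (A \<union> B)" unfolding la
      using chain_nth_le[OF finS zs, of k "length zs - 1"] chain_mem[OF zs, of "length zs - 1"] True by auto
    have "\<not> strict (ncp2_le (A \<union> B)) w (hd zs)" if w: "w \<in> NCP2 (A \<union> B)" for w
    proof
      assume lt: "strict (ncp2_le (A \<union> B)) w (hd zs)"
      then have wx: "ncp2_le (A \<union> B) w ?x" using NCP2_le_trans[OF finS w h0(2) x(1) _ h0(1)] by (simp add: strict_def)
      have "hd (map X.\<phi> (take (Suc k) zs)) = X.\<phi> (hd zs)" using ne by (simp add: hd_map)
      then show False using FC_hd_min[OF F(1) X.below_NCP2[OF w wx]] X.below_strict[OF w wx h0(2,1) lt] by simp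
    qed
    moreover have "\<not> strict (ncp2_le (A \<union> B)) (last zs) w" if w: "w \<in> NCP2 (A \<union> B)" for w
    proof
      assume lt: "strict (ncp2_le (A \<union> B)) (last zs) w"
      then have wx: "ncp2_le (A \<union> B) ?x w" using NCP2_le_trans[OF finS x(1) l0(2) w l0(1)] by (simp add: strict_def)
      have "last (map (proj_above B ?x) (drop k zs)) = proj_above B ?x (last zs)" using True by (simp add: last_map)
      then show False
        using FC_last_max[OF F(2) above.above_NCP2[OF above_x[OF x] w wx]] above_strict[OF x l0(2,1) w wx lt] by simp
    qed
    ultimately have "zs \<in> FC (A \<union> B)" by (rule FC_I[OF zs ne])
    then show False using True by simp
  qed
  then show ?thesis using True by (simp add: circ_apply[OF u v])
next
  case False
  then show ?thesis by (auto simp: circ_apply[OF u v])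
qed

lemma circ_CC:
  assumes u: "u \<in> CC (insert s A) (int k)" and v: "v \<in> CC B l"
  shows "circ_cochain A s B u v \<in> CC (A \<union> B) (int k + l)"
proof -
  have "zs \<in> FC (A \<union> B) \<and> int (length zs) = int k + l + 1" if "circ_cochain A s B u v zs \<noteq> 0" for zs
  proof -
    have z: "zs \<in> FC (A \<union> B)" "k < length zs" "v (map (proj_above B (zs ! k)) (drop k zs)) \<noteq> 0"
      using that unfolding circ_apply[OF u v] by (auto split: if_splits)
    have "int (length (drop k zs)) = l + 1" using cochains_support[OF v z(3)] by simp
    then show ?thesis using z(1,2) by (simp add: of_nat_diff)
  qed
  then show ?thesis by (auto simp: cochains_def)
qed

text \<open>Deleting an entry of index at most \<open>k\<close> moves the cut to
  \<open>zs ! Suc k\<close> and deletes inside the lower part. Deleting a later entry keeps the cut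
  and deletes inside the upper part, where the index is smaller by \<open>k\<close>, which gives the
  sign.\<close>

lemma leibniz:
  fixes u v :: "'a ncp2 list \<Rightarrow> 'k::{comm_ring, comm_monoid_mult}"
  assumes u: "u \<in> CC (insert s A) (int k)" and v: "v \<in> CC B l"
  shows "dC (A \<union> B) (circ_cochain A s B u v) = circ_cochain A s B (dC (insert s A) u) v
    + scale_fun ((-1) ^ k) (circ_cochain A s B u (dC B v))"
proof (rule ext)
  fix zs
  interpret P: finite_poset "NCP2 (A \<union> B)" "ncp2_le (A \<union> B)" by (rule finite_poset_NCP2[OF finS])
  interpret Q: finite_poset "NCP2 (insert s A)" "ncp2_le (insert s A)" using finA by (intro finite_poset_NCP2) simp
  interpret R: finite_poset "NCP2 B" "ncp2_le B" by (rule finite_poset_NCP2[OF finB])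
  have du: "dC (insert s A) u \<in> CC (insert s A) (int (Suc k))" using Q.codiff_cochains[OF u] by (simp add: add.commute)
  have dv: "dC B v \<in> CC B (l + 1)" by (rule R.codiff_cochains[OF v])
  let ?c = "circ_cochain A s B u v"
  have cF: "\<And>xs. ?c xs \<noteq> 0 \<Longrightarrow> xs \<in> FC (A \<union> B)" using cochains_support[OF circ_CC[OF u v]] by blast
  show "dC (A \<union> B) ?c zs = (circ_cochain A s B (dC (insert s A) u) v + scale_fun ((-1) ^ k) (circ_cochain A s B u (dC B v))) zs"
  proof (cases "zs \<in> FC (A \<union> B)")
    case False
    then show ?thesis using P.codiff_apply[of ?c, OF cF] circ_apply[OF du v] circ_apply[OF u dv] by simp
  next
    case True
    have ch: "chain (A \<union> B) zs" by (rule FC_chain[OF True])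
    have L: "dC (A \<union> B) ?c zs = (\<Sum>i\<in>{1..<length zs - 1}. (-1)^i * ?c (del i zs))"
      using P.codiff_apply[of ?c, OF cF] True by simp
    \<comment> \<open>In a shorter chain, a deletion leaves no entry at index \<open>k\<close>; the
      terms on the right vanish as well.\<close>
    show ?thesis
    proof (cases "Suc k < length zs")
      case False
      have z: "?c (del i zs) = 0" if "i \<in> {1..<length zs - 1}" for i
        using False that length_del[of i zs] by (auto simp: circ_apply[OF u v])
      then have 0: "dC (A \<union> B) ?c zs = 0" unfolding L by (intro sum.neutral) auto
      have 1: "circ_cochain A s B (dC (insert s A) u) v zs = 0" using False by (simp add: circ_apply[OF du v])
      have "dC B v (map (proj_above B (zs ! k)) (drop k zs)) = 0" if "k < length zs" "fst (zs ! k) = tp"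
        using chain_dC[OF finB v chain_above[OF ch that]] False that by simp
      then have 2: "circ_cochain A s B u (dC B v) zs = 0" by (simp add: circ_apply[OF u dv])
      show ?thesis using 0 1 2 by simp
    next
      case len: True
      have split: "{1..<length zs - 1} = {1..<Suc k} \<union> {Suc k..<length zs - 1}" using len by auto
      have "dC (A \<union> B) ?c zs = (\<Sum>i\<in>{1..<Suc k}. (-1)^i * ?c (del i zs)) + (\<Sum>i\<in>{Suc k..<length zs - 1}. (-1)^i * ?c (del i zs))"
        unfolding L split by (rule sum.union_disjoint) auto
      also have "(\<Sum>i\<in>{1..<Suc k}. (-1)^i * ?c (del i zs)) = circ_cochain A s B (dC (insert s A) u) v zs"
      proof (cases "fst (zs ! Suc k) = tp")
        case tpe: True
        let ?us = "map (proj_below A s B (zs ! Suc k)) (take (Suc (Suc k)) zs)"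
        let ?vs = "map (proj_above B (zs ! Suc k)) (drop (Suc k) zs)"
        have "?c (del i zs) = u (del i ?us) * v ?vs" if i: "i \<in> {1..<Suc k}" for i
        proof -
          have "del i zs \<in> FC (A \<union> B)" using i len by (intro P.full_chains_del[OF True]) auto
          moreover have "k < length (del i zs)" "del i zs ! k = zs ! Suc k" using i len by (auto simp: length_del nth_del)
          moreover have "take (Suc k) (del i zs) = del i (take (Suc (Suc k)) zs)" "drop k (del i zs) = drop (Suc k) zs"
            using i len by (auto simp: take_del_le drop_del_le)
          ultimately show ?thesis using tpe by (simp add: circ_apply[OF u v] map_del)
        qed
        then have "(\<Sum>i\<in>{1..<Suc k}. (-1)^i * ?c (del i zs)) = (\<Sum>i\<in>{1..<Suc k}. (-1)^i * u (del i ?us)) * v ?vs"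
          unfolding sum_distrib_right mult.assoc by (intro sum.cong refl) simp
        also have "(\<Sum>i\<in>{1..<Suc k}. (-1)^i * u (del i ?us)) = dC (insert s A) u ?us"
        proof -
          have "length ?us - 1 = Suc k" using len by simp
          then show ?thesis using chain_dC[OF _ u chain_below[OF ch len tpe]] finA by simp
        qed
        finally show ?thesis using True len tpe by (simp add: circ_apply[OF du v])
      next
        case False
        have "?c (del i zs) = 0" if i: "i \<in> {1..<Suc k}" for i
          using False i len by (simp add: circ_apply[OF u v] nth_del)
        then have "(\<Sum>i\<in>{1..<Suc k}. (-1)^i * ?c (del i zs)) = 0" by (intro sum.neutral) auto
        then show ?thesis using False by (simp add: circ_apply[OF du v])
      qed
      also have "(\<Sum>i\<in>{Suc k..<length zs - 1}. (-1)^i * ?c (del i zs)) = (-1)^k * circ_cochain A s B u (dC B v) zs"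
      proof (cases "fst (zs ! k) = tp")
        case tpe: True
        let ?us = "map (proj_below A s B (zs ! k)) (take (Suc k) zs)"
        let ?vs = "map (proj_above B (zs ! k)) (drop k zs)"
        have "?c (del i zs) = u ?us * v (del (i - k) ?vs)" if i: "i \<in> {Suc k..<length zs - 1}" for i
        proof -
          have "del i zs \<in> FC (A \<union> B)" using i len by (intro P.full_chains_del[OF True]) auto
          moreover have "k < length (del i zs)" "del i zs ! k = zs ! k" using i len by (auto simp: length_del nth_del)
          moreover have "take (Suc k) (del i zs) = take (Suc k) zs" "drop k (del i zs) = del (i - k) (drop k zs)"
            using i len by (auto simp: take_del_ge drop_del_ge)
          ultimately show ?thesis using tpe by (simp add: circ_apply[OF u v] map_del)
        qed
        then have "(\<Sum>i\<in>{Suc k..<length zs - 1}. (-1)^i * ?c (del i zs)) = (\<Sum>i\<in>{Suc k..<length zs - 1}. (-1)^i * (u ?us * v (del (i - k) ?vs)))"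
          by simp
        also have "\<dots> = (\<Sum>j\<in>{1..<length zs - k - 1}. (-1)^(j + k) * (u ?us * v (del j ?vs)))"
          by (rule sum.reindex_bij_witness[where i = "\<lambda>j. j + k" and j = "\<lambda>i. i - k"]) auto
        also have "\<dots> = (-1)^k * (u ?us * (\<Sum>j\<in>{1..<length zs - k - 1}. (-1)^j * v (del j ?vs)))"
          by (simp add: sum_distrib_left power_add mult.left_commute mult.commute mult.assoc)
        also have "(\<Sum>j\<in>{1..<length zs - k - 1}. (-1)^j * v (del j ?vs)) = dC B v ?vs"
          using chain_dC[OF finB v chain_above[OF ch _ tpe]] len by simp
        finally show ?thesis using True len tpe by (simp add: circ_apply[OF u dv])
      next
        case False
        have "?c (del i zs) = 0" if i: "i \<in> {Suc k..<length zs - 1}" for i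
        proof -
          have "del i zs ! k = zs ! k" using i by (subst nth_del) auto
          then show ?thesis using False by (simp add: circ_apply[OF u v])
        qed
        then have "(\<Sum>i\<in>{Suc k..<length zs - 1}. (-1)^i * ?c (del i zs)) = 0" by (intro sum.neutral) auto
        then show ?thesis using False by (simp add: circ_apply[OF u dv])
      qed
      finally show ?thesis by simp
    qed
  qed
qed

end


section \<open>Bilinearity and passage to cohomology classes\<close>

lemma pullback_add: "pullback P leP Q leQ f (u + v) = pullback P leP Q leQ f u + pullback P leP Q leQ f v"
  by (simp add: pullback_def lin_ext_add)

lemma pullback_scale: "pullback P leP Q leQ f (scale_fun c u) = scale_fun c (pullback P leP Q leQ f u)"
  by (simp add: pullback_def lin_ext_scale)

lemma circ_add_left: "circ_cochain A s B (u + u') v = circ_cochain A s B u v + circ_cochain A s B u' v"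
  by (rule ext) (simp add: circ_cochain_def Let_def concat_at_def sum_fun_apply pullback_add distrib_right distrib_left sum.distrib)

lemma circ_add_right: "circ_cochain A s B u (v + v') = circ_cochain A s B u v + circ_cochain A s B u v'"
  by (rule ext) (simp add: circ_cochain_def Let_def concat_at_def sum_fun_apply pullback_add distrib_right distrib_left sum.distrib)

lemma circ_scale_left: "circ_cochain A s B (scale_fun c u) v = scale_fun c (circ_cochain A s B u v)"
  by (rule ext) (simp add: circ_cochain_def Let_def concat_at_def sum_fun_apply pullback_scale sum_distrib_left mult.assoc)

lemma circ_scale_right: "circ_cochain A s B u (scale_fun c v) = scale_fun c (circ_cochain A s B u v)"
  by (rule ext) (simp add: circ_cochain_def Let_def concat_at_def sum_fun_apply pullback_scale sum_distrib_left mult.assoc mult.left_commute)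

lemma scale_zero [simp]: "scale_fun 0 u = 0" and scale_one [simp]: "scale_fun 1 u = u"
  and scale_zero_right [simp]: "scale_fun c 0 = 0"
  by (rule ext; simp)+

lemma scale_scale: "scale_fun a (scale_fun b u) = scale_fun (a * b) u"
  by (rule ext) (simp add: mult.assoc)

lemma scale_add: "scale_fun a (u + v) = scale_fun a u + scale_fun a v"
  by (rule ext) (simp add: distrib_left)

lemma scale_neg: "scale_fun (- a) u = - scale_fun a u"
  by (rule ext) (simp add: minus_mult_left[symmetric])

lemma scale_diff: "scale_fun a (u - v) = scale_fun a u - scale_fun a v"
  by (rule ext) (simp add: right_diff_distrib)

lemma circ_zero_left: "circ_cochain A s B 0 v = 0"
  using circ_scale_left[of A s B 0 0 v] by simp

lemma circ_zero_right: "circ_cochain A s B u 0 = 0"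
  using circ_scale_right[of A s B u 0 0] by simp

lemma circ_diff_left: "circ_cochain A s B (u - u') v = circ_cochain A s B u v - circ_cochain A s B u' v"
  using circ_add_left[of A s B "u - u'" u' v] by simp

lemma circ_diff_right: "circ_cochain A s B u (v - v') = circ_cochain A s B u v - circ_cochain A s B u v'"
  using circ_add_right[of A s B u "v - v'" v'] by simp

abbreviation ZC :: "'a set \<Rightarrow> int \<Rightarrow> ('a ncp2 list \<Rightarrow> 'k::{comm_ring, comm_monoid_mult}) set" where
  "ZC S k \<equiv> cocycles (NCP2 S) (ncp2_le S) k"

lemma cochains_neg: "k < 0 \<Longrightarrow> u \<in> cochains P le k \<Longrightarrow> u = 0"
proof -
  assume k: "k < 0" and u: "u \<in> cochains P le k"
  show "u = 0"
  proof (rule ext, rule ccontr)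
    fix xs assume "u xs \<noteq> 0 xs"
    then have "xs \<in> full_chains P le" "int (length xs) = k + 1" using cochains_support[OF u] by auto
    then show False using k by (cases xs) (auto simp: full_chains_def)
  qed
qed

context comp_sets
begin

text \<open>The Leibniz rule needs the degree of the left factor as a natural number; in negative
  degrees there are no nonzero cochains.\<close>

lemma circ_ZC:
  assumes u: "u \<in> ZC (insert s A) k" and v: "v \<in> ZC B l"
  shows "circ_cochain A s B u v \<in> ZC (A \<union> B) (k + l)"
proof (cases "k < 0")
  case True
  then have "u = 0" using u cochains_neg unfolding cocycles_def by blast
  then show ?thesis
    using submodule.zero_mem[OF submodule_cochains] by (simp add: circ_zero_left cocycles_def codiff_zero)
next
  case False
  then obtain k' where k: "k = int k'" by (metis nonneg_int_cases not_less)
  have u': "u \<in> CC (insert s A) (int k')" "dC (insert s A) u = 0" and v': "v \<in> CC B l" "dC B v = 0"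
    using u v k by (auto simp: cocycles_def)
  show ?thesis using circ_CC[OF u'(1) v'(1)] leibniz[OF u'(1) v'(1)]
    by (simp add: cocycles_def k u'(2) v'(2) circ_zero_left circ_zero_right)
qed

lemma circ_hB_right:
  assumes u: "u \<in> ZC (insert s A) k" and v: "v \<in> hB B l"
  shows "circ_cochain A s B u v \<in> hB (A \<union> B) (k + l)"
proof (cases "k < 0")
  case True
  then have "u = 0" using u cochains_neg unfolding cocycles_def by blast
  then show ?thesis
    using submodule.zero_mem[OF submodule_coboundaries] by (simp add: circ_zero_left)
next
  case False
  then obtain k' where k: "k = int k'" by (metis nonneg_int_cases not_less)
  obtain w where w: "w \<in> CC B (l - 1)" "v = dC B w" using v by (auto simp: coboundaries_def)
  have u': "u \<in> CC (insert s A) (int k')" "dC (insert s A) u = 0" using u k by (auto simp: cocycles_def)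
  \<comment> \<open>The sign compensates the one in the Leibniz rule, whose other term vanishes
    because \<open>u\<close> is a cocycle.\<close>
  let ?w = "scale_fun ((-1) ^ k') (circ_cochain A s B u w)"
  have "circ_cochain A s B u w \<in> CC (A \<union> B) (k + l - 1)" using circ_CC[OF u'(1) w(1)] k by (simp add: algebra_simps)
  then have "?w \<in> CC (A \<union> B) (k + l - 1)" by (rule submodule.scale_mem[OF submodule_cochains])
  moreover have "dC (A \<union> B) ?w = circ_cochain A s B u v"
    using leibniz[OF u'(1) w(1)]
    by (simp add: codiff_scale u'(2) circ_zero_left w(2) scale_scale minus_one_power scale_neg)
  ultimately show ?thesis unfolding coboundaries_def by (metis image_eqI)
qed

lemma circ_hB_left:
  assumes u: "u \<in> hB (insert s A) k" and v: "v \<in> ZC B l"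
  shows "circ_cochain A s B u v \<in> hB (A \<union> B) (k + l)"
proof -
  obtain w where w: "w \<in> CC (insert s A) (k - 1)" "u = dC (insert s A) w" using u by (auto simp: coboundaries_def)
  show ?thesis
  proof (cases "k - 1 < 0")
    case True
    then have "u = 0" using w cochains_neg codiff_zero by metis
    then show ?thesis
      using submodule.zero_mem[OF submodule_coboundaries] by (simp add: circ_zero_left)
  next
    case False
    then obtain k' where k: "k - 1 = int k'" by (metis nonneg_int_cases not_less)
    have w': "w \<in> CC (insert s A) (int k')" using w(1) k by simp
    have v': "v \<in> CC B l" "dC B v = 0" using v by (auto simp: cocycles_def)
    have "circ_cochain A s B w v \<in> CC (A \<union> B) (k + l - 1)" using circ_CC[OF w' v'(1)] k by (simp add: algebra_simps)
    moreover have "dC (A \<union> B) (circ_cochain A s B w v) = circ_cochain A s B u v"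
      using leibniz[OF w' v'(1)] by (simp add: v'(2) circ_zero_right w(2))
    ultimately show ?thesis unfolding coboundaries_def by (metis image_eqI)
  qed
qed

text \<open>The difference of the two composites splits into three, each with a coboundary as one
  factor and a cocycle as the other; in the last one the coboundary \<open>w - u\<close> is used as
  a cocycle.\<close>

lemma h_circ_coset:
  assumes u: "u \<in> ZC (insert s A) k" and v: "v \<in> ZC B l"
  shows "h_circ A s B k l (u +o hB (insert s A) k) (v +o hB B l) = circ_cochain A s B u v +o hB (A \<union> B) (k + l)"
  unfolding h_circ_def
proof (rule submodule.coset_map2_coset[OF submodule_coboundaries submodule_coboundaries submodule_coboundaries])
  fix w z assume w: "w - u \<in> hB (insert s A) k" and z: "z - v \<in> hB B l"
  interpret Q: finite_poset "NCP2 (insert s A)" "ncp2_le (insert s A)" using finA by (intro finite_poset_NCP2) simp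
  have wu: "w - u \<in> ZC (insert s A) k" using Q.coboundary_cocycle[OF w] .
  have "circ_cochain A s B w z - circ_cochain A s B u v
    = (circ_cochain A s B (w - u) v + circ_cochain A s B u (z - v)) + circ_cochain A s B (w - u) (z - v)"
    by (simp add: circ_diff_left circ_diff_right)
  then show "circ_cochain A s B w z - circ_cochain A s B u v \<in> hB (A \<union> B) (k + l)"
    using submodule.add_mem[OF submodule_coboundaries] circ_hB_left[OF w v] circ_hB_right[OF u z] circ_hB_right[OF wu z]
    by metis
qed

end

text \<open>Both sides cut the chain at the indices \<open>k\<close> and \<open>k + l\<close> and
  evaluate \<open>u\<close>, \<open>v\<close>, \<open>w\<close> on the three pieces; the double
  projections of each piece agree by \<open>seq_u\<close>, \<open>seq_v\<close> and
  \<open>above_above\<close>. No sign and no coboundary enters.\<close>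

lemma circ_seq:
  fixes u v w :: "'a ncp2 list \<Rightarrow> 'k::{comm_ring, comm_monoid_mult}"
  assumes fin: "finite A" "finite B" "finite D" and disj: "A \<inter> (B \<union> D) = {}" "B \<inter> D = {}" and Dne: "D \<noteq> {}"
    and s: "s \<notin> A" and t: "t \<notin> A" "t \<notin> B"
    and u: "u \<in> CC (insert s A) (int k)" and v: "v \<in> CC (insert t B) (int l)" and w: "w \<in> CC D m"
  shows "circ_cochain A s (B \<union> D) u (circ_cochain B t D v w) = circ_cochain (A \<union> B) t D (circ_cochain A s (insert t B) u v) w"
proof (rule ext)
  fix zs
  interpret C1: comp_sets A "B \<union> D" s using fin disj Dne s by unfold_locales auto
  interpret C2: comp_sets B D t using fin disj Dne t by unfold_locales auto
  interpret C3: comp_sets "A \<union> B" D t using fin disj Dne t by unfold_locales auto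
  interpret C4: comp_sets A "insert t B" s using fin disj t s by unfold_locales auto
  have vw: "circ_cochain B t D v w \<in> CC (B \<union> D) (int l + m)" by (rule C2.circ_CC[OF v w])
  have uv: "circ_cochain A s (insert t B) u v \<in> CC (insert t (A \<union> B)) (int (k + l))"
    using C4.circ_CC[OF u v] by simp
  have S: "A \<union> (B \<union> D) = A \<union> B \<union> D" by blast
  show "circ_cochain A s (B \<union> D) u (circ_cochain B t D v w) zs = circ_cochain (A \<union> B) t D (circ_cochain A s (insert t B) u v) w zs"
  proof (cases "zs \<in> FC (A \<union> B \<union> D) \<and> k + l < length zs")
    case False
    have "circ_cochain A s (B \<union> D) u (circ_cochain B t D v w) zs = 0"
    \<comment> \<open>For chains that are too short the second cut is missing on both sides.\<close>
    proof (cases "zs \<in> FC (A \<union> B \<union> D) \<and> k < length zs \<and> fst (zs ! k) = C1.tp")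
      case True
      have "chain (B \<union> D) (map (proj_above (B \<union> D) (zs ! k)) (drop k zs))"
        by (rule C1.chain_above) (use True FC_chain S in auto)
      then show ?thesis using True False by (auto simp: C1.circ_apply[OF u vw] C2.circ_apply_chain[OF v w])
    qed (auto simp: C1.circ_apply[OF u vw] S)
    then show ?thesis using False by (auto simp: C3.circ_apply[OF uv w])
  next
    case True
    then have zF: "zs \<in> FC (A \<union> B \<union> D)" and kl: "k + l < length zs" and k: "k < length zs" by auto
    have ch: "chain (A \<union> B \<union> D) zs" "chain (A \<union> (B \<union> D)) zs" using FC_chain[OF zF] S by simp_all
    let ?x = "zs ! k" and ?y = "zs ! (k + l)"
    have finS: "finite (A \<union> B \<union> D)" using fin by simp
    have x: "?x \<in> NCP2 (A \<union> B \<union> D)" and y: "?y \<in> NCP2 (A \<union> B \<union> D)" by (rule chain_mem[OF ch(1)], use kl in simp)+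
    have xy: "ncp2_le (A \<union> B \<union> D) ?x ?y" by (rule chain_nth_le[OF finS ch(1)]) (use kl in auto)
    let ?ws = "map (proj_above (B \<union> D) ?x) (drop k zs)"
    let ?us = "map (proj_below (A \<union> B) t D ?y) (take (Suc (k + l)) zs)"
    have L: "circ_cochain A s (B \<union> D) u (circ_cochain B t D v w) zs = (if fst ?x = C1.tp \<and> fst (?ws ! l) = C2.tp then
        u (map (proj_below A s (B \<union> D) ?x) (take (Suc k) zs)) *
        (v (map (proj_below B t D (?ws ! l)) (take (Suc l) ?ws)) * w (map (proj_above D (?ws ! l)) (drop l ?ws))) else 0)"
    proof (cases "fst ?x = C1.tp")
      case tp: True
      have "chain (B \<union> D) ?ws" by (rule C1.chain_above[OF ch(2) k tp])
      moreover have "l < length zs - k" using kl by simp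
      ultimately show ?thesis using tp zF k kl S by (simp add: C1.circ_apply[OF u vw] C2.circ_apply_chain[OF v w])
    qed (simp add: C1.circ_apply[OF u vw])
    have R: "circ_cochain (A \<union> B) t D (circ_cochain A s (insert t B) u v) w zs = (if fst ?y = C3.tp \<and> fst (?us ! k) = C4.tp then
        u (map (proj_below A s (insert t B) (?us ! k)) (take (Suc k) ?us)) * v (map (proj_above (insert t B) (?us ! k)) (drop k ?us))
        * w (map (proj_above D ?y) (drop (k + l) zs)) else 0)"
    proof (cases "fst ?y = C3.tp")
      case tp: True
      have "chain (insert t (A \<union> B)) ?us" by (rule C3.chain_below[OF ch(1) kl tp])
      then have "chain (A \<union> insert t B) ?us" by simp
      then show ?thesis using tp zF k kl
        by (simp add: C3.circ_apply[OF uv w] C4.circ_apply_chain[OF u v] del: nth_map)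
    qed (simp add: C3.circ_apply[OF uv w])
    have wsl: "?ws ! l = proj_above (B \<union> D) ?x ?y" using kl by simp
    have usk: "?us ! k = proj_below (A \<union> B) t D ?y ?x" using kl by simp
    have c1: "fst ?x = C1.tp \<Longrightarrow> fst (?ws ! l) = C2.tp \<longleftrightarrow> fst ?y = C3.tp"
      unfolding wsl by (rule fst_above_iff[OF fin disj Dne x y xy])
    have c2: "fst ?y = C3.tp \<Longrightarrow> fst (?us ! k) = C4.tp \<longleftrightarrow> fst ?x = C1.tp"
      unfolding usk by (rule seq_setup.fst_x_iff, unfold_locales) (use fin disj Dne s t x y xy in auto)
    show ?thesis
    proof (cases "fst ?x = C1.tp \<and> fst ?y = C3.tp")
      case True
      then have tx: "fst ?x = C1.tp" and ty: "fst ?y = C3.tp" by auto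
      interpret Q: seq_setup A B D s t ?x ?y using fin disj Dne s t x y xy ty by unfold_locales auto
      have e1: "map (proj_below A s (insert t B) (?us ! k)) (take (Suc k) ?us) = map (proj_below A s (B \<union> D) ?x) (take (Suc k) zs)"
      proof -
        have "take (Suc k) ?us = map (proj_below (A \<union> B) t D ?y) (take (Suc k) zs)" by (simp add: take_map min_def)
        moreover have "proj_below A s (insert t B) (?us ! k) (proj_below (A \<union> B) t D ?y z) = proj_below A s (B \<union> D) ?x z"
          if "z \<in> set (take (Suc k) zs)" for z
          unfolding usk by (rule Q.seq_u[OF tx chain_take_le[OF finS ch(1) k that]])
        ultimately show ?thesis by (simp del: nth_map)
      qed
      have e2: "map (proj_above (insert t B) (?us ! k)) (drop k ?us) = map (proj_below B t D (?ws ! l)) (take (Suc l) ?ws)"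
      proof -
        have d: "drop k ?us = map (proj_below (A \<union> B) t D ?y) (take (Suc l) (drop k zs))"
          by (simp add: drop_map drop_take Suc_diff_le)
        have tk: "take (Suc l) ?ws = map (proj_above (B \<union> D) ?x) (take (Suc l) (drop k zs))" by (simp add: take_map)
        have "proj_above (insert t B) (?us ! k) (proj_below (A \<union> B) t D ?y z) = proj_below B t D (?ws ! l) (proj_above (B \<union> D) ?x z)"
          if z: "z \<in> set (take (Suc l) (drop k zs))" for z
        proof -
          have z1: "z \<in> set (drop k zs)" using z by (rule in_set_takeD)
          have "chain (A \<union> B \<union> D) (drop k zs)" by (rule chain_drop[OF ch(1)])
          moreover have "l < length (drop k zs)" "drop k zs ! l = ?y" using kl by simp_all
          ultimately have z2: "ncp2_le (A \<union> B \<union> D) z ?y" using chain_take_le(2)[OF finS _ _ z] by metis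
          show ?thesis unfolding usk wsl
            by (rule Q.seq_v[OF tx chain_drop_ge[OF finS ch(1) z1] z2])
        qed
        then show ?thesis unfolding d tk by (simp del: nth_map)
      qed
      have e3: "map (proj_above D (?ws ! l)) (drop l ?ws) = map (proj_above D ?y) (drop (k + l) zs)"
      proof -
        have d: "drop l ?ws = map (proj_above (B \<union> D) ?x) (drop (k + l) zs)" by (simp add: drop_map add.commute)
        have "proj_above D (?ws ! l) (proj_above (B \<union> D) ?x z) = proj_above D ?y z" if z: "z \<in> set (drop (k + l) zs)" for z
          unfolding wsl
          by (rule above_above[OF finS x y chain_drop_ge(1)[OF finS ch(1) z] xy chain_drop_ge(2)[OF finS ch(1) z]])
            (use tx ty in auto)
        then show ?thesis unfolding d by (simp del: nth_map)
      qed
      show ?thesis unfolding L R using c1[OF tx] c2[OF ty] tx ty by (simp only: e1 e2 e3 mult.assoc simp_thms if_True)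
    next
      case False
      then show ?thesis unfolding L R using c1 c2 by (auto simp del: nth_map)
    qed
  qed
qed

section \<open>Relabelling and units\<close>

locale relabelling =
  fixes \<tau> :: "'a \<Rightarrow> 'b" and S :: "'a set"
  assumes finS: "finite S" and inj: "inj_on \<tau> S"
begin

abbreviation "R \<equiv> ncp2_relabel \<tau> S"

lemma inv_relabelling: "inj_on (inv_into S \<tau>) (\<tau> ` S)" "inv_into S \<tau> ` \<tau> ` S = S"
  using inj by (simp_all add: inj_on_inv_into)

lemma inv_R: "x \<in> NCP2 S \<Longrightarrow> ncp2_relabel (inv_into S \<tau>) (\<tau> ` S) (R x) = x"
  unfolding relabel_comp[OF inj inv_relabelling(1)] using inj by (intro relabel_id) simp_all

lemma R_inv: "y \<in> NCP2 (\<tau> ` S) \<Longrightarrow> R (ncp2_relabel (inv_into S \<tau>) (\<tau> ` S) y) = y"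
  using relabel_comp[OF inv_relabelling(1), unfolded inv_relabelling(2), OF inj, of y]
  by (simp add: relabel_id f_inv_into_f)

lemma R_mem: "x \<in> NCP2 S \<Longrightarrow> R x \<in> NCP2 (\<tau> ` S)"
  by (rule relabel_NCP2[OF inj])

lemma inv_mem: "y \<in> NCP2 (\<tau> ` S) \<Longrightarrow> ncp2_relabel (inv_into S \<tau>) (\<tau> ` S) y \<in> NCP2 S"
  using relabel_NCP2[OF inv_relabelling(1), of y] unfolding inv_relabelling(2) .

lemma map_R_chain: "chain S zs \<Longrightarrow> chain (\<tau> ` S) (map R zs)"
  by (rule chain_map) (auto intro: R_mem relabel_strict[OF inj] simp: chain_def subset_eq)

lemma map_R_FC:
  assumes zs: "zs \<in> FC S" shows "map R zs \<in> FC (\<tau> ` S)"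
proof (rule FC_I[OF map_R_chain[OF FC_chain[OF zs]]])
  have ne: "zs \<noteq> []" using zs by (auto simp: full_chains_def)
  then show "map R zs \<noteq> []" by simp
  have mem: "hd zs \<in> NCP2 S" "last zs \<in> NCP2 S"
    using zs hd_in_set[OF ne] last_in_set[OF ne] unfolding full_chains_def by blast+
  note strict' = relabel_strict[OF inv_relabelling(1), unfolded inv_relabelling(2)]
  fix y assume y: "y \<in> NCP2 (\<tau> ` S)"
  show "\<not> strict (ncp2_le (\<tau> ` S)) y (hd (map R zs))"
  proof
    assume "strict (ncp2_le (\<tau> ` S)) y (hd (map R zs))"
    then have "strict (ncp2_le (\<tau> ` S)) y (R (hd zs))" using ne by (simp add: hd_map)
    then show False using strict'[OF y R_mem[OF mem(1)]] FC_hd_min[OF zs inv_mem[OF y]] inv_R[OF mem(1)] by simp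
  qed
  show "\<not> strict (ncp2_le (\<tau> ` S)) (last (map R zs)) y"
  proof
    assume "strict (ncp2_le (\<tau> ` S)) (last (map R zs)) y"
    then have "strict (ncp2_le (\<tau> ` S)) (R (last zs)) y" using ne by (simp add: last_map)
    then show False using strict'[OF R_mem[OF mem(2)] y] FC_last_max[OF zs inv_mem[OF y]] inv_R[OF mem(2)] by simp
  qed
qed

lemma finite_FC: "finite (FC S)"
  by (rule finite_poset.finite_full_chains[OF finite_poset_NCP2[OF finS]])

lemma map_R_inj: "set zs \<subseteq> NCP2 S \<Longrightarrow> set zs' \<subseteq> NCP2 S \<Longrightarrow> map R zs = map R zs' \<Longrightarrow> zs = zs'"
proof -
  assume s: "set zs \<subseteq> NCP2 S" "set zs' \<subseteq> NCP2 S" and e: "map R zs = map R zs'"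
  have "inj_on R (NCP2 S)" by (rule inj_on_inverseI) (rule inv_R)
  then show ?thesis using s e by (meson inj_on_map_eq_map inj_on_subset sup.bounded_iff)
qed

lemma relabel_cochain_map:
  assumes u: "u \<in> CC S k" and zs: "set zs \<subseteq> NCP2 S"
  shows "relabel_cochain \<tau> S u (map R zs) = u zs"
proof -
  have "relabel_cochain \<tau> S u (map R zs) = (\<Sum>xs\<in>FC S. if xs = zs then u xs else 0)"
    unfolding relabel_cochain_def lin_ext_apply
  proof (rule sum.cong[OF refl])
    fix xs assume "xs \<in> FC S"
    then have "set xs \<subseteq> NCP2 S" by (simp add: full_chains_def)
    then have "map R zs = map R xs \<longleftrightarrow> xs = zs" using map_R_inj[OF zs] by auto
    then show "u xs * basis (map R xs) (map R zs) = (if xs = zs then u xs else 0)" by (simp add: basis_apply)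
  qed
  also have "\<dots> = u zs" using cochains_support[OF u, of zs] by (auto simp: sum.delta[OF finite_FC])
  finally show ?thesis .
qed

lemma relabel_cochain_support:
  assumes u: "u \<in> CC S k" and nz: "relabel_cochain \<tau> S u ys \<noteq> 0"
  obtains zs where "zs \<in> FC S" "ys = map R zs" "u zs \<noteq> 0"
proof -
  obtain xs where xs: "xs \<in> FC S" "u xs * basis (map R xs) ys \<noteq> 0"
    using nz unfolding relabel_cochain_def lin_ext_apply by (metis (no_types, lifting) sum.neutral)
  have "ys = map R xs" using xs(2) by (cases "ys = map R xs") (auto simp: basis_apply)
  moreover have "u xs \<noteq> 0" using xs(2) by (cases "u xs = 0") auto
  ultimately show ?thesis using that xs(1) by blast
qed

lemma relabel_cochain_CC: assumes u: "u \<in> CC S k" shows "relabel_cochain \<tau> S u \<in> CC (\<tau> ` S) k"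
proof -
  have "ys \<in> FC (\<tau> ` S) \<and> int (length ys) = k + 1" if nz: "relabel_cochain \<tau> S u ys \<noteq> 0" for ys
  proof -
    obtain zs where zs: "zs \<in> FC S" "ys = map R zs" "u zs \<noteq> 0" by (rule relabel_cochain_support[OF u nz])
    then show ?thesis using map_R_FC[OF zs(1)] cochains_support[OF u zs(3)] by simp
  qed
  then show ?thesis by (auto simp: cochains_def)
qed

lemma FC_image:
  assumes ys: "ys \<in> FC (\<tau> ` S)" obtains zs where "zs \<in> FC S" "ys = map R zs"
proof -
  interpret I: relabelling "inv_into S \<tau>" "\<tau> ` S"
    using finS inv_relabelling(1) by unfold_locales simp_all
  have "map I.R ys \<in> FC S" using I.map_R_FC[OF ys] unfolding inv_relabelling(2) .
  moreover have "map R (map I.R ys) = map (\<lambda>y. y) ys" unfolding map_map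
  proof (rule map_cong[OF refl])
    fix y assume "y \<in> set ys"
    then have "y \<in> NCP2 (\<tau> ` S)" using ys by (auto simp: full_chains_def)
    then show "(R \<circ> I.R) y = y" by (simp add: R_inv)
  qed
  ultimately show ?thesis using that by simp
qed

text \<open>Every full chain over the image is a relabelled one, so a cochain is known from its
  values there. All naturality statements are reduced to this.\<close>

lemma relabel_cochain_eqI:
  assumes u: "u \<in> CC S k" and w: "\<And>ys. w ys \<noteq> 0 \<Longrightarrow> ys \<in> FC (\<tau> ` S)" and eq: "\<And>zs. zs \<in> FC S \<Longrightarrow> w (map R zs) = u zs"
  shows "relabel_cochain \<tau> S u = w"
proof (rule ext)
  fix ys
  show "relabel_cochain \<tau> S u ys = w ys"
  proof (cases "ys \<in> FC (\<tau> ` S)")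
    case True
    then obtain zs where zs: "zs \<in> FC S" "ys = map R zs" by (rule FC_image)
    then have "set zs \<subseteq> NCP2 S" by (simp add: full_chains_def)
    then show ?thesis using relabel_cochain_map[OF u] eq[OF zs(1)] zs(2) by simp
  next
    case False
    then show ?thesis using w cochains_support[OF relabel_cochain_CC[OF u]] by metis
  qed
qed

lemma relabel_codiff:
  assumes u: "u \<in> CC S k" shows "relabel_cochain \<tau> S (dC S u) = dC (\<tau> ` S) (relabel_cochain \<tau> S u)"
proof -
  interpret P: finite_poset "NCP2 S" "ncp2_le S" by (rule finite_poset_NCP2[OF finS])
  interpret Q: finite_poset "NCP2 (\<tau> ` S)" "ncp2_le (\<tau> ` S)" using finS by (intro finite_poset_NCP2) simp
  show ?thesis
  proof (rule relabel_cochain_eqI[OF P.codiff_cochains[OF u]])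
    note ru = relabel_cochain_CC[OF u]
    show "ys \<in> FC (\<tau> ` S)" if "dC (\<tau> ` S) (relabel_cochain \<tau> S u) ys \<noteq> 0" for ys
      using cochains_support[OF Q.codiff_cochains[OF ru] that] by simp
    fix zs assume zs: "zs \<in> FC S"
    have "dC (\<tau> ` S) (relabel_cochain \<tau> S u) (map R zs) = (\<Sum>i\<in>{1..<length (map R zs) - 1}. (-1)^i * relabel_cochain \<tau> S u (del i (map R zs)))"
      by (rule chain_dC[OF _ ru FC_chain[OF map_R_FC[OF zs]], symmetric]) (use finS in simp)
    also have "\<dots> = (\<Sum>i\<in>{1..<length zs - 1}. (-1)^i * u (del i zs))"
    proof (rule sum.cong)
      fix i
      have "set (del i zs) \<subseteq> NCP2 S" using set_del_subset[of i zs] zs by (auto simp: full_chains_def)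
      then show "(-1)^i * relabel_cochain \<tau> S u (del i (map R zs)) = (-1)^i * u (del i zs)"
        by (simp add: map_del[symmetric] relabel_cochain_map[OF u])
    qed simp
    also have "\<dots> = dC S u zs" by (rule chain_dC[OF finS u FC_chain[OF zs]])
    finally show "dC (\<tau> ` S) (relabel_cochain \<tau> S u) (map R zs) = dC S u zs" .
  qed
qed

lemma relabel_hB: assumes "u \<in> hB S k" shows "relabel_cochain \<tau> S u \<in> hB (\<tau> ` S) k"
proof -
  obtain w where w: "w \<in> CC S (k - 1)" "u = dC S w" using assms by (auto simp: coboundaries_def)
  show ?thesis unfolding coboundaries_def w(2) relabel_codiff[OF w(1)] using relabel_cochain_CC[OF w(1)] by blast
qed

lemma relabel_ZC: assumes "u \<in> ZC S k" shows "relabel_cochain \<tau> S u \<in> ZC (\<tau> ` S) k"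
proof -
  have u: "u \<in> CC S k" "dC S u = 0" using assms by (auto simp: cocycles_def)
  have "dC (\<tau> ` S) (relabel_cochain \<tau> S u) = relabel_cochain \<tau> S 0" unfolding relabel_codiff[OF u(1), symmetric] u(2) ..
  also have "\<dots> = 0" by (simp only: relabel_cochain_def lin_ext_zero)
  finally show ?thesis using relabel_cochain_CC[OF u(1)] by (simp add: cocycles_def)
qed

end

lemma relabel_cochain_add: "relabel_cochain \<tau> S (u + v) = relabel_cochain \<tau> S u + relabel_cochain \<tau> S v"
  by (simp add: relabel_cochain_def lin_ext_add)

lemma relabel_cochain_scale: "relabel_cochain \<tau> S (scale_fun c u) = scale_fun c (relabel_cochain \<tau> S u)"
  by (simp add: relabel_cochain_def lin_ext_scale)

lemma relabel_cochain_zero: "relabel_cochain \<tau> S 0 = 0"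
  by (simp add: relabel_cochain_def lin_ext_zero)

lemma relabel_cochain_diff: "relabel_cochain \<tau> S (u - v) = relabel_cochain \<tau> S u - relabel_cochain \<tau> S v"
  using relabel_cochain_add[of \<tau> S "u - v" v] by simp

lemma relabel_cochain_basis:
  assumes "finite S" "xs \<in> FC S" shows "relabel_cochain \<tau> S (basis xs) = basis (map (ncp2_relabel \<tau> S) xs)"
  unfolding relabel_cochain_def
  by (rule lin_ext_basis[OF finite_poset.finite_full_chains[OF finite_poset_NCP2[OF assms(1)]] assms(2)])

lemma relabel_cochain_cong:
  assumes "inj_on \<tau> S" "\<And>a. a \<in> S \<Longrightarrow> \<tau> a = \<tau>' a"
  shows "relabel_cochain \<tau> S u = relabel_cochain \<tau>' S u"
proof -
  have "map (ncp2_relabel \<tau> S) xs = map (ncp2_relabel \<tau>' S) xs" if "xs \<in> FC S" for xs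
    using that by (intro map_cong refl relabel_cong[OF assms(2,1)]) (auto simp: full_chains_def)
  then show ?thesis unfolding relabel_cochain_def lin_ext_def by (intro sum.cong refl) (simp only:)
qed

lemma relabel_cochain_comp:
  assumes S: "finite S" and \<tau>: "inj_on \<tau> S" and \<sigma>: "inj_on \<sigma> (\<tau> ` S)" and u: "u \<in> CC S k"
  shows "relabel_cochain \<sigma> (\<tau> ` S) (relabel_cochain \<tau> S u) = relabel_cochain (\<sigma> \<circ> \<tau>) S u"
proof -
  interpret T: relabelling \<tau> S using S \<tau> by unfold_locales
  interpret U: relabelling \<sigma> "\<tau> ` S" using S \<sigma> by unfold_locales simp_all
  interpret V: relabelling "\<sigma> \<circ> \<tau>" S using S comp_inj_on[OF \<tau> \<sigma>] by unfold_locales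
  show ?thesis
  proof (rule sym, rule V.relabel_cochain_eqI[OF u])
    note tu = T.relabel_cochain_CC[OF u]
    show "ys \<in> FC ((\<sigma> \<circ> \<tau>) ` S)" if "relabel_cochain \<sigma> (\<tau> ` S) (relabel_cochain \<tau> S u) ys \<noteq> 0" for ys
      using cochains_support[OF U.relabel_cochain_CC[OF tu] that] by (simp add: image_comp)
    fix zs assume zs: "zs \<in> FC S"
    then have s: "set zs \<subseteq> NCP2 S" by (simp add: full_chains_def)
    have "map V.R zs = map U.R (map T.R zs)"
      using s relabel_comp[OF \<tau> \<sigma>] by (auto simp: subset_eq)
    moreover have "set (map T.R zs) \<subseteq> NCP2 (\<tau> ` S)" using s T.R_mem by auto
    ultimately show "relabel_cochain \<sigma> (\<tau> ` S) (relabel_cochain \<tau> S u) (map V.R zs) = u zs"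
      using U.relabel_cochain_map[OF tu] T.relabel_cochain_map[OF u s] by metis
  qed
qed

lemma relabel_cochain_id:
  assumes S: "finite S" and \<tau>: "\<And>a. a \<in> S \<Longrightarrow> \<tau> a = a" and u: "u \<in> CC S k"
  shows "relabel_cochain \<tau> S u = u"
proof -
  have im: "\<tau> ` S = S" using \<tau> by simp
  interpret T: relabelling \<tau> S using S \<tau> by unfold_locales (auto simp: inj_on_def)
  show ?thesis
  proof (rule T.relabel_cochain_eqI[OF u], unfold im)
    show "ys \<in> FC S" if "u ys \<noteq> 0" for ys using cochains_support[OF u that] by simp
    fix zs assume "zs \<in> FC S"
    then have "map T.R zs = map (\<lambda>z. z) zs" by (intro map_cong refl relabel_id \<tau>) (auto simp: full_chains_def)
    then show "u (map T.R zs) = u zs" by simp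
  qed
qed

lemma h_relabel_coset:
  assumes "finite S" "inj_on \<tau> S"
  shows "h_relabel \<tau> S k (u +o hB S k) = relabel_cochain \<tau> S u +o hB (\<tau> ` S) k"
  unfolding h_relabel_def
proof (rule submodule.coset_map_coset[OF submodule_coboundaries submodule_coboundaries])
  interpret T: relabelling \<tau> S using assms by unfold_locales
  show "relabel_cochain \<tau> S w - relabel_cochain \<tau> S u \<in> hB (\<tau> ` S) k" if "w - u \<in> hB S k" for w
    using T.relabel_hB[OF that] by (simp add: relabel_cochain_diff)
qed

context comp_sets
begin

text \<open>The label \<open>s\<close> is only a placeholder, so the relabelling of the outer factor
  has to agree with \<open>\<tau>\<close> on \<open>A\<close> but may send \<open>s\<close> anywhere
  that keeps it injective.\<close>

lemma relabel_circ:
  assumes inj: "inj_on \<tau> (A \<union> B)" and inj': "inj_on \<tau>' (insert s A)" and eq: "\<And>a. a \<in> A \<Longrightarrow> \<tau>' a = \<tau> a"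
    and u: "u \<in> CC (insert s A) (int k)" and v: "v \<in> CC B l"
  shows "relabel_cochain \<tau> (A \<union> B) (circ_cochain A s B u v)
    = circ_cochain (\<tau> ` A) (\<tau>' s) (\<tau> ` B) (relabel_cochain \<tau>' (insert s A) u) (relabel_cochain \<tau> B v)"
proof -
  interpret T: relabelling \<tau> "A \<union> B" using finS inj by unfold_locales
  interpret T': relabelling \<tau>' "insert s A" using finA inj' by unfold_locales simp_all
  interpret TB: relabelling \<tau> B using finB inj by unfold_locales (auto intro: inj_on_subset)
  have dj: "\<tau> ` A \<inter> \<tau> ` B = {}" using inj disj by (simp add: inj_on_image_Int[symmetric])
  have s': "\<tau>' s \<notin> \<tau> ` A"
  proof
    assume "\<tau>' s \<in> \<tau> ` A"
    then obtain a where "a \<in> A" "\<tau>' s = \<tau>' a" using eq by auto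
    then show False using inj_onD[OF inj', of s a] s by auto
  qed
  interpret D: comp_sets "\<tau> ` A" "\<tau> ` B" "\<tau>' s" using finA finB dj Bne s' by unfold_locales simp_all
  have ins: "\<tau>' ` insert s A = insert (\<tau>' s) (\<tau> ` A)" using eq by simp
  have u': "relabel_cochain \<tau>' (insert s A) u \<in> CC (insert (\<tau>' s) (\<tau> ` A)) (int k)"
    using T'.relabel_cochain_CC[OF u] unfolding ins .
  note v' = TB.relabel_cochain_CC[OF v]
  have un: "\<tau> ` (A \<union> B) = \<tau> ` A \<union> \<tau> ` B" by (rule image_Un)
  show ?thesis
  proof (rule T.relabel_cochain_eqI[OF circ_CC[OF u v]])
    show "ys \<in> FC (\<tau> ` (A \<union> B))" if "circ_cochain (\<tau> ` A) (\<tau>' s) (\<tau> ` B) (relabel_cochain \<tau>' (insert s A) u) (relabel_cochain \<tau> B v) ys \<noteq> 0" for ys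
      using cochains_support[OF D.circ_CC[OF u' v'] that] unfolding un by simp
    fix zs assume zs: "zs \<in> FC (A \<union> B)"
    have F: "map T.R zs \<in> FC (\<tau> ` A \<union> \<tau> ` B)" using T.map_R_FC[OF zs] unfolding un .
    note ch = FC_chain[OF zs]
    show "circ_cochain (\<tau> ` A) (\<tau>' s) (\<tau> ` B) (relabel_cochain \<tau>' (insert s A) u) (relabel_cochain \<tau> B v) (map T.R zs)
      = circ_cochain A s B u v zs"
    proof (cases "k < length zs")
      case k: True
      let ?x = "zs ! k"
      have x: "?x \<in> NCP2 (A \<union> B)" by (rule chain_mem[OF ch k])
      have px: "partition_on (A \<union> B) (fst ?x)" by (rule NC_D(1)[OF NCP2_D[OF x]])
      have tp: "fst (T.R ?x) = D.tp \<longleftrightarrow> fst ?x = tp"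
      proof -
        have "D.tp = (`) \<tau> ` tp" by (simp add: image_image)
        moreover have "(`) \<tau> ` fst ?x = (`) \<tau> ` tp \<longleftrightarrow> fst ?x = tp"
        proof (rule inj_on_image_eq_iff)
          show "inj_on ((`) \<tau>) (Pow (A \<union> B))" by (rule inj_on_image_Pow[OF inj])
          show "fst ?x \<subseteq> Pow (A \<union> B)" using partition_sub[OF px] by blast
        qed auto
        ultimately show ?thesis unfolding fst_relabel[OF inj x] by simp
      qed
      show ?thesis
      proof (cases "fst ?x = tp")
        case tpx: True
        interpret X: below A s B ?x by (rule below_x[OF x tpx])
        interpret Y: above "A \<union> B" B ?x by (rule above_x[OF x tpx])
        have m1: "map (proj_below (\<tau> ` A) (\<tau>' s) (\<tau> ` B) (T.R ?x)) (take (Suc k) (map T.R zs))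
           = map T'.R (map X.\<phi> (take (Suc k) zs))"
          using relabel_below(1)[OF X.below_axioms chain_take_le[OF finS ch k] inj inj' eq] by (simp add: take_map)
        have m2: "map (proj_above (\<tau> ` B) (T.R ?x)) (drop k (map T.R zs)) = map TB.R (map Y.\<psi> (drop k zs))"
          using relabel_above(1)[OF Y.above_axioms chain_drop_ge[OF finS ch] inj] by (simp add: drop_map)
        have "set (map X.\<phi> (take (Suc k) zs)) \<subseteq> NCP2 (insert s A)" "set (map Y.\<psi> (drop k zs)) \<subseteq> NCP2 B"
          using chain_below[OF ch k tpx] chain_above[OF ch k tpx] by (auto simp: chain_def)
        then show ?thesis using F zs k tp tpx
          by (simp only: D.circ_apply[OF u' v'] circ_apply[OF u v] length_map nth_map m1 m2
            T'.relabel_cochain_map[OF u] TB.relabel_cochain_map[OF v])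
      next
        case False
        then show ?thesis using tp k by (simp add: D.circ_apply[OF u' v'] circ_apply[OF u v])
      qed
    qed (simp add: D.circ_apply[OF u' v'] circ_apply[OF u v])
  qed
qed

end

section \<open>Cochains of top degree\<close>

abbreviation TC :: "'a set \<Rightarrow> ('a ncp2 list \<Rightarrow> 'k::{comm_ring, comm_monoid_mult}) set" where
  "TC S \<equiv> CC S (int (card S) - 1)"

lemma chain_card_diff:
  assumes "finite S" "chain S zs" "i \<le> j" "j < length zs"
  shows "card (fst (zs ! i)) + (j - i) \<le> card (fst (zs ! j))"
  using assms(3,4)
proof (induction j)
  case (Suc j)
  show ?case
  proof (cases "i = Suc j")
    case False
    then have "card (fst (zs ! i)) + (j - i) \<le> card (fst (zs ! j))" using Suc by simp
    moreover have "strict (ncp2_le S) (zs ! j) (zs ! Suc j)"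
      using assms(2) Suc.prems(2) sorted_wrt_nth_less[of _ zs j "Suc j"] by (auto simp: chain_def)
    then have "card (fst (zs ! j)) < card (fst (zs ! Suc j))"
      using strict_card[OF assms(1) chain_mem[OF assms(2)] chain_mem[OF assms(2)]] Suc.prems(2) by simp
    ultimately show ?thesis using False Suc.prems(1) by simp
  qed simp
qed simp

lemma chain_length:
  assumes "finite S" "S \<noteq> {}" "chain S zs" shows "length zs \<le> card S"
proof (cases zs)
  case (Cons a as)
  then have l: "length zs - 1 < length zs" by simp
  have "card (fst (zs ! 0)) + (length zs - 1) \<le> card (fst (zs ! (length zs - 1)))"
    using chain_card_diff[OF assms(1,3), of 0 "length zs - 1"] l by simp
  then show ?thesis using card_fst_bounds[OF assms(1,2) chain_mem[OF assms(3) l]]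
    card_fst_bounds(1)[OF assms(1,2) chain_mem[OF assms(3), of 0]] Cons by simp
qed simp

text \<open>The number of blocks rises strictly between 1 and \<open>card S\<close>, so a chain with
  \<open>card S\<close> entries meets every value in turn.\<close>

lemma chain_card:
  assumes "finite S" "S \<noteq> {}" "chain S zs" "length zs = card S" "j < length zs"
  shows "card (fst (zs ! j)) = Suc j"
proof -
  have l: "length zs - 1 < length zs" "0 < length zs" using assms(5) by auto
  have "card (fst (zs ! 0)) + j \<le> card (fst (zs ! j))"
    using chain_card_diff[OF assms(1,3) _ assms(5), of 0] by simp
  moreover have "card (fst (zs ! j)) + (length zs - 1 - j) \<le> card (fst (zs ! (length zs - 1)))"
    using chain_card_diff[OF assms(1,3) _ l(1), of j] assms(5) by simp
  ultimately show ?thesis using card_fst_bounds(2)[OF assms(1,2) chain_mem[OF assms(3) l(1)]]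
    card_fst_bounds(1)[OF assms(1,2) chain_mem[OF assms(3) l(2)]] assms(4,5) by simp
qed

lemma TC_ZC:
  assumes S: "finite S" "S \<noteq> {}" and u: "u \<in> TC S" shows "u \<in> ZC S (int (card S) - 1)"
proof -
  interpret P: finite_poset "NCP2 S" "ncp2_le S" by (rule finite_poset_NCP2[OF S(1)])
  have "dC S u zs = 0" for zs
  proof (rule ccontr)
    assume "dC S u zs \<noteq> 0"
    then have "zs \<in> FC S" "int (length zs) = int (card S) + 1" using cochains_support[OF P.codiff_cochains[OF u]] by auto
    then show False using chain_length[OF S FC_chain] by fastforce
  qed
  then have "dC S u = 0" by (intro ext) simp
  then show ?thesis using u by (simp add: cocycles_def)
qed

section \<open>Units for the composition\<close>

definition unit_cochain :: "'a \<Rightarrow> 'a ncp2 list \<Rightarrow> 'k::{comm_ring, comm_monoid_mult}" where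
  "unit_cochain b = basis [ncp2_bot {b}]"

lemma bot_FC: "[ncp2_bot {b}] \<in> FC {b}"
proof (rule FC_I)
  show "chain {b} [ncp2_bot {b}]" using bot_NCP2[of "{b}"] by (simp add: chain_def)
  show "\<not> strict (ncp2_le {b}) y (hd [ncp2_bot {b}])" "\<not> strict (ncp2_le {b}) (last [ncp2_bot {b}]) y" if "y \<in> NCP2 {b}" for y
    using NCP2_singleton[OF that] by (simp_all add: strict_def)
qed simp

lemma unit_cochain_CC: "unit_cochain b \<in> CC {b} 0"
  unfolding cochains_def unit_cochain_def basis_apply using bot_FC by (auto split: if_splits)

text \<open>With no outer labels the required type is that of the bottom element, so the chain is
  cut at its first entry and its upper part is the whole chain.\<close>

lemma circ_unit_left:
  assumes B: "finite B" "B \<noteq> {}" and v: "v \<in> CC B l"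
  shows "circ_cochain {} s B (unit_cochain s) v = v"
proof (rule ext)
  fix zs
  interpret C: comp_sets "{}" B s using B by unfold_locales simp_all
  have un: "unit_cochain s \<in> CC (insert s {}) (int 0)" using unit_cochain_CC[of s] by simp
  show "circ_cochain {} s B (unit_cochain s) v zs = v zs"
  proof (cases "zs \<in> FC B")
    case True
    then have ne: "zs \<noteq> []" by (simp add: full_chains_def)
    have z0: "zs ! 0 = ncp2_bot B" using full_chain_hd[OF B True] ne by (simp add: hd_conv_nth)
    have zB: "set zs \<subseteq> NCP2 B" using True by (simp add: full_chains_def)
    have tp: "fst (zs ! 0) = C.tp" unfolding z0 fst_bot by simp
    have x: "zs ! 0 \<in> NCP2 ({} \<union> B)" using z0 bot_NCP2[OF B] by simp
    interpret X: below "{}" s B "zs ! 0" by (rule C.below_x[OF x tp])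
    have "X.\<phi> (zs ! 0) \<in> NCP2 {s}" by (rule X.below_NCP2[OF x X.le_y_refl])
    then have b: "X.\<phi> (zs ! 0) = ncp2_bot {s}" by (rule NCP2_singleton)
    have t: "take (Suc 0) zs = [zs ! 0]" using ne by (cases zs) auto
    have "map (proj_above B (zs ! 0)) zs = map (\<lambda>z. z) zs"
      unfolding z0 using zB by (intro map_cong refl above_bot[OF B]) auto
    moreover have "unit_cochain s [ncp2_bot {s}] = (1::'b)" by (simp add: unit_cochain_def basis_apply)
    ultimately show ?thesis using True ne tp
      by (simp add: C.circ_apply[OF un v] t b)
  next
    case False
    then show ?thesis using cochains_support[OF v, of zs] by (auto simp: C.circ_apply[OF un v])
  qed
qed

text \<open>A chain of top degree ends in an element with singleton blocks only, which is the
  required type when a single label is inserted; the cut is at the last entry.\<close>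

lemma circ_unit_right:
  assumes A: "finite A" "s \<notin> A" "b \<notin> A" and u: "u \<in> TC (insert s A)"
  shows "circ_cochain A s {b} u (unit_cochain b) = relabel_cochain (\<lambda>a. if a = s then b else a) (insert s A) u"
proof -
  let ?\<tau> = "\<lambda>a. if a = s then b else a"
  let ?k = "card A"
  interpret C: comp_sets A "{b}" s using A by unfold_locales simp_all
  have im: "?\<tau> ` insert s A = A \<union> {b}" using A by auto
  interpret T: relabelling ?\<tau> "insert s A" using A by unfold_locales (auto simp: inj_on_def)
  have u': "u \<in> CC (insert s A) (int ?k)" using u A by simp
  note un = unit_cochain_CC[of b]
  show ?thesis
  proof (rule sym, rule T.relabel_cochain_eqI[OF u'])
    show "ys \<in> FC (?\<tau> ` insert s A)" if "circ_cochain A s {b} u (unit_cochain b) ys \<noteq> 0" for ys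
      unfolding im using cochains_support[OF C.circ_CC[OF u' un] that] by simp
    fix zs assume zs: "zs \<in> FC (insert s A)"
    let ?ys = "map T.R zs"
    have ys: "?ys \<in> FC (A \<union> {b})" using T.map_R_FC[OF zs] unfolding im .
    have zS: "set zs \<subseteq> NCP2 (insert s A)" using zs by (simp add: full_chains_def)
    show "circ_cochain A s {b} u (unit_cochain b) ?ys = u zs"
    proof (cases "length zs = Suc ?k")
      case False
      then have "u zs = 0" using cochains_support[OF u', of zs] by auto
      moreover have "circ_cochain A s {b} u (unit_cochain b) ?ys = 0"
        using False cochains_support[OF C.circ_CC[OF u' un], of ?ys] by auto
      ultimately show ?thesis by simp
    next
      case len: True
      have fS: "finite (A \<union> {b})" "A \<union> {b} \<noteq> {}" using A by auto
      have cS: "card (A \<union> {b}) = Suc ?k" using A by simp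
      note ch = FC_chain[OF ys]
      have k: "?k < length ?ys" using len by simp
      let ?x = "?ys ! ?k"
      have x: "?x \<in> NCP2 (A \<union> {b})" by (rule chain_mem[OF ch k])
      have "card (fst ?x) = card (A \<union> {b})" using chain_card[OF fS ch _ k] len cS by simp
      then have "fst ?x = singles (A \<union> {b})" by (rule card_fst_bounds(3)[OF fS x])
      then have tp: "fst ?x = C.tp" by auto
      interpret X: below A s "{b}" ?x by (rule C.below_x[OF x tp])
      interpret Y: above "A \<union> {b}" "{b}" ?x by (rule C.above_x[OF x tp])
      have d: "drop ?k ?ys = [?x]" using len k by (simp add: Cons_nth_drop_Suc[symmetric])
      have "Y.\<psi> ?x = ncp2_bot {b}"
        by (rule NCP2_singleton, rule Y.above_NCP2[OF x X.le_y_refl])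
      then have v1: "unit_cochain b (map (proj_above {b} ?x) (drop ?k ?ys)) = (1::'b)"
        unfolding d by (simp add: unit_cochain_def basis_apply)
      have t: "take (Suc ?k) ?ys = ?ys" using len by simp
      have "map X.\<phi> ?ys = map (\<lambda>z. z) zs" unfolding map_map
      proof (rule map_cong[OF refl])
        fix z assume z: "z \<in> set zs"
        have zN: "z \<in> NCP2 (insert s A)" using z zS by blast
        have "T.R z \<in> set (take (Suc ?k) ?ys)" unfolding t using z by simp
        note rz = chain_take_le[OF C.finS ch k this]
        have "X.\<phi> (T.R z) = ncp2_relabel (colq {b} s) (A \<union> {b}) (T.R z)" by (rule below_unit[OF X.below_axioms rz])
        also have "\<dots> = ncp2_relabel (colq {b} s \<circ> ?\<tau>) (insert s A) z"
          unfolding im[symmetric]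
          by (rule relabel_comp[OF T.inj _ zN]) (use A in \<open>auto simp: inj_on_def\<close>)
        also have "\<dots> = z" by (rule relabel_id[OF zN]) (use A in auto)
        finally show "(X.\<phi> \<circ> T.R) z = z" by simp
      qed
      then show ?thesis using ys k tp v1 t by (simp del: nth_map add: C.circ_apply[OF u' un])
    qed
  qed
qed

section \<open>The parallel axiom\<close>

text \<open>The pattern of a chain in a product records which of the two coordinates move in each step.\<close>

fun pat :: "('p \<Rightarrow> 'q) \<Rightarrow> ('p \<Rightarrow> 'r) \<Rightarrow> 'p list \<Rightarrow> (bool \<times> bool) list" where
  "pat f g (a # b # ws) = (f a \<noteq> f b, g a \<noteq> g b) # pat f g (b # ws)"
| "pat f g ws = []"

lemma length_pat: "length (pat f g ws) = length ws - 1"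
  by (induction f g ws rule: pat.induct) auto

lemma pat_nth: "Suc i < length ws \<Longrightarrow> pat f g ws ! i = (f (ws ! i) \<noteq> f (ws ! Suc i), g (ws ! i) \<noteq> g (ws ! Suc i))"
proof (induction f g ws arbitrary: i rule: pat.induct)
  case (1 f g a b ws)
  then show ?case by (cases i) auto
qed auto

lemma pat_append: "pat f g (xs @ a # ys) = pat f g (xs @ [a]) @ pat f g (a # ys)"
proof (induction xs)
  case Nil
  show ?case by simp
next
  case (Cons x xs)
  then show ?case by (cases xs) auto
qed

text \<open>A step that moves only the other coordinate leaves the chain of distinct values of this
  coordinate unchanged.\<close>

lemma remdups_adj_middle:
  assumes "b = a \<or> b = c" shows "remdups_adj (xs @ a # b # c # ys) = remdups_adj (xs @ a # c # ys)"
proof -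
  have 1: "remdups_adj (a # a # c # ys) = remdups_adj (a # c # ys)" by (simp only: remdups_adj.simps simp_thms if_True)
  have 2: "remdups_adj (a # c # c # ys) = remdups_adj (a # c # ys)" by (cases "a = c") (simp_all only: remdups_adj.simps simp_thms if_True if_False)
  have e: "remdups_adj (a # b # c # ys) = remdups_adj (a # c # ys)" using assms 1 2 by metis
  show ?thesis
    unfolding remdups_adj_append[of xs a "b # c # ys"] remdups_adj_append[of xs a "c # ys"] e ..
qed

text \<open>Meant for the coordinate that has finished at index \<open>l\<close>; the next lemma is
  for the one that starts to move there.\<close>

lemma remdups_adj_const_suffix:
  assumes "l < length xs" "distinct (take (Suc l) xs)" "\<And>i. l \<le> i \<Longrightarrow> i < length xs \<Longrightarrow> xs ! i = xs ! l"
  shows "remdups_adj xs = take (Suc l) xs"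
proof -
  have "drop l xs = replicate (length xs - l) (xs ! l)"
  proof (rule nth_equalityI)
    fix i assume i: "i < length (drop l xs)"
    then have "xs ! (l + i) = xs ! l" by (intro assms(3)) auto
    then show "drop l xs ! i = replicate (length xs - l) (xs ! l) ! i" using i by simp
  qed simp
  moreover obtain m where "length xs - l = Suc m" using assms(1) by (metis Suc_diff_Suc)
  ultimately have d: "drop l xs = xs ! l # replicate m (xs ! l)" by simp
  have t: "take (Suc l) xs = take l xs @ [xs ! l]" using assms(1) by (rule take_Suc_conv_app_nth)
  have "remdups_adj xs = remdups_adj (take l xs @ xs ! l # replicate m (xs ! l))"
    using d by (metis append_take_drop_id)
  also have "\<dots> = remdups_adj (take l xs @ [xs ! l]) @ tl (remdups_adj (xs ! l # replicate m (xs ! l)))"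
    by (rule remdups_adj_append)
  also have "remdups_adj (xs ! l # replicate m (xs ! l)) = [xs ! l]"
    using remdups_adj_replicate[of "Suc m" "xs ! l"] by simp
  also have "remdups_adj (take l xs @ [xs ! l]) = take (Suc l) xs"
    using assms(2) unfolding t by (rule remdups_adj_distinct)
  finally show ?thesis by simp
qed

lemma remdups_adj_const_prefix:
  assumes "l < length xs" "distinct (drop l xs)" "\<And>i. i \<le> l \<Longrightarrow> xs ! i = xs ! l"
  shows "remdups_adj xs = drop l xs"
proof -
  have t: "take l xs = replicate l (xs ! l)"
  proof (rule nth_equalityI)
    fix i assume i: "i < length (take l xs)"
    then have "xs ! i = xs ! l" by (intro assms(3)) auto
    then show "take l xs ! i = replicate l (xs ! l) ! i" using i by simp
  qed (use assms(1) in simp)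
  have d: "drop l xs = xs ! l # drop (Suc l) xs" using assms(1) by (simp add: Cons_nth_drop_Suc)
  have "remdups_adj (replicate m c @ c # ys) = remdups_adj (c # ys)" for m and c :: 'a and ys
  proof (induction m)
    case (Suc m)
    then show ?case by (cases m) auto
  qed simp
  then have "remdups_adj (take l xs @ drop l xs) = remdups_adj (drop l xs)" unfolding t d by simp
  then show ?thesis using remdups_adj_distinct[OF assms(2)] by simp
qed

text \<open>Selected through its joint partition, by a formula that treats \<open>(B, s)\<close> and
  \<open>(D, t)\<close> alike for disjoint \<open>B\<close> and \<open>D\<close>. Where it is used,
  existence comes from collapsing one block after the other.\<close>

definition dbl :: "'a set \<Rightarrow> 'a set \<Rightarrow> 'a set \<Rightarrow> 'a \<Rightarrow> 'a \<Rightarrow> 'a ncp2 \<Rightarrow> 'a ncp2 \<Rightarrow> 'a ncp2" where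
  "dbl A B D s t x z = (SOME e. e \<in> NCP2 (insert s (insert t A)) \<and>
     J e = (`) (map_sum (\<lambda>a. if a \<in> B then s else if a \<in> D then t else a) (pos (posns x))) ` J z)"

lemma dbl_eqI:
  assumes "e \<in> NCP2 (insert s (insert t A))"
    "J e = (`) (map_sum (\<lambda>a. if a \<in> B then s else if a \<in> D then t else a) (pos (posns x))) ` J z"
  shows "dbl A B D s t x z = e"
  unfolding dbl_def
proof (rule some_equality)
  show "e' = e" if "e' \<in> NCP2 (insert s (insert t A)) \<and>
     J e' = (`) (map_sum (\<lambda>a. if a \<in> B then s else if a \<in> D then t else a) (pos (posns x))) ` J z" for e'
    using NCP2_J_inj[of e' _ e] that assms by metis
qed (use assms in blast)

lemma dbl_commute: "B \<inter> D = {} \<Longrightarrow> dbl A D B t s x z = dbl A B D s t x z"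
proof -
  assume "B \<inter> D = {}"
  then have "(\<lambda>a. if a \<in> D then t else if a \<in> B then s else a) = (\<lambda>a. if a \<in> B then s else if a \<in> D then t else a)"
    by (auto simp: fun_eq_iff)
  then show ?thesis unfolding dbl_def by (simp only: insert_commute)
qed

text \<open>The cochain of the chains whose part above \<open>zs ! k\<close> is the shuffle, with the given pattern,
  of a chain in the first factor and of a chain in the second factor.\<close>

definition shuf :: "'a set \<Rightarrow> 'a set \<Rightarrow> 'a set \<Rightarrow> 'a \<Rightarrow> 'a \<Rightarrow> nat \<Rightarrow> ('a ncp2 list \<Rightarrow> 'k) \<Rightarrow> ('a ncp2 list \<Rightarrow> 'k)
   \<Rightarrow> ('a ncp2 list \<Rightarrow> 'k) \<Rightarrow> (bool \<times> bool) list \<Rightarrow> 'a ncp2 list \<Rightarrow> 'k::{comm_ring, comm_monoid_mult}" where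
  "shuf A B D s t k u v w W zs =
    (if zs \<in> FC (A \<union> B \<union> D) \<and> k < length zs \<and> fst (zs ! k) = insert B (insert D (singles A)) \<and>
        pat (proj_above B (zs ! k)) (proj_above D (zs ! k)) (drop k zs) = W
     then u (map (dbl A B D s t (zs ! k)) (take (Suc k) zs))
       * v (remdups_adj (map (proj_above B (zs ! k)) (drop k zs)))
       * w (remdups_adj (map (proj_above D (zs ! k)) (drop k zs)))
     else 0)"

section \<open>Shuffles of the steps in two factors\<close>

abbreviation "TF \<equiv> (True, False)"
abbreviation "FT \<equiv> (False, True)"
abbreviation "TT \<equiv> (True, True)"

locale par_comp =
  fixes A B D :: "'a set" and s t :: 'a
  assumes fin: "finite A" "finite B" "finite D" and disj: "A \<inter> B = {}" "A \<inter> D = {}" "B \<inter> D = {}"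
    and Bne: "B \<noteq> {}" and Dne: "D \<noteq> {}" and s: "s \<notin> A" "s \<notin> D" and t: "t \<notin> A" "t \<notin> B" and st: "s \<noteq> t"
begin

abbreviation "S \<equiv> A \<union> B \<union> D"
text \<open>An element of type \<open>tp2\<close> has \<open>card A + 2\<close> blocks, so it can
  only be the entry of index \<open>card A + 1\<close> in a maximal chain.\<close>

abbreviation "k \<equiv> Suc (card A)"
abbreviation "tp2 \<equiv> insert B (insert D (singles A))"

lemma finS: "finite S" and Sne: "S \<noteq> {}" using fin Bne by auto

lemma cardS: "card S = card A + card B + card D"
  using fin disj by (simp add: card_Un_disjoint Int_Un_distrib2)

lemma card_B: "1 \<le> card B" and card_D: "1 \<le> card D"
  using fin Bne Dne by (simp_all add: Suc_le_eq card_gt_0_iff)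

lemma card_tp2: "card tp2 = Suc k"
proof -
  have "B \<noteq> D" "B \<notin> singles A" "D \<notin> singles A" using disj Bne Dne by auto
  then show ?thesis using fin by (simp add: card_singles)
qed

lemma par_x: "x \<in> NCP2 S \<Longrightarrow> fst x = tp2 \<Longrightarrow> par_setup S A B D x"
  using finS disj Bne Dne by unfold_locales simp_all

text \<open>At least one coordinate moves since the two determine the element; both cannot move,
  since each would add a block.\<close>

lemma step:
  assumes x: "x \<in> NCP2 S" "fst x = tp2" and z: "z \<in> NCP2 S" "ncp2_le S x z" and z': "z' \<in> NCP2 S" "ncp2_le S x z'"
    and le: "ncp2_le S z z'" and c: "card (fst z') = Suc (card (fst z))"
  shows "(proj_above B x z \<noteq> proj_above B x z', proj_above D x z \<noteq> proj_above D x z') \<in> {TF, FT}"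
proof -
  interpret X: par_setup S A B D x by (rule par_x[OF x])
  have ne: "z \<noteq> z'" using c by auto
  have mB: "ncp2_le B (X.B.\<psi> z) (X.B.\<psi> z')" by (rule X.B.above_mono[OF z z' le])
  have mD: "ncp2_le D (X.D.\<psi> z) (X.D.\<psi> z')" by (rule X.D.above_mono[OF z z' le])
  have lB: "card (fst (X.B.\<psi> z)) \<le> card (fst (X.B.\<psi> z'))"
    by (rule le_card[OF fin(2) X.B.above_NCP2[OF z] X.B.above_NCP2[OF z'] mB])
  have lD: "card (fst (X.D.\<psi> z)) \<le> card (fst (X.D.\<psi> z'))"
    by (rule le_card[OF fin(3) X.D.above_NCP2[OF z] X.D.above_NCP2[OF z'] mD])
  have sB: "card (fst (X.B.\<psi> z)) < card (fst (X.B.\<psi> z'))" if "X.B.\<psi> z \<noteq> X.B.\<psi> z'"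
    by (rule strict_card[OF fin(2) X.B.above_NCP2[OF z] X.B.above_NCP2[OF z']]) (use mB that in \<open>simp add: strict_def\<close>)
  have sD: "card (fst (X.D.\<psi> z)) < card (fst (X.D.\<psi> z'))" if "X.D.\<psi> z \<noteq> X.D.\<psi> z'"
    by (rule strict_card[OF fin(3) X.D.above_NCP2[OF z] X.D.above_NCP2[OF z']]) (use mD that in \<open>simp add: strict_def\<close>)
  have "\<not> (X.B.\<psi> z = X.B.\<psi> z' \<and> X.D.\<psi> z = X.D.\<psi> z')" using X.joint_inj[OF z z'] ne by blast
  moreover have "\<not> (X.B.\<psi> z \<noteq> X.B.\<psi> z' \<and> X.D.\<psi> z \<noteq> X.D.\<psi> z')"
    using sB sD c X.card_decomp[OF z] X.card_decomp[OF z'] by linarith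
  ultimately show ?thesis by auto
qed

lemma shuf_CC: "shuf A B D s t k u v w W \<in> CC S (int (k + length W))"
proof -
  have "zs \<in> FC S \<and> int (length zs) = int (k + length W) + 1" if nz: "shuf A B D s t k u v w W zs \<noteq> 0" for zs
  proof -
    have z: "zs \<in> FC S" "k < length zs" "pat (proj_above B (zs ! k)) (proj_above D (zs ! k)) (drop k zs) = W"
      using nz unfolding shuf_def by (auto split: if_splits)
    have "length W = length (drop k zs) - 1" unfolding z(3)[symmetric] by (rule length_pat)
    then show ?thesis using z(1,2) by simp
  qed
  then show ?thesis by (auto simp: cochains_def)
qed

text \<open>The sum is, up to sign, the coboundary of the cochain with a single simultaneous step
  \<open>TT\<close> in that place. A maximal chain has no simultaneous steps, so one arises only by
  deleting the entry between the two steps, and these were made in one order or the other.\<close>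

lemma flip:
  fixes u v w :: "'a ncp2 list \<Rightarrow> 'k::{comm_ring, comm_monoid_mult}"
  assumes len: "length W1 + length W2 + 3 + k = card S" and W: "set W1 \<subseteq> {TF, FT}" "set W2 \<subseteq> {TF, FT}"
  shows "shuf A B D s t k u v w (W1 @ TF # FT # W2) + shuf A B D s t k u v w (W1 @ FT # TF # W2) \<in> hB S (int (card S) - 1)"
proof -
  let ?F = "shuf A B D s t k u v w (W1 @ TT # W2)"
  let ?E1 = "shuf A B D s t k u v w (W1 @ TF # FT # W2)" and ?E2 = "shuf A B D s t k u v w (W1 @ FT # TF # W2)"
  \<comment> \<open>The index of the entry between the two steps: the steps of \<open>W1\<close>
    start at index \<open>k\<close>, and one more step is made.\<close>
  let ?p = "k + Suc (length W1)"
  interpret P: finite_poset "NCP2 S" "ncp2_le S" by (rule finite_poset_NCP2[OF finS])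
  have e1: "int (k + length (W1 @ TT # W2)) = int (card S) - 1 - 1" using len by simp
  have F: "?F \<in> CC S (int (card S) - 1 - 1)" unfolding e1[symmetric] by (rule shuf_CC)
  have e2: "int (k + length (W1 @ TF # FT # W2)) = int (card S) - 1" "int (k + length (W1 @ FT # TF # W2)) = int (card S) - 1"
    using len by simp_all
  have E: "?E1 + ?E2 \<in> CC S (int (card S) - 1)"
    by (rule submodule.add_mem[OF submodule_cochains shuf_CC[of u v w "W1 @ TF # FT # W2", unfolded e2] shuf_CC[of u v w "W1 @ FT # TF # W2", unfolded e2]])
  have dF: "dC S ?F \<in> CC S (int (card S) - 1)" using P.codiff_cochains[OF F] by simp
  have "dC S ?F zs = (-1) ^ ?p * (?E1 + ?E2) zs" for zs
  proof (cases "zs \<in> FC S \<and> length zs = card S")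
    case False
    then have "dC S ?F zs = 0" "(?E1 + ?E2) zs = 0" using cochains_support[OF dF, of zs] cochains_support[OF E, of zs] by auto
    then show ?thesis by (simp only: mult_zero_right)
  next
    case True
    then have zs: "zs \<in> FC S" and lz: "length zs = card S" by auto
    note ch = FC_chain[OF zs]
    have lp: "1 \<le> ?p" "Suc ?p < length zs" using len lz by auto
    have k: "k < length zs" using lp by simp
    have cardz: "card (fst (zs ! j)) = Suc j" if "j < length zs" for j by (rule chain_card[OF finS Sne ch lz that])
    let ?x = "zs ! k"
    have x: "?x \<in> NCP2 S" by (rule chain_mem[OF ch k])
    define ws where "ws = drop k zs"
    let ?f = "proj_above B ?x" and ?g = "proj_above D ?x"
    have lws: "length ws = length W1 + length W2 + 3" unfolding ws_def using lz len by simp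
    have wsn: "ws ! i = zs ! (k + i)" if "i < length ws" for i using that k by (simp add: ws_def)
    have stp: "(?f (ws ! i) \<noteq> ?f (ws ! Suc i), ?g (ws ! i) \<noteq> ?g (ws ! Suc i)) \<in> {TF, FT}"
      if i: "Suc i < length ws" and tp: "fst ?x = tp2" for i
    proof -
      have ki: "k + Suc i < length zs" "k + i < length zs" using i by (auto simp: ws_def)
      have e: "ws ! i = zs ! (k + i)" "ws ! Suc i = zs ! (k + Suc i)" using i wsn by auto
      show ?thesis unfolding e
      proof (rule step[OF x tp])
        show "zs ! (k + i) \<in> NCP2 S" "zs ! (k + Suc i) \<in> NCP2 S" using chain_mem[OF ch] ki by auto
        show "ncp2_le S ?x (zs ! (k + i))" "ncp2_le S ?x (zs ! (k + Suc i))" "ncp2_le S (zs ! (k + i)) (zs ! (k + Suc i))"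
          by (rule chain_nth_le[OF finS ch]; use ki in simp)+
        show "card (fst (zs ! (k + Suc i))) = Suc (card (fst (zs ! (k + i))))" using cardz ki by simp
      qed
    qed
    \<comment> \<open>A deletion up to index \<open>k\<close> puts an element with too many blocks
      at the cut. Any other deletion leaves the step after \<open>W1\<close> a genuine step of
      \<open>zs\<close>, which moves one coordinate only.\<close>
    have zero: "?F (del i zs) = 0" if i: "i \<in> {1..<length zs - 1}" "i \<noteq> ?p" for i
    proof (rule ccontr)
      assume nz: "?F (del i zs) \<noteq> 0"
      have il: "i < length zs" using i by auto
      have kd: "k < length (del i zs)" "fst (del i zs ! k) = tp2"
        and pd: "pat (proj_above B (del i zs ! k)) (proj_above D (del i zs ! k)) (drop k (del i zs)) = W1 @ TT # W2"
        using nz unfolding shuf_def by (auto split: if_splits)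
      show False
      proof (cases "i \<le> k")
        case True
        then have "del i zs ! k = zs ! Suc k" "Suc k < length zs" using kd(1) il by (auto simp: nth_del length_del)
        then show False using kd(2) card_tp2 cardz[of "Suc k"] by simp
      next
        case False
        let ?j = "i - k"
        have d: "drop k (del i zs) = del ?j ws" unfolding ws_def using False by (intro drop_del_ge) simp
        have dk: "del i zs ! k = ?x" using False il by (simp add: nth_del)
        have tp: "fst ?x = tp2" using kd(2) dk by simp
        have jl: "?j < length ws" using il False by (simp add: ws_def)
        have pn: "pat ?f ?g (del ?j ws) ! length W1 = TT" using pd unfolding d dk by simp
        have l2: "Suc (length W1) < length (del ?j ws)" using lws jl by (simp add: length_del)
        show False
        proof (cases "?j \<le> length W1")
          case True
          then have "del ?j ws ! length W1 = ws ! Suc (length W1)" "del ?j ws ! Suc (length W1) = ws ! Suc (Suc (length W1))"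
            using jl by (auto simp: nth_del)
          then show False using pn stp[OF _ tp, of "Suc (length W1)"] lws unfolding pat_nth[OF l2] by auto
        next
          case F2: False
          have "?j \<noteq> Suc (length W1)" using i(2) False by auto
          then have "del ?j ws ! length W1 = ws ! length W1" "del ?j ws ! Suc (length W1) = ws ! Suc (length W1)"
            using F2 jl by (auto simp: nth_del)
          then show False using pn stp[OF _ tp, of "length W1"] lws unfolding pat_nth[OF l2] by auto
        qed
      qed
    qed
    have "dC S ?F zs = (\<Sum>i\<in>{1..<length zs - 1}. (-1)^i * ?F (del i zs))"
      by (rule chain_dC[OF finS F ch, symmetric])
    also have "\<dots> = (\<Sum>i\<in>{1..<length zs - 1}. if i = ?p then (-1)^i * ?F (del i zs) else 0)"
      by (rule sum.cong[OF refl]) (use zero in auto)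
    also have "\<dots> = (-1) ^ ?p * ?F (del ?p zs)" using lp by (subst sum.delta) auto
    also have "?F (del ?p zs) = (?E1 + ?E2) zs"
    proof -
      have delF: "del ?p zs \<in> FC S" by (rule P.full_chains_del[OF zs lp])
      have dk: "del ?p zs ! k = ?x" using lp by (subst nth_del) auto
      have tk: "take (Suc k) (del ?p zs) = take (Suc k) zs" by (rule take_del_ge) simp
      have kl: "k < length (del ?p zs)" using lp by (simp add: length_del)
      have dd: "drop k (del ?p zs) = del (Suc (length W1)) ws" unfolding ws_def by (subst drop_del_ge) auto
      define xs where "xs = take (length W1) ws"
      define ys where "ys = drop (length W1 + 3) ws"
      obtain a b c where w: "ws = xs @ a # b # c # ys"
      proof -
        have "ws = xs @ drop (length W1) ws" by (simp add: xs_def)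
        moreover have "drop (length W1) ws = ws ! length W1 # ws ! Suc (length W1) # ws ! Suc (Suc (length W1)) # ys"
          unfolding ys_def using lws by (simp add: Cons_nth_drop_Suc numeral_3_eq_3)
        ultimately show ?thesis using that by metis
      qed
      have lxs: "length xs = length W1" unfolding xs_def using lws by simp
      have dws: "del (Suc (length W1)) ws = xs @ a # c # ys" unfolding del_def w using lxs by simp
      show ?thesis
      proof (cases "fst ?x = tp2")
        case False
        then show ?thesis unfolding shuf_def plus_fun_apply dk by simp
      next
        case tp: True
        let ?pr = "\<lambda>y z. (?f y \<noteq> ?f z, ?g y \<noteq> ?g z)"
        have p1: "pat ?f ?g (xs @ a # c # ys) = pat ?f ?g (xs @ [a]) @ ?pr a c # pat ?f ?g (c # ys)"
          by (subst pat_append) simp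
        have p2: "pat ?f ?g ws = pat ?f ?g (xs @ [a]) @ ?pr a b # ?pr b c # pat ?f ?g (c # ys)"
          unfolding w by (subst pat_append) simp
        have lpx: "length (pat ?f ?g (xs @ [a])) = length W1" using lxs by (simp add: length_pat)
        have sab: "?pr a b \<in> {TF, FT}" using stp[OF _ tp, of "length W1"] lws lxs unfolding w by (simp add: nth_append)
        have sbc: "?pr b c \<in> {TF, FT}" using stp[OF _ tp, of "Suc (length W1)"] lws lxs unfolding w by (simp add: nth_append)
        \<comment> \<open>By monotonicity a coordinate that agrees at \<open>a\<close> and
          \<open>c\<close> is constant in between, so two steps in the same coordinate do not
          cancel.\<close>
        have mono: "?f a = ?f c \<Longrightarrow> ?f b = ?f a" "?g a = ?g c \<Longrightarrow> ?g b = ?g a"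
        proof -
          interpret X: par_setup S A B D ?x by (rule par_x[OF x tp])
          have idx: "a = zs ! (k + length W1)" "b = zs ! (k + Suc (length W1))" "c = zs ! (k + Suc (Suc (length W1)))"
            using wsn[of "length W1"] wsn[of "Suc (length W1)"] wsn[of "Suc (Suc (length W1))"] lws lxs unfolding w
            by (auto simp: nth_append)
          have m: "a \<in> NCP2 S" "b \<in> NCP2 S" "c \<in> NCP2 S" unfolding idx by (rule chain_mem[OF ch]; use len lz in simp)+
          have le: "ncp2_le S ?x a" "ncp2_le S ?x b" "ncp2_le S ?x c" "ncp2_le S a b" "ncp2_le S b c"
            unfolding idx by (rule chain_nth_le[OF finS ch]; use len lz in simp)+
          interpret PB: finite_poset "NCP2 B" "ncp2_le B" by (rule finite_poset_NCP2[OF fin(2)])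
          interpret PD: finite_poset "NCP2 D" "ncp2_le D" by (rule finite_poset_NCP2[OF fin(3)])
          show "?f a = ?f c \<Longrightarrow> ?f b = ?f a"
            using PB.le_antisym[OF X.B.above_NCP2[OF m(2) le(2)] X.B.above_NCP2[OF m(1) le(1)]]
              X.B.above_mono[OF m(1) le(1) m(2) le(2) le(4)] X.B.above_mono[OF m(2) le(2) m(3) le(3) le(5)] by simp
          show "?g a = ?g c \<Longrightarrow> ?g b = ?g a"
            using PD.le_antisym[OF X.D.above_NCP2[OF m(2) le(2)] X.D.above_NCP2[OF m(1) le(1)]]
              X.D.above_mono[OF m(1) le(1) m(2) le(2) le(4)] X.D.above_mono[OF m(2) le(2) m(3) le(3) le(5)] by simp
        qed
        have iff: "pat ?f ?g (xs @ a # c # ys) = W1 @ TT # W2 \<longleftrightarrow>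
            pat ?f ?g ws = W1 @ TF # FT # W2 \<or> pat ?f ?g ws = W1 @ FT # TF # W2"
        proof -
          have 1: "pat ?f ?g (xs @ a # c # ys) = W1 @ TT # W2 \<longleftrightarrow>
            pat ?f ?g (xs @ [a]) = W1 \<and> ?pr a c = TT \<and> pat ?f ?g (c # ys) = W2"
            unfolding p1 using lpx by (simp only: append_eq_append_conv list.inject simp_thms)
          have 2: "pat ?f ?g ws = W1 @ \<alpha> # \<beta> # W2 \<longleftrightarrow>
            pat ?f ?g (xs @ [a]) = W1 \<and> ?pr a b = \<alpha> \<and> ?pr b c = \<beta> \<and> pat ?f ?g (c # ys) = W2" for \<alpha> \<beta>
            unfolding p2 using lpx by (simp only: append_eq_append_conv list.inject simp_thms)
          have 3: "?pr a c = TT \<longleftrightarrow> ?pr a b = TF \<and> ?pr b c = FT \<or> ?pr a b = FT \<and> ?pr b c = TF"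
            using sab sbc mono by auto
          show ?thesis unfolding 1 2 using 3 by blast
        qed
        have excl: "W1 @ TF # FT # W2 \<noteq> W1 @ FT # TF # W2" by simp
        show ?thesis
        proof (cases "pat ?f ?g (xs @ a # c # ys) = W1 @ TT # W2")
          case True
          then have "pat ?f ?g (xs @ [a]) = W1 \<and> ?pr a c = TT \<and> pat ?f ?g (c # ys) = W2"
            unfolding p1 using lpx by (simp only: append_eq_append_conv list.inject simp_thms)
          then have "?f b = ?f a \<or> ?f b = ?f c" "?g b = ?g a \<or> ?g b = ?g c" using sab sbc by auto
          then have rd: "remdups_adj (map ?f ws) = remdups_adj (map ?f (xs @ a # c # ys))"
            "remdups_adj (map ?g ws) = remdups_adj (map ?g (xs @ a # c # ys))"
            unfolding w by (simp_all add: remdups_adj_middle)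
          have "(?E1 + ?E2) zs = u (map (dbl A B D s t ?x) (take (Suc k) zs)) * v (remdups_adj (map ?f ws)) * w (remdups_adj (map ?g ws))"
            unfolding shuf_def plus_fun_apply ws_def[symmetric]
            using zs k tp excl True iff by auto
          then show ?thesis
            unfolding shuf_def[of A B D s t k u v w "W1 @ TT # W2"] dk tk dd dws rd using delF kl tp True by simp
        next
          case False
          then show ?thesis
            unfolding shuf_def plus_fun_apply dk tk dd dws ws_def[symmetric]
            using iff by auto
        qed
      qed
    qed
    finally show ?thesis .
  qed
  then have "dC S ?F = scale_fun ((-1) ^ ?p) (?E1 + ?E2)" by (intro ext) simp
  then have "scale_fun ((-1) ^ ?p) (?E1 + ?E2) \<in> hB S (int (card S) - 1)"
    unfolding coboundaries_def using F by (metis image_eqI)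
  \<comment> \<open>A second factor of the same sign removes it.\<close>
  then have "scale_fun ((-1) ^ ?p) (scale_fun ((-1) ^ ?p) (?E1 + ?E2)) \<in> hB S (int (card S) - 1)"
    by (rule submodule.scale_mem[OF submodule_coboundaries])
  then show ?thesis by (cases "even ?p") (simp_all add: scale_scale minus_one_power scale_neg)
qed


text \<open>One step in the second coordinate passes \<open>i\<close> steps in the first, at the
  cost of one sign for each exchange.\<close>

lemma move_one:
  fixes u v w :: "'a ncp2 list \<Rightarrow> 'k::{comm_ring, comm_monoid_mult}"
  assumes "length W1 + i + length W2 + 2 + k = card S" "set W1 \<subseteq> {TF, FT}" "set W2 \<subseteq> {TF, FT}"
  shows "shuf A B D s t k u v w (W1 @ replicate i TF @ FT # W2)
    - scale_fun ((-1) ^ i) (shuf A B D s t k u v w (W1 @ FT # replicate i TF @ W2)) \<in> hB S (int (card S) - 1)"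
  using assms
proof (induction i arbitrary: W2)
  case 0
  show ?case
    unfolding replicate_0 append_Nil append_Nil2 mult_0_right power_0 scale_one diff_self
    by (rule submodule.zero_mem[OF submodule_coboundaries])
next
  case (Suc i)
  let ?E = "shuf A B D s t k u v w"
  let ?X = "?E (W1 @ replicate i TF @ TF # FT # W2)" and ?Y = "?E (W1 @ replicate i TF @ FT # TF # W2)"
    and ?Z = "?E (W1 @ FT # replicate i TF @ TF # W2)"
  have 1: "?X + ?Y \<in> hB S (int (card S) - 1)"
    using flip[of "W1 @ replicate i TF" W2 u v w] Suc.prems by (simp add: set_replicate_conv_if)
  have 2: "?Y - scale_fun ((-1) ^ i) ?Z \<in> hB S (int (card S) - 1)" 
    by (rule Suc.IH) (use Suc.prems in auto)
  have e: "?X - scale_fun ((-1) ^ Suc i) ?Z = (?X + ?Y) - (?Y - scale_fun ((-1) ^ i) ?Z)"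
    by (rule ext) (simp add: minus_mult_left[symmetric])
  have "?X - scale_fun ((-1) ^ Suc i) ?Z \<in> hB S (int (card S) - 1)"
    by (subst e) (rule submodule.diff_mem[OF submodule_coboundaries 1 2])
  moreover have r: "replicate (Suc i) TF @ xs = replicate i TF @ TF # xs" for xs
    by (simp add: replicate_app_Cons_same)
  ultimately show ?case unfolding r by (simp only:)
qed

text \<open>The steps in the second coordinate are moved one after the other, each past
  \<open>i\<close> steps in the first; those already moved join \<open>W1\<close>.\<close>

lemma move_all:
  fixes u v w :: "'a ncp2 list \<Rightarrow> 'k::{comm_ring, comm_monoid_mult}"
  assumes "length W1 + i + j + 1 + k = card S" "set W1 \<subseteq> {TF, FT}"
  shows "shuf A B D s t k u v w (W1 @ replicate i TF @ replicate j FT)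
    - scale_fun ((-1) ^ (i * j)) (shuf A B D s t k u v w (W1 @ replicate j FT @ replicate i TF)) \<in> hB S (int (card S) - 1)"
  using assms
proof (induction j arbitrary: W1)
  case 0
  show ?case
    unfolding replicate_0 append_Nil append_Nil2 mult_0_right power_0 scale_one diff_self
    by (rule submodule.zero_mem[OF submodule_coboundaries])
next
  case (Suc j)
  let ?E = "shuf A B D s t k u v w"
  let ?X = "?E (W1 @ replicate i TF @ FT # replicate j FT)" and ?Y = "?E (W1 @ FT # replicate i TF @ replicate j FT)"
    and ?Z = "?E (W1 @ FT # replicate j FT @ replicate i TF)"
  have 1: "?X - scale_fun ((-1) ^ i) ?Y \<in> hB S (int (card S) - 1)"
    using move_one[of W1 i "replicate j FT" u v w] Suc.prems by (simp add: set_replicate_conv_if)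
  have 2: "?Y - scale_fun ((-1) ^ (i * j)) ?Z \<in> hB S (int (card S) - 1)" 
  proof -
    have l: "length (W1 @ [FT]) + i + j + 1 + k = card S" "set (W1 @ [FT]) \<subseteq> {TF, FT}" using Suc.prems by auto
    have e: "(W1 @ [FT]) @ x = W1 @ FT # x" for x by simp
    show ?thesis using Suc.IH[OF l] unfolding e .
  qed
  have "?X - scale_fun ((-1) ^ (i * Suc j)) ?Z = (?X - scale_fun ((-1) ^ i) ?Y) + scale_fun ((-1) ^ i) (?Y - scale_fun ((-1) ^ (i * j)) ?Z)"
    by (rule ext) (simp add: right_diff_distrib power_add mult.assoc)
  then have "?X - scale_fun ((-1) ^ (i * Suc j)) ?Z \<in> hB S (int (card S) - 1)"
    using submodule.add_mem[OF submodule_coboundaries 1 submodule.scale_mem[OF submodule_coboundaries 2]] by metis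
  then show ?case unfolding replicate_Suc append_Cons .
qed

text \<open>The second cut, at index \<open>k + l\<close>, requires an element where the first
  coordinate has finished and the second has not moved. For a maximal chain this says that all steps
  in the first coordinate precede those in the second.\<close>

lemma circ_circ_shuf:
  fixes u v w :: "'a ncp2 list \<Rightarrow> 'k::{comm_ring, comm_monoid_mult}"
  assumes u: "u \<in> TC (insert s (insert t A))" and v: "v \<in> TC B" and w: "w \<in> TC D"
  shows "circ_cochain (A \<union> B) t D (circ_cochain (insert t A) s B u v) w
    = shuf A B D s t k u v w (replicate (card B - 1) TF @ replicate (card D - 1) FT)"
proof (rule ext)
  fix zs
  define l where "l = card B - 1"
  define m where "m = card D - 1"
  let ?W = "replicate l TF @ replicate m FT"
  interpret C1: comp_sets "insert t A" B s using fin disj t s Bne st by unfold_locales auto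
  interpret C2: comp_sets "A \<union> B" D t using fin disj t s Dne by unfold_locales auto
  have un: "insert t A \<union> B = insert t (A \<union> B)" by simp
  have u': "u \<in> CC (insert s (insert t A)) (int k)" using u fin s t st by simp
  have v': "v \<in> CC B (int l)" using v card_B by (simp add: l_def of_nat_diff)
  have w': "w \<in> CC D (int m)" using w card_D by (simp add: m_def of_nat_diff)
  have uv: "circ_cochain (insert t A) s B u v \<in> CC (insert t (A \<union> B)) (int (k + l))"
    using C1.circ_CC[OF u' v'] by (simp add: add.assoc)
  have klm: "k + l + m + 1 = card S" using cardS card_B card_D by (simp add: l_def m_def)
  let ?L = "circ_cochain (A \<union> B) t D (circ_cochain (insert t A) s B u v) w" and ?R = "shuf A B D s t k u v w ?W"
  have L: "?L \<in> CC S (int (k + l) + int m)" by (rule C2.circ_CC[OF uv w'])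
  have R: "?R \<in> CC S (int (k + length ?W))" by (rule shuf_CC)
  show "?L zs = shuf A B D s t k u v w (replicate (card B - 1) TF @ replicate (card D - 1) FT) zs"
    unfolding l_def[symmetric] m_def[symmetric]
  proof (cases "zs \<in> FC S \<and> length zs = card S")
    case False
    have "?L zs = 0" by (rule ccontr) (use cochains_support[OF L, of zs] False klm in auto)
    moreover have "?R zs = 0" by (rule ccontr) (use cochains_support[OF R, of zs] False klm in auto)
    ultimately show "?L zs = ?R zs" by simp
  next
    case True
    then have zs: "zs \<in> FC S" and lz: "length zs = card S" by auto
    note ch = FC_chain[OF zs]
    have k: "k < length zs" and kl: "k + l < length zs" using klm lz by auto
    let ?x = "zs ! k" and ?y = "zs ! (k + l)"
    let ?f = "proj_above B ?x" and ?g = "proj_above D ?x"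
    have x: "?x \<in> NCP2 S" and y: "?y \<in> NCP2 S" using chain_mem[OF ch] k kl by auto
    have xy: "ncp2_le S ?x ?y" by (rule chain_nth_le[OF finS ch]) (use kl in auto)
    let ?us = "map (proj_below (A \<union> B) t D ?y) (take (Suc (k + l)) zs)"
    have usk: "?us ! k = proj_below (A \<union> B) t D ?y ?x" using kl by simp
    have Lz: "?L zs = (if fst ?y = C2.tp \<and> fst (?us ! k) = C1.tp then
        u (map (proj_below (insert t A) s B (?us ! k)) (take (Suc k) ?us)) * v (map (proj_above B (?us ! k)) (drop k ?us))
        * w (map (proj_above D ?y) (drop (k + l) zs)) else 0)"
    proof (cases "fst ?y = C2.tp")
      case tp: True
      have "chain (insert t (A \<union> B)) ?us" by (rule C2.chain_below[OF ch kl tp])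
      then have "chain (insert t A \<union> B) ?us" unfolding un .
      then show ?thesis using tp zs k kl
        by (simp add: C2.circ_apply[OF uv w'] C1.circ_apply_chain[OF u' v'] del: nth_map)
    qed (simp add: C2.circ_apply[OF uv w'])
    have Rz: "?R zs = (if fst ?x = tp2 \<and> pat ?f ?g (drop k zs) = ?W then u (map (dbl A B D s t ?x) (take (Suc k) zs))
       * v (remdups_adj (map ?f (drop k zs))) * w (remdups_adj (map ?g (drop k zs))) else 0)"
      using zs k by (simp add: shuf_def)
    have c1: "fst (?us ! k) = C1.tp \<longleftrightarrow> fst ?x = tp2" if "fst ?y = C2.tp"
      unfolding usk by (rule par_fst_iff[OF C2.below_x[OF y that] disj(1) x xy])
    show "?L zs = ?R zs"
    proof (cases "fst ?x = tp2")
      case False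
      then show ?thesis unfolding Lz Rz using c1 by auto
    next
      case tp: True
      interpret X: par_setup S A B D ?x by (rule par_x[OF x tp])
      let ?ws = "drop k zs"
      have lws: "length ?ws = l + m + 1" using lz klm by simp
      have wsi: "?ws ! i = zs ! (k + i)" if "i < length ?ws" for i using that k by simp
      have wm: "?ws ! i \<in> NCP2 S" "ncp2_le S ?x (?ws ! i)" if "i < length ?ws" for i
        using chain_mem[OF ch, of "k + i"] chain_nth_le[OF finS ch, of k "k + i"] that by auto
      have wle: "ncp2_le S (?ws ! i) (?ws ! j)" if "i \<le> j" "j < length ?ws" for i j
        using chain_nth_le[OF finS ch, of "k + i" "k + j"] that by auto
      define cB where "cB i = card (fst (?f (?ws ! i)))" for i
      define cD where "cD i = card (fst (?g (?ws ! i)))" for i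
      have fm: "?f (?ws ! i) \<in> NCP2 B" "?g (?ws ! i) \<in> NCP2 D" if "i < length ?ws" for i
        using X.B.above_NCP2[OF wm[OF that]] X.D.above_NCP2[OF wm[OF that]] by auto
      have fle: "ncp2_le B (?f (?ws ! i)) (?f (?ws ! j))" "ncp2_le D (?g (?ws ! i)) (?g (?ws ! j))"
        if "i \<le> j" "j < length ?ws" for i j
      proof -
        have i: "i < length ?ws" using that by simp
        show "ncp2_le B (?f (?ws ! i)) (?f (?ws ! j))" by (rule X.B.above_mono[OF wm[OF i] wm[OF that(2)] wle[OF that]])
        show "ncp2_le D (?g (?ws ! i)) (?g (?ws ! j))" by (rule X.D.above_mono[OF wm[OF i] wm[OF that(2)] wle[OF that]])
      qed
      \<comment> \<open>The entry has \<open>k + i + 1\<close> blocks, of which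
        \<open>card A\<close> are the singletons outside \<open>B\<close> and
        \<open>D\<close>.\<close>
      have csum: "cB i + cD i = i + 2" if "i < length ?ws" for i
      proof -
        have "card (fst (?ws ! i)) = Suc (k + i)"
          using chain_card[OF finS Sne ch lz, of "k + i"] wsi[OF that] that by simp
        then show ?thesis using X.card_decomp[OF wm[OF that]] by (simp add: cB_def cD_def)
      qed
      have bnd: "1 \<le> cB i" "cB i \<le> Suc l" "1 \<le> cD i" "cD i \<le> Suc m" if "i < length ?ws" for i
        using card_fst_bounds[OF fin(2) Bne fm(1)[OF that]] card_fst_bounds[OF fin(3) Dne fm(2)[OF that]] card_B card_D
        by (auto simp: cB_def cD_def l_def m_def)
      have cmono: "cB i \<le> cB j" "cD i \<le> cD j" if "i \<le> j" "j < length ?ws" for i j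
        unfolding cB_def cD_def using le_card[OF fin(2) fm(1) fm(1) fle(1)[OF that]] le_card[OF fin(3) fm(2) fm(2) fle(2)[OF that]] that by auto
      have eqB: "?f (?ws ! i) = ?f (?ws ! j) \<longleftrightarrow> cB i = cB j" if "i \<le> j" "j < length ?ws" for i j
        using strict_card[OF fin(2) fm(1)[of i] fm(1)[of j]] fle(1)[OF that] that unfolding strict_def cB_def by fastforce
      have eqD: "?g (?ws ! i) = ?g (?ws ! j) \<longleftrightarrow> cD i = cD j" if "i \<le> j" "j < length ?ws" for i j
        using strict_card[OF fin(3) fm(2)[of i] fm(2)[of j]] fle(2)[OF that] that unfolding strict_def cD_def by fastforce
      have yl: "?y = ?ws ! l" using wsi[of l] lws by simp
      have ll: "l < length ?ws" using lws by simp
      have tyl: "fst ?y = C2.tp \<longleftrightarrow> cB l = Suc l \<and> cD l = 1"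
      proof -
        have "fst ?y = C2.tp \<longleftrightarrow> fst (?f ?y) = singles B \<and> fst (?g ?y) = {D}" by (rule X.fst_type_iff[OF y xy])
        also have "fst (?f ?y) = singles B \<longleftrightarrow> cB l = Suc l"
        proof -
          have c: "cB l = card (fst (?f ?y))" unfolding cB_def yl ..
          have l: "Suc l = card B" using card_B by (simp add: l_def)
          show ?thesis unfolding c l
            using card_fst_bounds(3)[OF fin(2) Bne fm(1)[OF ll, folded yl]] by (auto simp: card_singles)
        qed
        also have "fst (?g ?y) = {D} \<longleftrightarrow> cD l = 1"
        proof
          assume "cD l = 1"
          then have "?g ?y = ncp2_bot D" using card_fst_1_bot[OF fin(3) Dne fm(2)[OF ll]] unfolding yl cD_def by simp
          then show "fst (?g ?y) = {D}" by (simp add: fst_bot)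
        next
          have d: "cD l = card (fst (?g ?y))" unfolding cD_def yl ..
          assume "fst (?g ?y) = {D}"
          then show "cD l = 1" unfolding d by simp
        qed
        finally show ?thesis .
      qed
      have cond: "fst ?y = C2.tp \<longleftrightarrow> pat ?f ?g ?ws = ?W"
      proof
        assume "fst ?y = C2.tp"
        then have cl: "cB l = Suc l" "cD l = 1" using tyl by auto
        show "pat ?f ?g ?ws = ?W"
        proof (rule nth_equalityI)
          show "length (pat ?f ?g ?ws) = length ?W" using lws by (simp add: length_pat)
          fix i assume "i < length (pat ?f ?g ?ws)"
          then have i: "Suc i < length ?ws" by (simp add: length_pat)
          show "pat ?f ?g ?ws ! i = ?W ! i"
          proof (cases "i < l")
            case True
            have "cD i = 1" "cD (Suc i) = 1" using cmono(2)[of i l] cmono(2)[of "Suc i" l] bnd(3)[of i] bnd(3)[of "Suc i"] cl True ll i by auto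
            then show ?thesis unfolding pat_nth[OF i] using eqB[of i "Suc i"] eqD[of i "Suc i"] csum[of i] csum[of "Suc i"] i True
              by (simp add: nth_append)
          next
            case False
            have "cB i = Suc l" "cB (Suc i) = Suc l" using cmono(1)[of l i] cmono(1)[of l "Suc i"] bnd(2)[of i] bnd(2)[of "Suc i"] cl False ll i by auto
            then show ?thesis unfolding pat_nth[OF i] using eqB[of i "Suc i"] eqD[of i "Suc i"] csum[of i] csum[of "Suc i"] i False lws
              by (simp add: nth_append)
          qed
        qed
      next
        assume p: "pat ?f ?g ?ws = ?W"
        \<comment> \<open>The first \<open>l\<close> steps of the pattern leave the second
          coordinate fixed, and it starts with one block.\<close>
        have "cD i = cD 0" if "i \<le> l" for i
          using that
        proof (induction i)
          case (Suc i)
          have i: "Suc i < length ?ws" using Suc.prems lws by simp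
          have "pat ?f ?g ?ws ! i = TF" unfolding p using Suc.prems by (simp add: nth_append)
          then have "?g (?ws ! i) = ?g (?ws ! Suc i)" unfolding pat_nth[OF i] by blast
          then have "cD (Suc i) = cD i" using eqD[of i "Suc i"] i by simp
          also have "\<dots> = cD 0" by (rule Suc.IH) (use Suc.prems in simp)
          finally show ?case .
        qed simp
        then have "cD l = cD 0" by blast
        moreover have "0 < length ?ws" using lws by simp
        then have "cD 0 = 1" using csum[of 0] bnd(1)[of 0] bnd(3)[of 0] by linarith
        ultimately show "fst ?y = C2.tp" using tyl csum[OF ll] by simp
      qed
      show ?thesis
      proof (cases "fst ?y = C2.tp")
        case False
        then show ?thesis unfolding Lz Rz using cond by simp
      next
        case ty: True
        then have cl: "cB l = Suc l" "cD l = 1" using tyl by auto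
        have cDi: "cD i = 1" "cB i = Suc i" if "i \<le> l" for i
          using cmono(2)[OF that ll] bnd(3)[of i] csum[of i] cl that lws by auto
        have cBi: "cB i = Suc l" "cD i = Suc (i - l)" if "l \<le> i" "i < length ?ws" for i
          using cmono(1)[OF that] bnd(2)[of i] csum[of i] cl that by auto
        have e1: "map (proj_below (insert t A) s B (?us ! k)) (take (Suc k) ?us) = map (dbl A B D s t ?x) (take (Suc k) zs)"
        proof -
          have "take (Suc k) ?us = map (proj_below (A \<union> B) t D ?y) (take (Suc k) zs)" by (simp add: take_map min_def)
          moreover have "proj_below (insert t A) s B (?us ! k) (proj_below (A \<union> B) t D ?y z) = dbl A B D s t ?x z"
            if z: "z \<in> set (take (Suc k) zs)" for z
            unfolding usk using X.par_u_J[OF y xy ty t s(1) st chain_take_le[OF finS ch k z]] by (intro dbl_eqI[symmetric])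
          ultimately show ?thesis by (simp del: nth_map)
        qed
        have e2: "map (proj_above B (?us ! k)) (drop k ?us) = remdups_adj (map ?f ?ws)"
        proof -
          have d: "drop k ?us = map (proj_below (A \<union> B) t D ?y) (take (Suc l) ?ws)"
            by (simp add: drop_map drop_take Suc_diff_le)
          have "proj_above B (?us ! k) (proj_below (A \<union> B) t D ?y z) = ?f z" if z: "z \<in> set (take (Suc l) ?ws)" for z
          proof -
            have z1: "z \<in> set ?ws" using z by (rule in_set_takeD)
            have z2: "ncp2_le S z ?y" using chain_take_le(2)[OF finS chain_drop[OF ch] ll z] yl by simp
            show ?thesis unfolding usk by (rule X.par_v[OF y xy ty t chain_drop_ge[OF finS ch z1] z2])
          qed
          then have "map (proj_above B (?us ! k)) (drop k ?us) = take (Suc l) (map ?f ?ws)" unfolding d take_map by (simp del: nth_map)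
          also have "\<dots> = remdups_adj (map ?f ?ws)"
          proof (rule remdups_adj_const_suffix[symmetric])
            show "l < length (map ?f ?ws)" using ll by simp
            show "map ?f ?ws ! i = map ?f ?ws ! l" if "l \<le> i" "i < length (map ?f ?ws)" for i
              using that cBi(1)[of i] eqB[of l i] cl by simp
            show "distinct (take (Suc l) (map ?f ?ws))" unfolding distinct_conv_nth
            proof (intro allI impI)
              fix i j assume i: "i < length (take (Suc l) (map ?f ?ws))" and j: "j < length (take (Suc l) (map ?f ?ws))" and ne: "i \<noteq> j"
              have ij: "i \<le> l" "j \<le> l" using i j by auto
              then have "?f (?ws ! i) \<noteq> ?f (?ws ! j)"
                using ne cDi(2)[of i] cDi(2)[of j] unfolding cB_def by fastforce
              then show "take (Suc l) (map ?f ?ws) ! i \<noteq> take (Suc l) (map ?f ?ws) ! j" using ij ll by simp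
            qed
          qed
          finally show ?thesis .
        qed
        have e3: "map (proj_above D ?y) (drop (k + l) zs) = remdups_adj (map ?g ?ws)"
        proof -
          have "proj_above D ?y z = ?g z" if z: "z \<in> set (drop (k + l) zs)" for z
            by (rule X.par_w[OF y xy ty t chain_drop_ge[OF finS ch z]])
          then have "map (proj_above D ?y) (drop (k + l) zs) = drop l (map ?g ?ws)" by (simp add: drop_map add.commute)
          also have "\<dots> = remdups_adj (map ?g ?ws)"
          proof (rule remdups_adj_const_prefix[symmetric])
            show "l < length (map ?g ?ws)" using ll by simp
            show "map ?g ?ws ! i = map ?g ?ws ! l" if "i \<le> l" for i
              using that cDi(1)[of i] eqD[of i l] cl ll by simp
            show "distinct (drop l (map ?g ?ws))" unfolding distinct_conv_nth
            proof (intro allI impI)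
              fix i j assume i: "i < length (drop l (map ?g ?ws))" and j: "j < length (drop l (map ?g ?ws))" and ne: "i \<noteq> j"
              have "cD (l + i) = Suc i" "cD (l + j) = Suc j" using cBi(2)[of "l + i"] cBi(2)[of "l + j"] i j by auto
              then have "?g (?ws ! (l + i)) \<noteq> ?g (?ws ! (l + j))" using ne unfolding cD_def by fastforce
              then show "drop l (map ?g ?ws) ! i \<noteq> drop l (map ?g ?ws) ! j" using i j by simp
            qed
          qed
          finally show ?thesis .
        qed
        show ?thesis unfolding Lz Rz using c1[OF ty] cond tp ty by (simp only: e1 e2 e3 simp_thms if_True)
      qed
    qed
  qed
qed

end

lemma pat_swap: "pat g f ws = map prod.swap (pat f g ws)"
  by (induction f g ws rule: pat.induct) auto

lemma shuf_swap:
  assumes "B \<inter> D = {}"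
  shows "shuf A D B t s k u w v W = shuf A B D s t k u v w (map prod.swap W)"
proof (rule ext)
  fix zs
  have un: "A \<union> D \<union> B = A \<union> B \<union> D" by blast
  have p: "pat g f ws = W \<longleftrightarrow> pat f g ws = map prod.swap W" for f :: "'a ncp2 \<Rightarrow> 'a ncp2" and g :: "'a ncp2 \<Rightarrow> 'a ncp2" and ws
    using pat_swap[of g f ws] pat_swap[of f g ws] by auto
  show "shuf A D B t s k u w v W zs = shuf A B D s t k u v w (map prod.swap W) zs"
    unfolding shuf_def un dbl_commute[OF assms] insert_commute[of D B] p[of "proj_above D (zs ! k)"]
    by (simp add: mult.assoc mult.commute[of "v _"])
qed

text \<open>The parallel axiom holds in top degree up to coboundaries only.\<close>

lemma (in par_comp) circ_par:
  fixes u v w :: "'a ncp2 list \<Rightarrow> 'k::{comm_ring, comm_monoid_mult}"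
  assumes u: "u \<in> TC (insert s (insert t A))" and v: "v \<in> TC B" and w: "w \<in> TC D"
  shows "circ_cochain (A \<union> B) t D (circ_cochain (insert t A) s B u v) w
    - scale_fun ((-1) ^ ((card B - 1) * (card D - 1))) (circ_cochain (A \<union> D) s B (circ_cochain (insert s A) t D u w) v)
    \<in> hB (A \<union> B \<union> D) (int (card (A \<union> B \<union> D)) - 1)"
proof -
  interpret W: par_comp A D B t s using fin disj Bne Dne s t st by unfold_locales auto
  have u': "u \<in> TC (insert t (insert s A))" using u by (simp add: insert_commute)
  have 1: "circ_cochain (A \<union> D) s B (circ_cochain (insert s A) t D u w) v
    = shuf A B D s t k u v w (replicate (card D - 1) FT @ replicate (card B - 1) TF)"
    unfolding W.circ_circ_shuf[OF u' w v] shuf_swap[OF disj(3)] by simp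
  show ?thesis
    unfolding circ_circ_shuf[OF u v w] 1
    using move_all[of "[]" "card B - 1" "card D - 1" u v w] cardS card_B card_D by simp
qed

section \<open>The relation in arity 3\<close>

text \<open>A chain with \<open>card S\<close> entries runs through all possible numbers of blocks,
  so nothing lies below its first or above its last entry.\<close>

lemma top_chain_FC:
  assumes S: "finite S" "S \<noteq> {}" and zs: "chain S zs" and len: "length zs = card S"
  shows "zs \<in> FC S"
proof (rule FC_I[OF zs])
  have pos: "0 < card S" using S by (simp add: card_gt_0_iff)
  then show ne: "zs \<noteq> []" using len by auto
  have hd: "hd zs = zs ! 0" and la: "last zs = zs ! (card S - 1)" using ne len by (simp_all add: hd_conv_nth last_conv_nth)
  have c0: "card (fst (hd zs)) = 1" "hd zs \<in> NCP2 S" unfolding hd using chain_card[OF S zs len, of 0] chain_mem[OF zs, of 0] pos len by simp_all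
  have c1: "card (fst (last zs)) = card S" "last zs \<in> NCP2 S" unfolding la
    using chain_card[OF S zs len, of "card S - 1"] chain_mem[OF zs, of "card S - 1"] pos len by simp_all
  fix y assume y: "y \<in> NCP2 S"
  show "\<not> strict (ncp2_le S) y (hd zs)" using strict_card[OF S(1) y c0(2)] card_fst_bounds(1)[OF S y] c0(1) by auto
  show "\<not> strict (ncp2_le S) (last zs) y" using strict_card[OF S(1) c1(2) y] card_fst_bounds(2)[OF S y] c1(1) by auto
qed

lemma chain2: "chain S [x, y] \<longleftrightarrow> x \<in> NCP2 S \<and> y \<in> NCP2 S \<and> strict (ncp2_le S) x y"
  by (auto simp: chain_def)

lemma w12_NCP2: "w12 \<in> NCP2 {1, 2}"
proof -
  have e: "{1..card {1, 2 :: nat}} = {1, 2}" by auto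
  have p: "partition_on {1, 2} {{1}, {2 :: nat}}" using partition_on_singletons[of "{1, 2 :: nat}"] by simp
  show ?thesis unfolding NCP2_NC e
    by (rule NC_I) (use p in \<open>auto simp: w12_def noncr_def bij_betw_def inj_on_def\<close>)
qed

lemma asg_w12: "asg w12 {1} = {1}" "asg w12 {2} = {2}" "fst w12 = {{1}, {2}}"
  by (simp_all add: w12_def)

lemma w12_FC: "[ncp2_bot {1, 2}, w12] \<in> FC {1, 2}"
proof (rule top_chain_FC)
  have b: "ncp2_bot {1, 2 :: nat} \<in> NCP2 {1, 2}" by (rule bot_NCP2) simp_all
  have "fst (ncp2_bot {1, 2 :: nat}) \<noteq> fst w12" unfolding fst_bot asg_w12(3) by (auto simp: doubleton_eq_iff)
  then have "strict (ncp2_le {1, 2}) (ncp2_bot {1, 2}) w12"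
    using bot_le[OF _ _ w12_NCP2] by (auto simp: strict_def)
  then show "chain {1, 2} [ncp2_bot {1, 2}, w12]" using b w12_NCP2 by (simp add: chain2)
qed simp_all

lemma w12_unique:
  assumes x: "x \<in> NCP2 {1, 2}" and f: "fst x = {{1}, {2 :: nat}}" and a: "asg x {1} = {1}" shows "x = w12"
proof (rule NCP2_J_inj[OF x w12_NCP2])
  note xN = NCP2_D[OF x]
  have ne: "asg x {2} \<noteq> asg x {1}"
  proof
    assume "asg x {2} = asg x {1}"
    moreover have "inj_on (asg x) (fst x)" using NC_D(5)[OF xN] by (simp add: bij_betw_def)
    ultimately show False unfolding f by (auto simp: inj_on_def)
  qed
  have "card (asg x {2}) = 1" using NC_D(6)[OF xN, of "{2}"] f by simp
  then obtain j where j: "asg x {2} = {j}" by (auto simp: card_1_singleton_iff)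
  have "asg x {2} \<subseteq> {1..card {1, 2 :: nat}}" by (rule asg_sub[OF xN]) (simp add: f)
  then have "j \<in> {1, 2}" unfolding j by auto
  then have "asg x {2} = {2}" using j ne a by auto
  then show "J x = J w12" unfolding J_def f asg_w12(3) image_insert image_empty a asg_w12(1,2) by (simp only:)
qed

text \<open>The cochain representing \<open>a \<prec> b\<close>.\<close>

definition prc :: "nat \<Rightarrow> nat \<Rightarrow> nat ncp2 list \<Rightarrow> 'k::{comm_ring, comm_monoid_mult}" where
  "prc a b = relabel_cochain (\<lambda>x. if x = 1 then a else b) {1, 2} (basis [ncp2_bot {1, 2}, w12])"

lemma basis_CC: "xs \<in> full_chains P le \<Longrightarrow> int (length xs) = k + 1 \<Longrightarrow> basis xs \<in> cochains P le k"
  by (auto simp: cochains_def basis_apply split: if_splits)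

lemma basis_w12_TC: "basis [ncp2_bot {1, 2}, w12] \<in> TC {1, 2}"
  by (rule basis_CC[OF w12_FC]) simp

lemma relabelling_12: "a \<noteq> b \<Longrightarrow> relabelling (\<lambda>x. if x = 1 then a else b) {1, 2 :: nat}"
  by unfold_locales (auto simp: inj_on_def)

lemma image_12: "(\<lambda>x. if x = 1 then a else b) ` {1, 2 :: nat} = {a, b}"
  by auto

lemma prc_TC: assumes "a \<noteq> b" shows "prc a b \<in> TC {a, b}"
proof -
  interpret relabelling "\<lambda>x. if x = 1 then a else b" "{1, 2 :: nat}" by (rule relabelling_12[OF assms])
  have "int (card {1, 2 :: nat}) - 1 = int (card {a, b}) - 1" using assms by simp
  then show ?thesis using relabel_cochain_CC[OF basis_w12_TC] unfolding prc_def image_12 by simp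
qed

lemma relabel_prc:
  assumes "a \<noteq> b" "\<tau> a \<noteq> \<tau> b" shows "relabel_cochain \<tau> {a, b} (prc a b) = prc (\<tau> a) (\<tau> b)"
proof -
  let ?t = "\<lambda>x. if x = 1 then a else b"
  interpret relabelling ?t "{1, 2 :: nat}" by (rule relabelling_12[OF assms(1)])
  have i: "inj_on \<tau> (?t ` {1, 2})" unfolding image_12 using assms by (auto simp: inj_on_def)
  have "relabel_cochain \<tau> {a, b} (prc a b) = relabel_cochain (\<tau> \<circ> ?t) {1, 2} (basis [ncp2_bot {1, 2}, w12])"
    unfolding prc_def using relabel_cochain_comp[OF finS inj i basis_w12_TC] unfolding image_12 .
  also have "\<tau> \<circ> ?t = (\<lambda>x. if x = 1 then \<tau> a else \<tau> b)" by auto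
  finally show ?thesis unfolding prc_def .
qed

text \<open>In arity 2 a maximal chain is given by its last element, and this by the position of one
  label.\<close>

lemma prc_apply:
  assumes ab: "a \<noteq> b" and ys: "chain {a, b} ys" "length ys = 2"
  shows "prc a b ys = (if asg (ys ! 1) {a} = {1} then 1 else 0)"
proof -
  let ?t = "\<lambda>x :: nat. if x = 1 then a else b"
  interpret relabelling ?t "{1, 2 :: nat}" by (rule relabelling_12[OF ab])
  have "ys \<in> FC {a, b}" by (rule top_chain_FC[OF _ _ ys(1)]) (use ab ys in simp_all)
  then have "ys \<in> FC (?t ` {1, 2})" unfolding image_12 .
  then obtain zs where zs: "zs \<in> FC {1, 2}" "ys = map R zs" by (rule FC_image)
  have l: "length zs = card {1, 2 :: nat}" using ys zs by simp
  have zc: "chain {1, 2} zs" by (rule FC_chain[OF zs(1)])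
  have m: "set zs \<subseteq> NCP2 {1, 2}" using zc by (simp add: chain_def)
  have z1: "zs ! 1 \<in> NCP2 {1, 2}" by (rule chain_mem[OF zc]) (use l in simp)
  have "card (fst (zs ! 1)) = card {1, 2 :: nat}" using chain_card[OF _ _ zc l, of 1] l by simp
  then have f: "fst (zs ! 1) = {{1}, {2}}" using card_fst_bounds(3)[OF _ _ z1] by simp
  have "asg (ys ! 1) {a} = asg (R (zs ! 1)) (?t ` {1})" using zs l by simp
  also have "\<dots> = asg (zs ! 1) {1}" by (rule asg_relabel[OF inj z1]) (unfold f, simp)
  finally have a: "asg (ys ! 1) {a} = asg (zs ! 1) {1}" .
  obtain x y where xy: "zs = [x, y]" using l by (cases zs; cases "tl zs") auto
  have x: "x = ncp2_bot {1, 2}" using full_chain_hd[OF _ _ zs(1)] xy by simp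
  have "zs = [ncp2_bot {1, 2}, w12] \<longleftrightarrow> asg (zs ! 1) {1} = {1}"
    using w12_unique[OF z1 f] asg_w12(1) unfolding xy x by auto
  then show ?thesis unfolding prc_def a using relabel_cochain_map[OF basis_w12_TC m] zs(2) by (simp add: basis_apply)
qed

text \<open>Position 1 is the least possible minimum, so the block that contains it is the one
  numbered 1.\<close>

lemma pos_1_iff:
  assumes "finite N" "partition_on N \<rho>" "R \<in> \<rho>" "\<And>i. i \<in> N \<Longrightarrow> 1 \<le> i" "1 \<in> N"
  shows "pos \<rho> ` R = {1} \<longleftrightarrow> 1 \<in> R"
proof -
  obtain R1 where R1: "R1 \<in> \<rho>" "1 \<in> R1" using partition_ex[OF assms(2,5)] by blast
  have m1: "Min R1 = 1"
    using Min_eqI[OF fin_blocks(2)[OF assms(1,2) R1(1)] _ R1(2)] partition_sub[OF assms(2) R1(1)] assms(4) by blast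
  have "pos \<rho> 1 = rk (Min ` \<rho>) 1" using pos_eq[OF assms(2) R1] m1 by simp
  also have "{m \<in> Min ` \<rho>. m \<le> 1} = {1}"
  proof
    show "{m \<in> Min ` \<rho>. m \<le> 1} \<subseteq> {1}"
    proof
      fix m assume "m \<in> {m \<in> Min ` \<rho>. m \<le> 1}"
      then obtain R' where R': "R' \<in> \<rho>" "m = Min R'" "m \<le> 1" by blast
      have "m \<in> N" using Min_block[OF assms(1,2) R'(1)] partition_sub[OF assms(2) R'(1)] R'(2) by blast
      then show "m \<in> {1}" using assms(4)[of m] R'(3) by simp
    qed
    show "{1} \<subseteq> {m \<in> Min ` \<rho>. m \<le> 1}" using R1(1) m1 by force
  qed
  then have "rk (Min ` \<rho>) 1 = 1" by (simp add: rk_def)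
  finally have p1: "pos \<rho> 1 = 1" .
  have q: "qm \<rho> (pos \<rho>)" by (rule pos_qm[OF assms(1,2)])
  have ne: "R \<noteq> {}" by (rule partition_ne[OF assms(2,3)])
  have U: "1 \<in> \<Union>\<rho>" using R1 by blast
  show ?thesis
  proof
    assume "pos \<rho> ` R = {1}"
    then obtain i where "i \<in> R" "pos \<rho> 1 = pos \<rho> i" using ne p1 by blast
    then show "1 \<in> R" using q assms(3) U unfolding qm_def by blast
  next
    assume 1: "1 \<in> R"
    have "pos \<rho> i = 1" if i: "i \<in> R" for i
    proof -
      have "i \<in> \<Union>\<rho>" using i assms(3) by blast
      then have "pos \<rho> i = pos \<rho> 1" using q assms(3) 1 i unfolding qm_def by blast
      then show ?thesis using p1 by simp
    qed
    then show "pos \<rho> ` R = {1}" using ne by auto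
  qed
qed

lemma rk_1_iff:
  assumes "finite F" "1 \<in> F" "\<And>i. i \<in> F \<Longrightarrow> 1 \<le> i" "j \<in> F" shows "rk F j = 1 \<longleftrightarrow> j = 1"
proof -
  have "{m \<in> F. m \<le> 1} = {1}"
  proof
    show "{m \<in> F. m \<le> 1} \<subseteq> {1}"
    proof
      fix m assume "m \<in> {m \<in> F. m \<le> 1}"
      then show "m \<in> {1}" using assms(3)[of m] by simp
    qed
  qed (use assms(2) in simp)
  then have "rk F 1 = 1" by (simp add: rk_def)
  then show ?thesis using inj_onD[OF rk_inj[OF assms(1)] _ assms(4,2)] by auto
qed

context
  fixes a b c :: nat
  assumes abc: "a \<noteq> b" "a \<noteq> c" "b \<noteq> c" "a \<noteq> 0" "b \<noteq> 0" "c \<noteq> 0"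
begin

text \<open>The outer factor asks that the block of \<open>a\<close> and \<open>b\<close> contain
  position 1, the inner one that \<open>a\<close> have the first position in it; together they say
  that \<open>a\<close> has position 1.\<close>

lemma prec_left_apply:
  assumes zs: "zs \<in> FC {a, b, c}" "length zs = 3"
  shows "circ_cochain {c} 0 {a, b} (prc 0 c) (prc a b) zs
    = (if fst (zs ! 1) = {{a, b}, {c}} \<and> asg (zs ! 2) {a} = {1} then 1 else 0)"
proof -
  interpret C: comp_sets "{c}" "{a, b}" 0 using abc by unfold_locales auto
  have S: "{c} \<union> {a, b} = {a, b, c}" by auto
  have u: "prc 0 c \<in> CC (insert 0 {c}) (int 1)" using prc_TC[of 0 c] abc by simp
  have v: "prc a b \<in> CC {a, b} 1" using prc_TC[of a b] abc by simp
  have ch: "chain ({c} \<union> {a, b}) zs" unfolding S by (rule FC_chain[OF zs(1)])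
  have cS: "card ({c} \<union> {a, b}) = 3" using abc by simp
  let ?x = "zs ! 1" and ?z = "zs ! 2"
  have k: "1 < length zs" using zs by simp
  have x: "?x \<in> NCP2 ({c} \<union> {a, b})" and z: "?z \<in> NCP2 ({c} \<union> {a, b})" using chain_mem[OF ch] zs(2) by auto
  have xz: "ncp2_le ({c} \<union> {a, b}) ?x ?z" by (rule chain_nth_le[OF C.finS ch]) (use zs in auto)
  have tpe: "C.tp = {{a, b}, {c}}" by simp
  show ?thesis
  proof (cases "fst ?x = C.tp")
    case tp: True
    interpret X: below "{c}" 0 "{a, b}" ?x by (rule C.below_x[OF x tp])
    interpret Y: above "{c} \<union> {a, b}" "{a, b}" ?x by (rule C.above_x[OF x tp])
    have cz: "card (fst ?z) = card ({c} \<union> {a, b})" using chain_card[OF C.finS _ ch, of 2] zs(2) cS by simp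
    have fz: "fst ?z = singles ({c} \<union> {a, b})" by (rule card_fst_bounds(3)[OF C.finS _ z cz]) simp
    have az: "{a} \<in> fst ?z" unfolding fz by blast
    note D = Y.crsD[OF z xz]
    have sub: "asg ?z {a} \<subseteq> Y.F" by (rule D(3)[OF Y.B az]) simp
    obtain j where j: "asg ?z {a} = {j}" using NC_D(6)[OF NCP2_D[OF z] az] by (auto simp: card_1_singleton_iff)
    have us: "map X.\<phi> (take (Suc 1) zs) ! 1 = X.\<phi> ?x" using zs by simp
    have "prc 0 c (map X.\<phi> (take (Suc 1) zs)) = (if asg (X.\<phi> ?x) {0} = {1} then 1 else (0::'a))"
      using prc_apply[of 0 c, OF _ C.chain_below[OF ch k tp]] abc zs unfolding us by simp
    moreover have "asg (X.\<phi> ?x) {0} = pos X.\<rho> ` Y.F"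
    proof -
      have "colq {a, b} 0 ` {a, b} = {0}" by auto
      then show ?thesis using X.asg_below[OF x X.le_y_refl Y.B] by simp
    qed
    moreover have "pos X.\<rho> ` Y.F = {1} \<longleftrightarrow> 1 \<in> Y.F"
      by (rule pos_1_iff[OF _ X.partN asg_in[OF Y.xNC Y.B]]) (use cS in auto)
    ultimately have 1: "prc 0 c (map X.\<phi> (take (Suc 1) zs)) = (if 1 \<in> Y.F then 1 else (0::'a))" by simp
    have dl: "map Y.\<psi> (drop 1 zs) ! 1 = Y.\<psi> ?z" using zs by (simp add: numeral_2_eq_2)
    have "prc a b (map Y.\<psi> (drop 1 zs)) = (if asg (Y.\<psi> ?z) {a} = {1} then 1 else (0::'a))"
      using prc_apply[of a b, OF _ C.chain_above[OF ch k tp]] abc zs unfolding dl by simp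
    moreover have "asg (Y.\<psi> ?z) {a} = rk Y.F ` asg ?z {a}" by (rule Y.asg_above[OF z xz az]) simp
    ultimately have 2: "prc a b (map Y.\<psi> (drop 1 zs)) = (if rk Y.F j = 1 then 1 else (0::'a))" unfolding j by simp
    have jF: "j \<in> Y.F" using sub j by simp
    have ge: "1 \<le> i" if "i \<in> Y.F" for i using asg_sub[OF Y.xNC Y.B] that by auto
    have iff: "1 \<in> Y.F \<and> rk Y.F j = 1 \<longleftrightarrow> j = 1"
      using rk_1_iff[OF Y.finF _ ge jF] jF by auto
    have zF: "zs \<in> FC ({c} \<union> {a, b})" unfolding S by (rule zs(1))
    show ?thesis unfolding C.circ_apply[OF u v] 1 2 j using zF k tp tpe iff by auto
  next
    case False
    then show ?thesis unfolding C.circ_apply[OF u v] using tpe by simp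
  qed
qed

text \<open>The outer factor asks that \<open>a\<close> have position 1. The inner factors ask that
  \<open>b\<close>, respectively \<open>c\<close>, come first of the two, and exactly one of these
  is true.\<close>

lemma prec_right_apply:
  assumes zs: "zs \<in> FC {a, b, c}" "length zs = 3"
  shows "circ_cochain {a} 0 {b, c} (prc a 0) (prc b c) zs + circ_cochain {a} 0 {b, c} (prc a 0) (prc c b) zs
    = (if fst (zs ! 1) = {{b, c}, {a}} \<and> asg (zs ! 2) {a} = {1} then 1 else 0)"
proof -
  interpret C: comp_sets "{a}" "{b, c}" 0 using abc by unfold_locales auto
  have S: "{a} \<union> {b, c} = {a, b, c}" by auto
  have u: "prc a 0 \<in> CC (insert 0 {a}) (int 1)" using prc_TC[of a 0] abc by (simp add: insert_commute)
  have v: "prc b c \<in> CC {b, c} 1" using prc_TC[of b c] abc by simp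
  have v': "prc c b \<in> CC {b, c} 1" using prc_TC[of c b] abc by (simp add: insert_commute)
  have ch: "chain ({a} \<union> {b, c}) zs" unfolding S by (rule FC_chain[OF zs(1)])
  have cS: "card ({a} \<union> {b, c}) = 3" using abc by simp
  let ?x = "zs ! 1" and ?z = "zs ! 2"
  have k: "1 < length zs" using zs by simp
  have x: "?x \<in> NCP2 ({a} \<union> {b, c})" and z: "?z \<in> NCP2 ({a} \<union> {b, c})" using chain_mem[OF ch] zs(2) by auto
  have xz: "ncp2_le ({a} \<union> {b, c}) ?x ?z" by (rule chain_nth_le[OF C.finS ch]) (use zs in auto)
  have tpe: "C.tp = {{b, c}, {a}}" by simp
  show ?thesis
  proof (cases "fst ?x = C.tp")
    case tp: True
    interpret X: below "{a}" 0 "{b, c}" ?x by (rule C.below_x[OF x tp])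
    interpret Y: above "{a} \<union> {b, c}" "{b, c}" ?x by (rule C.above_x[OF x tp])
    have cz: "card (fst ?z) = card ({a} \<union> {b, c})" using chain_card[OF C.finS _ ch, of 2] zs(2) cS by simp
    have fz: "fst ?z = singles ({a} \<union> {b, c})" by (rule card_fst_bounds(3)[OF C.finS _ z cz]) simp
    have ax: "{a} \<in> fst ?x" unfolding tp by blast
    have az: "{a} \<in> fst ?z" unfolding fz by blast
    note D = Y.crsD[OF z xz]
    have "asg ?z {a} \<subseteq> asg ?x {a}" by (rule D(3)[OF ax az]) simp
    moreover have "finite (asg ?x {a})" using asg_sub[OF Y.xNC ax] finite_subset by blast
    ultimately have asg_eq: "asg ?z {a} = asg ?x {a}"
      using card_subset_eq[of "asg ?x {a}" "asg ?z {a}"] NC_D(6)[OF NCP2_D[OF z] az] NC_D(6)[OF Y.xNC ax] by simp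
    obtain j where j: "asg ?z {a} = {j}" using NC_D(6)[OF NCP2_D[OF z] az] by (auto simp: card_1_singleton_iff)
    have us: "map X.\<phi> (take (Suc 1) zs) ! 1 = X.\<phi> ?x" using zs by simp
    have e: "insert 0 {a} = {a, 0}" by auto
    have l: "length (map X.\<phi> (take (Suc 1) zs)) = 2" using zs by simp
    have "prc a 0 (map X.\<phi> (take (Suc 1) zs)) = (if asg (X.\<phi> ?x) {a} = {1} then 1 else (0::'a))"
      using prc_apply[OF abc(4) C.chain_below[OF ch k tp, unfolded e] l] unfolding us .
    moreover have "asg (X.\<phi> ?x) {a} = pos X.\<rho> ` asg ?x {a}"
    proof -
      have "colq {b, c} 0 ` {a} = {a}" using abc by auto
      then show ?thesis using X.asg_below[OF x X.le_y_refl ax] by simp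
    qed
    moreover have "pos X.\<rho> ` asg ?x {a} = {1} \<longleftrightarrow> 1 \<in> asg ?x {a}"
      by (rule pos_1_iff[OF _ X.partN asg_in[OF Y.xNC ax]]) (use cS in auto)
    moreover have "1 \<in> asg ?x {a} \<longleftrightarrow> asg ?z {a} = {1}" unfolding asg_eq[symmetric] j by auto
    ultimately have 1: "prc a 0 (map X.\<phi> (take (Suc 1) zs)) = (if asg ?z {a} = {1} then 1 else (0::'a))" by simp
    note cA = C.chain_above[OF ch k tp]
    have dl: "map Y.\<psi> (drop 1 zs) ! 1 = Y.\<psi> ?z" using zs by (simp add: numeral_2_eq_2)
    have l2: "length (map Y.\<psi> (drop 1 zs)) = 2" using zs by simp
    have 2: "prc b c (map Y.\<psi> (drop 1 zs)) = (if asg (Y.\<psi> ?z) {b} = {1} then 1 else (0::'a))"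
      using prc_apply[of b c, OF abc(3) cA l2] unfolding dl .
    have cA': "chain {c, b} (map Y.\<psi> (drop 1 zs))" using cA by (simp add: insert_commute)
    have 3: "prc c b (map Y.\<psi> (drop 1 zs)) = (if asg (Y.\<psi> ?z) {c} = {1} then 1 else (0::'a))"
      using prc_apply[of c b, OF _ cA' l2] abc(3) unfolding dl by simp
    have pz: "Y.\<psi> ?z \<in> NCP2 {b, c}" by (rule Y.above_NCP2[OF z xz])
    have fp: "fst (Y.\<psi> ?z) = {{b}, {c}}" unfolding Y.fst_above[OF z xz] fz using abc by auto
    have one: "(asg (Y.\<psi> ?z) {b} = {1}) \<noteq> (asg (Y.\<psi> ?z) {c} = {1})"
    proof -
      note pN = NCP2_D[OF pz]
      have c1: "card (asg (Y.\<psi> ?z) {b}) = 1" "card (asg (Y.\<psi> ?z) {c}) = 1"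
        using NC_D(6)[OF pN, of "{b}"] NC_D(6)[OF pN, of "{c}"] fp by simp_all
      have inj: "asg (Y.\<psi> ?z) {b} \<noteq> asg (Y.\<psi> ?z) {c}"
        using NC_D(5)[OF pN] abc(3) unfolding bij_betw_def inj_on_def fp by auto
      have un: "asg (Y.\<psi> ?z) {b} \<union> asg (Y.\<psi> ?z) {c} = {1..card {b, c}}"
        using partition_onD1[OF NC_D(2)[OF pN]] asg_image[OF pN] unfolding fp by auto
      have "1 \<in> asg (Y.\<psi> ?z) {b} \<union> asg (Y.\<psi> ?z) {c}" unfolding un using abc(3) by simp
      then have "asg (Y.\<psi> ?z) {b} = {1} \<or> asg (Y.\<psi> ?z) {c} = {1}" using c1 by (auto simp: card_1_singleton_iff)
      then show ?thesis using inj by auto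
    qed
    have zF: "zs \<in> FC ({a} \<union> {b, c})" unfolding S by (rule zs(1))
    show ?thesis unfolding C.circ_apply[OF u v] C.circ_apply[OF u v'] 1 2 3 using zF k tp tpe one by auto
  next
    case False
    then show ?thesis unfolding C.circ_apply[OF u v] C.circ_apply[OF u v'] using tpe by simp
  qed
qed

end

lemma partition_123:
  assumes "partition_on {1, 2, 3 :: nat} P" "card P = 2"
  shows "P = {{1, 2}, {3}} \<or> P = {{1, 3}, {2}} \<or> P = {{2, 3}, {1}}"
proof -
  obtain X where X: "X \<in> P" "1 \<in> X" using partition_ex[OF assms(1), of 1] by auto
  obtain Y where Y: "P = {X, Y}" "X \<noteq> Y"
  proof -
    obtain U V where "P = {U, V}" "U \<noteq> V" using assms(2) by (meson card_2_iff)
    then show ?thesis using that[of U] that[of V] X by blast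
  qed
  have XY: "X \<inter> Y = {}" using partition_eq[OF assms(1) X(1), of Y] Y by blast
  have un: "X \<union> Y = {1, 2, 3}" using partition_onD1[OF assms(1)] Y by auto
  have Yne: "Y \<noteq> {}" using partition_ne[OF assms(1)] Y by blast
  have Yeq: "Y = {1, 2, 3} - X" using un XY by blast
  have "X \<subseteq> {1, 2, 3}" using un by blast
  then have "X = {1} \<or> X = {1, 2} \<or> X = {1, 3} \<or> X = {1, 2, 3}" using X(2) by auto
  then show ?thesis
  proof (elim disjE)
    assume "X = {1}"
    moreover have "{1, 2, 3} - {1} = {2, 3 :: nat}" by auto
    ultimately have "P = {{1}, {2, 3}}" unfolding Y(1) Yeq by (simp only:)
    then show ?thesis by (simp only: insert_commute simp_thms)
  next
    assume "X = {1, 2}"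
    moreover have "{1, 2, 3} - {1, 2} = {3 :: nat}" by auto
    ultimately have "P = {{1, 2}, {3}}" unfolding Y(1) Yeq by (simp only:)
    then show ?thesis by (simp only: simp_thms)
  next
    assume "X = {1, 3}"
    moreover have "{1, 2, 3} - {1, 3} = {2 :: nat}" by auto
    ultimately have "P = {{1, 3}, {2}}" unfolding Y(1) Yeq by (simp only:)
    then show ?thesis by (simp only: simp_thms)
  next
    assume "X = {1, 2, 3}"
    then show ?thesis using Yeq Yne by simp
  qed
qed

definition relation :: "nat ncp2 list \<Rightarrow> 'k::{comm_ring, comm_monoid_mult}" where
  "relation = circ_cochain {3} 0 {1, 2} (prc 0 3) (prc 1 2) + circ_cochain {1} 0 {2, 3} (prc 1 0) (prc 2 3)
     + circ_cochain {2} 0 {1, 3} (prc 0 2) (prc 1 3) + circ_cochain {1} 0 {3, 2} (prc 1 0) (prc 3 2)"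

text \<open>On every maximal chain the relation takes the value 1 or 0 according as the last element
  assigns the position 1 to the label 1 or not, independently of the middle element.\<close>

lemma relation_apply:
  assumes zs: "zs \<in> FC {1, 2, 3}" "length zs = 3"
  shows "relation zs = (if asg (zs ! 2) {1} = {1} then 1 else 0)"
proof -
  have zs': "zs \<in> FC {1, 3, 2}" using zs(1) by (simp add: insert_commute)
  have ch: "chain {1, 2, 3} zs" by (rule FC_chain[OF zs(1)])
  have m: "zs ! 1 \<in> NCP2 {1, 2, 3}" by (rule chain_mem[OF ch]) (use zs in simp)
  have "card (fst (zs ! 1)) = 2" using chain_card[OF _ _ ch, of 1] zs(2) by simp
  then have P: "fst (zs ! 1) = {{1, 2}, {3}} \<or> fst (zs ! 1) = {{1, 3}, {2}} \<or> fst (zs ! 1) = {{2, 3}, {1}}"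
    by (rule partition_123[OF NC_D(1)[OF NCP2_D[OF m]]])
  have e: "{3, 2 :: nat} = {2, 3}" by auto
  have "relation zs = circ_cochain {3} 0 {1, 2} (prc 0 3) (prc 1 2) zs + circ_cochain {2} 0 {1, 3} (prc 0 2) (prc 1 3) zs
     + (circ_cochain {1} 0 {2, 3} (prc 1 0) (prc 2 3) zs + circ_cochain {1} 0 {2, 3} (prc 1 0) (prc 3 2) zs)"
    unfolding relation_def plus_fun_apply e by (simp add: ac_simps)
  also have "circ_cochain {3} 0 {1, 2} (prc 0 3) (prc 1 2) zs = (if fst (zs ! 1) = {{1, 2}, {3}} \<and> asg (zs ! 2) {1} = {1} then 1 else 0)"
    by (rule prec_left_apply[OF _ _ _ _ _ _ zs]) auto
  also have "circ_cochain {2} 0 {1, 3} (prc 0 2) (prc 1 3) zs = (if fst (zs ! 1) = {{1, 3}, {2}} \<and> asg (zs ! 2) {1} = {1} then 1 else 0)"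
    by (rule prec_left_apply[OF _ _ _ _ _ _ zs' zs(2)]) auto
  also have "circ_cochain {1} 0 {2, 3} (prc 1 0) (prc 2 3) zs + circ_cochain {1} 0 {2, 3} (prc 1 0) (prc 3 2) zs
    = (if fst (zs ! 1) = {{2, 3}, {1}} \<and> asg (zs ! 2) {1} = {1} then 1 else 0)"
    by (rule prec_right_apply[OF _ _ _ _ _ _ zs]) auto
  finally have r: "relation zs = (if fst (zs ! 1) = {{1, 2}, {3}} \<and> asg (zs ! 2) {1} = {1} then 1 else 0)
     + (if fst (zs ! 1) = {{1, 3}, {2}} \<and> asg (zs ! 2) {1} = {1} then 1 else 0)
     + (if fst (zs ! 1) = {{2, 3}, {1}} \<and> asg (zs ! 2) {1} = {1} then 1 else (0::'a))" .
  have ne: "{{1, 2}, {3 :: nat}} \<noteq> {{1, 3}, {2}}" "{{1, 2}, {3 :: nat}} \<noteq> {{2, 3}, {1}}" "{{1, 3}, {2 :: nat}} \<noteq> {{2, 3}, {1}}"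
    by (auto simp: doubleton_eq_iff)
  show ?thesis using P unfolding r using ne by (elim disjE) auto
qed

lemma relation_summands_ZC:
  fixes a b c :: nat
  assumes "a \<noteq> b" "a \<noteq> c" "b \<noteq> c" "a \<noteq> 0" "b \<noteq> 0" "c \<noteq> (0::nat)"
  shows "(circ_cochain {c} 0 {a, b} (prc 0 c) (prc a b) :: _ \<Rightarrow> 'k::{comm_ring, comm_monoid_mult}) \<in> ZC {a, b, c} 2"
    "(circ_cochain {a} 0 {b, c} (prc a 0) (prc b c) :: _ \<Rightarrow> 'k) \<in> ZC {a, b, c} 2"
proof -
  have z: "(prc x y :: _ \<Rightarrow> 'k) \<in> ZC {x, y} 1" if "x \<noteq> y" for x y using TC_ZC[OF _ _ prc_TC[OF that]] that by simp
  interpret C: comp_sets "{c}" "{a, b}" 0 using assms by unfold_locales auto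
  have S: "{c} \<union> {a, b} = {a, b, c}" by auto
  have "(circ_cochain {c} 0 {a, b} (prc 0 c) (prc a b) :: _ \<Rightarrow> 'k) \<in> ZC ({c} \<union> {a, b}) (1 + 1)"
    by (rule C.circ_ZC) (use z assms in auto)
  then show "(circ_cochain {c} 0 {a, b} (prc 0 c) (prc a b) :: _ \<Rightarrow> 'k) \<in> ZC {a, b, c} 2" unfolding S by simp
  interpret D: comp_sets "{a}" "{b, c}" 0 using assms by unfold_locales auto
  have S': "{a} \<union> {b, c} = {a, b, c}" by auto
  have "(prc a 0 :: _ \<Rightarrow> 'k) \<in> ZC (insert 0 {a}) 1" using z[of a 0] assms by (simp add: insert_commute)
  then have "(circ_cochain {a} 0 {b, c} (prc a 0) (prc b c) :: _ \<Rightarrow> 'k) \<in> ZC ({a} \<union> {b, c}) (1 + 1)"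
    by (rule D.circ_ZC) (use z assms in auto)
  then show "(circ_cochain {a} 0 {b, c} (prc a 0) (prc b c) :: _ \<Rightarrow> 'k) \<in> ZC {a, b, c} 2" unfolding S' by simp
qed

lemma relation_hB: "(relation :: nat ncp2 list \<Rightarrow> 'k::{comm_ring, comm_monoid_mult}) \<in> hB {1, 2, 3} 2"
proof -
  let ?S = "{1, 2, 3 :: nat}"
  \<comment> \<open>The value is \<open>- 1\<close> because a chain of three elements has only one
    interior deletion, at index 1, with sign \<open>-1\<close>.\<close>
  define G :: "nat ncp2 list \<Rightarrow> 'k" where
    "G zs = (if zs \<in> FC ?S \<and> length zs = 2 \<and> asg (zs ! 1) {1} = {1} then - 1 else 0)" for zs
  interpret P: finite_poset "NCP2 ?S" "ncp2_le ?S" by (rule finite_poset_NCP2) simp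
  have G: "G \<in> CC ?S 1" by (auto simp: cochains_def G_def split: if_splits)
  have e: "{1, 3, 2 :: nat} = ?S" by auto
  have zc: "w \<in> CC S k" if "w \<in> ZC S k" for w :: "nat ncp2 list \<Rightarrow> 'k" and S k
    using that by (simp add: cocycles_def)
  have r1: "(circ_cochain {3} 0 {1, 2} (prc 0 3) (prc 1 2) :: _ \<Rightarrow> 'k) \<in> CC ?S 2"
    "(circ_cochain {1} 0 {2, 3} (prc 1 0) (prc 2 3) :: _ \<Rightarrow> 'k) \<in> CC ?S 2"
    by (rule zc, rule relation_summands_ZC; simp)+
  have r2: "(circ_cochain {2} 0 {1, 3} (prc 0 2) (prc 1 3) :: _ \<Rightarrow> 'k) \<in> CC ?S 2"
    "(circ_cochain {1} 0 {3, 2} (prc 1 0) (prc 3 2) :: _ \<Rightarrow> 'k) \<in> CC ?S 2"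
    by (rule zc, rule relation_summands_ZC[of 1 3 2, unfolded e]; simp)+
  have rel: "(relation :: _ \<Rightarrow> 'k) \<in> CC ?S 2"
    unfolding relation_def by (intro submodule.add_mem[OF submodule_cochains] r1 r2)
  have "dC ?S G zs = relation zs" for zs
  proof (cases "zs \<in> FC ?S \<and> length zs = 3")
    case True
    then have z: "zs \<in> FC ?S" "length zs = 3" by auto
    have "dC ?S G zs = (\<Sum>i\<in>{1..<length zs - 1}. (-1) ^ i * G (del i zs))"
      by (rule chain_dC[OF _ G FC_chain[OF z(1)], symmetric]) simp
    also have "{1..<length zs - 1} = {1}" using z(2) by auto
    finally have "dC ?S G zs = - G (del 1 zs)" by (simp add: minus_mult_left[symmetric])
    moreover have "del 1 zs \<in> FC ?S" by (rule P.full_chains_del[OF z(1)]) (use z in auto)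
    moreover have "length (del 1 zs) = 2" "del 1 zs ! 1 = zs ! 2" using z(2) by (simp_all add: length_del nth_del numeral_2_eq_2)
    ultimately show ?thesis unfolding relation_apply[OF z] by (simp add: G_def)
  next
    case False
    have "dC ?S G zs = 0" by (rule ccontr) (use cochains_support[OF P.codiff_cochains[OF G], of zs] False in auto)
    moreover have "relation zs = (0 :: 'k)" by (rule ccontr) (use cochains_support[OF rel, of zs] False in auto)
    ultimately show ?thesis by simp
  qed
  then have "relation = dC ?S G" by (intro ext) simp
  then show ?thesis unfolding coboundaries_def using G by auto
qed

section \<open>Iterated composites\<close>

type_synonym 'k ncochain = "nat ncp2 list \<Rightarrow> 'k"

abbreviation L :: "'a bitree \<Rightarrow> 'a set" where "L t \<equiv> set (leaves t)"

lemma leaves_ne: "leaves t \<noteq> []"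
  by (induction t) auto

lemma L_ne: "L t \<noteq> {}"
  using leaves_ne by auto

lemma leaves_map: "leaves (map_bitree f t) = map f (leaves t)"
  by (induction t) auto

lemma hd_in_L: "hd (leaves t) \<in> L t"
  by (rule hd_in_set[OF leaves_ne])

lemma card_L: "distinct (leaves t) \<Longrightarrow> card (L t) = length (leaves t)"
  by (rule distinct_card)

text \<open>The product of \<open>u\<close> and \<open>v\<close>: the arguments of
  \<open>prc a b\<close> are replaced one after the other. The letters \<open>a\<close> and
  \<open>b\<close> are placeholders; \<open>b\<close> must avoid \<open>A\<close>, since it is still
  present when \<open>u\<close> has been inserted.\<close>

definition join :: "nat \<Rightarrow> nat \<Rightarrow> nat set \<Rightarrow> nat set \<Rightarrow> (nat ncp2 list \<Rightarrow> 'k) \<Rightarrow> (nat ncp2 list \<Rightarrow> 'k)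
   \<Rightarrow> nat ncp2 list \<Rightarrow> 'k::{comm_ring, comm_monoid_mult}" where
  "join a b A B u v = circ_cochain A b B (circ_cochain {b} a A (prc a b) u) v"

lemma TC_nat: "finite S \<Longrightarrow> S \<noteq> {} \<Longrightarrow> TC S = CC S (int (card S - 1))"
  by (simp add: of_nat_diff Suc_le_eq card_gt_0_iff)

lemma circ_TC:
  assumes fin: "finite A" "finite B" and disj: "A \<inter> B = {}" and Bne: "B \<noteq> {}" and s: "s \<notin> A"
    and u: "u \<in> TC (insert s A)" and v: "v \<in> TC B"
  shows "circ_cochain A s B u v \<in> TC (A \<union> B)"
proof -
  interpret C: comp_sets A B s using assms by unfold_locales
  have u': "u \<in> CC (insert s A) (int (card A))" using u fin s by simp
  have "circ_cochain A s B u v \<in> CC (A \<union> B) (int (card A) + (int (card B) - 1))" by (rule C.circ_CC[OF u' v])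
  moreover have "int (card A) + (int (card B) - 1) = int (card (A \<union> B)) - 1" using fin disj by (simp add: card_Un_disjoint)
  ultimately show ?thesis by (simp only:)
qed

lemma join_inner_TC:
  assumes "finite A" "A \<noteq> {}" "a \<noteq> b" "b \<notin> A" "u \<in> TC A"
  shows "circ_cochain {b} a A (prc a b) u \<in> TC (insert b A)"
proof -
  have "circ_cochain {b} a A (prc a b) u \<in> TC ({b} \<union> A)"
    by (rule circ_TC) (use assms prc_TC[OF assms(3)] in auto)
  then show ?thesis by simp
qed

lemma join_TC:
  assumes "finite A" "finite B" "A \<inter> B = {}" "A \<noteq> {}" "B \<noteq> {}" "a \<noteq> b" "b \<notin> A" "u \<in> TC A" "v \<in> TC B"
  shows "join a b A B u v \<in> TC (A \<union> B)"
  unfolding join_def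
  by (rule circ_TC[OF assms(1-3,5,7) join_inner_TC[OF assms(1,4,6-8)] assms(9)])

lemma relabel_join:
  assumes fin: "finite A" "finite B" and disj: "A \<inter> B = {}" and ne: "A \<noteq> {}" "B \<noteq> {}" and ab: "a \<noteq> b" "b \<notin> A"
    and ab': "a' \<noteq> b'" "b' \<notin> \<tau> ` A" and inj: "inj_on \<tau> (A \<union> B)" and u: "u \<in> TC A" and v: "v \<in> TC B"
  shows "relabel_cochain \<tau> (A \<union> B) (join a b A B u v) = join a' b' (\<tau> ` A) (\<tau> ` B) (relabel_cochain \<tau> A u) (relabel_cochain \<tau> B v)"
proof -
  interpret C: comp_sets A B b using assms by unfold_locales
  interpret D: comp_sets "{b}" A a using assms by unfold_locales auto
  let ?s = "\<lambda>x. if x = b then b' else \<tau> x"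
  let ?r = "\<lambda>x. if x = b then b' else a'"
  have injA: "inj_on \<tau> A" using inj by (rule inj_on_subset) auto
  have injs: "inj_on ?s (insert b A)"
  proof (rule inj_onI)
    fix x y assume "x \<in> insert b A" "y \<in> insert b A" "?s x = ?s y"
    then show "x = y" using injA ab(2) ab'(2) by (auto split: if_splits dest: inj_onD)
  qed
  have U: "circ_cochain {b} a A (prc a b) u \<in> CC (insert b A) (int (card A))"
    using join_inner_TC[OF fin(1) ne(1) ab u] fin ab by simp
  have "relabel_cochain \<tau> (A \<union> B) (join a b A B u v)
    = circ_cochain (\<tau> ` A) (?s b) (\<tau> ` B) (relabel_cochain ?s (insert b A) (circ_cochain {b} a A (prc a b) u)) (relabel_cochain \<tau> B v)"
    unfolding join_def by (rule C.relabel_circ[OF inj injs _ U v]) (use ab in auto)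
  also have "relabel_cochain ?s (insert b A) (circ_cochain {b} a A (prc a b) u)
    = circ_cochain {b'} a' (\<tau> ` A) (prc a' b') (relabel_cochain \<tau> A u)"
  proof -
    have p: "prc a b \<in> CC (insert a {b}) (int 1)" using prc_TC[OF ab(1)] ab by simp
    have injs': "inj_on ?s ({b} \<union> A)" using injs by simp
    have injr: "inj_on ?r (insert a {b})" using ab' ab by (auto simp: inj_on_def)
    have im: "?s ` {b} = {b'}" "?s ` A = \<tau> ` A" using ab(2) by (auto intro!: image_cong)
    have "relabel_cochain ?s ({b} \<union> A) (circ_cochain {b} a A (prc a b) u)
      = circ_cochain (?s ` {b}) (?r a) (?s ` A) (relabel_cochain ?r (insert a {b}) (prc a b)) (relabel_cochain ?s A u)"
      by (rule D.relabel_circ[OF injs' injr _ p u]) simp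
    also have "relabel_cochain ?r (insert a {b}) (prc a b) = prc (?r a) (?r b)"
      by (rule relabel_prc) (use ab ab' in auto)
    also have "relabel_cochain ?s A u = relabel_cochain \<tau> A u"
      by (rule relabel_cochain_cong) (use ab injs in \<open>auto intro: inj_on_subset\<close>)
    finally show ?thesis unfolding im using ab by simp
  qed
  finally show ?thesis unfolding join_def by simp
qed

text \<open>Relabelling by the identity leaves both sides alone but allows the placeholders to be
  changed.\<close>

lemma join_labels:
  assumes fin: "finite A" "finite B" and disj: "A \<inter> B = {}" and ne: "A \<noteq> {}" "B \<noteq> {}" and ab: "a \<noteq> b" "b \<notin> A"
    and ab': "a' \<noteq> b'" "b' \<notin> A" and u: "u \<in> TC A" and v: "v \<in> TC B"
  shows "join a b A B u v = join a' b' A B u v"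
proof -
  have "relabel_cochain id (A \<union> B) (join a b A B u v) = join a' b' (id ` A) (id ` B) (relabel_cochain id A u) (relabel_cochain id B v)"
    by (rule relabel_join[OF fin disj ne ab ab'(1) _ _ u v]) (use ab' in simp_all)
  moreover have "relabel_cochain id (A \<union> B) (join a b A B u v) = join a b A B u v"
    by (rule relabel_cochain_id[OF _ _ join_TC[OF fin disj ne ab u v]]) (use fin in simp_all)
  moreover have "relabel_cochain id A u = u" by (rule relabel_cochain_id[OF fin(1) _ u]) simp
  moreover have "relabel_cochain id B v = v" by (rule relabel_cochain_id[OF fin(2) _ v]) simp
  ultimately show ?thesis by simp
qed

text \<open>The iterated product described by a tree, without the signs of the desuspension.\<close>

fun tc :: "nat bitree \<Rightarrow> nat ncp2 list \<Rightarrow> 'k::{comm_ring, comm_monoid_mult}" where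
  "tc (Leaf a) = unit_cochain a"
| "tc (Node t s) = join (hd (leaves t)) (hd (leaves s)) (L t) (L s) (tc t) (tc s)"

lemma tc_TC: "distinct (leaves t) \<Longrightarrow> tc t \<in> TC (L t)"
proof (induction t)
  case (Leaf a)
  then show ?case using unit_cochain_CC[of a] by simp
next
  case (Node t s)
  have h: "hd (leaves s) \<notin> L t" "hd (leaves t) \<noteq> hd (leaves s)" using Node.prems hd_in_L[of t] hd_in_L[of s] by auto
  have d: "L t \<inter> L s = {}" "distinct (leaves t)" "distinct (leaves s)" using Node.prems by auto
  show ?case unfolding tc.simps leaves.simps set_append
    by (rule join_TC[OF finite_set finite_set d(1) L_ne L_ne h(2,1) Node.IH(1)[OF d(2)] Node.IH(2)[OF d(3)]])
qed

lemma tc_Node: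
  assumes "distinct (leaves (Node t s))" "a \<noteq> b" "b \<notin> L t"
  shows "tc (Node t s) = join a b (L t) (L s) (tc t) (tc s)"
proof -
  have h: "hd (leaves s) \<notin> L t" "hd (leaves t) \<noteq> hd (leaves s)" using assms(1) hd_in_L[of t] hd_in_L[of s] by auto
  have d: "L t \<inter> L s = {}" "distinct (leaves t)" "distinct (leaves s)" using assms(1) by auto
  show ?thesis unfolding tc.simps
    by (rule join_labels[OF finite_set finite_set d(1) L_ne L_ne h(2,1) assms(2,3) tc_TC[OF d(2)] tc_TC[OF d(3)]])
qed

lemma relabel_unit: "relabel_cochain \<tau> {a} (unit_cochain a) = unit_cochain (\<tau> a)"
proof -
  have "ncp2_relabel \<tau> {a} (ncp2_bot {a}) \<in> NCP2 (\<tau> ` {a})"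
    by (rule relabel_NCP2) (simp_all add: bot_NCP2)
  then have "ncp2_relabel \<tau> {a} (ncp2_bot {a}) = ncp2_bot {\<tau> a}" using NCP2_singleton by simp
  then show ?thesis unfolding unit_cochain_def using relabel_cochain_basis[OF _ bot_FC, of a \<tau>] by simp
qed

lemma relabel_tc:
  "distinct (leaves t) \<Longrightarrow> inj_on \<tau> (L t) \<Longrightarrow> relabel_cochain \<tau> (L t) (tc t) = (tc (map_bitree \<tau> t) :: _ \<Rightarrow> 'k::{comm_ring, comm_monoid_mult})"
proof (induction t)
  case (Leaf a)
  then show ?case by (simp add: relabel_unit)
next
  case (Node t s)
  have h: "hd (leaves t) \<in> L t" "hd (leaves s) \<in> L s" by (rule hd_in_L)+
  have inj: "inj_on \<tau> (L t \<union> L s)" "inj_on \<tau> (L t)" "inj_on \<tau> (L s)"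
    using Node.prems(2) by (auto intro: inj_on_subset)
  have d: "L t \<inter> L s = {}" "distinct (leaves t)" "distinct (leaves s)" using Node.prems(1) by auto
  have dj: "\<tau> ` L t \<inter> \<tau> ` L s = {}" using inj(1) d(1) by (simp add: inj_on_image_Int[symmetric])
  have "relabel_cochain \<tau> (L t \<union> L s) (join (hd (leaves t)) (hd (leaves s)) (L t) (L s) (tc t) (tc s))
    = join (\<tau> (hd (leaves t))) (\<tau> (hd (leaves s))) (\<tau> ` L t) (\<tau> ` L s) (relabel_cochain \<tau> (L t) (tc t)) (relabel_cochain \<tau> (L s) (tc s) :: _ \<Rightarrow> 'k)"
  proof (rule relabel_join[OF finite_set finite_set d(1) L_ne L_ne _ _ _ _ inj(1) tc_TC[OF d(2)] tc_TC[OF d(3)]])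
    show "hd (leaves t) \<noteq> hd (leaves s)" "hd (leaves s) \<notin> L t" using h d(1) by auto
    show "\<tau> (hd (leaves t)) \<noteq> \<tau> (hd (leaves s))" "\<tau> (hd (leaves s)) \<notin> \<tau> ` L t" using h dj by blast+
  qed
  then show ?case using Node.IH(1)[OF d(2) inj(2)] Node.IH(2)[OF d(3) inj(3)]
    by (simp add: leaves_map hd_map leaves_ne)
qed

section \<open>Substitution of trees and composition of iterated products\<close>

definition subst :: "'a \<Rightarrow> 'a bitree \<Rightarrow> 'a bitree \<Rightarrow> 'a bitree" where
  "subst z s = graft (\<lambda>j. if j = z then s else Leaf j)"

lemma subst_simps [simp]:
  "subst z s (Leaf a) = (if a = z then s else Leaf a)"
  "subst z s (Node t1 t2) = Node (subst z s t1) (subst z s t2)"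
  by (simp_all add: subst_def)

lemma subst_fresh: "z \<notin> L t \<Longrightarrow> subst z s t = t"
  by (induction t) auto

lemma split_unique:
  "xs @ z # ys = us @ z # vs \<Longrightarrow> z \<notin> set xs \<Longrightarrow> z \<notin> set us \<Longrightarrow> xs = us \<and> ys = vs"
proof (induction xs arbitrary: us)
  case Nil
  then show ?case by (cases us) auto
next
  case (Cons x xs)
  then show ?case by (cases us) auto
qed

lemma leaves_subst:
  "distinct (leaves t) \<Longrightarrow> leaves t = xs @ z # ys \<Longrightarrow> leaves (subst z s t) = xs @ leaves s @ ys"
proof (induction t arbitrary: xs ys)
  case (Leaf a)
  then show ?case by (cases xs) auto
next
  case (Node t1 t2)
  show ?case
  proof (cases "z \<in> L t1")
    case True
    then obtain x1 y1 where 1: "leaves t1 = x1 @ z # y1" by (meson split_list)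
    have "distinct (leaves t1)" using Node.prems(1) by simp
    then have "distinct (x1 @ z # y1)" unfolding 1 .
    moreover have "distinct (xs @ z # ys)" using Node.prems(1) unfolding Node.prems(2) .
    ultimately have "z \<notin> set xs" "z \<notin> set x1" by auto
    moreover have "xs @ z # ys = x1 @ z # (y1 @ leaves t2)" using Node.prems(2) 1 by simp
    ultimately have e: "xs = x1" "ys = y1 @ leaves t2" using split_unique by metis+
    have "z \<notin> L t2" using True Node.prems(1) by auto
    then show ?thesis using Node.IH(1)[OF _ 1] Node.prems(1) e by (simp add: subst_fresh)
  next
    case False
    then have "z \<in> L t2" using Node.prems(2) by (metis Un_iff in_set_conv_decomp leaves.simps(2) set_append)
    then obtain x2 y2 where 2: "leaves t2 = x2 @ z # y2" by (meson split_list)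
    have "distinct (leaves t2)" using Node.prems(1) by simp
    then have "distinct (x2 @ z # y2)" unfolding 2 .
    moreover have "distinct (xs @ z # ys)" using Node.prems(1) unfolding Node.prems(2) .
    ultimately have "z \<notin> set xs" "z \<notin> set (leaves t1 @ x2)" using False by auto
    moreover have "xs @ z # ys = (leaves t1 @ x2) @ z # y2" using Node.prems(2) 2 by simp
    ultimately have e: "xs = leaves t1 @ x2" "ys = y2" using split_unique by metis+
    then show ?thesis using Node.IH(2)[OF _ 2] Node.prems(1) False by (simp add: subst_fresh)
  qed
qed

lemma L_subst: "distinct (leaves t) \<Longrightarrow> z \<in> L t \<Longrightarrow> L (subst z s t) = (L t - {z}) \<union> L s"
  and distinct_subst: "distinct (leaves t) \<Longrightarrow> z \<in> L t \<Longrightarrow> distinct (leaves s) \<Longrightarrow> L s \<inter> (L t - {z}) = {} \<Longrightarrow> distinct (leaves (subst z s t))"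
proof -
  assume d: "distinct (leaves t)" and z: "z \<in> L t"
  obtain xs ys where e: "leaves t = xs @ z # ys" using z by (meson split_list)
  show "L (subst z s t) = (L t - {z}) \<union> L s" unfolding leaves_subst[OF d e] using d e by auto
  show "distinct (leaves (subst z s t))" if "distinct (leaves s)" "L s \<inter> (L t - {z}) = {}"
    unfolding leaves_subst[OF d e] using d e that by auto
qed

fun jumps :: "'a \<Rightarrow> 'a bitree \<Rightarrow> nat" where
  "jumps z (Leaf a) = 0"
| "jumps z (Node t s) = (if z \<in> L t then jumps z t + (length (leaves s) - 1) else jumps z s)"

text \<open>Inserting \<open>s\<close> at a leaf in the left subtree moves its steps past those of the right subtree;
  \<open>jumps\<close> counts the latter.\<close>

lemma tc_subst:
  "distinct (leaves t) \<Longrightarrow> z \<in> L t \<Longrightarrow> distinct (leaves s) \<Longrightarrow> L s \<inter> (L t - {z}) = {} \<Longrightarrow>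
   tc (subst z s t) - scale_fun ((-1) ^ ((length (leaves s) - 1) * jumps z t)) (circ_cochain (L t - {z}) z (L s) (tc t) (tc s))
   \<in> (hB (L t - {z} \<union> L s) (int (card (L t - {z} \<union> L s)) - 1) :: (nat ncp2 list \<Rightarrow> 'k::{comm_ring, comm_monoid_mult}) set)"
proof (induction t)
  case (Leaf a)
  then have z: "a = z" by simp
  have "circ_cochain {} z (L s) (unit_cochain z) (tc s) = (tc s :: _ \<Rightarrow> 'k)"
    by (rule circ_unit_left[OF _ L_ne tc_TC[OF Leaf.prems(3)]]) simp
  then have "tc (subst z s (Leaf a)) - scale_fun ((-1) ^ ((length (leaves s) - 1) * jumps z (Leaf a))) (circ_cochain (L (Leaf a) - {z}) z (L s) (tc (Leaf a)) (tc s))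
    = (0 :: _ \<Rightarrow> 'k)" using z by (simp del: One_nat_def)
  then show ?case using submodule.zero_mem[OF submodule_coboundaries] by metis
next
  case (Node t1 t2)
  let ?A = "L t1" and ?B = "L t2" and ?E = "L s" and ?n = "length (leaves s) - 1"
  have d: "distinct (leaves t1)" "distinct (leaves t2)" "?A \<inter> ?B = {}" using Node.prems(1) by auto
  \<comment> \<open>New placeholders for the root, distinct from all leaves and from
    \<open>z\<close>, so that the substitution does not interfere with them.\<close>
  obtain b where b: "b \<notin> ?A \<union> ?B \<union> ?E \<union> {z}" using ex_new_if_finite[of "?A \<union> ?B \<union> ?E \<union> {z}"] by auto
  obtain a where a: "a \<notin> insert b (?A \<union> ?B \<union> ?E \<union> {z})" using ex_new_if_finite[of "insert b (?A \<union> ?B \<union> ?E \<union> {z})"] by auto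
  have ab: "a \<noteq> b" "b \<notin> ?A" "b \<notin> ?B" "b \<notin> ?E" "b \<noteq> z" using a b by auto
  have T1: "(tc t1 :: _ \<Rightarrow> 'k) \<in> TC ?A" by (rule tc_TC[OF d(1)])
  have T2: "(tc t2 :: _ \<Rightarrow> 'k) \<in> TC ?B" by (rule tc_TC[OF d(2)])
  have Ts: "(tc s :: _ \<Rightarrow> 'k) \<in> TC ?E" by (rule tc_TC[OF Node.prems(3)])
  have cs: "card ?E = length (leaves s)" by (rule card_L[OF Node.prems(3)])
  have cB: "card ?B = length (leaves t2)" by (rule card_L[OF d(2)])
  let ?U = "circ_cochain {b} a ?A (prc a b) (tc t1) :: _ \<Rightarrow> 'k"
  have U: "?U \<in> TC (insert b ?A)" by (rule join_inner_TC[OF _ L_ne ab(1,2) T1]) simp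
  have tN: "tc (Node t1 t2) = (circ_cochain ?A b ?B ?U (tc t2) :: _ \<Rightarrow> 'k)"
    using tc_Node[OF Node.prems(1) ab(1,2)] unfolding join_def .
  show ?case
  proof (cases "z \<in> ?A")
    case True
    have zB: "z \<notin> ?B" using True d(3) by auto
    let ?A1 = "?A - {z}"
    have sE: "?E \<inter> ?A1 = {}" "?E \<inter> ?B = {}" using Node.prems(4) zB by auto
    have insA: "insert z ?A1 = ?A" using True by auto
    have Lt: "L (Node t1 t2) - {z} = ?A1 \<union> ?B" using zB by auto
    have Ls1: "L (subst z s t1) = ?A1 \<union> ?E" by (rule L_subst[OF d(1) True])
    have ds1: "distinct (leaves (subst z s t1))" by (rule distinct_subst[OF d(1) True Node.prems(3) sE(1)])
    let ?e = "(-1 :: 'k) ^ (?n * jumps z t1)"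
    let ?V = "circ_cochain ?A1 z ?E (tc t1) (tc s) :: _ \<Rightarrow> 'k"
    have IH: "tc (subst z s t1) - scale_fun ?e ?V \<in> hB (?A1 \<union> ?E) (int (card (?A1 \<union> ?E)) - 1)"
      by (rule Node.IH(1)[OF d(1) True Node.prems(3) sE(1)])
    have sub: "subst z s (Node t1 t2) = Node (subst z s t1) t2" using zB by (simp add: subst_fresh)
    have dN: "distinct (leaves (Node (subst z s t1) t2))" using ds1 d Ls1 sE by auto
    have tS: "tc (subst z s (Node t1 t2)) = (join a b (?A1 \<union> ?E) ?B (tc (subst z s t1)) (tc t2) :: _ \<Rightarrow> 'k)"
      unfolding sub Ls1[symmetric] by (rule tc_Node[OF dN ab(1)]) (use ab Ls1 in auto)
    interpret C1: comp_sets "{b}" "?A1 \<union> ?E" a using ab a leaves_ne[of s] by unfold_locales auto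
    interpret C2: comp_sets "?A1 \<union> ?E" ?B b using ab d sE leaves_ne[of t2] by unfold_locales auto
    have pZ: "(prc a b :: _ \<Rightarrow> 'k) \<in> ZC (insert a {b}) 1" using TC_ZC[OF _ _ prc_TC[OF ab(1)]] ab by simp
    have T2Z: "(tc t2 :: _ \<Rightarrow> 'k) \<in> ZC ?B (int (card ?B) - 1)" by (rule TC_ZC[OF _ L_ne T2]) simp
    let ?S = "?A1 \<union> ?E \<union> ?B"
      have deg: "(1 + (int (card (?A1 \<union> ?E)) - 1)) + (int (card ?B) - 1) = int (card ?S) - 1"
      using C2.disj by (simp add: card_Un_disjoint)
    have step1: "join a b (?A1 \<union> ?E) ?B (tc (subst z s t1)) (tc t2) - scale_fun ?e (join a b (?A1 \<union> ?E) ?B ?V (tc t2)) \<in> hB ?S (int (card ?S) - 1)"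
    proof -
      have 1: "circ_cochain {b} a (?A1 \<union> ?E) (prc a b) (tc (subst z s t1) - scale_fun ?e ?V) \<in> hB ({b} \<union> (?A1 \<union> ?E)) (1 + (int (card (?A1 \<union> ?E)) - 1))"
        by (rule C1.circ_hB_right[OF pZ IH])
      have 2: "circ_cochain (?A1 \<union> ?E) b ?B (circ_cochain {b} a (?A1 \<union> ?E) (prc a b) (tc (subst z s t1) - scale_fun ?e ?V)) (tc t2) \<in> hB ?S (int (card ?S) - 1)"
        unfolding deg[symmetric] by (rule C2.circ_hB_left[OF _ T2Z]) (use 1 in simp)
      then show ?thesis unfolding join_def by (simp only: circ_diff_right circ_diff_left circ_scale_right circ_scale_left)
    qed
    have T1': "(tc t1 :: _ \<Rightarrow> 'k) \<in> CC (insert z ?A1) (int (card ?A - 1))"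
      unfolding insA using T1 unfolding TC_nat[OF finite_set L_ne] .
    have pC: "(prc a b :: _ \<Rightarrow> 'k) \<in> CC (insert a {b}) (int 1)" using pZ by (simp add: cocycles_def)
    \<comment> \<open>The insertion of \<open>s\<close> into the left factor is pulled out of the
      insertion of that factor by the sequential axiom.\<close>
    have seq: "circ_cochain {b} a (?A1 \<union> ?E) (prc a b) ?V = circ_cochain (insert b ?A1) z ?E ?U (tc s)"
      using circ_seq[of "{b}" ?A1 ?E a z, OF _ _ _ _ _ L_ne _ _ _ pC T1' Ts] ab a sE insA by (simp add: Int_commute)
    interpret Q: par_comp ?A1 ?E ?B z b using ab d sE zB leaves_ne[of s] leaves_ne[of t2] by unfold_locales auto
    have insbA: "insert z (insert b ?A1) = insert b ?A" using insA by auto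
    have U': "?U \<in> TC (insert z (insert b ?A1))" unfolding insbA by (rule U)
    \<comment> \<open>It is then moved past the insertion of the right factor by the parallel axiom,
      which accounts for the part of \<open>jumps\<close> contributed by the right subtree.\<close>
    have par: "circ_cochain (?A1 \<union> ?E) b ?B (circ_cochain (insert b ?A1) z ?E ?U (tc s)) (tc t2)
      - scale_fun ((-1) ^ ((card ?E - 1) * (card ?B - 1))) (circ_cochain (?A1 \<union> ?B) z ?E (circ_cochain ?A b ?B ?U (tc t2)) (tc s))
      \<in> hB ?S (int (card ?S) - 1)"
      using Q.circ_par[OF U' Ts T2] unfolding insA .
    let ?X = "tc (subst z s (Node t1 t2)) :: _ \<Rightarrow> 'k" and ?Y = "join a b (?A1 \<union> ?E) ?B ?V (tc t2)"
      and ?Z = "circ_cochain (?A1 \<union> ?B) z ?E (tc (Node t1 t2)) (tc s) :: _ \<Rightarrow> 'k"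
    have p1: "?X - scale_fun ?e ?Y \<in> hB ?S (int (card ?S) - 1)" unfolding tS by (rule step1)
    have p2: "?Y - scale_fun ((-1) ^ (?n * (length (leaves t2) - 1))) ?Z \<in> hB ?S (int (card ?S) - 1)"
      using par unfolding join_def seq tN cs cB .
    have eq: "?X - scale_fun ((-1) ^ (?n * jumps z (Node t1 t2))) ?Z
      = (?X - scale_fun ?e ?Y) + scale_fun ?e (?Y - scale_fun ((-1) ^ (?n * (length (leaves t2) - 1))) ?Z)"
      by (rule ext) (use True in \<open>simp add: right_diff_distrib power_add distrib_left mult.assoc\<close>)
    have "?X - scale_fun ((-1) ^ (?n * jumps z (Node t1 t2))) ?Z \<in> hB ?S (int (card ?S) - 1)"
      unfolding eq by (rule submodule.add_mem[OF submodule_coboundaries p1 submodule.scale_mem[OF submodule_coboundaries p2]])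
    moreover have "?A1 \<union> ?B \<union> ?E = ?S" by auto
    ultimately show ?thesis unfolding Lt by (simp only:)
  next
    case False
    then have zB: "z \<in> ?B" using Node.prems(2) by auto
    let ?B1 = "?B - {z}"
    have sE: "?E \<inter> ?B1 = {}" "?E \<inter> ?A = {}" using Node.prems(4) False by auto
    have insB: "insert z ?B1 = ?B" using zB by auto
    have Lt: "L (Node t1 t2) - {z} = ?A \<union> ?B1" using False by auto
    have Ls2: "L (subst z s t2) = ?B1 \<union> ?E" by (rule L_subst[OF d(2) zB])
    have ds2: "distinct (leaves (subst z s t2))" by (rule distinct_subst[OF d(2) zB Node.prems(3) sE(1)])
    let ?e = "(-1 :: 'k) ^ (?n * jumps z t2)"
    let ?V = "circ_cochain ?B1 z ?E (tc t2) (tc s) :: _ \<Rightarrow> 'k"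
    have IH: "tc (subst z s t2) - scale_fun ?e ?V \<in> hB (?B1 \<union> ?E) (int (card (?B1 \<union> ?E)) - 1)"
      by (rule Node.IH(2)[OF d(2) zB Node.prems(3) sE(1)])
    have sub: "subst z s (Node t1 t2) = Node t1 (subst z s t2)" using False by (simp add: subst_fresh)
    have dN: "distinct (leaves (Node t1 (subst z s t2)))" using ds2 d Ls2 sE by auto
    have tS: "tc (subst z s (Node t1 t2)) = (circ_cochain ?A b (?B1 \<union> ?E) ?U (tc (subst z s t2)) :: _ \<Rightarrow> 'k)"
      unfolding sub Ls2[symmetric] join_def[symmetric] by (rule tc_Node[OF dN ab(1,2)])
    interpret C2: comp_sets ?A "?B1 \<union> ?E" b using ab d sE leaves_ne[of s] by unfold_locales auto
    have UZ: "?U \<in> ZC (insert b ?A) (int (card ?A))" using TC_ZC[OF _ _ U] ab by simp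
    let ?S = "?A \<union> (?B1 \<union> ?E)"
    have deg: "int (card ?A) + (int (card (?B1 \<union> ?E)) - 1) = int (card ?S) - 1"
      using C2.disj by (simp add: card_Un_disjoint)
    have step1: "circ_cochain ?A b (?B1 \<union> ?E) ?U (tc (subst z s t2)) - scale_fun ?e (circ_cochain ?A b (?B1 \<union> ?E) ?U ?V) \<in> hB ?S (int (card ?S) - 1)"
      using C2.circ_hB_right[OF UZ IH] unfolding deg by (simp only: circ_diff_right circ_scale_right)
    have T2': "(tc t2 :: _ \<Rightarrow> 'k) \<in> CC (insert z ?B1) (int (card ?B - 1))"
      unfolding insB using T2 unfolding TC_nat[OF finite_set L_ne] .
    have UC: "?U \<in> CC (insert b ?A) (int (card ?A))" using UZ by (simp add: cocycles_def)
    have AB1: "?A \<inter> ?B1 = {}" using d(3) by auto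
    \<comment> \<open>For a leaf of the right factor, inserted last, the sequential axiom alone
      suffices and no sign appears.\<close>
    have seq: "circ_cochain ?A b (?B1 \<union> ?E) ?U ?V = circ_cochain (?A \<union> ?B1) z ?E (tc (Node t1 t2)) (tc s)"
      unfolding tN
      using d(3) circ_seq[of ?A ?B1 ?E b z, OF _ _ _ _ _ L_ne _ _ _ UC T2' Ts] ab sE False insB AB1 by (simp add: Int_Un_distrib Int_commute)
    have "(tc (subst z s (Node t1 t2)) :: _ \<Rightarrow> 'k) - scale_fun ((-1) ^ (?n * jumps z (Node t1 t2))) (circ_cochain (?A \<union> ?B1) z ?E (tc (Node t1 t2)) (tc s))
      \<in> hB ?S (int (card ?S) - 1)"
      using step1 unfolding tS seq using False by (simp only: jumps.simps if_False)
    moreover have "?A \<union> ?B1 \<union> ?E = ?S" by auto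
    ultimately show ?thesis unfolding Lt by (simp only:)
  qed
qed

section \<open>Signs of words and trees\<close>

fun cr :: "nat list \<Rightarrow> nat list \<Rightarrow> nat" where
  "cr [] ys = 0"
| "cr (x # xs) ys = length (filter (\<lambda>y. y < x) ys) + cr xs ys"

fun inv_count :: "nat list \<Rightarrow> nat" where
  "inv_count [] = 0"
| "inv_count (x # xs) = cr [x] xs + inv_count xs"

lemma cr_append_left: "cr (xs @ xs') ys = cr xs ys + cr xs' ys"
  by (induction xs) auto

lemma cr_append_right: "cr xs (ys @ ys') = cr xs ys + cr xs ys'"
  by (induction xs) auto

lemma cr_Cons_right: "cr xs (y # ys) = cr xs [y] + cr xs ys"
  using cr_append_right[of xs "[y]" ys] by simp

lemma inv_count_append: "inv_count (xs @ ys) = inv_count xs + inv_count ys + cr xs ys"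
  by (induction xs) (auto simp: cr_append_right)

lemma inv_count_Cons: "inv_count (x # xs) = cr [x] xs + inv_count xs"
  by simp

lemma cr_swap: "y \<notin> set xs \<Longrightarrow> cr xs [y] + cr [y] xs = length xs"
  by (induction xs) auto

text \<open>In the sum of both counts, a letter of \<open>ys\<close> is compared with
  \<open>u\<close> from both sides and likewise with \<open>v\<close>, giving 2 in all; the pair
  \<open>u\<close>, \<open>v\<close> gives 1, and every other inversion occurs twice.\<close>

lemma inv_count_transpose:
  assumes "u \<noteq> v" "u \<notin> set ys" "v \<notin> set ys"
  shows "odd (inv_count (xs @ u # ys @ v # zs) + inv_count (xs @ v # ys @ u # zs))"
proof -
  have e: "cr [u] [v] + cr [v] [u] = 1" using assms(1) by auto
  have "inv_count (xs @ u # ys @ v # zs) + inv_count (xs @ v # ys @ u # zs)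
    = 2 * (inv_count xs + inv_count ys + inv_count zs + cr xs ys + cr xs zs + cr ys zs + cr xs [u] + cr xs [v] + cr [u] zs + cr [v] zs)
      + (cr ys [u] + cr [u] ys) + (cr ys [v] + cr [v] ys) + (cr [u] [v] + cr [v] [u])"
    unfolding inv_count_append inv_count_Cons cr_append_right cr_Cons_right[of xs u "ys @ v # zs"] cr_Cons_right[of xs v "ys @ u # zs"]
      cr_Cons_right[of xs u zs] cr_Cons_right[of xs v zs] cr_Cons_right[of ys u zs] cr_Cons_right[of ys v zs]
      cr_Cons_right[of "[u]" v zs] cr_Cons_right[of "[v]" u zs] by (simp del: cr.simps)
  also have "\<dots> = 2 * (inv_count xs + inv_count ys + inv_count zs + cr xs ys + cr xs zs + cr ys zs + cr xs [u] + cr xs [v] + cr [u] zs + cr [v] zs + length ys) + 1"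
    unfolding cr_swap[OF assms(2)] cr_swap[OF assms(3)] e by simp
  finally show ?thesis by simp
qed

lemma inv_count_map_transpose:
  assumes d: "distinct w" and ab: "a \<in> set w" "b \<in> set w" "a \<noteq> b"
  shows "odd (inv_count (map (transpose a b) w) + inv_count w)"
proof -
  have id: "map (transpose a b) l = l" if "a \<notin> set l" "b \<notin> set l" for l
    using that by (induction l) (auto simp: transpose_def)
  obtain xs r where 1: "w = xs @ a # r" using ab(1) by (meson split_list)
  show ?thesis
  proof (cases "b \<in> set r")
    case True
    then obtain ys zs where 2: "r = ys @ b # zs" by (meson split_list)
    have "map (transpose a b) w = xs @ b # ys @ a # zs" using d ab unfolding 1 2 by (simp add: id)
    then show ?thesis using inv_count_transpose[of b a ys xs zs] d ab unfolding 1 2 by simp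
  next
    case False
    then have "b \<in> set xs" using ab 1 by auto
    then obtain us ys where 2: "xs = us @ b # ys" by (meson split_list)
    have "map (transpose a b) w = us @ a # ys @ b # r" using d ab unfolding 1 2 by (simp add: id)
    then show ?thesis using inv_count_transpose[of a b ys us r] d ab unfolding 1 2 by simp
  qed
qed

text \<open>By induction on a product of transpositions: each of them changes both parities.\<close>

lemma inv_count_permutation:
  assumes p: "p permutes S" and fin: "finite S" and w: "distinct w" "set w = S"
  shows "even (inv_count (map p w) + inv_count w) = evenperm p"
  using p fin
proof (induction rule: permutes_induct)
  case id
  then show ?case by simp
next
  case (swap a b p)
  have "permutation p" using swap fin permutation_permutes by blast
  then have "evenperm (transpose a b \<circ> p) = (evenperm (transpose a b) = evenperm p)"
    by (rule evenperm_comp[OF permutation_swap_id])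
  then have e: "evenperm (transpose a b \<circ> p) \<longleftrightarrow> \<not> evenperm p" using swap by (simp add: evenperm_swap)
  have s: "set (map p w) = S" using w swap by (simp add: permutes_image)
  have d: "distinct (map p w)" using w swap by (simp add: distinct_map permutes_inj_on)
  have o: "odd (inv_count (map (transpose a b) (map p w)) + inv_count (map p w))"
    by (rule inv_count_map_transpose[OF d]) (use s swap in auto)
  show ?case unfolding e using o swap.IH by (simp only: map_map even_add) blast
qed

text \<open>The sign \<open>(-1)^((i - 1)(n - 1))\<close> of the desuspension for the two insertions
  in \<open>join\<close>. The left subtree enters at input 1, without sign; the right one, with q
  leaves, enters at input p + 1, where p is the number of leaves on the left.\<close>

fun step_sign :: "'a bitree \<Rightarrow> nat" where
  "step_sign (Leaf a) = 0"
| "step_sign (Node t s) = step_sign t + step_sign s + length (leaves t) * (length (leaves s) - 1)"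

definition leaves_before :: "'a \<Rightarrow> 'a bitree \<Rightarrow> nat" where
  "leaves_before z t = length (takeWhile (\<lambda>x. x \<noteq> z) (leaves t))"

lemma length_pos: "length (leaves t) \<ge> 1"
  using leaves_ne[of t] by (cases "leaves t") auto

lemma length_subst: "distinct (leaves t) \<Longrightarrow> z \<in> L t \<Longrightarrow> length (leaves (subst z s t)) = length (leaves t) + (length (leaves s) - 1)"
proof -
  assume d: "distinct (leaves t)" and z: "z \<in> L t"
  obtain xs ys where e: "leaves t = xs @ z # ys" using z by (meson split_list)
  show ?thesis unfolding leaves_subst[OF d e] using e length_pos[of s] by simp
qed

text \<open>For a leaf on the left, the factor counting the left leaves grows, and
  \<open>jumps\<close> changes by the matching amount. For a leaf on the right, the other factor
  grows, and the left leaves are added to those before \<open>z\<close>.\<close>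

lemma step_sign_subst:
  "distinct (leaves t) \<Longrightarrow> z \<in> L t \<Longrightarrow>
   even (step_sign (subst z s t) + (length (leaves s) - 1) * jumps z t + step_sign t + step_sign s + (length (leaves s) - 1) * leaves_before z t)"
proof (induction t)
  case (Leaf a)
  then show ?case by (simp add: leaves_before_def)
next
  case (Node t1 t2)
  obtain q where q: "length (leaves t2) = Suc q" using length_pos[of t2] by (cases "length (leaves t2)") auto
  obtain r where r: "length (leaves s) = Suc r" using length_pos[of s] by (cases "length (leaves s)") auto
  show ?case
  proof (cases "z \<in> L t1")
    case True
    then have z: "z \<notin> L t2" using Node.prems by auto
    have "leaves_before z (Node t1 t2) = leaves_before z t1" using True by (simp add: leaves_before_def takeWhile_append1)
    moreover have "even (step_sign (subst z s t1) + (length (leaves s) - 1) * jumps z t1 + step_sign t1 + step_sign s + (length (leaves s) - 1) * leaves_before z t1)"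
      using Node.IH(1)[OF _ True] Node.prems by simp
    moreover have "length (leaves (subst z s t1)) = length (leaves t1) + (length (leaves s) - 1)"
      by (rule length_subst) (use True Node.prems in auto)
    ultimately show ?thesis using True z q r by (auto simp add: subst_fresh)
  next
    case False
    then have z: "z \<in> L t2" using Node.prems by auto
    have "takeWhile (\<lambda>x. x \<noteq> z) (leaves t1 @ leaves t2) = leaves t1 @ takeWhile (\<lambda>x. x \<noteq> z) (leaves t2)"
      using False by (intro takeWhile_append2) auto
    then have "leaves_before z (Node t1 t2) = length (leaves t1) + leaves_before z t2" by (simp add: leaves_before_def)
    moreover have "even (step_sign (subst z s t2) + (length (leaves s) - 1) * jumps z t2 + step_sign t2 + step_sign s + (length (leaves s) - 1) * leaves_before z t2)"
      using Node.IH(2)[OF _ z] Node.prems by simp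
    moreover have "length (leaves (subst z s t2)) = length (leaves t2) + (length (leaves s) - 1)"
      by (rule length_subst) (use z Node.prems in auto)
    ultimately show ?thesis using False q r by (auto simp add: subst_fresh)
  qed
qed

lemma step_sign_map: "step_sign (map_bitree f t) = step_sign t"
  by (induction t) (auto simp: leaves_map)

definition tree_sign :: "nat bitree \<Rightarrow> nat" where
  "tree_sign t = inv_count (leaves t) + step_sign t"

definition signed_tc :: "nat bitree \<Rightarrow> nat ncp2 list \<Rightarrow> 'k::{comm_ring, comm_monoid_mult}" where
  "signed_tc t = scale_fun ((-1) ^ tree_sign t) (tc t)"

section \<open>Composition of signed trees\<close>

abbreviation (input) outer :: "nat \<Rightarrow> nat \<Rightarrow> nat \<Rightarrow> nat" where
  "outer n i \<equiv> \<lambda>j. if j < i then j else if j = i then 0 else j + n - 1"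

abbreviation (input) inner :: "nat \<Rightarrow> nat \<Rightarrow> nat" where
  "inner i \<equiv> \<lambda>j. j + i - 1"

abbreviation (input) rest :: "nat \<Rightarrow> nat \<Rightarrow> nat \<Rightarrow> nat set" where
  "rest m n i \<equiv> {1..m + n - 1} - {i..i + n - 1}"

abbreviation (input) pcirc where
  "pcirc m n i u v \<equiv> circ_cochain (rest m n i) 0 {i..i + n - 1}
    (relabel_cochain (outer n i) {1..m} u) (relabel_cochain (inner i) {1..n} v)"

lemma treesD: "t \<in> trees n \<Longrightarrow> distinct (leaves t)" "t \<in> trees n \<Longrightarrow> L t = {1..n}"
  by (auto simp: trees_def)

lemma trees_length: "t \<in> trees n \<Longrightarrow> length (leaves t) = n"
  using card_L[of t] by (auto simp: trees_def)

lemma map_trees: "t \<in> trees n \<Longrightarrow> \<sigma> permutes {1..n} \<Longrightarrow> map_bitree \<sigma> t \<in> trees n"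
  by (auto simp: trees_def leaves_map distinct_map permutes_inj_on permutes_image)

lemma even_pow_cong: "even (a + b) \<Longrightarrow> (-1 :: 'k::{comm_ring, comm_monoid_mult}) ^ a = (-1) ^ b"
  by (auto simp: minus_one_power)

lemma signed_tc_act:
  assumes t: "t \<in> trees n" and p: "\<sigma> permutes {1..n}"
  shows "signed_tc (map_bitree \<sigma> t) = (scale_fun (if evenperm \<sigma> then 1 else -1) (relabel_cochain \<sigma> {1..n} (signed_tc t)) :: _ \<Rightarrow> 'k::{comm_ring, comm_monoid_mult})"
proof -
  have "even (inv_count (map \<sigma> (leaves t)) + inv_count (leaves t)) = evenperm \<sigma>"
    by (rule inv_count_permutation[OF p _ treesD[OF t]]) simp
  then have "even (tree_sign (map_bitree \<sigma> t) + tree_sign t) = evenperm \<sigma>"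
    by (simp add: tree_sign_def leaves_map step_sign_map) blast
  then have e: "(-1 :: 'k) ^ tree_sign (map_bitree \<sigma> t) = (if evenperm \<sigma> then 1 else -1) * (-1) ^ tree_sign t"
    by (auto simp: minus_one_power minus_mult_left[symmetric])
  have "relabel_cochain \<sigma> {1..n} (tc t) = (tc (map_bitree \<sigma> t) :: _ \<Rightarrow> 'k)"
    using relabel_tc[OF treesD(1)[OF t], of \<sigma>] treesD(2)[OF t] permutes_inj_on[OF p] by simp
  then show ?thesis unfolding signed_tc_def e relabel_cochain_scale scale_scale by simp
qed

text \<open>Labels of trees are positive, which leaves 0 free as the placeholder for the input that
  is composed.\<close>

lemma tree_comp_subst:
  "0 \<notin> L t \<Longrightarrow> n \<ge> 1 \<Longrightarrow> tree_comp n i t s = subst 0 (map_bitree (inner i) s) (map_bitree (outer n i) t)"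
  by (induction t) (auto simp: tree_comp_def)

lemma inner_inj: "i \<ge> 1 \<Longrightarrow> inj (inner i)"
  by (auto simp: inj_def)

lemma outer_inj: "n \<ge> 1 \<Longrightarrow> inj_on (outer n i) {1..m}"
  by (auto simp: inj_on_def)

lemma inner_image: "i \<ge> 1 \<Longrightarrow> inner i ` {1..n} = {i..i + n - 1}"
proof -
  assume i: "i \<ge> 1"
  have "x \<in> inner i ` {1..n}" if "x \<in> {i..i + n - 1}" for x
    using that i by (intro image_eqI[of _ _ "x + 1 - i"]) auto
  then show ?thesis using i by auto
qed

lemma outer_image:
  assumes "n \<ge> 1" "i \<in> {1..m}"
  shows "outer n i ` {1..m} = insert 0 (rest m n i)"
proof -
  have "x \<in> outer n i ` {1..m}" if "x \<in> {1..m + n - 1}" "x \<notin> {i..i + n - 1}" for x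
  proof (cases "x < i")
    case True
    then show ?thesis using that assms by (intro image_eqI[of _ _ x]) auto
  next
    case False
    then show ?thesis using that assms by (intro image_eqI[of _ _ "x + 1 - n"]) auto
  qed
  moreover have "0 \<in> outer n i ` {1..m}" using assms by (intro image_eqI[of _ _ i]) auto
  ultimately have "insert 0 (rest m n i) \<subseteq> outer n i ` {1..m}" by (intro insert_subsetI subsetI) simp_all
  moreover have "outer n i j \<in> insert 0 (rest m n i)" if "j \<in> {1..m}" for j
    using that assms by auto
  ultimately show ?thesis by (intro equalityI image_subsetI)
qed

lemma tree_comp_trees:
  assumes t: "t \<in> trees m" and s: "s \<in> trees n" and n: "n \<ge> 1" and i: "i \<in> {1..m}"
  shows "tree_comp n i t s \<in> trees (m + n - 1)"
proof -
  let ?t = "map_bitree (outer n i) t" and ?s = "map_bitree (inner i) s"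
  have z: "0 \<notin> L t" using treesD(2)[OF t] by simp
  have d: "distinct (leaves ?t)" "distinct (leaves ?s)"
    using treesD[OF t] treesD[OF s] outer_inj[OF n, of i m] inner_inj[of i] i by (auto simp: leaves_map distinct_map intro: inj_on_subset)
  have Lt: "L ?t = insert 0 (rest m n i)"
    using outer_image[OF n i] treesD(2)[OF t] by (simp add: leaves_map)
  have Ls: "L ?s = {i..i + n - 1}" using inner_image[of i n] treesD(2)[OF s] i by (simp add: leaves_map)
  have 0: "0 \<in> L ?t" unfolding Lt by simp
  have ds: "distinct (leaves (subst 0 ?s ?t))" by (rule distinct_subst[OF d(1) 0 d(2)]) (unfold Lt Ls, auto)
  have "L (subst 0 ?s ?t) = {1..m + n - 1}" unfolding L_subst[OF d(1) 0] Lt Ls using i n by auto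
  then show ?thesis unfolding trees_def tree_comp_subst[OF z n] using ds by simp
qed

lemma inv_count_strict_mono:
  "(\<And>x y. x \<in> set xs \<Longrightarrow> y \<in> set xs \<Longrightarrow> f x < f y \<longleftrightarrow> x < y) \<Longrightarrow> inv_count (map f xs) = inv_count xs"
proof (induction xs)
  case (Cons x xs)
  have "filter (\<lambda>y. f y < f x) xs = filter (\<lambda>y. y < x) xs" using Cons.prems by (intro filter_cong) auto
  then show ?case using Cons by (simp add: filter_map comp_def)
qed simp

lemma cr_strict_mono:
  "(\<And>x y. x \<in> set xs \<Longrightarrow> y \<in> set ys \<Longrightarrow> g y < f x \<longleftrightarrow> y < x) \<Longrightarrow> cr (map f xs) (map g ys) = cr xs ys"
proof (induction xs)
  case (Cons x xs)
  have "filter (\<lambda>y. g y < f x) ys = filter (\<lambda>y. y < x) ys" using Cons.prems by (intro filter_cong) auto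
  then show ?case using Cons by (simp add: filter_map comp_def)
qed simp

lemma cr_const_left:
  "(\<And>x y. x \<in> set xs \<Longrightarrow> y \<in> set ys \<Longrightarrow> y < f x \<longleftrightarrow> i < x) \<Longrightarrow> cr (map f xs) ys = length ys * cr xs [i]"
proof (induction xs)
  case (Cons x xs)
  have "filter (\<lambda>y. y < f x) ys = (if i < x then ys else [])"
    using Cons.prems by (auto intro: filter_True filter_False)
  then show ?case using Cons by simp
qed simp

lemma cr_const_right:
  "(\<And>x y. x \<in> set xs \<Longrightarrow> y \<in> set ys \<Longrightarrow> f y < x \<longleftrightarrow> y < i) \<Longrightarrow> cr xs (map f ys) = length xs * cr [i] ys"
proof (induction xs)
  case (Cons x xs)
  have "filter (\<lambda>y. f y < x) ys = filter (\<lambda>y. y < i) ys" using Cons.prems by (intro filter_cong) auto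
  then show ?case using Cons by (simp add: filter_map comp_def)
qed simp

text \<open>Replacing the letter \<open>i\<close> by \<open>n\<close> consecutive letters repeats
  each of its inversions \<open>n\<close> times. The larger letters before \<open>i\<close> are all
  letters before it except the smaller ones, and \<open>i - 1\<close> letters are smaller in total;
  this gives the last term modulo 2.\<close>

lemma inv_count_tree_comp:
  assumes t: "t \<in> trees m" and s: "s \<in> trees n" and n: "n \<ge> 1" and i: "i \<in> {1..m}"
  shows "even (inv_count (leaves (tree_comp n i t s)) + inv_count (leaves t) + inv_count (leaves s)
    + (n - 1) * (leaves_before 0 (map_bitree (outer n i) t) + (i - 1)))"
proof -
  let ?f = "outer n i" and ?g = "inner i"
  have "i \<in> L t" using treesD(2)[OF t] i by simp
  then obtain xs ys where e: "leaves t = xs @ i # ys" by (meson split_list)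
  have dt: "distinct (xs @ i # ys)" using treesD(1)[OF t] unfolding e .
  have st: "set (xs @ i # ys) = {1..m}" using treesD(2)[OF t] unfolding e .
  have z: "0 \<notin> L t" using treesD(2)[OF t] by simp
  have ni: "i \<notin> set xs" "i \<notin> set ys" "0 \<notin> set xs" using dt st by auto
  have d: "distinct (leaves (map_bitree ?f t))"
    using treesD[OF t] outer_inj[OF n, of i m] by (simp add: leaves_map distinct_map)
  have sl: "set (leaves s) = {1..n}" "length (leaves s) = n" using treesD(2)[OF s] trees_length[OF s] by auto
  have lt: "leaves (map_bitree ?f t) = map ?f xs @ 0 # map ?f ys" by (simp add: leaves_map e)
  have "?f x \<noteq> 0" if "x \<in> set xs" for x
  proof -
    have "x \<noteq> 0" "x \<noteq> i" using that ni by metis+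
    then show ?thesis using n by simp
  qed
  then have "x \<noteq> 0" if "x \<in> set (map ?f xs)" for x using that unfolding set_map by blast
  then have "takeWhile (\<lambda>x. x \<noteq> 0) (map ?f xs @ 0 # map ?f ys) = map ?f xs @ takeWhile (\<lambda>x. x \<noteq> 0) (0 # map ?f ys)"
    by (rule takeWhile_append2)
  then have leaves_before: "leaves_before 0 (map_bitree ?f t) = length xs" unfolding leaves_before_def lt by simp
  have mono: "?f x < ?f y \<longleftrightarrow> x < y" if "x \<in> set xs \<union> set ys" "y \<in> set xs \<union> set ys" for x y
    using that ni n by (auto split: if_splits)
  have l: "leaves (tree_comp n i t s) = map ?f xs @ map ?g (leaves s) @ map ?f ys"
    unfolding tree_comp_subst[OF z n] leaves_subst[OF d lt] by (simp add: leaves_map)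
  have m1: "inv_count (map ?f xs) = inv_count xs" by (rule inv_count_strict_mono) (use mono in blast)
  have m2: "inv_count (map ?f ys) = inv_count ys" by (rule inv_count_strict_mono) (use mono in blast)
  have m3: "inv_count (map ?g (leaves s)) = inv_count (leaves s)" by (rule inv_count_strict_mono) (use i in auto)
  have m4: "cr (map ?f xs) (map ?f ys) = cr xs ys" by (rule cr_strict_mono) (use mono in blast)
  have m5: "cr (map ?f xs) (map ?g (leaves s)) = length (map ?g (leaves s)) * cr xs [i]"
    by (rule cr_const_left) (use i n ni sl in \<open>auto split: if_splits\<close>)
  have m6: "cr (map ?g (leaves s)) (map ?f ys) = length (map ?g (leaves s)) * cr [i] ys"
    by (rule cr_const_right) (use i n ni sl in \<open>auto split: if_splits\<close>)
  have len: "cr xs [i] + cr [i] xs = length xs" by (rule cr_swap[OF ni(1)])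
  have low: "cr [i] xs + cr [i] ys = i - 1"
  proof -
    have "cr [i] xs + cr [i] ys = length (filter (\<lambda>y. y < i) (xs @ i # ys))" by simp
    also have "\<dots> = card {y \<in> {1..m}. y < i}"
      using distinct_card[OF distinct_filter[OF dt, of "\<lambda>y. y < i"]] unfolding set_filter st by (simp only:)
    also have "{y \<in> {1..m}. y < i} = {1..<i}" using i by auto
    finally show ?thesis by simp
  qed
  obtain n' where n': "n = Suc n'" using n by (cases n) auto
  have tot: "inv_count (leaves (tree_comp n i t s)) + inv_count (leaves t) + inv_count (leaves s)
    + (n - 1) * (length xs + (i - 1)) = 2 * (inv_count xs + inv_count ys + inv_count (leaves s) + cr xs ys
      + (cr xs [i] + cr [i] ys) + n' * (cr xs [i] + cr [i] xs + cr [i] ys))"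
    unfolding l e inv_count_append inv_count_Cons cr_append_right cr_append_left cr_Cons_right[of xs i ys] m1 m2 m3 m4 m5 m6 len[symmetric] low[symmetric] length_map sl(2)
    by (simp add: n' algebra_simps del: cr.simps)
  show ?thesis unfolding leaves_before tot by simp
qed

lemma parity_sum:
  "even (a + b + c + (x + y)) \<Longrightarrow> even (d + j + e + f + x) \<Longrightarrow> even (a + d + j + (y + (b + e) + (c + f)))" for a b c d e f j x y :: nat
  by presburger

text \<open>The word of the leaves and the order of the insertions both contribute the leaves before
  the inserted tree, times \<open>n - 1\<close>. These cancel, the sign of \<open>tc_subst\<close>
  is absorbed, and the sign of the desuspension remains.\<close>

lemma signed_tc_comp:
  assumes t: "t \<in> trees m" and s: "s \<in> trees n" and n: "n \<ge> 1" and i: "i \<in> {1..m}"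
  shows "signed_tc (tree_comp n i t s) - scale_fun ((-1) ^ ((n - 1) * (i - 1)))
     (pcirc m n i (signed_tc t) (signed_tc s))
    \<in> (hB {1..m + n - 1} (int (m + n - 1) - 1) :: (nat ncp2 list \<Rightarrow> 'k::{comm_ring, comm_monoid_mult}) set)"
proof -
  let ?t = "map_bitree (outer n i) t" and ?s = "map_bitree (inner i) s" and ?c = "tree_comp n i t s"
  let ?B = "{i..i + n - 1}" let ?A = "{1..m + n - 1} - ?B"
  have z: "0 \<notin> L t" using treesD(2)[OF t] by simp
  have d: "distinct (leaves ?t)" "distinct (leaves ?s)"
    using treesD[OF t] treesD[OF s] outer_inj[OF n, of i m] inner_inj[of i] i by (auto simp: leaves_map distinct_map intro: inj_on_subset)
  have Lt: "L ?t = insert 0 ?A" using outer_image[OF n i] treesD(2)[OF t] by (simp add: leaves_map)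
  have Ls: "L ?s = ?B" using inner_image[of i n] treesD(2)[OF s] i by (simp add: leaves_map)
  have 0: "0 \<in> L ?t" unfolding Lt by simp
  have A: "L ?t - {0} = ?A" unfolding Lt by auto
  have AB: "?A \<union> ?B = {1..m + n - 1}" using i n by auto
  have ls: "length (leaves ?s) = n" using trees_length[OF s] by (simp add: leaves_map)
  let ?C = "circ_cochain ?A 0 ?B (tc ?t) (tc ?s) :: _ \<Rightarrow> 'k" and ?j = "(n - 1) * jumps 0 ?t"
  have dj: "L ?s \<inter> (L ?t - {0}) = {}" unfolding A Ls by auto
  have "tc (subst 0 ?s ?t) - scale_fun ((-1) ^ ((length (leaves ?s) - 1) * jumps 0 ?t)) (circ_cochain (L ?t - {0}) 0 (L ?s) (tc ?t) (tc ?s))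
    \<in> (hB (L ?t - {0} \<union> L ?s) (int (card (L ?t - {0} \<union> L ?s)) - 1) :: 'k ncochain set)"
    by (rule tc_subst[OF d(1) 0 d(2) dj])
  then have main: "tc ?c - scale_fun ((-1) ^ ?j) ?C \<in> hB {1..m + n - 1} (int (m + n - 1) - 1)"
    unfolding tree_comp_subst[OF z n, symmetric] A Ls AB ls by simp
  have ev: "even (tree_sign ?c + ?j + ((n - 1) * (i - 1) + tree_sign t + tree_sign s))"
    using inv_count_tree_comp[OF t s n i] step_sign_subst[OF d(1) 0, of ?s]
    unfolding tree_sign_def tree_comp_subst[OF z n, symmetric] ls step_sign_map distrib_left by (rule parity_sum)
  have rt: "relabel_cochain (outer n i) {1..m} (tc t) = (tc ?t :: _ \<Rightarrow> 'k)"
    using relabel_tc[OF treesD(1)[OF t], of "outer n i"] treesD(2)[OF t] outer_inj[OF n, of i m] by simp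
  have rs: "relabel_cochain (inner i) {1..n} (tc s) = (tc ?s :: _ \<Rightarrow> 'k)"
    using relabel_tc[OF treesD(1)[OF s], of "inner i"] treesD(2)[OF s] inj_on_subset[OF inner_inj[of i] subset_UNIV] i by simp
  have sg: "(-1 :: 'k) ^ ((n - 1) * (i - 1)) * ((-1) ^ tree_sign s * (-1) ^ tree_sign t) = (-1) ^ tree_sign ?c * (-1) ^ ?j"
    unfolding power_add[symmetric] by (rule even_pow_cong) (use ev in \<open>simp only: ac_simps\<close>)
  have "signed_tc ?c - scale_fun ((-1) ^ ((n - 1) * (i - 1)))
     (circ_cochain ?A 0 ?B (relabel_cochain (outer n i) {1..m} (signed_tc t)) (relabel_cochain (inner i) {1..n} (signed_tc s)))
    = scale_fun ((-1) ^ tree_sign ?c) (tc ?c - scale_fun ((-1) ^ ?j) ?C)"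
    unfolding signed_tc_def relabel_cochain_scale rt rs circ_scale_left circ_scale_right scale_scale scale_diff sg ..
  then show ?thesis using submodule.scale_mem[OF submodule_coboundaries main] by (simp only:)
qed

section \<open>Morphisms from presented operads\<close>

lemma lin_ext_mem: "submodule Md \<Longrightarrow> (\<And>t. t \<in> X \<Longrightarrow> F t \<in> Md) \<Longrightarrow> lin_ext X F u \<in> Md"
  unfolding lin_ext_def by (rule submodule.sum_mem) (auto intro: submodule.scale_mem)

lemma zero_ZC: "0 \<in> ZC S k"
  unfolding cocycles_def using submodule.zero_mem[OF submodule_cochains] by (simp add: codiff_def lin_ext_zero)

lemma (in submodule) cancel_mem: "u - v \<in> I \<Longrightarrow> v \<in> I \<Longrightarrow> u \<in> I"
  using add_mem[of "u - v" v] by simp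

lemma add_diff_pair: "(a + b) - (c + d) = (a - c) + (b - d :: 'a::ab_group_add)"
  by simp

lemma lin_ext_diff: "lin_ext X F (u - v) = lin_ext X F u - lin_ext X F v"
  using lin_ext_add[of X F "u - v" v] by simp

lemma lin_ext_fun_add: "lin_ext X (\<lambda>b. F b + G b) u = lin_ext X F u + lin_ext X G u"
  by (rule ext) (simp add: lin_ext_apply distrib_left sum.distrib)

lemma lin_ext_fun_scale: "lin_ext X (\<lambda>b. scale_fun c (F b)) u = scale_fun c (lin_ext X F u)"
  by (rule ext) (simp add: lin_ext_apply sum_distrib_left mult.left_commute)

lemma finite_bounded_trees:
  "finite A \<Longrightarrow> finite {t. L t \<subseteq> A \<and> length (leaves t) \<le> k}"
proof (induction k)
  case 0
  then show ?case by (simp add: leaves_ne)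
next
  case (Suc k)
  let ?T = "{t. L t \<subseteq> A \<and> length (leaves t) \<le> k}"
  have "t \<in> Leaf ` A \<union> (\<lambda>(t, s). Node t s) ` (?T \<times> ?T)" if "L t \<subseteq> A" "length (leaves t) \<le> Suc k" for t
  proof (cases t)
    case (Leaf a)
    then show ?thesis using that by auto
  next
    case (Node t1 t2)
    then show ?thesis using that length_pos[of t1] length_pos[of t2] by (auto intro!: image_eqI[of _ _ "(t1, t2)"])
  qed
  then have "{t. L t \<subseteq> A \<and> length (leaves t) \<le> Suc k} \<subseteq> Leaf ` A \<union> (\<lambda>(t, s). Node t s) ` (?T \<times> ?T)"
    by (intro subsetI) (simp only: mem_Collect_eq)
  then show ?case by (rule finite_subset) (use Suc in simp)
qed

lemma finite_trees: "finite (trees n)"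
  by (rule finite_subset[OF _ finite_bounded_trees[of "{1..n}" n]]) (use trees_length in \<open>auto simp: trees_def\<close>)

lemma submodule_Mag: "submodule (Mag n)"
  by unfold_locales (auto simp: Mag_def, metis add.right_neutral, metis mult_zero_right)

lemma basis_Mag: "t \<in> trees n \<Longrightarrow> basis t \<in> Mag n"
  by (auto simp: Mag_def basis_apply)

text \<open>There are finitely many trees of given arity, so their basis elements span, and linear
  statements need checking on trees only.\<close>

lemma mag_induct [consumes 1, case_names zero add scale basis]:
  fixes u :: "'k::{comm_ring, comm_monoid_mult} mag"
  assumes u: "u \<in> Mag n" and P: "P 0" "\<And>u v. P u \<Longrightarrow> P v \<Longrightarrow> P (u + v)" "\<And>c u. P u \<Longrightarrow> P (scale_fun c u)"
    "\<And>t. t \<in> trees n \<Longrightarrow> P (basis t)"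
  shows "P u"
proof -
  have eq: "u = (\<Sum>t\<in>trees n. scale_fun (u t) (basis t))"
  proof (rule ext)
    fix s
    have "(\<Sum>t\<in>trees n. scale_fun (u t) (basis t)) s = (\<Sum>t\<in>trees n. if t = s then u t else 0)"
      unfolding sum_fun_apply by (rule sum.cong) (auto simp: basis_apply)
    also have "\<dots> = u s" using u by (auto simp: Mag_def sum.delta finite_trees)
    finally show "u s = (\<Sum>t\<in>trees n. scale_fun (u t) (basis t)) s" ..
  qed
  have "T \<subseteq> trees n \<longrightarrow> P (\<Sum>t\<in>T. scale_fun (u t) (basis t))" if "finite T" for T
    using that
  proof (induction T rule: finite_induct)
    case empty
    then show ?case using P(1) by (simp only: sum.empty) blast
  next
    case (insert t T)
    show ?case
    proof
      assume a: "insert t T \<subseteq> trees n"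
      have "P (scale_fun (u t) (basis t))" by (rule P(3), rule P(4)) (use a in blast)
      moreover have "P (\<Sum>t\<in>T. scale_fun (u t) (basis t))" by (rule insert.IH[THEN mp]) (use a in blast)
      ultimately show "P (\<Sum>t\<in>insert t T. scale_fun (u t) (basis t))" unfolding sum.insert[OF insert.hyps(1,2)] by (rule P(2))
    qed
  qed
  from this[OF finite_trees] have "P (\<Sum>t\<in>trees n. scale_fun (u t) (basis t))" by (rule mp) simp
  then show ?thesis unfolding eq[symmetric] .
qed

lemma mag_act_basis: "t \<in> trees n \<Longrightarrow> mag_act n \<sigma> (basis t) = basis (map_bitree \<sigma> t)"
  unfolding mag_act_def by (rule lin_ext_basis[OF finite_trees])

lemma mag_comp_basis:
  "t \<in> trees m \<Longrightarrow> s \<in> trees n \<Longrightarrow> mag_comp m n i (basis t) (basis s) = basis (tree_comp n i t s)"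
  unfolding mag_comp_def by (simp add: lin_ext_basis[OF finite_trees])

lemma mag_act_Mag: "\<sigma> permutes {1..n} \<Longrightarrow> mag_act n \<sigma> u \<in> Mag n"
  unfolding mag_act_def by (intro lin_ext_mem[OF submodule_Mag] basis_Mag map_trees)

lemma mag_comp_Mag: "n \<ge> 1 \<Longrightarrow> i \<in> {1..m} \<Longrightarrow> mag_comp m n i u v \<in> Mag (m + n - 1)"
  unfolding mag_comp_def
  by (intro lin_ext_mem[OF submodule_Mag] basis_Mag tree_comp_trees)

lemma mag_comp_add_left: "mag_comp m n i (u + u') v = mag_comp m n i u v + mag_comp m n i u' v"
  and mag_comp_scale_left: "mag_comp m n i (scale_fun c u) v = scale_fun c (mag_comp m n i u v)"
  and mag_comp_zero_left: "mag_comp m n i 0 v = 0"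
  and mag_comp_diff_left: "mag_comp m n i (u - u') v = mag_comp m n i u v - mag_comp m n i u' v"
  unfolding mag_comp_def by (rule lin_ext_add lin_ext_scale lin_ext_zero lin_ext_diff)+

lemma mag_comp_add_right: "mag_comp m n i u (v + v') = mag_comp m n i u v + mag_comp m n i u v'"
  and mag_comp_scale_right: "mag_comp m n i u (scale_fun c v) = scale_fun c (mag_comp m n i u v)"
  unfolding mag_comp_def by (simp_all only: lin_ext_add lin_ext_scale lin_ext_fun_add lin_ext_fun_scale)

lemma mag_comp_zero_right: "mag_comp m n i u 0 = 0"
  using mag_comp_scale_right[of m n i u 0 0] by (simp only: scale_zero)

lemma mag_comp_diff_right: "mag_comp m n i u (v - v') = mag_comp m n i u v - mag_comp m n i u v'"
  using mag_comp_add_right[of m n i u "v - v'" v'] by simp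

lemma mag_act_linear:
  "mag_act n \<sigma> (u + v) = mag_act n \<sigma> u + mag_act n \<sigma> v"
  "mag_act n \<sigma> (scale_fun c u) = scale_fun c (mag_act n \<sigma> u)"
  "mag_act n \<sigma> 0 = 0"
  "mag_act n \<sigma> (u - v) = mag_act n \<sigma> u - mag_act n \<sigma> v"
  unfolding mag_act_def by (rule lin_ext_add lin_ext_scale lin_ext_zero lin_ext_diff)+

abbreviation sgn_of :: "(nat \<Rightarrow> nat) \<Rightarrow> 'k::{comm_ring, comm_monoid_mult}" where
  "sgn_of \<sigma> \<equiv> (if evenperm \<sigma> then 1 else -1)"

abbreviation comp_sign :: "nat \<Rightarrow> int \<Rightarrow> nat \<Rightarrow> nat \<Rightarrow> 'k::{comm_ring, comm_monoid_mult}" where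
  "comp_sign m k n i \<equiv> (if even ((k - (int m - 1)) * (int n - 1) + (int i - 1) * (int n - 1)) then 1 else -1)"

section \<open>Operations of the desuspension on representatives\<close>

locale presented =
  fixes R :: "(nat \<times> 'k::{comm_ring, comm_monoid_mult} mag) set"
  assumes rel: "(n, r) \<in> R \<Longrightarrow> n \<ge> 1" "(n, r) \<in> R \<Longrightarrow> r \<in> Mag n"
begin

lemma ideal_Mag: "operad_ideal R n u \<Longrightarrow> u \<in> Mag n"
proof (induction rule: operad_ideal.induct)
  case (comp_left m u v n i)
  then show ?case by (intro mag_comp_Mag)
next
  case (comp_right u m n v i)
  then show ?case by (intro mag_comp_Mag)
qed (rule rel mag_act_Mag submodule.zero_mem[OF submodule_Mag] submodule.add_mem[OF submodule_Mag] submodule.scale_mem[OF submodule_Mag]; assumption)+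

abbreviation "Dp \<equiv> desuspension (presented_operad R)"
abbreviation "Jd n k \<equiv> presented_ideal R n (k - (int n - 1))"
abbreviation "Md n k \<equiv> deg0 (Mag n :: 'k mag set) (k - (int n - 1))"

lemma submodule_ideal: "submodule {u. operad_ideal R n u}"
  by unfold_locales (auto intro: operad_ideal.intros)

lemma submodule_J: "submodule (presented_ideal R n k)"
  using submodule_ideal submodule.zero_mem[OF submodule_ideal]
  unfolding presented_ideal_def deg0_def by (auto simp: submodule_def scale_zero_right)

lemma J_deg: "presented_ideal R n k \<subseteq> deg0 (Mag n) k"
  using ideal_Mag by (auto simp: presented_ideal_def deg0_def)

lemma D_component: "component Dp n k = (\<lambda>u. u +o Jd n k) ` Md n k"
  by (simp add: desuspension_def presented_operad_def Let_def)

lemma D_unit: "op_unit Dp = basis (Leaf 1) +o Jd 1 0"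
  by (simp add: desuspension_def presented_operad_def Let_def)

lemma P_scale: "op_scale (presented_operad R) n k c (u +o presented_ideal R n k) = scale_fun c u +o presented_ideal R n k"
  unfolding presented_operad_def Let_def graded_operad.simps
  by (rule submodule.coset_map_coset[OF submodule_J submodule_J])
    (simp only: scale_diff[symmetric], rule submodule.scale_mem[OF submodule_J])

lemma D_scale: "op_scale Dp n k c (u +o Jd n k) = scale_fun c u +o Jd n k"
  unfolding desuspension_def graded_operad.simps by (rule P_scale)

lemma D_add: "op_add Dp n k (u +o Jd n k) (v +o Jd n k) = (u + v) +o Jd n k"
  unfolding desuspension_def presented_operad_def Let_def graded_operad.simps
proof (rule submodule.coset_map2_coset[OF submodule_J submodule_J submodule_J])
  fix w z assume a: "w - u \<in> Jd n k" "z - v \<in> Jd n k"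
  have "w + z - (u + v) = (w - u) + (z - v)" by simp
  then show "w + z - (u + v) \<in> Jd n k" using submodule.add_mem[OF submodule_J a] by (simp only:)
qed

lemma D_act:
  assumes "\<sigma> permutes {1..n}"
  shows "op_act Dp n k \<sigma> (u +o Jd n k) = scale_fun (sgn_of \<sigma>) (mag_act n \<sigma> u) +o Jd n k"
proof -
  have "op_act (presented_operad R) n (k - (int n - 1)) \<sigma> (u +o Jd n k) = mag_act n \<sigma> u +o Jd n k"
    unfolding presented_operad_def Let_def graded_operad.simps
  proof (rule submodule.coset_map_coset[OF submodule_J submodule_J])
    fix w assume "w - u \<in> Jd n k"
    then show "mag_act n \<sigma> w - mag_act n \<sigma> u \<in> Jd n k"
      unfolding mag_act_linear(4)[symmetric] presented_ideal_def deg0_def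
      using assms by (auto intro: operad_ideal.act simp: mag_act_linear(3) split: if_splits)
  qed
  then show ?thesis unfolding desuspension_def graded_operad.simps by (simp only: P_scale)
qed

text \<open>Outside degree 0 one of the factors is zero; in degree 0 the difference is a sum of two
  composites with a factor in the ideal.\<close>

lemma P_comp:
  assumes n: "n \<ge> 1" and i: "i \<in> {1..m}" and u: "u \<in> deg0 (Mag m) k" and v: "v \<in> deg0 (Mag n) l"
  shows "pcomp (presented_operad R) m k n l i (u +o presented_ideal R m k) (v +o presented_ideal R n l)
    = mag_comp m n i u v +o presented_ideal R (m + n - 1) (k + l)"
  unfolding presented_operad_def Let_def graded_operad.simps
proof (rule submodule.coset_map2_coset[OF submodule_J submodule_J submodule_J])
  fix w z assume w: "w - u \<in> presented_ideal R m k" and z: "z - v \<in> presented_ideal R n l"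
  have eq: "mag_comp m n i w z - mag_comp m n i u v = mag_comp m n i (w - u) z + mag_comp m n i u (z - v)"
    by (simp add: mag_comp_diff_left mag_comp_diff_right)
  have "submodule (deg0 (Mag n) l :: 'k mag set)"
    using submodule_Mag[of n] submodule.zero_mem[OF submodule_Mag] unfolding deg0_def by (auto simp: submodule_def scale_zero_right)
  then have z': "z \<in> deg0 (Mag n) l" using submodule.add_mem[of "deg0 (Mag n) l" "z - v" v] z v J_deg[of n l] by auto
  have 1: "mag_comp m n i (w - u) z \<in> presented_ideal R (m + n - 1) (k + l)"
  proof (cases "k = 0 \<and> l = 0")
    case True
    then show ?thesis using operad_ideal.comp_left[of R m "w - u" z n i] w z' n i by (simp add: presented_ideal_def deg0_def del: One_nat_def)
  next
    case False
    then have "w - u = 0 \<or> z = 0" using w z' by (auto simp: presented_ideal_def deg0_def)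
    then have "mag_comp m n i (w - u) z = 0" by (metis mag_comp_zero_left mag_comp_zero_right)
    then show ?thesis using submodule.zero_mem[OF submodule_J] by (simp only:)
  qed
  have 2: "mag_comp m n i u (z - v) \<in> presented_ideal R (m + n - 1) (k + l)"
  proof (cases "k = 0 \<and> l = 0")
    case True
    then show ?thesis using operad_ideal.comp_right[of u m R n "z - v" i] u z n i by (simp add: presented_ideal_def deg0_def del: One_nat_def)
  next
    case False
    then have "u = 0 \<or> z - v = 0" using u z by (auto simp: presented_ideal_def deg0_def)
    then have "mag_comp m n i u (z - v) = 0" by (metis mag_comp_zero_left mag_comp_zero_right)
    then show ?thesis using submodule.zero_mem[OF submodule_J] by (simp only:)
  qed
  show "mag_comp m n i w z - mag_comp m n i u v \<in> presented_ideal R (m + n - 1) (k + l)"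
    unfolding eq by (rule submodule.add_mem[OF submodule_J 1 2])
qed

lemma D_comp:
  assumes n: "n \<ge> 1" and m: "m \<ge> 1" and i: "i \<in> {1..m}" and u: "u \<in> Md m k" and v: "v \<in> Md n l"
  shows "pcomp Dp m k n l i (u +o Jd m k) (v +o Jd n l)
    = scale_fun (comp_sign m k n i) (mag_comp m n i u v) +o Jd (m + n - 1) (k + l)"
proof -
  have "k - (int m - 1) + (l - (int n - 1)) = k + l - (int (m + n - 1) - 1)" using m by (simp add: of_nat_diff)
  then show ?thesis
    using P_comp[OF n i u v] unfolding desuspension_def graded_operad.simps Let_def by (simp only: P_scale)
qed

end

text \<open>Data on trees that extend linearly to a morphism from the desuspension of a presented operad.\<close>

locale operad_data = presented R for R :: "(nat \<times> 'k::{comm_ring, comm_monoid_mult} mag) set" +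
  fixes g :: "nat bitree \<Rightarrow> nat ncp2 list \<Rightarrow> 'k"
  assumes g_TC: "t \<in> trees n \<Longrightarrow> g t \<in> TC {1..n}"
    and g_act: "t \<in> trees n \<Longrightarrow> \<sigma> permutes {1..n} \<Longrightarrow>
      g (map_bitree \<sigma> t) = scale_fun (sgn_of \<sigma>) (relabel_cochain \<sigma> {1..n} (g t))"
    and g_comp: "t \<in> trees m \<Longrightarrow> s \<in> trees n \<Longrightarrow> n \<ge> 1 \<Longrightarrow> i \<in> {1..m} \<Longrightarrow>
      g (tree_comp n i t s) - scale_fun ((-1) ^ ((n - 1) * (i - 1)))
       (pcirc m n i (g t) (g s))
      \<in> hB {1..m + n - 1} (int (m + n - 1) - 1)"
    and g_unit: "g (Leaf 1) = unit_cochain 1"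
    and g_rel: "(n, r) \<in> R \<Longrightarrow> lin_ext (trees n) g r \<in> hB {1..n} (int n - 1)"
begin

abbreviation "G n \<equiv> lin_ext (trees n) g"

lemma G_basis: "t \<in> trees n \<Longrightarrow> G n (basis t) = g t"
  by (rule lin_ext_basis[OF finite_trees])

lemma G_TC: "G n u \<in> TC {1..n}"
  by (rule lin_ext_mem[OF submodule_cochains g_TC])

lemma G_act: "u \<in> Mag n \<Longrightarrow> \<sigma> permutes {1..n} \<Longrightarrow> G n (mag_act n \<sigma> u) = scale_fun (sgn_of \<sigma>) (relabel_cochain \<sigma> {1..n} (G n u))"
proof (induction u rule: mag_induct)
  case zero
  then show ?case by (simp only: mag_act_linear lin_ext_zero relabel_cochain_zero scale_zero_right)
next
  case (add u v)
  then show ?case by (simp only: mag_act_linear lin_ext_add relabel_cochain_add scale_add)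
next
  case (scale c u)
  then show ?case by (simp only: mag_act_linear lin_ext_scale relabel_cochain_scale scale_scale mult.commute)
next
  case (basis t)
  show ?case unfolding mag_act_basis[OF basis(1)] G_basis[OF basis(1)] G_basis[OF map_trees[OF basis]]
    by (rule g_act[OF basis])
qed

lemma G_comp:
  assumes n: "n \<ge> 1" and i: "i \<in> {1..m}" and u: "u \<in> Mag m" and v: "v \<in> Mag n"
  shows "G (m + n - 1) (mag_comp m n i u v) - scale_fun ((-1) ^ ((n - 1) * (i - 1))) (pcirc m n i (G m u) (G n v))
     \<in> hB {1..m + n - 1} (int (m + n - 1) - 1)" (is "?Q u v \<in> ?I")
  using u
proof (induction u rule: mag_induct)
  case zero
  have e: "?Q 0 v = 0" by (simp only: mag_comp_zero_left lin_ext_zero relabel_cochain_zero circ_zero_left scale_zero_right diff_self)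
  show ?case unfolding e by (rule submodule.zero_mem[OF submodule_coboundaries])
next
  case (add u u')
  have e: "?Q (u + u') v = ?Q u v + ?Q u' v"
    by (simp only: mag_comp_add_left lin_ext_add relabel_cochain_add circ_add_left scale_add add_diff_pair)
  show ?case unfolding e by (rule submodule.add_mem[OF submodule_coboundaries add])
next
  case (scale c u)
  have e: "?Q (scale_fun c u) v = scale_fun c (?Q u v)"
    by (simp only: mag_comp_scale_left lin_ext_scale relabel_cochain_scale circ_scale_left scale_diff scale_scale mult.commute)
  show ?case unfolding e by (rule submodule.scale_mem[OF submodule_coboundaries scale])
next
  case (basis t)
  note t = this
  show ?case using v
  proof (induction v rule: mag_induct)
    case zero
    have e: "?Q (basis t) 0 = 0" by (simp only: mag_comp_zero_right lin_ext_zero relabel_cochain_zero circ_zero_right scale_zero_right diff_self)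
    show ?case unfolding e by (rule submodule.zero_mem[OF submodule_coboundaries])
  next
    case (add v v')
    have e: "?Q (basis t) (v + v') = ?Q (basis t) v + ?Q (basis t) v'"
      by (simp only: mag_comp_add_right lin_ext_add relabel_cochain_add circ_add_right scale_add add_diff_pair)
    show ?case unfolding e by (rule submodule.add_mem[OF submodule_coboundaries add])
  next
    case (scale c v)
    have e: "?Q (basis t) (scale_fun c v) = scale_fun c (?Q (basis t) v)"
      by (simp only: mag_comp_scale_right lin_ext_scale relabel_cochain_scale circ_scale_right scale_diff scale_scale mult.commute)
    show ?case unfolding e by (rule submodule.scale_mem[OF submodule_coboundaries scale])
  next
    case (basis s)
    then show ?case using g_comp[OF t basis n i] by (simp only: mag_comp_basis[OF t basis] G_basis[OF t] G_basis[OF basis] G_basis[OF tree_comp_trees[OF t basis n i]])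
  qed
qed

lemma relabelling_outer: "n \<ge> 1 \<Longrightarrow> relabelling (outer n i) {1..m}"
  by (unfold_locales, simp, rule outer_inj)

lemma relabelling_inner: "i \<ge> 1 \<Longrightarrow> relabelling (inner i) {1..n}"
  by (unfold_locales, simp, rule inj_on_subset[OF inner_inj subset_UNIV])

lemma relabel_outer:
  assumes "n \<ge> 1" "i \<in> {1..m}"
  shows "u \<in> ZC {1..m} k \<Longrightarrow> relabel_cochain (outer n i) {1..m} u \<in> ZC (insert 0 (rest m n i)) k"
    "u \<in> hB {1..m} k \<Longrightarrow> relabel_cochain (outer n i) {1..m} u \<in> hB (insert 0 (rest m n i)) k"
  unfolding outer_image[OF assms, symmetric]
  by (rule relabelling.relabel_ZC[OF relabelling_outer[OF assms(1)]] relabelling.relabel_hB[OF relabelling_outer[OF assms(1)]]; assumption)+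

lemma relabel_inner:
  assumes "i \<ge> 1"
  shows "u \<in> ZC {1..n} k \<Longrightarrow> relabel_cochain (inner i) {1..n} u \<in> ZC {i..i + n - 1} k"
    "u \<in> hB {1..n} k \<Longrightarrow> relabel_cochain (inner i) {1..n} u \<in> hB {i..i + n - 1} k"
  unfolding inner_image[OF assms, symmetric]
  by (rule relabelling.relabel_ZC[OF relabelling_inner[OF assms]] relabelling.relabel_hB[OF relabelling_inner[OF assms]]; assumption)+

lemma outer_inner_sets:
  "n \<ge> 1 \<Longrightarrow> i \<in> {1..m :: nat} \<Longrightarrow> (rest m n i) \<union> {i..i + n - 1} = {1..m + n - 1}"
  by auto

lemma comp_sets_pcomp:
  "n \<ge> 1 \<Longrightarrow> i \<in> {1..m :: nat} \<Longrightarrow> comp_sets (rest m n i) {i..i + n - 1} 0"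
  by unfold_locales auto

lemma G_ZC: "n \<ge> 1 \<Longrightarrow> G n u \<in> ZC {1..n} (int n - 1)"
  using TC_ZC[OF _ _ G_TC, of n u] by simp

lemma degrees: "m \<ge> 1 \<Longrightarrow> n \<ge> 1 \<Longrightarrow> int m - 1 + (int n - 1) = int (m + n - 1) - 1"
  by (simp add: of_nat_diff)

text \<open>The relators map to coboundaries by assumption. A composite with an element of the ideal
  maps, up to a coboundary, to the composite of a coboundary with a cocycle.\<close>

lemma G_ideal: "operad_ideal R n u \<Longrightarrow> n \<ge> 1 \<Longrightarrow> G n u \<in> hB {1..n} (int n - 1)"
proof (induction rule: operad_ideal.induct)
  case (gen n u)
  then show ?case by (intro g_rel)
next
  case (zero n)
  then show ?case unfolding lin_ext_zero by (intro submodule.zero_mem submodule_coboundaries)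
next
  case (add n u v)
  then show ?case unfolding lin_ext_add by (intro submodule.add_mem submodule_coboundaries) auto
next
  case (scale n u c)
  then show ?case unfolding lin_ext_scale by (intro submodule.scale_mem submodule_coboundaries) auto
next
  case (act n u \<sigma>)
  interpret relabelling \<sigma> "{1..n}" by (unfold_locales, simp, rule permutes_inj_on[OF act.hyps(2)])
  have "relabel_cochain \<sigma> {1..n} (G n u) \<in> hB {1..n} (int n - 1)"
    using relabel_hB[OF act.IH[OF act.prems]] unfolding permutes_image[OF act.hyps(2)] .
  then show ?case unfolding G_act[OF ideal_Mag[OF act.hyps(1)] act.hyps(2)]
    by (intro submodule.scale_mem submodule_coboundaries)
next
  case (comp_left m u v n i)
  then have m: "m \<ge> 1" by simp
  interpret comp_sets "rest m n i" "{i..i + n - 1}" 0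
    by (rule comp_sets_pcomp[OF comp_left.hyps(3,4)])
  have "pcirc m n i (G m u) (G n v) \<in> hB {1..m + n - 1} (int m - 1 + (int n - 1))"
    using circ_hB_left[OF relabel_outer(2)[OF comp_left.hyps(3,4) comp_left.IH[OF m]] relabel_inner(1)[OF _ G_ZC[OF comp_left.hyps(3)]]]
      comp_left.hyps(4) unfolding outer_inner_sets[OF comp_left.hyps(3,4)] by auto
  then have *: "scale_fun ((-1) ^ ((n - 1) * (i - 1))) (pcirc m n i (G m u) (G n v)) \<in> hB {1..m + n - 1} (int (m + n - 1) - 1)"
    unfolding degrees[OF m comp_left.hyps(3)] by (rule submodule.scale_mem[OF submodule_coboundaries])
  show ?case
    by (rule submodule.cancel_mem[OF submodule_coboundaries G_comp[OF comp_left.hyps(3,4) ideal_Mag[OF comp_left.hyps(1)] comp_left.hyps(2)] *])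
next
  case (comp_right u m n v i)
  then have m: "m \<ge> 1" by simp
  interpret comp_sets "rest m n i" "{i..i + n - 1}" 0
    by (rule comp_sets_pcomp[OF comp_right.hyps(3,4)])
  have "pcirc m n i (G m u) (G n v) \<in> hB {1..m + n - 1} (int m - 1 + (int n - 1))"
    using circ_hB_right[OF relabel_outer(1)[OF comp_right.hyps(3,4) G_ZC[OF m]] relabel_inner(2)[OF _ comp_right.IH[OF comp_right.hyps(3)]]]
      comp_right.hyps(4) unfolding outer_inner_sets[OF comp_right.hyps(3,4)] by auto
  then have *: "scale_fun ((-1) ^ ((n - 1) * (i - 1))) (pcirc m n i (G m u) (G n v)) \<in> hB {1..m + n - 1} (int (m + n - 1) - 1)"
    unfolding degrees[OF m comp_right.hyps(3)] by (rule submodule.scale_mem[OF submodule_coboundaries])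
  show ?case
    by (rule submodule.cancel_mem[OF submodule_coboundaries G_comp[OF comp_right.hyps(3,4,1) ideal_Mag[OF comp_right.hyps(2)]] *])
qed

definition phi :: "nat \<Rightarrow> int \<Rightarrow> 'k mag set \<Rightarrow> 'k ncochain set" where
  "phi n k = coset_map (hB {1..n} k) (G n)"

text \<open>Away from degree \<open>n - 1\<close> the desuspended ideal is zero.\<close>

lemma G_J: "n \<ge> 1 \<Longrightarrow> u \<in> Jd n k \<Longrightarrow> G n u \<in> hB {1..n} k"
  using G_ideal[of n u] submodule.zero_mem[OF submodule_coboundaries]
  by (cases "k = int n - 1") (auto simp: presented_ideal_def deg0_def lin_ext_zero)

lemma G_M: "n \<ge> 1 \<Longrightarrow> u \<in> Md n k \<Longrightarrow> G n u \<in> ZC {1..n} k"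
  using G_ZC[of n u] zero_ZC[of "{1..n}" k]
  by (cases "k = int n - 1") (auto simp: deg0_def lin_ext_zero)

lemma phi_coset: "n \<ge> 1 \<Longrightarrow> phi n k (u +o Jd n k) = G n u +o hB {1..n} k"
  unfolding phi_def
  by (rule submodule.coset_map_coset[OF submodule_coboundaries submodule_J])
    (simp only: lin_ext_diff[symmetric] G_J)

lemma h_coset_scale: "op_scale hNCP2 n k c (u +o hB {1..n} k) = scale_fun c u +o (hB {1..n} k :: 'k ncochain set)"
  unfolding hNCP2_def graded_operad.simps
  by (rule submodule.coset_map_coset[OF submodule_coboundaries submodule_coboundaries])
    (simp only: scale_diff[symmetric], rule submodule.scale_mem[OF submodule_coboundaries])

lemma h_coset_add: "h_add S k (u +o hB S k) (v +o hB S k) = (u + v) +o (hB S k :: 'k ncochain set)"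
  unfolding h_add_def
proof (rule submodule.coset_map2_coset[OF submodule_coboundaries submodule_coboundaries submodule_coboundaries])
  fix w z assume a: "w - u \<in> hB S k" "z - v \<in> hB S k"
  have "w + z - (u + v) = (w - u) + (z - v)" by simp
  then show "w + z - (u + v) \<in> hB S k" using submodule.add_mem[OF submodule_coboundaries a] by (simp only:)
qed

lemma pcomp_hNCP2: "pcomp hNCP2 m k n l i X Y = h_circ (rest m n i) 0 {i..i + n - 1} k l
    (h_relabel (outer n i) {1..m} k X) (h_relabel (inner i) {1..n} l Y)"
  by (simp add: hNCP2_def Let_def)

lemma h_comp:
  assumes n: "n \<ge> 1" and i: "i \<in> {1..m}" and u: "u \<in> ZC {1..m} k" and v: "v \<in> ZC {1..n} l"
  shows "pcomp hNCP2 m k n l i (u +o hB {1..m} k) (v +o hB {1..n} l) = pcirc m n i u v +o (hB {1..m + n - 1} (k + l) :: 'k ncochain set)"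
proof -
  interpret comp_sets "rest m n i" "{i..i + n - 1}" 0 by (rule comp_sets_pcomp[OF n i])
  have i1: "i \<ge> 1" using i by simp
  have 1: "h_relabel (outer n i) {1..m} k (u +o hB {1..m} k)
    = relabel_cochain (outer n i) {1..m} u +o (hB (insert 0 (rest m n i)) k :: 'k ncochain set)"
    using h_relabel_coset[OF finite_atLeastAtMost outer_inj[OF n, of i m], where k = k and u = u] unfolding outer_image[OF n i] .
  have 2: "h_relabel (inner i) {1..n} l (v +o hB {1..n} l)
    = relabel_cochain (inner i) {1..n} v +o (hB {i..i + n - 1} l :: 'k ncochain set)"
    using h_relabel_coset[OF finite_atLeastAtMost[of 1 n] inj_on_subset[OF inner_inj[OF i1] subset_UNIV, of "{1..n}"], where k = l and u = v] unfolding inner_image[OF i1] .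
  have 3: "h_circ (rest m n i) 0 {i..i + n - 1} k l
      (relabel_cochain (outer n i) {1..m} u +o hB (insert 0 (rest m n i)) k)
      (relabel_cochain (inner i) {1..n} v +o hB {i..i + n - 1} l) = pcirc m n i u v +o (hB {1..m + n - 1} (k + l) :: 'k ncochain set)"
    using h_circ_coset[OF relabel_outer(1)[OF n i u] relabel_inner(1)[OF i1 v]] unfolding outer_inner_sets[OF n i] .
  show ?thesis by (rule trans[OF pcomp_hNCP2], subst 1, subst 2, rule 3)
qed

text \<open>Outside the top degrees one argument is zero and both sides vanish.\<close>

lemma G_comp_degree:
  assumes n: "n \<ge> 1" and m: "m \<ge> 1" and i: "i \<in> {1..m}" and u: "u \<in> Md m k" and v: "v \<in> Md n l"
  shows "G (m + n - 1) (scale_fun (comp_sign m k n i) (mag_comp m n i u v)) - pcirc m n i (G m u) (G n v) \<in> hB {1..m + n - 1} (k + l)"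
proof (cases "k = int m - 1 \<and> l = int n - 1")
  case True
  have kl: "k + l = int (m + n - 1) - 1" unfolding conjunct1[OF True] conjunct2[OF True] by (rule degrees[OF m n])
  obtain n' where n': "n = Suc n'" using n by (cases n) auto
  obtain i' where i': "i = Suc i'" using i by (cases i) auto
  \<comment> \<open>The undesuspended degree of the left factor is 0, so only the sign of the
    generators of the endomorphism operad remains.\<close>
  have "(k - (int m - 1)) * (int n - 1) + (int i - 1) * (int n - 1) = int ((n - 1) * (i - 1))"
    using True by (simp add: n' i' mult.commute)
  then have c': "comp_sign m k n i = ((-1) ^ ((n - 1) * (i - 1)) :: 'k)"
    unfolding minus_one_power by (simp only: even_of_nat)
  have c: "comp_sign m k n i * (-1) ^ ((n - 1) * (i - 1)) = (1 :: 'k)"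
    unfolding c' minus_one_power by (simp add: minus_mult_left[symmetric])
  have uv: "u \<in> Mag m" "v \<in> Mag n" using u v True by (auto simp: deg0_def)
  have e: "G (m + n - 1) (scale_fun (comp_sign m k n i) (mag_comp m n i u v)) - pcirc m n i (G m u) (G n v)
    = scale_fun (comp_sign m k n i) (G (m + n - 1) (mag_comp m n i u v) - scale_fun ((-1) ^ ((n - 1) * (i - 1))) (pcirc m n i (G m u) (G n v)))"
    unfolding lin_ext_scale scale_diff scale_scale c scale_one ..
  show ?thesis unfolding kl e by (rule submodule.scale_mem[OF submodule_coboundaries G_comp[OF n i uv]])
next
  case False
  then have "u = 0 \<or> v = 0" using u v by (auto simp: deg0_def split: if_splits)
  then have 1: "mag_comp m n i u v = 0" and 2: "pcirc m n i (G m u) (G n v) = 0"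
    using mag_comp_zero_left[of m n i v] mag_comp_zero_right[of m n i u]
    by (auto simp only: lin_ext_zero relabel_cochain_zero circ_zero_left circ_zero_right)
  show ?thesis unfolding 1 2 scale_zero_right lin_ext_zero diff_self by (rule submodule.zero_mem[OF submodule_coboundaries])
qed

lemma morphism: "operad_morphism Dp hNCP2 phi"
  unfolding operad_morphism_def
proof (intro conjI allI impI ballI)
  fix n :: nat and k :: int assume n: "1 \<le> n"
  show "phi n k ` component Dp n k \<subseteq> component hNCP2 n k"
    unfolding D_component using G_M[OF n]
    by (auto simp: phi_coset[OF n] hNCP2_def cohomology_def)
  fix x assume "x \<in> component Dp n k"
  then obtain u where u: "u \<in> Md n k" "x = u +o Jd n k" unfolding D_component by blast
  show "phi n k (op_scale Dp n k c x) = op_scale hNCP2 n k c (phi n k x)" for c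
    unfolding u(2) D_scale phi_coset[OF n] h_coset_scale lin_ext_scale ..
  show "phi n k (op_add Dp n k x y) = op_add hNCP2 n k (phi n k x) (phi n k y)" if y: "y \<in> component Dp n k" for y
  proof -
    obtain v where v: "y = v +o Jd n k" using y unfolding D_component by blast
    show ?thesis unfolding u(2) v D_add phi_coset[OF n] lin_ext_add h_coset_add[symmetric] by (simp add: hNCP2_def)
  qed
  show "phi n k (op_act Dp n k \<sigma> x) = op_act hNCP2 n k \<sigma> (phi n k x)" if \<sigma>: "\<sigma> permutes {1..n}" for \<sigma>
  proof -
    have "G n (scale_fun (sgn_of \<sigma>) (mag_act n \<sigma> u)) = relabel_cochain \<sigma> {1..n} (G n u)"
    proof (cases "u \<in> Mag n")
      case True
      have "sgn_of \<sigma> * sgn_of \<sigma> = (1 :: 'k)" by (simp add: minus_mult_left[symmetric])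
      then show ?thesis unfolding lin_ext_scale G_act[OF True \<sigma>] scale_scale by simp
    next
      case False
      then have "u = 0" using u(1) by (auto simp: deg0_def split: if_splits)
      then show ?thesis by (simp only: mag_act_linear scale_zero_right lin_ext_zero relabel_cochain_zero)
    qed
    then show ?thesis unfolding u(2) D_act[OF \<sigma>] phi_coset[OF n]
      using h_relabel_coset[OF finite_atLeastAtMost permutes_inj_on[OF \<sigma>], where k = k and u = "G n u"] permutes_image[OF \<sigma>]
      by (simp add: hNCP2_def)
  qed
next
  fix m n :: nat and k l :: int and i x y
  assume mn: "1 \<le> m" "1 \<le> n" and i: "i \<in> {1..m}" and x: "x \<in> component Dp m k" and y: "y \<in> component Dp n l"
  obtain u where u: "u \<in> Md m k" "x = u +o Jd m k" using x unfolding D_component by blast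
  obtain v where v: "v \<in> Md n l" "y = v +o Jd n l" using y unfolding D_component by blast
  have mn1: "1 \<le> m + n - 1" using mn by simp
  show "phi (m + n - 1) (k + l) (pcomp Dp m k n l i x y) = pcomp hNCP2 m k n l i (phi m k x) (phi n l y)"
    unfolding u(2) v(2) D_comp[OF mn(2,1) i u(1) v(1)] phi_coset[OF mn(1)] phi_coset[OF mn(2)] phi_coset[OF mn1]
      h_comp[OF mn(2) i G_M[OF mn(1) u(1)] G_M[OF mn(2) v(1)]] submodule.coset_eq_iff[OF submodule_coboundaries]
    by (rule G_comp_degree[OF mn(2,1) i u(1) v(1)])
next
  have "Leaf 1 \<in> trees 1" by (simp add: trees_def)
  then show "phi 1 0 (op_unit Dp) = op_unit hNCP2"
    unfolding D_unit phi_coset[OF le_refl] using G_basis[of "Leaf 1" 1] g_unit by (simp add: hNCP2_def unit_cochain_def)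
qed

end

section \<open>Antisymmetrization\<close>

text \<open>The signed sum over all exchanges of subtrees at the nodes of the tree. The function
  argument allows values in any abelian group: \<open>basis\<close> gives the antisymmetrization and
  \<open>signed_tc\<close> its image under the pre-Lie datum.\<close>

fun asum :: "'a bitree \<Rightarrow> ('a bitree \<Rightarrow> 'c) \<Rightarrow> 'c::ab_group_add" where
  "asum (Leaf a) K = K (Leaf a)"
| "asum (Node t s) K = asum t (\<lambda>x. asum s (\<lambda>y. K (Node x y) - K (Node y x)))"

lemma asum_hom: "(\<And>u v. h (u - v) = h u - h v) \<Longrightarrow> h (asum t K) = asum t (\<lambda>x. h (K x))"
  by (induction t arbitrary: K) simp_all

lemma asum_diff: "asum t (\<lambda>x. K x - K' x) = asum t K - asum t K'"
proof (induction t arbitrary: K K')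
  case (Node t s)
  show ?case unfolding asum.simps Node.IH by (simp add: algebra_simps)
qed simp

lemma asum_apply: "asum t K y = asum t (\<lambda>x. K x y)"
  by (rule asum_hom[where h = "\<lambda>f. f y"]) simp

lemma asum_comm: "asum t (\<lambda>x. asum s (F x)) = asum s (\<lambda>y. asum t (\<lambda>x. F x y))"
proof -
  have "asum s (asum t F) = asum t (\<lambda>x. asum s (F x))"
    \<comment> \<open>Here one signed sum is applied, as an additive map on functions, to the
      other.\<close>
    by (rule asum_hom[where h = "asum s"]) (simp add: fun_diff_def asum_diff)
  then show ?thesis by (simp add: asum_apply[abs_def] asum_apply)
qed

text \<open>Exchanging subtrees permutes the leaves, so only trees with the same multiset of leaves
  occur.\<close>

lemma asum_closed:
  assumes I: "\<And>u v. u \<in> I \<Longrightarrow> v \<in> I \<Longrightarrow> u - v \<in> I"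
  shows "(\<And>x. mset (leaves x) = mset (leaves t) \<Longrightarrow> K x \<in> I) \<Longrightarrow> asum t K \<in> I"
proof (induction t arbitrary: K)
  case (Node t s)
  show ?case unfolding asum.simps
    by (intro Node.IH(1) Node.IH(2) I Node.prems) (simp_all add: union_commute)
qed simp

lemma asum_cong:
  assumes "\<And>x. mset (leaves x) = mset (leaves t) \<Longrightarrow> K x = K' x"
  shows "asum t K = asum t K'"
proof -
  have "asum t (\<lambda>x. K x - K' x) \<in> {0}" by (rule asum_closed) (simp_all add: assms)
  then show ?thesis by (simp add: asum_diff)
qed

lemma asum_map: "asum (map_bitree f t) K = asum t (\<lambda>x. K (map_bitree f x))"
  by (induction t arbitrary: K) simp_all

text \<open>The nodes of the composite are those of the two trees, and exchanges at the ones are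
  independent of exchanges at the others.\<close>

lemma asum_subst:
  "distinct (leaves t) \<Longrightarrow> z \<in> L t \<Longrightarrow> asum (subst z s t) K = asum t (\<lambda>x. asum s (\<lambda>y. K (subst z y x)))"
proof (induction t arbitrary: K)
  case (Leaf a)
  then show ?case by simp
next
  case (Node t1 t2)
  have d: "distinct (leaves t1)" "distinct (leaves t2)" using Node.prems by auto
  have fresh: "subst z y x = x" if "mset (leaves x) = mset (leaves t)" "z \<notin> L t" for x y t :: "'a bitree"
    by (rule subst_fresh) (use mset_eq_setD[OF that(1)] that(2) in simp)
  show ?case
  proof (cases "z \<in> L t1")
    case True
    then have z: "z \<notin> L t2" using Node.prems by auto
    have "asum (subst z s (Node t1 t2)) K
      = asum t1 (\<lambda>x. asum s (\<lambda>y. asum t2 (\<lambda>b. K (Node (subst z y x) b) - K (Node b (subst z y x)))))"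
      by (simp only: subst_simps asum.simps subst_fresh[OF z] Node.IH(1)[OF d(1) True])
    also have "\<dots> = asum t1 (\<lambda>x. asum t2 (\<lambda>b. asum s (\<lambda>y. K (Node (subst z y x) b) - K (Node b (subst z y x)))))"
      by (simp only: asum_comm[of s])
    also have "\<dots> = asum t1 (\<lambda>x. asum t2 (\<lambda>b. asum s (\<lambda>y. K (Node (subst z y x) (subst z y b)) - K (Node (subst z y b) (subst z y x)))))"
      by (intro asum_cong) (simp only: fresh[OF _ z])
    finally show ?thesis by (simp only: asum.simps subst_simps asum_diff)
  next
    case False
    then have z: "z \<in> L t2" using Node.prems by auto
    have "asum (subst z s (Node t1 t2)) K
      = asum t1 (\<lambda>x. asum t2 (\<lambda>b. asum s (\<lambda>y. K (Node x (subst z y b)) - K (Node (subst z y b) x))))"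
      by (simp only: subst_simps asum.simps subst_fresh[OF False] Node.IH(2)[OF d(2) z])
    also have "\<dots> = asum t1 (\<lambda>x. asum t2 (\<lambda>b. asum s (\<lambda>y. K (Node (subst z y x) (subst z y b)) - K (Node (subst z y b) (subst z y x)))))"
      by (intro asum_cong) (simp only: fresh[OF _ False])
    finally show ?thesis by (simp only: asum.simps subst_simps asum_diff)
  qed
qed

lemma tree_mult_basis: "tree_mult (basis x) (basis y) = basis (Node x y)"
  by (rule ext) (auto simp: tree_mult_def basis_apply split: bitree.split)

lemma tree_mult_diff:
  "tree_mult (u - u') v = tree_mult u v - tree_mult u' v" "tree_mult u (v - v') = tree_mult u v - tree_mult u v'"
  by (rule ext, simp add: tree_mult_def left_diff_distrib right_diff_distrib split: bitree.split)+

lemma antisym_asum: "antisym t = asum t basis"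
proof (induction t)
  case (Node t s)
  have m: "tree_mult (asum t basis) (asum s basis) = asum t (\<lambda>x. asum s (\<lambda>y. basis (Node x y)))" for t s :: "nat bitree"
  proof -
    have "tree_mult (asum t basis) (asum s basis) = asum t (\<lambda>x. tree_mult (basis x) (asum s basis))"
      by (rule asum_hom[where h = "\<lambda>u. tree_mult u (asum s basis)"]) (rule tree_mult_diff)
    also have "(\<lambda>x. tree_mult (basis x) (asum s basis)) = (\<lambda>x. asum s (\<lambda>y. tree_mult (basis x) (basis y)))"
      by (rule ext, rule asum_hom[where h = "tree_mult _"]) (rule tree_mult_diff)
    finally show ?thesis by (simp only: tree_mult_basis)
  qed
  show ?case unfolding antisym.simps Node.IH m asum.simps asum_diff
    by (rule arg_cong2[where f = minus, OF refl], rule asum_comm)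
qed simp

section \<open>The data for the pre-Lie and the Lie operad\<close>

lemma trees_mset: "t \<in> trees n \<Longrightarrow> mset (leaves x) = mset (leaves t) \<Longrightarrow> x \<in> trees n"
  unfolding trees_def mem_Collect_eq using mset_eq_imp_distinct_iff mset_eq_setD by metis

lemma signed_tc_TC: "t \<in> trees n \<Longrightarrow> (signed_tc t :: _ \<Rightarrow> 'k::{comm_ring, comm_monoid_mult}) \<in> TC {1..n}"
proof -
  assume t: "t \<in> trees n"
  have "(tc t :: _ \<Rightarrow> 'k) \<in> TC {1..n}" using tc_TC[OF treesD(1)[OF t]] unfolding treesD(2)[OF t] .
  then show ?thesis unfolding signed_tc_def by (rule submodule.scale_mem[OF submodule_cochains])
qed

lemma signed_tc_unit: "signed_tc (Leaf 1) = unit_cochain 1"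
  by (simp add: signed_tc_def tree_sign_def)

lemma circ_unit_same:
  assumes "finite A" "s \<notin> A" "u \<in> TC (insert s A)"
  shows "circ_cochain A s {s} u (unit_cochain s) = u"
  unfolding circ_unit_right[OF assms(1,2,2,3)]
  by (rule relabel_cochain_id[OF _ _ assms(3)]) (use assms(1) in auto)

lemma tc_two: "a \<noteq> b \<Longrightarrow> tc (Node (Leaf a) (Leaf b)) = (prc a b :: _ \<Rightarrow> 'k::{comm_ring, comm_monoid_mult})"
proof -
  assume ab: "a \<noteq> b"
  have p: "(prc a b :: _ \<Rightarrow> 'k) \<in> TC (insert a {b})" "(prc a b :: _ \<Rightarrow> 'k) \<in> TC (insert b {a})"
    using prc_TC[OF ab] by (simp_all add: insert_commute)
  have "circ_cochain {b} a {a} (prc a b) (unit_cochain a) = (prc a b :: _ \<Rightarrow> 'k)"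
    by (rule circ_unit_same[OF _ _ p(1)]) (use ab in simp_all)
  moreover have "circ_cochain {a} b {b} (prc a b) (unit_cochain b) = (prc a b :: _ \<Rightarrow> 'k)"
    by (rule circ_unit_same[OF _ _ p(2)]) (use ab in simp_all)
  ultimately show ?thesis by (simp add: join_def)
qed

lemma tc_left:
  assumes "a \<noteq> b" "a \<noteq> c" "b \<noteq> c" "a \<noteq> 0" "b \<noteq> 0" "c \<noteq> 0"
  shows "tc (Node (Node (Leaf a) (Leaf b)) (Leaf c)) = (circ_cochain {c} 0 {a, b} (prc 0 c) (prc a b) :: _ \<Rightarrow> 'k::{comm_ring, comm_monoid_mult})"
proof -
  have p: "tc (Node (Leaf a) (Leaf b)) = (prc a b :: _ \<Rightarrow> 'k)" by (rule tc_two[OF assms(1)])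
  have "tc (Node (Node (Leaf a) (Leaf b)) (Leaf c))
    = (join 0 c (L (Node (Leaf a) (Leaf b))) (L (Leaf c)) (tc (Node (Leaf a) (Leaf b))) (tc (Leaf c)) :: _ \<Rightarrow> 'k)"
    by (rule tc_Node) (use assms in auto)
  also have "\<dots> = join 0 c {a, b} {c} (prc a b) (unit_cochain c)" unfolding p by simp
  also have "\<dots> = circ_cochain {c} 0 {a, b} (prc 0 c) (prc a b)"
    unfolding join_def by (rule circ_unit_same, simp, use assms in simp, rule join_inner_TC) (use assms prc_TC[OF assms(1)] in auto)
  finally show ?thesis .
qed

lemma tc_right:
  assumes "a \<noteq> b" "a \<noteq> c" "b \<noteq> c" "a \<noteq> 0" "b \<noteq> 0" "c \<noteq> 0"
  shows "tc (Node (Leaf a) (Node (Leaf b) (Leaf c))) = (circ_cochain {a} 0 {b, c} (prc a 0) (prc b c) :: _ \<Rightarrow> 'k::{comm_ring, comm_monoid_mult})"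
proof -
  have p: "tc (Node (Leaf b) (Leaf c)) = (prc b c :: _ \<Rightarrow> 'k)" by (rule tc_two[OF assms(3)])
  have "tc (Node (Leaf a) (Node (Leaf b) (Leaf c)))
    = (join a 0 (L (Leaf a)) (L (Node (Leaf b) (Leaf c))) (tc (Leaf a)) (tc (Node (Leaf b) (Leaf c))) :: _ \<Rightarrow> 'k)"
    by (rule tc_Node) (use assms in auto)
  also have "\<dots> = join a 0 {a} {b, c} (unit_cochain a) (prc b c)" unfolding p by simp
  also have "\<dots> = circ_cochain {a} 0 {b, c} (prc a 0) (prc b c)"
  proof -
  have "circ_cochain {0} a {a} (prc a 0) (unit_cochain a) = (prc a 0 :: _ \<Rightarrow> 'k)"
    by (rule circ_unit_same) (use assms prc_TC[OF assms(4)] in auto)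
  then have "join a 0 {a} {b, c} (unit_cochain a) (prc b c) = (circ_cochain {a} 0 {b, c} (prc a 0) (prc b c) :: _ \<Rightarrow> 'k)"
    by (simp only: join_def)
  then show ?thesis .
  qed
  finally show ?thesis .
qed

lemma trees_two: "Node (Leaf 1) (Leaf 2) \<in> trees 2" "Node (Leaf 2) (Leaf 1) \<in> trees 2"
  by (auto simp: trees_def)

lemma trees_three:
  assumes "distinct [a, b, c]" "set [a, b, c] = {1..3}"
  shows "Node (Node (Leaf a) (Leaf b)) (Leaf c) \<in> trees 3" "Node (Leaf a) (Node (Leaf b) (Leaf c)) \<in> trees 3"
  using assms by (simp_all add: trees_def)

lemma relator_trees: "Node (Node (Leaf 1) (Leaf 2)) (Leaf 3) \<in> trees 3" "Node (Leaf 1) (Node (Leaf 2) (Leaf 3)) \<in> trees 3"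
    "Node (Node (Leaf 1) (Leaf 3)) (Leaf 2) \<in> trees 3" "Node (Leaf 1) (Node (Leaf 3) (Leaf 2)) \<in> trees 3"
  by (rule trees_three; auto)+

lemma three: "{1..3} = {1, 2, 3 :: nat}"
  by auto

interpretation PL: operad_data "prelie_relators :: (nat \<times> 'k::{comm_ring, comm_monoid_mult} mag) set" signed_tc
proof unfold_locales
  let ?R = "(tr_left 1 2 3 - tr_right 1 2 3) - (tr_left 1 3 2 - tr_right 1 3 2) :: 'k mag"
  note t = relator_trees
  have M: "?R \<in> Mag 3"
    unfolding tr_left_def tr_right_def by (intro submodule.diff_mem[OF submodule_Mag] basis_Mag t)
  fix n :: nat and r :: "'k mag"
  show "n \<ge> 1" "r \<in> Mag n" if "(n, r) \<in> prelie_relators"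
    using that M unfolding prelie_relators_def by simp_all
  show "lin_ext (trees n) signed_tc r \<in> hB {1..n} (int n - 1)" if "(n, r) \<in> prelie_relators"
  proof -
    have n: "n = 3" "r = ?R" using that unfolding prelie_relators_def by simp_all
    \<comment> \<open>The tree signs are negative for \<open>1 (2 3)\<close> and
      \<open>(1 3) 2\<close> and positive for the two others, exactly as in the relator.\<close>
    have "lin_ext (trees 3) signed_tc ?R = (relation :: _ \<Rightarrow> 'k)"
      unfolding tr_left_def tr_right_def lin_ext_diff lin_ext_basis[OF finite_trees t(1)] lin_ext_basis[OF finite_trees t(2)]
        lin_ext_basis[OF finite_trees t(3)] lin_ext_basis[OF finite_trees t(4)] relation_def signed_tc_def
      by (simp add: tc_left tc_right tree_sign_def scale_neg power2_eq_square minus_mult_left[symmetric] del: tc.simps)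
    moreover have "int 3 - 1 = 2" by simp
    moreover have "(relation :: _ \<Rightarrow> 'k) \<in> hB {1, 2, 3} 2" by (rule relation_hB)
    ultimately show ?thesis unfolding n by (simp only: three of_nat_numeral)
  qed
qed (rule signed_tc_TC signed_tc_act signed_tc_comp signed_tc_unit; assumption)+

text \<open>Permuted relators belong to the ideal, so their images are coboundaries without a new
  computation on chains.\<close>

lemma signed_tc_relation:
  assumes p: "\<sigma> permutes {1..3}"
  shows "signed_tc (Node (Node (Leaf (\<sigma> 1)) (Leaf (\<sigma> 2))) (Leaf (\<sigma> 3))) - signed_tc (Node (Leaf (\<sigma> 1)) (Node (Leaf (\<sigma> 2)) (Leaf (\<sigma> 3))))
    - (signed_tc (Node (Node (Leaf (\<sigma> 1)) (Leaf (\<sigma> 3))) (Leaf (\<sigma> 2))) - signed_tc (Node (Leaf (\<sigma> 1)) (Node (Leaf (\<sigma> 3)) (Leaf (\<sigma> 2)))))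
    \<in> (hB {1..3} 2 :: (nat ncp2 list \<Rightarrow> 'k::{comm_ring, comm_monoid_mult}) set)"
proof -
  let ?R = "(tr_left 1 2 3 - tr_right 1 2 3) - (tr_left 1 3 2 - tr_right 1 3 2) :: 'k mag"
  note t = relator_trees
  note t' = map_trees[OF t(1) p] map_trees[OF t(2) p] map_trees[OF t(3) p] map_trees[OF t(4) p]
  have "operad_ideal prelie_relators 3 ?R" by (rule operad_ideal.gen) (simp add: prelie_relators_def)
  then have "operad_ideal prelie_relators 3 (mag_act 3 \<sigma> ?R)" using p by (rule operad_ideal.act)
  then have "lin_ext (trees 3) signed_tc (mag_act 3 \<sigma> ?R) \<in> (hB {1..3} (int 3 - 1) :: 'k ncochain set)"
    by (rule PL.G_ideal) simp
  then show ?thesis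
    unfolding tr_left_def tr_right_def mag_act_linear mag_act_basis[OF t(1)] mag_act_basis[OF t(2)] mag_act_basis[OF t(3)] mag_act_basis[OF t(4)]
      lin_ext_diff lin_ext_basis[OF finite_trees t'(1)] lin_ext_basis[OF finite_trees t'(2)] lin_ext_basis[OF finite_trees t'(3)] lin_ext_basis[OF finite_trees t'(4)]
    by simp
qed

lemma jacobi_hB:
  "asum (Node (Node (Leaf 1) (Leaf 2)) (Leaf 3)) signed_tc + asum (Node (Node (Leaf 2) (Leaf 3)) (Leaf 1)) signed_tc
   + asum (Node (Node (Leaf 3) (Leaf 1)) (Leaf 2)) signed_tc \<in> (hB {1..3} 2 :: (nat ncp2 list \<Rightarrow> 'k::{comm_ring, comm_monoid_mult}) set)"
proof -
  \<comment> \<open>The rotation that sends 1 to 2, 2 to 3 and 3 to 1.\<close>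
  define \<sigma> where "\<sigma> = transpose 1 2 \<circ> transpose 2 (3 :: nat)"
  have v: "\<sigma> 1 = 2" "\<sigma> 2 = 3" "\<sigma> 3 = 1" by (simp_all add: \<sigma>_def transpose_def)
  have p: "\<sigma> permutes {1..3}" unfolding \<sigma>_def by (intro permutes_compose permutes_swap_id) auto
  let ?s = "signed_tc :: _ \<Rightarrow> _ \<Rightarrow> 'k"
  note rel = signed_tc_relation[OF permutes_id] signed_tc_relation[OF p, unfolded v] signed_tc_relation[OF permutes_compose[OF p p], unfolded comp_def v]
  \<comment> \<open>Each of the twelve trees on three leaves occurs once on either side: the three
    rotated pre-Lie relators add up to the expanded Jacobi relator.\<close>
  have eq: "asum (Node (Node (Leaf 1) (Leaf 2)) (Leaf 3)) ?s + asum (Node (Node (Leaf 2) (Leaf 3)) (Leaf 1)) ?s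
   + asum (Node (Node (Leaf 3) (Leaf 1)) (Leaf 2)) ?s =
   (?s (Node (Node (Leaf (id 1)) (Leaf (id 2))) (Leaf (id 3))) - ?s (Node (Leaf (id 1)) (Node (Leaf (id 2)) (Leaf (id 3))))
    - (?s (Node (Node (Leaf (id 1)) (Leaf (id 3))) (Leaf (id 2))) - ?s (Node (Leaf (id 1)) (Node (Leaf (id 3)) (Leaf (id 2))))))
   + (?s (Node (Node (Leaf 2) (Leaf 3)) (Leaf 1)) - ?s (Node (Leaf 2) (Node (Leaf 3) (Leaf 1)))
    - (?s (Node (Node (Leaf 2) (Leaf 1)) (Leaf 3)) - ?s (Node (Leaf 2) (Node (Leaf 1) (Leaf 3)))))
   + (?s (Node (Node (Leaf 3) (Leaf 1)) (Leaf 2)) - ?s (Node (Leaf 3) (Node (Leaf 1) (Leaf 2)))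
    - (?s (Node (Node (Leaf 3) (Leaf 2)) (Leaf 1)) - ?s (Node (Leaf 3) (Node (Leaf 2) (Leaf 1)))))"
    by (simp add: algebra_simps)
  show ?thesis unfolding eq by (intro submodule.add_mem[OF submodule_coboundaries] rel)
qed

text \<open>All properties are inherited from \<open>signed_tc\<close> term by term, because the
  signed sum commutes with additive maps and with substitution.\<close>

interpretation LI: operad_data "lie_relators :: (nat \<times> 'k::{comm_ring, comm_monoid_mult} mag) set" "\<lambda>t. asum t signed_tc"
proof unfold_locales
  let ?J = "tr_left 1 2 3 + tr_left 2 3 1 + tr_left 3 1 2 :: 'k mag"
  let ?B = "basis (Node (Leaf 1) (Leaf 2)) + basis (Node (Leaf 2) (Leaf 1)) :: 'k mag"
  have t: "Node (Node (Leaf 1) (Leaf 2)) (Leaf 3) \<in> trees 3" "Node (Node (Leaf 2) (Leaf 3)) (Leaf 1) \<in> trees 3"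
     "Node (Node (Leaf 3) (Leaf 1)) (Leaf 2) \<in> trees 3" by (rule trees_three; auto)+
  have M: "?J \<in> Mag 3" "?B \<in> Mag 2"
    unfolding tr_left_def by (intro submodule.add_mem[OF submodule_Mag] basis_Mag t trees_two)+
  fix n :: nat and r :: "'k mag"
  show "n \<ge> 1" "r \<in> Mag n" if "(n, r) \<in> lie_relators"
    using that M unfolding lie_relators_def by auto
  let ?G = "\<lambda>n. lin_ext (trees n) (\<lambda>t. asum t signed_tc) :: 'k mag \<Rightarrow> nat ncp2 list \<Rightarrow> 'k"
  show "?G n r \<in> hB {1..n} (int n - 1)" if "(n, r) \<in> lie_relators"
  proof -
    have "(n = 2 \<and> r = ?B) \<or> (n = 3 \<and> r = ?J)" using that unfolding lie_relators_def by simp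
    then show ?thesis
    proof (elim disjE conjE)
      assume n: "n = 2" "r = ?B"
      \<comment> \<open>The expansion of the bracket is antisymmetric term by term.\<close>
      have "?G 2 ?B = 0"
        unfolding lin_ext_add lin_ext_basis[OF finite_trees trees_two(1)] lin_ext_basis[OF finite_trees trees_two(2)] by simp
      then show ?thesis unfolding n using submodule.zero_mem[OF submodule_coboundaries] by (simp only:)
    next
      assume n: "n = 3" "r = ?J"
      have "int 3 - 1 = 2" by simp
      then show ?thesis using jacobi_hB[where 'k = 'k]
        unfolding n tr_left_def lin_ext_add lin_ext_basis[OF finite_trees t(1)] lin_ext_basis[OF finite_trees t(2)] lin_ext_basis[OF finite_trees t(3)]
        by (simp only:)
    qed
  qed
  fix t assume t: "t \<in> trees n"
  note t' = trees_mset[OF t]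
  show "asum t signed_tc \<in> TC {1..n}"
    by (rule asum_closed[OF submodule.diff_mem[OF submodule_cochains] signed_tc_TC[OF t']])
  show "asum (map_bitree \<sigma> t) signed_tc = (scale_fun (sgn_of \<sigma>) (relabel_cochain \<sigma> {1..n} (asum t signed_tc)) :: _ \<Rightarrow> 'k)"
    if p: "\<sigma> permutes {1..n}" for \<sigma>
  proof -
    have "asum (map_bitree \<sigma> t) signed_tc = asum t (\<lambda>x. scale_fun (sgn_of \<sigma>) (relabel_cochain \<sigma> {1..n} (signed_tc x)) :: _ \<Rightarrow> 'k)"
      unfolding asum_map by (rule asum_cong) (rule signed_tc_act[OF t' p])
    also have "\<dots> = scale_fun (sgn_of \<sigma>) (relabel_cochain \<sigma> {1..n} (asum t signed_tc))"
      by (rule asum_hom[symmetric, where h = "\<lambda>u. scale_fun (sgn_of \<sigma>) (relabel_cochain \<sigma> {1..n} u)"])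
        (simp only: relabel_cochain_diff scale_diff)
    finally show ?thesis .
  qed
next
  fix m n i :: nat and t s :: "nat bitree"
  assume t: "t \<in> trees m" and s: "s \<in> trees n" and n: "n \<ge> 1" and i: "i \<in> {1..m}"
  define b where "b u v = scale_fun ((-1) ^ ((n - 1) * (i - 1)))
       (pcirc m n i u v)" for u v :: "nat ncp2 list \<Rightarrow> 'k"
  have b_diff: "b (u - u') v = b u v - b u' v" "b u (v - v') = b u v - b u v'" for u u' v v'
    unfolding b_def relabel_cochain_diff circ_diff_left circ_diff_right scale_diff by (rule refl)+
  let ?t = "map_bitree (outer n i) t" and ?s = "map_bitree (inner i) s"
  have z: "0 \<notin> L x" if "mset (leaves x) = mset (leaves t)" for x
    using treesD(2)[OF trees_mset[OF t that]] by simp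
  have d: "distinct (leaves ?t)" "0 \<in> L ?t"
    using treesD[OF t] outer_inj[OF n, of i m] outer_image[OF n i] by (simp_all add: leaves_map distinct_map)
  have "b (asum t signed_tc) (asum s signed_tc) = asum t (\<lambda>x. b (signed_tc x) (asum s signed_tc))"
    by (rule asum_hom[where h = "\<lambda>u. b u (asum s signed_tc)"]) (rule b_diff)
  also have "\<dots> = asum t (\<lambda>x. asum s (\<lambda>y. b (signed_tc x) (signed_tc y)))"
    by (intro asum_cong asum_hom[where h = "b _"]) (rule b_diff)
  finally have 1: "b (asum t signed_tc) (asum s signed_tc) = asum t (\<lambda>x. asum s (\<lambda>y. b (signed_tc x) (signed_tc y)))" .
  have "asum (tree_comp n i t s) signed_tc = asum t (\<lambda>x. asum s (\<lambda>y. signed_tc (subst 0 (map_bitree (inner i) y) (map_bitree (outer n i) x))) :: _ \<Rightarrow> 'k)"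
    unfolding tree_comp_subst[OF z[OF refl] n] asum_subst[OF d] asum_map ..
  also have "\<dots> = asum t (\<lambda>x. asum s (\<lambda>y. signed_tc (tree_comp n i x y)))"
    by (intro asum_cong) (simp only: tree_comp_subst[OF z n])
  finally have "asum (tree_comp n i t s) signed_tc - b (asum t signed_tc) (asum s signed_tc)
    = asum t (\<lambda>x. asum s (\<lambda>y. signed_tc (tree_comp n i x y) - b (signed_tc x) (signed_tc y)))"
    unfolding 1 asum_diff by simp
  also have "\<dots> \<in> hB {1..m + n - 1} (int (m + n - 1) - 1)"
    unfolding b_def
    by (intro asum_closed[OF submodule.diff_mem[OF submodule_coboundaries]] signed_tc_comp trees_mset[OF t] trees_mset[OF s] n i)
  finally show "asum (tree_comp n i t s) signed_tc - scale_fun ((-1) ^ ((n - 1) * (i - 1)))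
       (pcirc m n i (asum t signed_tc) (asum s signed_tc))
      \<in> (hB {1..m + n - 1} (int (m + n - 1) - 1) :: 'k ncochain set)"
    unfolding b_def .
next
  show "asum (Leaf 1) signed_tc = (unit_cochain 1 :: _ \<Rightarrow> 'k)" unfolding asum.simps by (rule signed_tc_unit)
qed

section \<open>Generation by the binary operation and uniqueness\<close>

fun std :: "nat \<Rightarrow> 'a bitree \<Rightarrow> nat bitree" where
  "std k (Leaf a) = Leaf k"
| "std k (Node t s) = Node (std k t) (std (k + length (leaves t)) s)"

lemma leaves_std: "leaves (std k t) = [k..<k + length (leaves t)]"
proof (induction t arbitrary: k)
  case (Node t s)
  have "[k..<k + length (leaves t) + length (leaves s)] = [k..<k + length (leaves t)] @ [k + length (leaves t)..<k + length (leaves t) + length (leaves s)]"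
    by (rule upt_add_eq_append) simp
  then show ?case using Node.IH by (simp add: add.assoc)
qed simp

lemma std_trees: "std 1 t \<in> trees (length (leaves t))"
  unfolding trees_def mem_Collect_eq leaves_std by auto

lemma map_std: "map_bitree (\<lambda>j. j + d) (std k t) = std (k + d) t"
  by (induction t arbitrary: k) (simp_all add: ac_simps)

lemma graft_Leaf: "(\<And>j. j \<in> L t \<Longrightarrow> g j = Leaf (h j)) \<Longrightarrow> graft g t = map_bitree h t"
  by (induction t) auto

text \<open>The right subtree is inserted first, so that the left one can still be inserted at input
  1 and shifts the labels of the right one into place.\<close>

lemma std_Node:
  "std 1 (Node t s) = tree_comp (length (leaves t)) 1 (tree_comp (length (leaves s)) 2 (Node (Leaf 1) (Leaf 2)) (std 1 s)) (std 1 t)"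
proof -
  let ?p = "length (leaves t)"
  let ?X = "map_bitree (\<lambda>j. j + 2 - 1) (std 1 s)"
  have X: "?X = std 2 s" using map_std[of 1 1 s] by (simp add: numeral_2_eq_2)
  have "graft (\<lambda>j. if j < 1 then Leaf j else if j = 1 then map_bitree (\<lambda>p. p + 1 - 1) (std 1 t) else Leaf (j + ?p - 1)) (std 2 s)
    = map_bitree (\<lambda>j. j + ?p - 1) (std 2 s)"
  proof (rule graft_Leaf)
    fix j assume "j \<in> L (std 2 s)"
    then have "j \<ge> 2" by (simp only: leaves_std set_upt atLeastLessThan_iff)
    then show "(if j < 1 then Leaf j else if j = 1 then map_bitree (\<lambda>p. p + 1 - 1) (std 1 t) else Leaf (j + ?p - 1)) = Leaf (j + ?p - 1)"
      by simp
  qed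
  also have "\<dots> = map_bitree (\<lambda>j. j + ?p) (std 1 s)"
    unfolding X[symmetric] bitree.map_comp comp_def by simp
  also have "\<dots> = std (1 + ?p) s" by (rule map_std)
  finally have e: "graft (\<lambda>j. if j < 1 then Leaf j else if j = 1 then map_bitree (\<lambda>p. p + 1 - 1) (std 1 t) else Leaf (j + ?p - 1)) ?X = std (1 + ?p) s"
    unfolding X .
  have a: "tree_comp (length (leaves s)) 2 (Node (Leaf 1) (Leaf 2)) (std 1 s) = Node (Leaf 1) ?X"
    by (simp add: tree_comp_def)
  have b: "tree_comp ?p 1 (Node (Leaf 1) ?X) (std 1 t) = Node (map_bitree (\<lambda>p. p + 1 - 1) (std 1 t))
     (graft (\<lambda>j. if j < 1 then Leaf j else if j = 1 then map_bitree (\<lambda>p. p + 1 - 1) (std 1 t) else Leaf (j + ?p - 1)) ?X)"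
    unfolding tree_comp_def graft.simps by simp
  have c: "map_bitree (\<lambda>p. p + 1 - 1) (std 1 t) = std 1 t" by (simp add: bitree.map_ident)
  show ?thesis unfolding a b e unfolding c std.simps ..
qed

lemma map_std_eq: "(\<And>j. j < length (leaves t) \<Longrightarrow> \<sigma> (k + j) = leaves t ! j) \<Longrightarrow> map_bitree \<sigma> (std k t) = t"
proof (induction t arbitrary: k)
  case (Leaf a)
  then show ?case by simp
next
  case (Node t s)
  have "map_bitree \<sigma> (std k t) = t"
    by (rule Node.IH(1)) (use Node.prems in \<open>auto simp: nth_append\<close>)
  moreover have "map_bitree \<sigma> (std (k + length (leaves t)) s) = s"
  proof (rule Node.IH(2))
    fix j assume "j < length (leaves s)"
    then show "\<sigma> (k + length (leaves t) + j) = leaves s ! j"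
      using Node.prems[of "length (leaves t) + j"] by (simp add: add.assoc)
  qed
  ultimately show ?case by simp
qed

text \<open>The permutation reads the leaves of \<open>t\<close> from left to right; it is extended
  by the identity outside the labels.\<close>

lemma std_act:
  assumes t: "t \<in> trees n"
  obtains \<sigma> where "\<sigma> permutes {1..n}" "map_bitree \<sigma> (std 1 t) = t"
proof -
  define \<sigma> where "\<sigma> j = (if j \<in> {1..n} then leaves t ! (j - 1) else j)" for j
  have len: "length (leaves t) = n" by (rule trees_length[OF t])
  have e: "map_bitree \<sigma> (std 1 t) = t" by (rule map_std_eq) (simp add: \<sigma>_def len)
  have l: "map \<sigma> [1..<1 + n] = leaves t" using arg_cong[OF e, of leaves] by (simp add: leaves_map leaves_std len)
  have S: "set [1..<1 + n] = {1..n}" by auto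
  have "inj_on \<sigma> {1..n}" using treesD(1)[OF t] unfolding l[symmetric] distinct_map S by blast
  moreover have "\<sigma> ` {1..n} = {1..n}" using treesD(2)[OF t] unfolding l[symmetric] set_map S .
  ultimately have "\<sigma> permutes {1..n}" by (intro bij_imp_permutes bij_betw_imageI) (auto simp: \<sigma>_def)
  then show thesis using e by (rule that)
qed

context operad_data
begin

lemma morphismD:
  assumes f: "operad_morphism Dp hNCP2 f"
  shows "n \<ge> 1 \<Longrightarrow> x \<in> component Dp n k \<Longrightarrow> f n k x \<in> component hNCP2 n k"
    "n \<ge> 1 \<Longrightarrow> x \<in> component Dp n k \<Longrightarrow> y \<in> component Dp n k \<Longrightarrow> f n k (op_add Dp n k x y) = op_add hNCP2 n k (f n k x) (f n k y)"
    "n \<ge> 1 \<Longrightarrow> x \<in> component Dp n k \<Longrightarrow> f n k (op_scale Dp n k c x) = op_scale hNCP2 n k c (f n k x)"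
    "n \<ge> 1 \<Longrightarrow> \<sigma> permutes {1..n} \<Longrightarrow> x \<in> component Dp n k \<Longrightarrow> f n k (op_act Dp n k \<sigma> x) = op_act hNCP2 n k \<sigma> (f n k x)"
  using f[unfolded operad_morphism_def, THEN conjunct1, rule_format, of n k] by (simp_all only: image_subset_iff)

lemma morphism_comp:
  "operad_morphism Dp hNCP2 f \<Longrightarrow> m \<ge> 1 \<Longrightarrow> n \<ge> 1 \<Longrightarrow> i \<in> {1..m} \<Longrightarrow> x \<in> component Dp m k \<Longrightarrow> y \<in> component Dp n l \<Longrightarrow>
    f (m + n - 1) (k + l) (pcomp Dp m k n l i x y) = pcomp hNCP2 m k n l i (f m k x) (f n l y)"
  unfolding operad_morphism_def by (elim conjE) simp

lemma morphism_unit: "operad_morphism Dp hNCP2 f \<Longrightarrow> f 1 0 (op_unit Dp) = op_unit hNCP2"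
  unfolding operad_morphism_def by (elim conjE)

lemma component_coset: "u \<in> Md n k \<Longrightarrow> u +o Jd n k \<in> component Dp n k"
  unfolding D_component by (rule imageI)

text \<open>Zero is its own multiple by the scalar 0, and morphisms preserve scalar
  multiples.\<close>

lemma morphism_zero:
  assumes f: "operad_morphism Dp hNCP2 f" and n: "n \<ge> 1"
  shows "f n k (0 +o Jd n k) = 0 +o hB {1..n} k"
proof -
  have x: "0 +o Jd n k \<in> component Dp n k"
    by (rule component_coset) (simp add: deg0_def Mag_def)
  obtain w where w: "f n k (0 +o Jd n k) = w +o hB {1..n} k"
    using morphismD(1)[OF f n x] by (auto simp: hNCP2_def cohomology_def)
  have "f n k (op_scale Dp n k 0 (0 +o Jd n k)) = 0 +o hB {1..n} k"
    unfolding morphismD(3)[OF f n x] w h_coset_scale scale_zero ..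
  then show ?thesis unfolding D_scale scale_zero .
qed

text \<open>The free operad on one binary operation is generated by it: every tree arises from the
  standard labelling, which is an iterated composite, by a permutation.\<close>

lemma morphism_unique:
  assumes f: "operad_morphism Dp hNCP2 f"
    and gen: "f 2 1 (basis (Node (Leaf 1) (Leaf 2)) +o Jd 2 1) = phi 2 1 (basis (Node (Leaf 1) (Leaf 2)) +o Jd 2 1)"
    and n: "n \<ge> 1" and x: "x \<in> component Dp n k"
  shows "f n k x = phi n k x"
proof -
  define cl where "cl n u = u +o Jd n (int n - 1)" for n u
  define Eq where "Eq n u \<longleftrightarrow> u \<in> Mag n \<and> f n (int n - 1) (cl n u) = phi n (int n - 1) (cl n u)" for n u
  note h = morphismD[OF f] and h' = morphismD[OF morphism]
  have M: "u \<in> Md n (int n - 1)" if "u \<in> Mag n" for n u using that by (simp add: deg0_def)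
  have comp: "cl n u \<in> component Dp n (int n - 1)" if "u \<in> Mag n" for n u
    unfolding cl_def by (rule component_coset[OF M[OF that]])
  have EqD: "u \<in> Mag n" "f n (int n - 1) (cl n u) = phi n (int n - 1) (cl n u)" if "Eq n u" for n u
    using that unfolding Eq_def by blast+
  have add: "Eq n (u + v)" if n: "n \<ge> 1" and u: "Eq n u" and v: "Eq n v" for n u v
    using h(2)[OF n comp[OF EqD(1)[OF u]] comp[OF EqD(1)[OF v]]] h'(2)[OF n comp[OF EqD(1)[OF u]] comp[OF EqD(1)[OF v]]]
      submodule.add_mem[OF submodule_Mag EqD(1)[OF u] EqD(1)[OF v]] EqD(2)[OF u] EqD(2)[OF v]
    unfolding Eq_def cl_def D_add by simp
  have scale: "Eq n (scale_fun c u)" if n: "n \<ge> 1" and u: "Eq n u" for n u c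
    using h(3)[OF n comp[OF EqD(1)[OF u]], of c] h'(3)[OF n comp[OF EqD(1)[OF u]], of c]
      submodule.scale_mem[OF submodule_Mag EqD(1)[OF u], of c] EqD(2)[OF u]
    unfolding Eq_def cl_def D_scale by simp
  \<comment> \<open>Actions and compositions in the desuspension carry a sign, which is removed by
    multiplying with it once more.\<close>
  have unscale: "Eq n u" if n: "n \<ge> 1" and u: "Eq n (scale_fun (if b then 1 else -1) u)" for n u b
  proof -
    have "(if b then 1 else -1) * (if b then 1 else -1) = (1 :: 'k)" by (simp add: minus_mult_left[symmetric])
    then show ?thesis using scale[OF n u, of "if b then 1 else -1"] unfolding scale_scale by simp
  qed
  have act: "Eq n (mag_act n \<sigma> u)" if n: "n \<ge> 1" and u: "Eq n u" and \<sigma>: "\<sigma> permutes {1..n}" for n u \<sigma>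
  proof (rule unscale[OF n])
    have "scale_fun (sgn_of \<sigma>) (mag_act n \<sigma> u) \<in> Mag n"
      by (rule submodule.scale_mem[OF submodule_Mag mag_act_Mag[OF \<sigma>]])
    then show "Eq n (scale_fun (sgn_of \<sigma>) (mag_act n \<sigma> u))"
      using h(4)[OF n \<sigma> comp[OF EqD(1)[OF u]]] h'(4)[OF n \<sigma> comp[OF EqD(1)[OF u]]] EqD(2)[OF u]
      unfolding Eq_def cl_def D_act[OF \<sigma>] by (simp only: simp_thms)
  qed
  have circ: "Eq (m + n - 1) (mag_comp m n i u v)"
    if m: "m \<ge> 1" and n: "n \<ge> 1" and i: "i \<in> {1..m}" and u: "Eq m u" and v: "Eq n v" for m n i u v
  proof (rule unscale)
    show "1 \<le> m + n - 1" using m n by simp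
    let ?w = "scale_fun (comp_sign m (int m - 1) n i) (mag_comp m n i u v)"
    note uv = EqD(1)[OF u] EqD(1)[OF v]
    have "f (m + n - 1) (int m - 1 + (int n - 1)) (?w +o Jd (m + n - 1) (int m - 1 + (int n - 1)))
      = phi (m + n - 1) (int m - 1 + (int n - 1)) (?w +o Jd (m + n - 1) (int m - 1 + (int n - 1)))"
      using morphism_comp[OF f m n i comp[OF uv(1)] comp[OF uv(2)]] morphism_comp[OF morphism m n i comp[OF uv(1)] comp[OF uv(2)]] EqD(2)[OF u] EqD(2)[OF v]
      unfolding cl_def D_comp[OF n m i M[OF uv(1)] M[OF uv(2)]] by simp
    then show "Eq (m + n - 1) ?w"
      unfolding degrees[OF m n] Eq_def cl_def using submodule.scale_mem[OF submodule_Mag mag_comp_Mag[OF n i]] by blast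
  qed
  have std: "Eq (length (leaves t)) (basis (std 1 t))" for t :: "nat bitree"
  proof (induction t)
    case (Leaf a)
    have "Leaf 1 \<in> trees 1" by (simp add: trees_def)
    then show ?case using morphism_unit[OF f] morphism_unit[OF morphism] unfolding Eq_def cl_def D_unit by (simp add: basis_Mag)
  next
    case (Node t s)
    let ?p = "length (leaves t)" and ?q = "length (leaves s)"
    have N: "Eq 2 (basis (Node (Leaf 1) (Leaf 2)))"
      using gen basis_Mag[OF trees_two(1)] unfolding Eq_def cl_def by simp
    have 1: "Eq (2 + ?q - 1) (mag_comp 2 ?q 2 (basis (Node (Leaf 1) (Leaf 2))) (basis (std 1 s)))"
      by (rule circ[OF _ length_pos _ N Node.IH(2)]) simp_all
    have 2: "Eq (2 + ?q - 1 + ?p - 1) (mag_comp (2 + ?q - 1) ?p 1 (mag_comp 2 ?q 2 (basis (Node (Leaf 1) (Leaf 2))) (basis (std 1 s))) (basis (std 1 t)))"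
      by (rule circ[OF _ length_pos _ 1 Node.IH(1)]) simp_all
    have i: "2 \<in> {1..2 :: nat}" by simp
    have e: "2 + ?q - 1 + ?p - 1 = length (leaves (Node t s))" by simp
    show ?case using 2
      unfolding mag_comp_basis[OF trees_two(1) std_trees] mag_comp_basis[OF tree_comp_trees[OF trees_two(1) std_trees length_pos i] std_trees] std_Node[symmetric] e .
  qed
  have tree: "Eq n (basis t)" if n: "n \<ge> 1" and t: "t \<in> trees n" for n t
  proof -
    obtain \<sigma> where s: "\<sigma> permutes {1..n}" "map_bitree \<sigma> (std 1 t) = t" by (rule std_act[OF t])
    have "mag_act n \<sigma> (basis (std 1 t)) = (basis t :: 'k mag)"
      using mag_act_basis[OF std_trees[of t], of \<sigma>] unfolding trees_length[OF t] s(2) .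
    then show ?thesis using act[OF n std[of t, unfolded trees_length[OF t]] s(1)] by simp
  qed
  obtain u where u: "u \<in> Md n k" "x = u +o Jd n k" using x unfolding D_component by blast
  have z: "f n k (0 +o Jd n k) = phi n k (0 +o Jd n k)" for k
    unfolding morphism_zero[OF f n] morphism_zero[OF morphism n] ..
  show ?thesis
  proof (cases "k = int n - 1")
    case True
    have "u \<in> Mag n" using u(1) True by (simp add: deg0_def)
    then have "Eq n u"
    proof (induction u rule: mag_induct)
      case zero
      show ?case unfolding Eq_def cl_def using z submodule.zero_mem[OF submodule_Mag] by blast
    qed (rule add[OF n] scale[OF n] tree[OF n]; assumption)+
    then show ?thesis unfolding u(2) True Eq_def cl_def by blast
  next
    case False
    then have "u = 0" using u(1) by (simp add: deg0_def)
    then show ?thesis unfolding u(2) using z by simp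
  qed
qed

end

section \<open>Factorization through the pre-Lie operad\<close>

lemma lin_ext_cong: "(\<And>b. b \<in> X \<Longrightarrow> F b = G b) \<Longrightarrow> lin_ext X F u = lin_ext X G u"
  unfolding lin_ext_def by (rule sum.cong) simp_all

lemma lin_ext_lin_ext: "lin_ext X F (lin_ext Y H u) = lin_ext Y (\<lambda>t. lin_ext X F (H t)) u"
proof (rule ext)
  fix c
  have "lin_ext X F (lin_ext Y H u) c = (\<Sum>b\<in>X. \<Sum>t\<in>Y. u t * (H t b * F b c))"
    by (simp add: lin_ext_apply sum_distrib_right mult.assoc)
  also have "\<dots> = (\<Sum>t\<in>Y. \<Sum>b\<in>X. u t * (H t b * F b c))" by (rule sum.swap)
  finally show "lin_ext X F (lin_ext Y H u) c = lin_ext Y (\<lambda>t. lin_ext X F (H t)) u c"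
    by (simp add: lin_ext_apply sum_distrib_left)
qed

lemma signed_tc_antisym:
  assumes "t \<in> trees n"
  shows "lin_ext (trees n) signed_tc (antisym t) = (asum t signed_tc :: _ \<Rightarrow> 'k::{comm_ring, comm_monoid_mult})"
proof -
  have "lin_ext (trees n) signed_tc (asum t basis) = (asum t (\<lambda>x. lin_ext (trees n) signed_tc (basis x)) :: _ \<Rightarrow> 'k)"
    by (rule asum_hom[where h = "lin_ext (trees n) signed_tc"]) (rule lin_ext_diff)
  also have "\<dots> = asum t signed_tc"
    by (rule asum_cong) (rule lin_ext_basis[OF finite_trees trees_mset[OF assms]])
  finally show ?thesis unfolding antisym_asum .
qed

text \<open>On each tree the Lie datum is the pre-Lie datum applied to the
  antisymmetrization.\<close>

lemma phi_lie_to_prelie: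
  assumes n: "n \<ge> 1" and x: "x \<in> component (desuspension Lie) n k"
  shows "PL.phi n k (desuspension_map lie_to_prelie n k x) = (LI.phi n k x :: (nat ncp2 list \<Rightarrow> 'k::{comm_ring, comm_monoid_mult}) set)"
proof -
  let ?J = "presented_ideal prelie_relators n (k - (int n - 1)) :: 'k mag set"
  let ?A = "lin_ext (trees n) antisym :: 'k mag \<Rightarrow> 'k mag"
  obtain u where u: "x = u +o presented_ideal lie_relators n (k - (int n - 1))"
    using x unfolding Lie_def LI.D_component by blast
  have AG: "lin_ext (trees n) signed_tc (?A w) = (lin_ext (trees n) (\<lambda>t. asum t signed_tc) w :: _ \<Rightarrow> 'k)" for w
    unfolding lin_ext_lin_ext by (rule lin_ext_cong) (rule signed_tc_antisym)
  have "PL.phi n k (?A w +o ?J) = LI.phi n k x" if "w \<in> x" for w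
  proof -
    have "w - u \<in> presented_ideal lie_relators n (k - (int n - 1))" using that unfolding u mem_coset .
    then have "lin_ext (trees n) (\<lambda>t. asum t signed_tc) w - lin_ext (trees n) (\<lambda>t. asum t signed_tc) u \<in> (hB {1..n} k :: 'k ncochain set)"
      unfolding lin_ext_diff[symmetric] by (rule LI.G_J[OF n])
    then show ?thesis unfolding u PL.phi_coset[OF n] LI.phi_coset[OF n] AG submodule.coset_eq_iff[OF submodule_coboundaries] .
  qed
  moreover have "x \<noteq> {}" unfolding u using submodule.self_mem[OF LI.submodule_J] by blast
  \<comment> \<open>The image is a union over all representatives of \<open>x\<close>, and it
    suffices that each of them contributes the same class; no comparison of the two ideals
    enters.\<close>
  moreover have "PL.phi n k (desuspension_map lie_to_prelie n k x) = (\<Union>w\<in>x. PL.phi n k (?A w +o ?J))"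
    unfolding PL.phi_def desuspension_map_def lie_to_prelie_def coset_map_def by blast
  ultimately show ?thesis by auto
qed

lemma prec_coset: "i \<noteq> j \<Longrightarrow> prec i j = prc i j +o (hB {i, j} 1 :: (nat ncp2 list \<Rightarrow> 'k::{comm_ring, comm_monoid_mult}) set)"
proof -
  assume ij: "i \<noteq> j"
  let ?\<tau> = "\<lambda>a :: nat. if a = 1 then i else j"
  have im: "?\<tau> ` {1, 2} = {i, j}" by auto
  have "inj_on ?\<tau> {1, 2}" using ij by (auto simp: inj_on_def)
  then have "h_relabel ?\<tau> {1, 2} 1 (basis [ncp2_bot {1, 2}, w12] +o hB {1, 2} 1)
    = relabel_cochain ?\<tau> {1, 2} (basis [ncp2_bot {1, 2}, w12]) +o (hB (?\<tau> ` {1, 2}) 1 :: 'k ncochain set)"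
    by (intro h_relabel_coset) simp
  then show ?thesis unfolding prec_def prec12_def prc_def im .
qed

lemma prc_ZC: "a \<noteq> b \<Longrightarrow> (prc a b :: _ \<Rightarrow> 'k::{comm_ring, comm_monoid_mult}) \<in> ZC {a, b} 1"
  using TC_ZC[OF _ _ prc_TC, of a b] by simp

lemma prec_left_coset:
  assumes "i \<noteq> j" "i \<noteq> k" "j \<noteq> k" "i \<noteq> 0" "j \<noteq> 0" "k \<noteq> 0" "{k} \<union> {i, j} = S"
  shows "prec_left i j k = circ_cochain {k} 0 {i, j} (prc 0 k) (prc i j) +o (hB S 2 :: (nat ncp2 list \<Rightarrow> 'k::{comm_ring, comm_monoid_mult}) set)"
proof -
  interpret comp_sets "{k}" "{i, j}" 0 using assms by unfold_locales auto
  have k: "0 \<noteq> k" using assms(6) by simp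
  show ?thesis
    using h_circ_coset[OF prc_ZC[OF k] prc_ZC[OF assms(1)]] assms(7)
    unfolding prec_left_def prec_coset[OF k] prec_coset[OF assms(1)] by simp
qed

lemma prec_right_coset:
  assumes "i \<noteq> j" "i \<noteq> k" "j \<noteq> k" "i \<noteq> 0" "j \<noteq> 0" "k \<noteq> 0" "{i} \<union> {j, k} = S"
  shows "prec_right i j k = circ_cochain {i} 0 {j, k} (prc i 0) (prc j k) +o (hB S 2 :: (nat ncp2 list \<Rightarrow> 'k::{comm_ring, comm_monoid_mult}) set)"
proof -
  interpret comp_sets "{i}" "{j, k}" 0 using assms by unfold_locales auto
  have "(prc i 0 :: _ \<Rightarrow> 'k) \<in> ZC (insert 0 {i}) 1"
    using prc_ZC[OF assms(4)] unfolding insert_commute[of i 0] .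
  from h_circ_coset[OF this prc_ZC[OF assms(3)]] show ?thesis
    using assms(7) unfolding prec_right_def prec_coset[OF assms(4)] prec_coset[OF assms(3)] insert_commute[of i 0] by simp
qed

lemma phi_lie_bracket: "LI.phi 2 1 lie_bracket = (h_add {1, 2} 1 (prec 1 2) (prec 2 1) :: (nat ncp2 list \<Rightarrow> 'k::{comm_ring, comm_monoid_mult}) set)"
proof -
  have two: "{1..2} = {1, 2 :: nat}" by auto
  have g: "asum (Node (Leaf 1) (Leaf 2)) signed_tc = (prc 1 2 + prc 2 1 :: _ \<Rightarrow> 'k)"
    by (simp add: signed_tc_def tc_two tree_sign_def scale_neg del: tc.simps)
  have "LI.phi 2 1 lie_bracket = asum (Node (Leaf 1) (Leaf 2)) signed_tc +o (hB {1..2} 1 :: 'k ncochain set)"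
    using LI.phi_coset[where n = 2 and u = "basis (Node (Leaf 1) (Leaf 2))" and k = 1]
    unfolding lie_bracket_def lin_ext_basis[OF finite_trees trees_two(1)] by simp
  moreover have p: "prec 1 2 = prc 1 2 +o (hB {1, 2} 1 :: 'k ncochain set)" "prec 2 1 = prc 2 1 +o (hB {1, 2} 1 :: 'k ncochain set)"
    using prec_coset[of 1 2] prec_coset[of 2 1] by (simp_all add: insert_commute)
  ultimately show ?thesis unfolding g two p LI.h_coset_add by simp
qed

theorem proposition5p9:
  shows "h_add {1, 2, 3} 2
           (h_add {1, 2, 3} 2
             (h_add {1, 2, 3} 2 (prec_left 1 2 3) (prec_right 1 2 3))
             (prec_left 1 3 2))
           (prec_right 1 3 2)
         = (h_zero {1, 2, 3} 2 :: (nat ncp2 list \<Rightarrow> 'k::{comm_ring, comm_monoid_mult}) set)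
       \<and> (\<exists>a :: nat \<Rightarrow> int \<Rightarrow> 'k mag set \<Rightarrow> (nat ncp2 list \<Rightarrow> 'k) set. is_a_star a)
       \<and> (\<forall>a :: nat \<Rightarrow> int \<Rightarrow> 'k mag set \<Rightarrow> (nat ncp2 list \<Rightarrow> 'k) set. is_a_star a \<longrightarrow>
            (\<exists>b. operad_morphism (desuspension PreLie) hNCP2 b \<and>
               (\<forall>n\<ge>1. \<forall>k. \<forall>x\<in>component (desuspension Lie) n k.
                  a n k x = b n k (desuspension_map lie_to_prelie n k x))))"
proof (intro conjI allI impI)
  let ?S = "{1, 2, 3 :: nat}"
  have p: "prec_left 1 2 3 = circ_cochain {3} 0 {1, 2} (prc 0 3) (prc 1 2) +o (hB ?S 2 :: 'k ncochain set)"
    "prec_right 1 2 3 = circ_cochain {1} 0 {2, 3} (prc 1 0) (prc 2 3) +o (hB ?S 2 :: 'k ncochain set)"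
    "prec_left 1 3 2 = circ_cochain {2} 0 {1, 3} (prc 0 2) (prc 1 3) +o (hB ?S 2 :: 'k ncochain set)"
    "prec_right 1 3 2 = circ_cochain {1} 0 {3, 2} (prc 1 0) (prc 3 2) +o (hB ?S 2 :: 'k ncochain set)"
    by (rule prec_left_coset prec_right_coset; auto)+
  have "(relation :: _ \<Rightarrow> 'k) - 0 \<in> hB ?S 2" using relation_hB by simp
  then show "h_add ?S 2 (h_add ?S 2 (h_add ?S 2 (prec_left 1 2 3) (prec_right 1 2 3)) (prec_left 1 3 2)) (prec_right 1 3 2)
         = (h_zero ?S 2 :: 'k ncochain set)"
    unfolding p LI.h_coset_add h_zero_def relation_def submodule.coset_eq_iff[OF submodule_coboundaries] .
  show "\<exists>a :: nat \<Rightarrow> int \<Rightarrow> 'k mag set \<Rightarrow> 'k ncochain set. is_a_star a"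
    unfolding is_a_star_def Lie_def using LI.morphism phi_lie_bracket by blast
next
  fix a :: "nat \<Rightarrow> int \<Rightarrow> 'k mag set \<Rightarrow> 'k ncochain set"
  assume a: "is_a_star a"
  \<comment> \<open>Both maps take the prescribed value on the bracket, which by uniqueness makes
    them equal on the desuspension of \<open>Lie\<close>.\<close>
  have gen: "a 2 1 (basis (Node (Leaf 1) (Leaf 2)) +o presented_ideal lie_relators 2 (1 - (int 2 - 1)))
    = LI.phi 2 1 (basis (Node (Leaf 1) (Leaf 2)) +o presented_ideal lie_relators 2 (1 - (int 2 - 1)))"
    using a phi_lie_bracket[where 'k = 'k] unfolding is_a_star_def lie_bracket_def by simp
  have m: "operad_morphism (desuspension (presented_operad lie_relators)) hNCP2 a"
    using a unfolding is_a_star_def Lie_def by blast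
  have "a n k x = PL.phi n k (desuspension_map lie_to_prelie n k x)" if "n \<ge> 1" "x \<in> component (desuspension Lie) n k" for n k x
    unfolding phi_lie_to_prelie[OF that] by (rule LI.morphism_unique[OF m gen that(1)]) (use that(2) in \<open>simp only: Lie_def\<close>)
  moreover have "operad_morphism (desuspension PreLie) hNCP2 (PL.phi :: nat \<Rightarrow> int \<Rightarrow> 'k mag set \<Rightarrow> 'k ncochain set)"
    unfolding PreLie_def by (rule PL.morphism)
  ultimately show "\<exists>b. operad_morphism (desuspension PreLie) hNCP2 b \<and>
               (\<forall>n\<ge>1. \<forall>k. \<forall>x\<in>component (desuspension Lie) n k.
                  a n k x = b n k (desuspension_map lie_to_prelie n k x))"
    by blast
qed

end
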